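(* Let $\mathcal{G}$ be a class of measurable functions from $\mathbb{R}$ to $\mathbb{R}$ that has uniformly integrable $L_2$-entropy and an envelope $V\in L_2(F)$ satisfying $$\int(V(y+s)-V(y))^2f(y)\,dy\to0\quad\text{as }s\to0.$$ If $$\sup_{g\in\mathcal{G}}\Big|n^{1/2}\int g(y)\big(f*k_{b_n}(y)-f(y)\big)\,dy\Big|\to0,$$ then $$\sup_{g\in\mathcal{G}}\Big|\int g(y)\hat f(y)\,dy-\frac1n\sum_{i=1}^ng(\varepsilon_i)\Big|=o_p(n^{-1/2}),$$ and the smoothed empirical process $\{n^{1/2}\int g(y)(\hat f(y)-f(y))\,dy:g\in\mathcal{G}\}$ converges weakly in $\ell_\infty(\mathcal{G})$ to a tight Brownian bridge process.
   Context: $\varepsilon_1,\varepsilon_2,\dots$ are i.i.d. real random variables with mean zero, finite variance, positive density $f$ and distribution function $F$. With $k_{b_n}(y)=k(y/b_n)/b_n$, $\hat f(y)=\frac1n\sum_{i=1}^nk_{b_n}(y-\varepsilon_i)$ is the kernel density estimator and $f*k_{b_n}$ denotes convolution. The kernel $k$ is a symmetric, twice continuously differentiable density with compact support $[-1,1]$. The bandwidth satisfies $nb_n^4\to0$ and $nb_n^{d_*}\to\infty$ with $d_*=(50+20d)/(14+5d)$, where $d$ is a fixed positive integer (the parameter dimension in the paper's model). A class has envelope $V$ if $|g|\le V$ for all its members $g$. Uniformly integrable $L_2$-entropy (relative to the envelope $V$) is the usual uniform entropy condition of empirical process theory: $\int_0^\infty\sup_Q\sqrt{\log N(\delta\|V\|_{L_2(Q)},\mathcal{G},L_2(Q))}\,d\delta<\infty$,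 the supremum being over finitely discrete probability measures $Q$ with $\|V\|_{L_2(Q)}>0$ and $N$ denoting covering numbers. A (tight) Brownian bridge process indexed by $\mathcal{G}$ is a tight centered Gaussian process in $\ell_\infty(\mathcal{G})$ with covariance $E[g_1(\varepsilon)g_2(\varepsilon)]-E[g_1(\varepsilon)]E[g_2(\varepsilon)]$, where $\varepsilon$ has density $f$.
   Formalization: The class 𝒢 is also assumed suitably measurable (weighted sums over its differences and squared differences have measurable suprema); otherwise, under CH, indicators of initial segments of an ω₁-type well-order of the reals refute the claim. *)

theory Defs
  imports "HOL-Probability.Probability"
begin

subsection \<open>Kernel density estimator\<close>

definition twice_cont_differentiable :: "(real \<Rightarrow> real) \<Rightarrow> bool" where
  "twice_cont_differentiable k \<longleftrightarrow>
     (\<exists>k' k''. (\<forall>x. (k has_real_derivative k' x) (at x)) \<and>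
               (\<forall>x. (k' has_real_derivative k'' x) (at x)) \<and>
               continuous_on UNIV k'')"

text \<open>"Support \<open>[-1,1]\<close>" is read as "vanishes outside \<open>[-1,1]\<close>".\<close>

definition smoothing_kernel :: "(real \<Rightarrow> real) \<Rightarrow> bool" where
  "smoothing_kernel k \<longleftrightarrow>
     (\<forall>x. 0 \<le> k x) \<and> integrable lborel k \<and> (LINT x|lborel. k x) = 1 \<and>
     (\<forall>x. k (- x) = k x) \<and> twice_cont_differentiable k \<and>
     (\<forall>x. \<bar>x\<bar> > 1 \<longrightarrow> k x = 0)"

definition scaled_kernel :: "(real \<Rightarrow> real) \<Rightarrow> real \<Rightarrow> real \<Rightarrow> real" where
  "scaled_kernel k b y = k (y / b) / b"

definition conv :: "(real \<Rightarrow> real) \<Rightarrow> (real \<Rightarrow> real) \<Rightarrow> real \<Rightarrow> real" where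
  "conv f h y = (LINT x|lborel. f x * h (y - x))"

text \<open>The sample of size \<open>n\<close> consists of \<open>eps 0, \<dots>, eps (n - 1)\<close>.\<close>

definition kde :: "(real \<Rightarrow> real) \<Rightarrow> (nat \<Rightarrow> real) \<Rightarrow> (nat \<Rightarrow> 'w \<Rightarrow> real) \<Rightarrow> nat \<Rightarrow> 'w \<Rightarrow> real \<Rightarrow> real"
  where "kde k b eps n \<omega> y = (1 / real n) * (\<Sum>i<n. scaled_kernel k (b n) (y - eps i \<omega>))"

subsection \<open>Uniform entropy\<close>

text \<open>Only meant for functions that are square integrable with respect to \<open>Q\<close>.\<close>

definition L2_seminorm :: "real measure \<Rightarrow> (real \<Rightarrow> real) \<Rightarrow> real" where
  "L2_seminorm Q g = sqrt (LINT x|Q. (g x)\<^sup>2)"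

definition envelope :: "(real \<Rightarrow> real) \<Rightarrow> (real \<Rightarrow> real) set \<Rightarrow> bool" where
  "envelope V \<G> \<longleftrightarrow> (\<forall>g\<in>\<G>. \<forall>y. \<bar>g y\<bar> \<le> V y)"

text \<open>
  The centres of the balls need not belong to \<open>\<G>\<close>. They can be arbitrary functions because
  this is applied to finitely discrete \<open>Q\<close> only, for which every function is square integrable.
\<close>

definition covering_number :: "real \<Rightarrow> (real \<Rightarrow> real) set \<Rightarrow> real measure \<Rightarrow> enat" where
  "covering_number r \<G> Q =
     Inf {enat (card C) | C. finite C \<and> (\<forall>g\<in>\<G>. \<exists>c\<in>C. L2_seminorm Q (\<lambda>x. g x - c x) < r)}"

definition sqrt_log :: "enat \<Rightarrow> ennreal" where
  "sqrt_log N = (case N of enat m \<Rightarrow> ennreal (sqrt (ln (real m))) | \<infinity> \<Rightarrow> \<infinity>)"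

text \<open>Finitely discrete probability measures are probability mass functions of finite support.\<close>

definition uniformly_integrable_L2_entropy :: "(real \<Rightarrow> real) set \<Rightarrow> (real \<Rightarrow> real) \<Rightarrow> bool" where
  "uniformly_integrable_L2_entropy \<G> V \<longleftrightarrow>
     (\<integral>\<^sup>+ \<delta>. indicator {0<..} \<delta> *
        (SUP Q \<in> {Q :: real pmf. finite (set_pmf Q) \<and> L2_seminorm (measure_pmf Q) V > 0}.
           sqrt_log (covering_number (\<delta> * L2_seminorm (measure_pmf Q) V) \<G> (measure_pmf Q)))
      \<partial>lborel) < \<infinity>"

subsection \<open>Measurability of the class\<close>

text \<open>
  Measurability in the sense of van der Vaart and Wellner (Weak Convergence and Empirical
  Processes, Definition 2.3.3). The uniform entropy central limit theorem (Theorem 2.5.2 there)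
  requires it for the classes of differences \<open>\<G>\<^sub>\<delta>\<close>, \<open>\<delta> > 0\<close>, and for the class of all squared
  differences. Some such condition is indispensable: under the continuum hypothesis, the
  indicators of the initial segments of a well-order of the reals of type \<open>\<omega>\<^sub>1\<close> are Borel
  functions forming a VC class with envelope 1, all of them vanish almost everywhere, and yet
  the supremum of their empirical means is always 1.
\<close>

definition P_measurable_class :: "real measure \<Rightarrow> (real \<Rightarrow> real) set \<Rightarrow> bool" where
  "P_measurable_class P \<H> \<longleftrightarrow>
     (\<forall>n. \<forall>e :: nat \<Rightarrow> real.
        (\<lambda>x. SUP h\<in>\<H>. ennreal \<bar>\<Sum>i<n. e i * h (x i)\<bar>)
          \<in> borel_measurable (completion (Pi\<^sub>M {..<n} (\<lambda>_. P))))"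

definition L2_differences :: "real measure \<Rightarrow> real \<Rightarrow> (real \<Rightarrow> real) set \<Rightarrow> (real \<Rightarrow> real) set" where
  "L2_differences P \<delta> \<G> =
     {\<lambda>x. g x - h x | g h. g \<in> \<G> \<and> h \<in> \<G> \<and> L2_seminorm P (\<lambda>x. g x - h x) < \<delta>}"

definition squared_differences :: "(real \<Rightarrow> real) set \<Rightarrow> (real \<Rightarrow> real) set" where
  "squared_differences \<G> = {\<lambda>x. (g x - h x)\<^sup>2 | g h. g \<in> \<G> \<and> h \<in> \<G>}"

definition suitably_measurable_class :: "real measure \<Rightarrow> (real \<Rightarrow> real) set \<Rightarrow> bool" where
  "suitably_measurable_class P \<G> \<longleftrightarrow>
     (\<forall>\<delta>>0. P_measurable_class P (L2_differences P \<delta> \<G>)) \<and>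
     P_measurable_class P (squared_differences \<G>)"

subsection \<open>Stochastic convergence of possibly non-measurable maps\<close>

definition small_o_outer_prob :: "'w measure \<Rightarrow> (nat \<Rightarrow> 'w \<Rightarrow> ennreal) \<Rightarrow> (nat \<Rightarrow> real) \<Rightarrow> bool" where
  "small_o_outer_prob M Z a \<longleftrightarrow>
     (\<forall>c>0. (\<lambda>n. outer_measure_of M {\<omega> \<in> space M. Z n \<omega> > ennreal (c * a n)}) \<longlonglongrightarrow> 0)"

text \<open>Outer expectation of a map \<open>T\<close> that is bounded almost everywhere.\<close>

definition outer_expectation :: "'w measure \<Rightarrow> ('w \<Rightarrow> real) \<Rightarrow> real" where
  "outer_expectation M T =
     Inf {LINT \<omega>|M. U \<omega> | U. integrable M U \<and> (AE \<omega> in M. T \<omega> \<le> U \<omega>)}"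

definition borel_sets_of :: "'b metric \<Rightarrow> 'b set set" where
  "borel_sets_of m = sigma_sets (mspace m) {U. openin (mtopology_of m) U}"

text \<open>
  Weak convergence in the sense of Hoffmann-Jorgensen of maps \<open>X n\<close> into the metric space \<open>m\<close> to
  a Borel law \<open>L\<close> on \<open>m\<close>. For large \<open>n\<close>, \<open>X n\<close> has to take its values in \<open>m\<close> up to a null set;
  \<open>outer_expectation\<close> ignores the arbitrary values of \<open>h (X n \<omega>)\<close> on that null set.
\<close>

definition weakly_converges_outer ::
    "'w measure \<Rightarrow> (nat \<Rightarrow> 'w \<Rightarrow> 'b) \<Rightarrow> 'b metric \<Rightarrow> 'b measure \<Rightarrow> bool" where
  "weakly_converges_outer M X m L \<longleftrightarrow>
     prob_space L \<and> space L = mspace m \<and> sets L = borel_sets_of m \<and>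
     (\<forall>\<^sub>F n in sequentially. AE \<omega> in M. X n \<omega> \<in> mspace m) \<and>
     (\<forall>h :: 'b \<Rightarrow> real. continuous_map (mtopology_of m) euclideanreal h \<and> bounded (h ` mspace m) \<longrightarrow>
        (\<lambda>n. outer_expectation M (\<lambda>\<omega>. h (X n \<omega>))) \<longlonglongrightarrow> (LINT z|L. h z))"

subsection \<open>Brownian bridge in the space of bounded functions on a class\<close>

text \<open>
  Elements of \<open>linfty \<G>\<close> are bounded functions on \<open>\<G>\<close>, extended by \<open>undefined\<close> outside \<open>\<G>\<close>;
  the distance is the supremum distance over \<open>\<G>\<close>.
\<close>

definition linfty :: "(real \<Rightarrow> real) set \<Rightarrow> ((real \<Rightarrow> real) \<Rightarrow> real) metric" where
  "linfty \<G> = funspace \<G> euclidean_metric"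

definition tight_law :: "'b metric \<Rightarrow> 'b measure \<Rightarrow> bool" where
  "tight_law m L \<longleftrightarrow> (\<forall>c>0. \<exists>K. compactin (mtopology_of m) K \<and> measure L K > 1 - c)"

definition centered_normal_law :: "real \<Rightarrow> real measure" where
  "centered_normal_law v =
     (if v = 0 then return borel 0 else density lborel (\<lambda>x. ennreal (normal_density 0 (sqrt v) x)))"

definition bridge_cov :: "real measure \<Rightarrow> (real \<Rightarrow> real) \<Rightarrow> (real \<Rightarrow> real) \<Rightarrow> real" where
  "bridge_cov P g h = (LINT x|P. g x * h x) - (LINT x|P. g x) * (LINT x|P. h x)"

text \<open>
  \<open>L\<close> is the law of the process. It is centered Gaussian with the given covariance:
  every finite linear combination of its coordinates is centered normal (possibly degenerate)
  with the corresponding variance.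
\<close>

definition tight_brownian_bridge_law ::
    "real measure \<Rightarrow> (real \<Rightarrow> real) set \<Rightarrow> ((real \<Rightarrow> real) \<Rightarrow> real) measure \<Rightarrow> bool" where
  "tight_brownian_bridge_law P \<G> L \<longleftrightarrow>
     prob_space L \<and> space L = mspace (linfty \<G>) \<and> sets L = borel_sets_of (linfty \<G>) \<and>
     tight_law (linfty \<G>) L \<and>
     (\<forall>I a. finite I \<and> I \<subseteq> \<G> \<longrightarrow>
        distr L borel (\<lambda>z. \<Sum>g\<in>I. a g * z g) =
          centered_normal_law (\<Sum>g\<in>I. \<Sum>h\<in>I. a g * a h * bridge_cov P g h))"

end

theory Submission
  imports Defs
begin

text \<open>
  Writing \<open>\<integral> g (y) k\<^sub>b (y - x) dy = E (g (x + b U))\<close> with \<open>U\<close> distributed according to \<open>k\<close>, the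
  smoothed minus the raw empirical measure is an average over independent copies of \<open>b U\<close> of
  differences between the empirical processes of the samples \<open>\<epsilon>\<^sub>i + b U\<^sub>i\<close> and \<open>\<epsilon>\<^sub>i\<close>, up to the
  bias. The uniform entropy condition does not see the law of the sample, so both processes are
  asymptotically equicontinuous with the same constants (symmetrization and chaining; the
  measurability of the class transfers because \<open>f > 0\<close> makes all laws with a density absolutely
  continuous). This reduces the first claim to a finite net of the class, where the continuity of
  \<open>s \<mapsto> V (\<cdot> + s)\<close> in \<open>L\<^sub>2\<close> makes the variances vanish.

  The Brownian bridge is built on a countable dense subset of the class from a Gaussian sequence;
  equicontinuity passes from the empirical process to this Gaussian process and yields uniform
  convergence along finite nets, hence a tight limit. Weak convergence is then tested with Lipschitz
  functions of the process restricted to a finite net, and bounded continuous functions are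
  monotone limits of Lipschitz ones.
\<close>

subsection \<open>Rademacher sums\<close>

text \<open>The law \<open>conv f \<kappa>\<close> of the smoothed observations moves with
  \<open>n\<close>, so equicontinuity under the single law \<open>P\<close> would not do: every
  deviation bound is proved for all densities \<open>q\<close> with \<open>env_dist q\<close> small.
  This L1 distance weighted by V^2 controls at once the second moment of \<open>V\<close>, its tail
  and the L2 distances inside the class, and it is what the shift condition on \<open>V\<close>
  makes small. Suprema over the class need not be measurable. Each bound on a supremum is therefore
  stated as an integrable \<open>U\<close> dominating it almost everywhere, together with a bound on
  the integral of \<open>U\<close>. Such majorants can be added, averaged over the auxiliary noise
  by Fubini, and converted at the end into outer probabilities and outer expectations. Chaining
  measures distances in the empirical seminorm, while closeness in the class is meant in the
  seminorm of \<open>P\<close>. A law of large numbers for squared differences, uniform over the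
  class and over the admissible laws, passes from one to the other; it also makes the class totally
  bounded.\<close>

definition signs :: "nat \<Rightarrow> (nat \<Rightarrow> real) set" where
  "signs n = PiE {..<n} (\<lambda>_. {-1, 1})"

lemma finite_signs [simp]: "finite (signs n)"
  unfolding signs_def by (intro finite_PiE) auto

lemma card_signs [simp]: "card (signs n) = 2 ^ n"
  unfolding signs_def by (subst card_PiE) (auto simp: numeral_2_eq_2)

text \<open>This is cosh x <= exp (x^2 / 2), taken from the auxiliary estimate behind Hoeffding's
  lemma at weight 1/2, that is, for a fair sign times \<open>x\<close>. Evenness reduces it to
  \<open>x \<ge> 0\<close>.\<close>

lemma exp_add_exp_minus_le: "exp x + exp (- x) \<le> 2 * exp (x\<^sup>2 / 2)" for x :: real
proof -
  have nonneg: "exp x + exp (- x) \<le> 2 * exp (x\<^sup>2 / 2)" if "x \<ge> 0" for x :: real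
  proof -
    have "- x + ln (1 + (exp (2 * x) - 1) / 2) \<le> x\<^sup>2 / 2"
      using Hoeffdings_lemma_aux[of "2 * x" "1 / 2"] that by (simp add: power_mult_distrib)
    then have "exp (ln (1 + (exp (2 * x) - 1) / 2)) \<le> exp (x\<^sup>2 / 2 + x)"
      by (subst exp_le_cancel_iff) simp
    moreover have "1 + (exp (2 * x) - 1) / 2 = (exp (2 * x) + 1) / 2"
      by (simp add: field_simps)
    ultimately have "exp (2 * x) + 1 \<le> 2 * exp (x\<^sup>2 / 2) * exp x"
      by (simp add: add_pos_pos exp_add del: exp_ln_iff)
    then have "(exp (2 * x) + 1) * exp (- x) \<le> 2 * exp (x\<^sup>2 / 2) * exp x * exp (- x)"
      by (intro mult_right_mono) auto
    moreover have "(exp (2 * x) + 1) * exp (- x) = exp x + exp (- x)"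
      by (simp add: distrib_right flip: exp_add)
    moreover have "2 * exp (x\<^sup>2 / 2) * exp x * exp (- x) = 2 * exp (x\<^sup>2 / 2)"
      by (simp add: mult.assoc flip: exp_add)
    ultimately show ?thesis by simp
  qed
  show ?thesis using nonneg[of x] nonneg[of "- x"] by (cases "x \<ge> 0") auto
qed

text \<open>Expectations over independent fair signs appear as finite sums over
  \<open>signs n\<close>, larger by the factor 2^n, which spares an auxiliary probability space.
  Independence of the signs becomes the distributive law \<open>prod_sum_PiE\<close>.\<close>

lemma rademacher_mgf_le:
  "(\<Sum>r\<in>signs n. exp (l * (\<Sum>i<n. r i * a i))) \<le> 2 ^ n * exp (l\<^sup>2 * (\<Sum>i<n. (a i)\<^sup>2) / 2)"
proof -
  have "(\<Sum>r\<in>signs n. exp (l * (\<Sum>i<n. r i * a i))) = (\<Sum>r\<in>signs n. \<Prod>i<n. exp (l * a i * r i))"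
    by (simp add: exp_sum[symmetric] sum_distrib_left algebra_simps)
  also have "\<dots> = (\<Prod>i<n. \<Sum>s\<in>{-1, 1}. exp (l * a i * s))"
    unfolding signs_def by (subst prod_sum_PiE) auto
  also have "\<dots> \<le> (\<Prod>i<n. 2 * exp ((l * a i)\<^sup>2 / 2))"
    using exp_add_exp_minus_le[of "l * a _"]
    by (intro prod_mono) (auto simp: algebra_simps add_nonneg_nonneg)
  also have "\<dots> = 2 ^ n * exp (l\<^sup>2 * (\<Sum>i<n. (a i)\<^sup>2) / 2)"
    by (simp add: prod.distrib exp_sum[symmetric] power_mult_distrib sum_distrib_left sum_divide_distrib)
  finally show ?thesis .
qed

text \<open>Massart's inequality for finite classes. The exponential moment includes every sum with
  both signs because of the absolute value, so the logarithm sees twice the cardinality.\<close>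

lemma rademacher_max_le:
  assumes A: "finite A" "A \<noteq> {}" and s: "s \<ge> 0" "\<And>a. a \<in> A \<Longrightarrow> (\<Sum>i<n. (a i)\<^sup>2) \<le> s\<^sup>2"
  shows "(\<Sum>r\<in>signs n. Max ((\<lambda>a. \<bar>\<Sum>i<n. r i * a i\<bar>) ` A)) \<le> 2 ^ n * (s * sqrt (2 * ln (2 * real (card A))))"
proof (cases "s = 0")
  case True
  have zero: "a i = 0" if "a \<in> A" "i < n" for a i
  proof -
    have "(\<Sum>i<n. (a i)\<^sup>2) = 0"
      using s(2)[OF that(1)] True sum_nonneg[of "{..<n}" "\<lambda>i. (a i)\<^sup>2"] by simp
    then show ?thesis using that(2) by (subst (asm) sum_nonneg_eq_0_iff) auto
  qed
  have "Max ((\<lambda>a. \<bar>\<Sum>i<n. r i * a i\<bar>) ` A) = 0" for r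
  proof -
    have "(\<lambda>a. \<bar>\<Sum>i<n. r i * a i\<bar>) ` A = {0}"
    proof -
      have "(\<lambda>a. \<bar>\<Sum>i<n. r i * a i\<bar>) a = 0" if "a \<in> A" for a
        using zero[OF that] by simp
      then show ?thesis using A by (auto simp: image_iff)
    qed
    then show ?thesis by simp
  qed
  then show ?thesis using True by simp
next
  case False
  define N where "N = real (card A)"
  have N: "N \<ge> 1" unfolding N_def using A by (simp add: Suc_leI card_gt_0_iff)
  define L where "L = ln (2 * N)"
  have L: "L > 0" unfolding L_def using N by simp
  \<comment> \<open>The bound L / l + l s^2 / 2 for the mean of the maximum is minimal at this
    \<open>l\<close>, and \<open>c\<close> is the minimum. The division by \<open>s\<close> is why
    \<open>s = 0\<close> was split off.\<close>
  define l where "l = sqrt (2 * L) / s"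
  have s0: "s > 0" using False s by simp
  have l: "l > 0" unfolding l_def using L s0 by simp
  define c where "c = s * sqrt (2 * L)"
  have lc: "l * c = 2 * L" unfolding l_def c_def using s0 L by simp
  have ls: "l\<^sup>2 * s\<^sup>2 = 2 * L" unfolding l_def using s0 L by (simp add: power_divide)
  define m where "m r = Max ((\<lambda>a. \<bar>\<Sum>i<n. r i * a i\<bar>) ` A)" for r
  \<comment> \<open>The tangent inequality 1 + u <= exp u takes the place of Jensen's inequality:
    the right side averages to at most \<open>c\<close> as soon as the exponential moment of
    \<open>m\<close> is at most exp (l c).\<close>
  have m_le: "m r \<le> c + (exp (l * m r) * exp (- (l * c)) - 1) / l" for r
  proof -
    have "1 + (l * m r - l * c) \<le> exp (l * m r - l * c)" by (rule exp_ge_add_one_self)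
    then have "l * (m r - c) \<le> exp (l * m r) * exp (- (l * c)) - 1"
      by (simp add: exp_diff exp_minus field_simps)
    then show ?thesis using l by (simp add: field_simps)
  qed
  have exp_m: "exp (l * m r) \<le> (\<Sum>a\<in>A. exp (l * (\<Sum>i<n. r i * a i)) + exp (- l * (\<Sum>i<n. r i * a i)))" for r
  proof -
    have "m r \<in> (\<lambda>a. \<bar>\<Sum>i<n. r i * a i\<bar>) ` A"
      unfolding m_def using A by (intro Max_in) auto
    then obtain a where a: "a \<in> A" "m r = \<bar>\<Sum>i<n. r i * a i\<bar>" by auto
    have "exp (l * m r) \<le> exp (l * (\<Sum>i<n. r i * a i)) + exp (- l * (\<Sum>i<n. r i * a i))"
      unfolding a(2) by (cases "(\<Sum>i<n. r i * a i) \<ge> 0") auto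
    also have "\<dots> \<le> (\<Sum>a\<in>A. exp (l * (\<Sum>i<n. r i * a i)) + exp (- l * (\<Sum>i<n. r i * a i)))"
      using A a by (intro member_le_sum) (auto intro: add_nonneg_nonneg)
    finally show ?thesis .
  qed
  have "(\<Sum>r\<in>signs n. exp (l * m r)) \<le>
      (\<Sum>r\<in>signs n. \<Sum>a\<in>A. exp (l * (\<Sum>i<n. r i * a i)) + exp (- l * (\<Sum>i<n. r i * a i)))"
    by (intro sum_mono exp_m)
  also have "\<dots> = (\<Sum>a\<in>A. (\<Sum>r\<in>signs n. exp (l * (\<Sum>i<n. r i * a i))) + (\<Sum>r\<in>signs n. exp (- l * (\<Sum>i<n. r i * a i))))"
    by (subst sum.swap) (simp add: sum.distrib)
  also have "\<dots> \<le> (\<Sum>a\<in>A. 2 ^ n * exp L + 2 ^ n * exp L)"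
  proof (intro sum_mono add_mono)
    fix a assume a: "a \<in> A"
    have "l\<^sup>2 * (\<Sum>i<n. (a i)\<^sup>2) / 2 \<le> L"
      using mult_left_mono[OF s(2)[OF a], of "l\<^sup>2"] ls by simp
    then have *: "2 ^ n * exp (l\<^sup>2 * (\<Sum>i<n. (a i)\<^sup>2) / 2) \<le> 2 ^ n * exp L" by simp
    show "(\<Sum>r\<in>signs n. exp (l * (\<Sum>i<n. r i * a i))) \<le> 2 ^ n * exp L"
      using rademacher_mgf_le[of l a n] * by linarith
    show "(\<Sum>r\<in>signs n. exp (- l * (\<Sum>i<n. r i * a i))) \<le> 2 ^ n * exp L"
      using rademacher_mgf_le[of "- l" a n, unfolded power2_minus] * by linarith
  qed
  also have "\<dots> = 2 ^ n * (exp L * (2 * N))" by (simp add: N_def)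
  also have "2 * N = exp L" unfolding L_def using N by simp
  also have "exp L * exp L = exp (l * c)" by (simp add: lc exp_add[symmetric])
  finally have E: "(\<Sum>r\<in>signs n. exp (l * m r)) \<le> 2 ^ n * exp (l * c)" .
  have "(\<Sum>r\<in>signs n. m r) \<le> (\<Sum>r\<in>signs n. c + (exp (l * m r) * exp (- (l * c)) - 1) / l)"
    by (intro sum_mono m_le)
  also have "\<dots> = 2 ^ n * c + ((\<Sum>r\<in>signs n. exp (l * m r)) * exp (- (l * c)) - 2 ^ n) / l"
    by (simp add: sum.distrib sum_divide_distrib[symmetric] sum_subtractf sum_distrib_right)
  also have "\<dots> \<le> 2 ^ n * c + ((2 ^ n * exp (l * c)) * exp (- (l * c)) - 2 ^ n) / l"
    using l E by (intro add_left_mono divide_right_mono diff_right_mono mult_right_mono) auto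
  also have "\<dots> = 2 ^ n * c" by (simp add: exp_minus)
  finally show ?thesis unfolding m_def c_def L_def N_def .
qed

subsection \<open>Uniform entropy and nets\<close>

definition emp_norm :: "nat \<Rightarrow> (nat \<Rightarrow> real) \<Rightarrow> (real \<Rightarrow> real) \<Rightarrow> real" where
  "emp_norm n x g = sqrt ((\<Sum>i<n. (g (x i))\<^sup>2) / real n)"

text \<open>The empirical measure of the first \<open>n\<close> points, ties included, in the form
  of a finitely supported \<open>pmf\<close>, so that it can be inserted for \<open>Q\<close> in the
  entropy condition.\<close>

definition emp_pmf :: "nat \<Rightarrow> (nat \<Rightarrow> real) \<Rightarrow> real pmf" where
  "emp_pmf n x = map_pmf x (pmf_of_set {..<n})"

lemma finite_emp_pmf: "n > 0 \<Longrightarrow> finite (set_pmf (emp_pmf n x))"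
  by (subst emp_pmf_def, subst set_map_pmf, subst set_pmf_of_set) auto

lemma L2_seminorm_emp_pmf:
  assumes "n > 0" shows "L2_seminorm (measure_pmf (emp_pmf n x)) g = emp_norm n x g"
proof -
  have "{..<n} \<noteq> {}" using assms by auto
  then show ?thesis
    by (simp add: L2_seminorm_def emp_norm_def emp_pmf_def integral_map_pmf integral_pmf_of_set)
qed

lemma emp_norm_nonneg [simp]: "emp_norm n x g \<ge> 0"
  by (simp add: emp_norm_def sum_nonneg)

lemma emp_norm_sq: "n > 0 \<Longrightarrow> (\<Sum>i<n. (g (x i))\<^sup>2) = real n * (emp_norm n x g)\<^sup>2"
  by (simp add: emp_norm_def sum_nonneg)

lemma emp_norm_mono: "(\<And>i. i < n \<Longrightarrow> \<bar>g (x i)\<bar> \<le> \<bar>h (x i)\<bar>) \<Longrightarrow> emp_norm n x g \<le> emp_norm n x h"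
  unfolding emp_norm_def
  by (intro real_sqrt_le_mono divide_right_mono sum_mono) (auto simp: abs_le_square_iff)

lemma emp_norm_add_le: "emp_norm n x (\<lambda>y. g y + h y) \<le> emp_norm n x g + emp_norm n x h"
proof -
  have "emp_norm n x u = L2_set (\<lambda>i. u (x i)) {..<n} / sqrt (real n)" for u
    by (simp add: emp_norm_def L2_set_def real_sqrt_divide)
  then show ?thesis
    using L2_set_triangle_ineq[of "\<lambda>i. g (x i)" "\<lambda>i. h (x i)" "{..<n}"]
    by (simp add: divide_right_mono flip: add_divide_distrib)
qed

lemma emp_norm_minus_commute: "emp_norm n x (\<lambda>y. g y - h y) = emp_norm n x (\<lambda>y. h y - g y)"
  by (simp add: emp_norm_def power2_commute)

lemma emp_norm_diff_le:
  "emp_norm n x (\<lambda>y. g y - h y) \<le> emp_norm n x (\<lambda>y. g y - u y) + emp_norm n x (\<lambda>y. u y - h y)"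
  using emp_norm_add_le[of n x "\<lambda>y. g y - u y" "\<lambda>y. u y - h y"] by simp

lemma sum_abs_le_emp_norm: "(\<Sum>i<n. \<bar>g (x i)\<bar>) \<le> real n * emp_norm n x g"
proof (cases "n = 0")
  case False
  have "(\<Sum>i<n. \<bar>g (x i)\<bar> * \<bar>1\<bar>) \<le> L2_set (\<lambda>i. g (x i)) {..<n} * L2_set (\<lambda>i. 1) {..<n}"
    by (rule L2_set_mult_ineq)
  also have "\<dots> = real n * emp_norm n x g"
    using False by (simp add: L2_set_def emp_norm_def real_sqrt_divide field_simps)
  finally show ?thesis by simp
qed auto

lemma covering_number_le_obtain:
  assumes "covering_number r \<G> Q \<le> enat m"
  obtains C where "finite C" "card C \<le> m" "\<And>g. g \<in> \<G> \<Longrightarrow> \<exists>c\<in>C. L2_seminorm Q (\<lambda>x. g x - c x) < r"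
proof -
  let ?S = "{enat (card C) | C. finite C \<and> (\<forall>g\<in>\<G>. \<exists>c\<in>C. L2_seminorm Q (\<lambda>x. g x - c x) < r)}"
  have "?S \<noteq> {}"
    using assms unfolding covering_number_def by (metis (lifting) Inf_enat_def enat_ord_simps(5) infinity_ileE)
  then have "Inf ?S \<in> ?S"
    by (rule wellorder_InfI[of _ ?S, OF someI_ex[OF ex_in_conv[THEN iffD2]]])
  then show ?thesis
    using assms that unfolding covering_number_def by auto
qed

lemma covering_number_antimono:
  assumes "r \<le> r'" shows "covering_number r' \<G> Q \<le> covering_number r \<G> Q"
  unfolding covering_number_def
  by (rule Inf_superset_mono) (use assms in \<open>fastforce intro: less_le_trans\<close>)

lemma sqrt_log_mono: "m \<le> n \<Longrightarrow> sqrt_log m \<le> sqrt_log n"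
proof -
  \<comment> \<open>The case \<open>a = 0\<close> rests on \<open>ln 0 = 0\<close>; it occurs
    because the empty class has covering number 0.\<close>
  have "ln (real a) \<le> ln (real b)" if "a \<le> b" for a b
    using that by (cases "a = 0"; cases "b = 0") (auto simp: ln_ge_zero)
  then show "m \<le> n \<Longrightarrow> sqrt_log m \<le> sqrt_log n"
    unfolding sqrt_log_def by (cases m; cases n) (auto intro!: ennreal_leI)
qed

definition sup_entropy :: "(real \<Rightarrow> real) set \<Rightarrow> (real \<Rightarrow> real) \<Rightarrow> real \<Rightarrow> ennreal" where
  "sup_entropy \<G> V \<delta> = (SUP Q \<in> {Q :: real pmf. finite (set_pmf Q) \<and> L2_seminorm (measure_pmf Q) V > 0}.
           sqrt_log (covering_number (\<delta> * L2_seminorm (measure_pmf Q) V) \<G> (measure_pmf Q)))"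

lemma sup_entropy_antimono: "\<delta> \<le> \<delta>' \<Longrightarrow> sup_entropy \<G> V \<delta>' \<le> sup_entropy \<G> V \<delta>"
  unfolding sup_entropy_def
  by (intro SUP_mono') (auto intro!: sqrt_log_mono covering_number_antimono mult_right_mono simp: L2_seminorm_def)

text \<open>A lower Riemann sum: the entropy decreases in the radius, so on the dyadic interval from
  2^-(k+1) to 2^-k, of length 2^-(k+1), it is at least its value at the right end.\<close>

lemma suminf_sup_entropy_le:
  "(\<Sum>k. ennreal ((1/2) ^ Suc k) * sup_entropy \<G> V ((1/2) ^ k)) \<le>
    (\<integral>\<^sup>+ \<delta>. indicator {0<..} \<delta> * sup_entropy \<G> V \<delta> \<partial>lborel)"
proof -
  define I where "I k = {(1/2::real) ^ Suc k<..(1/2) ^ k}" for k :: nat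
  have disj: "disjoint_family I"
  proof -
    have *: "I i \<inter> I j = {}" if "i < j" for i j
    proof -
      have "(1/2::real) ^ j \<le> (1/2) ^ Suc i" using that by (intro power_decreasing) auto
      then show ?thesis by (auto simp: I_def)
    qed
    have "I i \<inter> I j = {}" if "i \<noteq> j" for i j
      using that *[of i j] *[of j i] by (cases "i < j") auto
    then show ?thesis by (auto simp: disjoint_family_on_def)
  qed
  have "(\<Sum>k. ennreal ((1/2) ^ Suc k) * sup_entropy \<G> V ((1/2) ^ k)) =
      (\<Sum>k. \<integral>\<^sup>+ \<delta>. sup_entropy \<G> V ((1/2) ^ k) * indicator (I k) \<delta> \<partial>lborel)"
    by (simp add: nn_integral_cmult_indicator I_def mult.commute)
  also have "\<dots> = (\<integral>\<^sup>+ \<delta>. (\<Sum>k. sup_entropy \<G> V ((1/2) ^ k) * indicator (I k) \<delta>) \<partial>lborel)"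
    by (rule nn_integral_suminf[symmetric]) (simp add: I_def)
  also have "\<dots> \<le> (\<integral>\<^sup>+ \<delta>. indicator {0<..} \<delta> * sup_entropy \<G> V \<delta> \<partial>lborel)"
  proof (rule nn_integral_mono)
    fix \<delta> :: real
    show "(\<Sum>k. sup_entropy \<G> V ((1/2) ^ k) * indicator (I k) \<delta>) \<le> indicator {0<..} \<delta> * sup_entropy \<G> V \<delta>"
    proof (cases "\<exists>k. \<delta> \<in> I k")
      case True
      then obtain k where k: "\<delta> \<in> I k" by blast
      then have other: "\<delta> \<notin> I j" if "j \<noteq> k" for j
        using disj that by (auto simp: disjoint_family_on_def)
      have pos: "\<delta> > 0" using k by (auto simp: I_def intro: less_trans[rotated])
      have "(\<Sum>j. sup_entropy \<G> V ((1/2) ^ j) * indicator (I j) \<delta>) =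
          (\<Sum>j\<in>{k}. sup_entropy \<G> V ((1/2) ^ j) * indicator (I j) \<delta>)"
        by (rule suminf_finite) (auto simp: other)
      also have "\<dots> \<le> sup_entropy \<G> V \<delta>"
        using k by (auto simp: I_def intro!: sup_entropy_antimono)
      finally show ?thesis using pos by simp
    qed simp
  qed
  finally show ?thesis .
qed

text \<open>
  The two properties of the class extracted from the uniform entropy condition: nets of
  radius \<open>2 ^ - k\<close> whose cardinality does not depend on the sample, and Dudley's sum.
\<close>

definition dyadic_nets :: "(real \<Rightarrow> real) set \<Rightarrow> (real \<Rightarrow> real) \<Rightarrow> (nat \<Rightarrow> nat) \<Rightarrow> bool" where
  "dyadic_nets \<G> V N \<longleftrightarrow> (\<forall>k. N k \<ge> 1) \<and> summable (\<lambda>k. (1/2) ^ k * sqrt (ln (real (N k)))) \<and>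
     (\<forall>n>0. \<forall>x k. \<exists>C. finite C \<and> card C \<le> N k \<and>
        (\<forall>g\<in>\<G>. \<exists>c\<in>C. emp_norm n x (\<lambda>y. g y - c y) \<le> (1/2) ^ k * emp_norm n x V))"

text \<open>Finiteness of the dyadic sum makes every \<open>l k\<close> finite, and
  \<open>N k\<close> is the largest number compatible with sqrt (ln m) <= L k. Since the supremum
  runs over all finitely discrete measures, the same \<open>N k\<close> serves the empirical measure
  of every sample of every size.\<close>

lemma uniform_entropy_imp_dyadic_nets:
  assumes ent: "uniformly_integrable_L2_entropy \<G> V" and env: "envelope V \<G>"
  obtains N where "dyadic_nets \<G> V N"
proof -
  define l where "l k = sup_entropy \<G> V ((1/2) ^ k)" for k :: nat
  have fin: "(\<Sum>k. ennreal ((1/2) ^ Suc k) * l k) < \<infinity>"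
    using ent suminf_sup_entropy_le[of \<G> V]
    unfolding uniformly_integrable_L2_entropy_def l_def sup_entropy_def[symmetric]
    by (meson le_less_trans)
  have l_fin: "l k < \<infinity>" for k
    using ennreal_suminf_lessD[OF fin, of k] by (auto simp: ennreal_mult_less_top)
  define L where "L k = enn2real (l k)" for k
  have L: "l k = ennreal (L k)" "L k \<ge> 0" for k
    using l_fin[of k] by (auto simp: L_def)
  define N where "N k = max 1 (nat \<lfloor>exp ((L k)\<^sup>2)\<rfloor>)" for k
  have "summable (\<lambda>k. (1/2) ^ Suc k * L k)"
  proof (rule summable_suminf_not_top)
    show "0 \<le> (1/2) ^ Suc k * L k" for k using L by simp
    have "(\<Sum>k. ennreal ((1/2) ^ Suc k * L k)) = (\<Sum>k. ennreal ((1/2) ^ Suc k) * l k)"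
      by (intro suminf_cong) (simp add: L ennreal_mult del: power_Suc)
    then show "(\<Sum>k. ennreal ((1/2) ^ Suc k * L k)) \<noteq> top"
      using fin by simp
  qed
  then have sum_L: "summable (\<lambda>k. (1/2) ^ k * L k)"
    using summable_mult[of "\<lambda>k. (1/2) ^ Suc k * L k" 2] by simp
  have N1: "N k \<ge> 1" for k unfolding N_def by simp
  have N_le: "real (N k) \<le> exp ((L k)\<^sup>2)" for k
    unfolding N_def by (simp add: of_nat_max)
  have lnN: "sqrt (ln (real (N k))) \<le> L k" for k
  proof -
    have "ln (real (N k)) \<le> (L k)\<^sup>2"
      using N_le[of k] N1[of k] by (metis ln_le_cancel_iff ln_exp exp_gt_zero of_nat_0_less_iff less_le_trans zero_less_one)
    then show ?thesis using L(2) real_le_lsqrt by blast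
  qed
  have "summable (\<lambda>k. (1/2) ^ k * sqrt (ln (real (N k))))"
    using lnN N1 by (intro summable_comparison_test'[OF sum_L, where N = 0]) (auto intro!: mult_left_mono)
  moreover have "\<exists>C. finite C \<and> card C \<le> N k \<and>
        (\<forall>g\<in>\<G>. \<exists>c\<in>C. emp_norm n x (\<lambda>y. g y - c y) \<le> (1/2) ^ k * emp_norm n x V)"
    if n: "n > 0" for n x k
  \<comment> \<open>Measures under which the envelope vanishes are excluded from the supremum. For
    them the whole class vanishes at the sample points and the zero function alone is a net; this is
    one reason for \<open>N k \<ge> 1\<close>.\<close>
  proof (cases "emp_norm n x V = 0")
    case True
    have "emp_norm n x (\<lambda>y. g y - 0) \<le> emp_norm n x V" if "g \<in> \<G>" for g
      using env that by (intro emp_norm_mono) (auto simp: envelope_def intro: order_trans[OF _ abs_ge_self])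
    then show ?thesis
      using True N1 by (intro exI[of _ "{\<lambda>_. 0}"]) auto
  next
    case False
    then have pos: "emp_norm n x V > 0" by (simp add: less_le)
    let ?Q = "measure_pmf (emp_pmf n x)"
    have "sqrt_log (covering_number ((1/2) ^ k * emp_norm n x V) \<G> ?Q) \<le> l k"
      unfolding l_def sup_entropy_def
      by (rule SUP_upper2[of "emp_pmf n x"]) (use n pos in \<open>auto simp: L2_seminorm_emp_pmf finite_emp_pmf\<close>)
    then obtain m where m: "covering_number ((1/2) ^ k * emp_norm n x V) \<G> ?Q = enat m"
        "sqrt (ln (real m)) \<le> L k"
      using l_fin[of k] L[of k] by (auto simp: sqrt_log_def ennreal_le_iff top_unique split: enat.splits)
    have "m \<le> N k"
    proof (cases "m = 0")
      case False
      then have "ln (real m) \<le> (L k)\<^sup>2"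
        using m(2) L(2)[of k] by (metis sqrt_le_D)
      then have "real m \<le> exp ((L k)\<^sup>2)"
        using False by (metis exp_le_cancel_iff exp_ln of_nat_0_less_iff gr0I)
      then show ?thesis unfolding N_def by (simp add: le_nat_floor le_max_iff_disj)
    qed simp
    then have "covering_number ((1/2) ^ k * emp_norm n x V) \<G> ?Q \<le> enat (N k)"
      using m by simp
    then obtain C where "finite C" "card C \<le> N k"
      "\<And>g. g \<in> \<G> \<Longrightarrow> \<exists>c\<in>C. L2_seminorm ?Q (\<lambda>x. g x - c x) < (1/2) ^ k * emp_norm n x V"
      using covering_number_le_obtain by blast
    then show ?thesis
      using n by (intro exI[of _ C]) (auto simp: L2_seminorm_emp_pmf intro: less_imp_le)
  qed
  ultimately have "dyadic_nets \<G> V N"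
    unfolding dyadic_nets_def using N1 by blast
  then show ?thesis ..
qed

subsection \<open>Chaining\<close>

text \<open>Massart's factor sqrt (2 ln (2 m)) for the m = (N K)^2 differences of two centres of
  level \<open>K\<close>, the coarsest level of the chains.\<close>

definition level_const :: "(nat \<Rightarrow> nat) \<Rightarrow> nat \<Rightarrow> real" where
  "level_const N K = sqrt (2 * ln (2 * (real (N K))\<^sup>2))"

text \<open>The radius of level \<open>k\<close> times Massart's factor for the N k N (k + 1)
  possible links between the levels \<open>k\<close> and \<open>k + 1\<close>. Its sum is the
  discrete form of the entropy integral.\<close>

definition entropy_step :: "(nat \<Rightarrow> nat) \<Rightarrow> nat \<Rightarrow> real" where
  "entropy_step N k = (1/2) ^ k * sqrt (2 * ln (2 * (real (N k) * real (N (Suc k)))))"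

lemma dyadic_nets_ge_1: "dyadic_nets \<G> V N \<Longrightarrow> N k \<ge> 1"
  by (simp add: dyadic_nets_def)

lemma level_const_nonneg: "dyadic_nets \<G> V N \<Longrightarrow> level_const N K \<ge> 0"
proof -
  assume "dyadic_nets \<G> V N"
  then have "1 \<le> (real (N K))\<^sup>2"
    using dyadic_nets_ge_1[of \<G> V N K] by (intro one_le_power) auto
  then have "1 \<le> 2 * (real (N K))\<^sup>2" by linarith
  then show ?thesis
    unfolding level_const_def by (intro real_sqrt_ge_zero mult_nonneg_nonneg ln_ge_zero) auto
qed

lemma one_le_mult_real: "(a::real) \<ge> 1 \<Longrightarrow> b \<ge> 1 \<Longrightarrow> a * b \<ge> 1"
  using mult_mono[of 1 a 1 b] by simp

lemma entropy_step_nonneg: "dyadic_nets \<G> V N \<Longrightarrow> entropy_step N k \<ge> 0"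
  using dyadic_nets_ge_1[of \<G> V N k] dyadic_nets_ge_1[of \<G> V N "Suc k"]
    one_le_mult_real[of "real (N k)" "real (N (Suc k))"]
  unfolding entropy_step_def by (intro real_sqrt_ge_zero mult_nonneg_nonneg ln_ge_zero) auto

text \<open>The logarithm of the product splits and the square root is subadditive. The factor 2 in
  front of \<open>a (Suc k)\<close> restores the radius of level \<open>k\<close>.\<close>

lemma summable_entropy_step:
  assumes "dyadic_nets \<G> V N" shows "summable (entropy_step N)"
proof -
  define a where "a k = (1/2::real) ^ k * sqrt (ln (real (N k)))" for k
  have N: "real (N k) \<ge> 1" for k using dyadic_nets_ge_1[OF assms, of k] by simp
  have a: "summable a" using assms unfolding dyadic_nets_def a_def by blast
  have "summable (\<lambda>k. sqrt (2 * ln 2) * (1/2) ^ k + sqrt 2 * a k + 2 * sqrt 2 * a (Suc k))"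
    using a by (intro summable_add summable_mult) (auto simp: summable_Suc_iff intro!: summable_geometric)
  moreover have "norm (entropy_step N k) \<le> sqrt (2 * ln 2) * (1/2) ^ k + sqrt 2 * a k + 2 * sqrt 2 * a (Suc k)" for k
  proof -
    have "2 * ln (2 * (real (N k) * real (N (Suc k)))) = 2 * ln 2 + 2 * ln (real (N k)) + 2 * ln (real (N (Suc k)))"
      using N[of k] N[of "Suc k"] by (simp add: ln_mult)
    then have "sqrt (2 * ln (2 * (real (N k) * real (N (Suc k))))) \<le>
        sqrt (2 * ln 2) + sqrt (2 * ln (real (N k))) + sqrt (2 * ln (real (N (Suc k))))"
      using N[of k] N[of "Suc k"] by (simp, intro order_trans[OF sqrt_add_le_add_sqrt] add_right_mono sqrt_add_le_add_sqrt) auto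
    then have "entropy_step N k \<le> (1/2) ^ k * (sqrt (2 * ln 2) + sqrt (2 * ln (real (N k))) + sqrt (2 * ln (real (N (Suc k)))))"
      unfolding entropy_step_def by (intro mult_left_mono) auto
    also have "\<dots> = sqrt (2 * ln 2) * (1/2) ^ k + sqrt 2 * a k + 2 * sqrt 2 * a (Suc k)"
      by (simp add: a_def real_sqrt_mult algebra_simps)
    finally show ?thesis using entropy_step_nonneg[OF assms] by simp
  qed
  ultimately show ?thesis by (rule summable_comparison_test'[where N = 0])
qed

lemma dyadic_nets_obtain_projections:
  assumes "dyadic_nets \<G> V N" "n > 0"
  obtains C \<pi> where "\<And>k. finite (C k)" "\<And>k. card (C k) \<le> N k"
    "\<And>k g. g \<in> \<G> \<Longrightarrow> \<pi> k g \<in> C k"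
    "\<And>k g. g \<in> \<G> \<Longrightarrow> emp_norm n x (\<lambda>y. g y - \<pi> k g y) \<le> (1/2) ^ k * emp_norm n x V"
proof -
  have "\<forall>k. \<exists>C. finite C \<and> card C \<le> N k \<and>
        (\<forall>g\<in>\<G>. \<exists>c\<in>C. emp_norm n x (\<lambda>y. g y - c y) \<le> (1/2) ^ k * emp_norm n x V)"
    using assms unfolding dyadic_nets_def by blast
  then obtain C where C: "finite (C k) \<and> card (C k) \<le> N k \<and>
        (\<forall>g\<in>\<G>. \<exists>c\<in>C k. emp_norm n x (\<lambda>y. g y - c y) \<le> (1/2) ^ k * emp_norm n x V)" for k
    by metis
  then have "\<forall>k g. \<exists>c. g \<in> \<G> \<longrightarrow> c \<in> C k \<and> emp_norm n x (\<lambda>y. g y - c y) \<le> (1/2) ^ k * emp_norm n x V"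
    by blast
  then obtain \<pi> where "g \<in> \<G> \<longrightarrow> \<pi> k g \<in> C k \<and> emp_norm n x (\<lambda>y. g y - \<pi> k g y) \<le> (1/2) ^ k * emp_norm n x V" for k g
    by metis
  then show ?thesis using C that by blast
qed

lemma emp_norm_const: "n > 0 \<Longrightarrow> c \<ge> 0 \<Longrightarrow> emp_norm n x (\<lambda>_. c) = c"
  by (simp add: emp_norm_def)

text \<open>Massart's inequality for the vectors of values at the sample points, whose squared
  length is \<open>n\<close> times the squared empirical norm. Distinct functions may give the same
  vector, so the cardinality of the image is only bounded by \<open>m\<close>.\<close>

lemma rademacher_max_net_le:
  fixes D :: "(real \<Rightarrow> real) set"
  assumes D: "finite D" "D \<noteq> {}" "card D \<le> m" and s: "s \<ge> 0" "\<And>c. c \<in> D \<Longrightarrow> emp_norm n x c \<le> s"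
    and n: "n > 0"
  shows "(\<Sum>r\<in>signs n. Max ((\<lambda>c. \<bar>\<Sum>i<n. r i * c (x i)\<bar>) ` D)) \<le> 2 ^ n * (sqrt (real n) * s * sqrt (2 * ln (2 * real m)))"
proof -
  let ?A = "(\<lambda>c i. c (x i)) ` D"
  have "(\<Sum>i<n. (a i)\<^sup>2) \<le> (sqrt (real n) * s)\<^sup>2" if a: "a \<in> ?A" for a
  proof -
    from a obtain c where c: "c \<in> D" "a = (\<lambda>i. c (x i))" by (rule imageE)
    have "(emp_norm n x c)\<^sup>2 \<le> s\<^sup>2" using s(2)[OF c(1)] by (intro power_mono) auto
    then show ?thesis using n by (simp add: c(2) emp_norm_sq power_mult_distrib)
  qed
  then have "(\<Sum>r\<in>signs n. Max ((\<lambda>a. \<bar>\<Sum>i<n. r i * a i\<bar>) ` ?A)) \<le>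
      2 ^ n * (sqrt (real n) * s * sqrt (2 * ln (2 * real (card ?A))))"
    using D s by (intro rademacher_max_le) auto
  also have "\<dots> \<le> 2 ^ n * (sqrt (real n) * s * sqrt (2 * ln (2 * real m)))"
  proof -
    have "card ?A \<le> m" using card_image_le[OF D(1)] D(3) order_trans by blast
    moreover have "card ?A > 0" using D by (simp add: card_gt_0_iff)
    ultimately have "ln (2 * real (card ?A)) \<le> ln (2 * real m)" by (subst ln_le_cancel_iff) auto
    then show ?thesis using s by (intro mult_left_mono real_sqrt_le_mono) auto
  qed
  finally show ?thesis by (simp add: image_image)
qed

lemma abs_sign_mult: "r \<in> signs n \<Longrightarrow> i < n \<Longrightarrow> \<bar>r i * a\<bar> = \<bar>a\<bar>"
proof -
  assume "r \<in> signs n" "i < n"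
  then have "r i = -1 \<or> r i = 1" unfolding signs_def by (auto dest!: PiE_mem[of _ _ _ i])
  then show ?thesis by auto
qed

text \<open>Dudley's chaining for one fixed sample. A difference of two members is split into the
  difference of their centres of level \<open>K\<close>, which inherits the small norm
  \<open>t\<close> up to twice the radius, the links of two chains, and a remainder. The factor 4 is
  two chains times the bound 2 v / 2^k for the norm of a link.\<close>

lemma rademacher_chaining:
  assumes nets: "dyadic_nets \<G> V N" and n: "n > 0" and t: "t \<ge> 0"
    and H: "\<And>h. h \<in> H \<Longrightarrow> (\<exists>g\<in>\<G>. \<exists>g'\<in>\<G>. h = (\<lambda>y. g y - g' y)) \<and> emp_norm n x h \<le> t"
  shows "(\<Sum>r\<in>signs n. SUP h\<in>H. ennreal \<bar>\<Sum>i<n. r i * h (x i)\<bar>) \<le>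
     ennreal (2 ^ n * sqrt (real n) * ((t + 2 * (1/2) ^ K * emp_norm n x V) * level_const N K +
        4 * emp_norm n x V * (\<Sum>k. entropy_step N (k + K))))"
proof (cases "H = {}")
  case True
  then show ?thesis by (simp add: bot_ennreal)
next
  case False
  then obtain g0 where g0: "g0 \<in> \<G>" using H by blast
  define v where "v = emp_norm n x V"
  have v: "v \<ge> 0" unfolding v_def by simp
  obtain C \<pi> where C: "\<And>k. finite (C k)" "\<And>k. card (C k) \<le> N k"
    and \<pi>: "\<And>k g. g \<in> \<G> \<Longrightarrow> \<pi> k g \<in> C k"
      "\<And>k g. g \<in> \<G> \<Longrightarrow> emp_norm n x (\<lambda>y. g y - \<pi> k g y) \<le> (1/2) ^ k * v"
    unfolding v_def by (rule dyadic_nets_obtain_projections[OF nets n]) blast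
  \<comment> \<open>All pairs of centres that are close enough are collected, so that the set
    depends on the nets only and its cardinality is bounded by the product of the two net
    sizes.\<close>
  define A where "A k = (\<lambda>(c, c') y. c' y - c y) ` {(c, c') \<in> C k \<times> C (Suc k). emp_norm n x (\<lambda>y. c' y - c y) \<le> 2 * (1/2) ^ k * v}" for k
  define B where "B = (\<lambda>(c, c') y. c y - c' y) ` {(c, c') \<in> C K \<times> C K. emp_norm n x (\<lambda>y. c y - c' y) \<le> t + 2 * (1/2) ^ K * v}"
  have A_mem: "(\<lambda>y. \<pi> (Suc k) g y - \<pi> k g y) \<in> A k" if g: "g \<in> \<G>" for k g
  proof -
    have "emp_norm n x (\<lambda>y. \<pi> (Suc k) g y - \<pi> k g y) \<le>
        emp_norm n x (\<lambda>y. \<pi> (Suc k) g y - g y) + emp_norm n x (\<lambda>y. g y - \<pi> k g y)"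
      by (rule emp_norm_diff_le)
    also have "\<dots> \<le> (1/2) ^ Suc k * v + (1/2) ^ k * v"
      using \<pi>(2)[OF g, of k] \<pi>(2)[OF g, of "Suc k"]
      unfolding emp_norm_minus_commute[of n x "\<pi> (Suc k) g"] by linarith
    also have "\<dots> \<le> 2 * (1/2) ^ k * v"
      using v mult_nonneg_nonneg[of "(1/2::real) ^ k" v] by (simp add: algebra_simps)
    finally show ?thesis
      unfolding A_def using \<pi>(1)[OF g]
      by (intro image_eqI[of _ _ "(\<pi> k g, \<pi> (Suc k) g)"]) auto
  qed
  have B_mem: "(\<lambda>y. \<pi> K g y - \<pi> K g' y) \<in> B"
    if g: "g \<in> \<G>" "g' \<in> \<G>" and "emp_norm n x (\<lambda>y. g y - g' y) \<le> t" for g g'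
  proof -
    have "emp_norm n x (\<lambda>y. \<pi> K g y - \<pi> K g' y) \<le>
        emp_norm n x (\<lambda>y. \<pi> K g y - g y) + (emp_norm n x (\<lambda>y. g y - g' y) + emp_norm n x (\<lambda>y. g' y - \<pi> K g' y))"
      using emp_norm_diff_le[of n x "\<pi> K g" "\<pi> K g'" g] emp_norm_diff_le[of n x g "\<pi> K g'" g'] by linarith
    also have "\<dots> \<le> (1/2) ^ K * v + (t + (1/2) ^ K * v)"
      using \<pi>(2)[OF g(1), of K] \<pi>(2)[OF g(2), of K] that(3)
      unfolding emp_norm_minus_commute[of n x "\<pi> K g"] by linarith
    finally have "emp_norm n x (\<lambda>y. \<pi> K g y - \<pi> K g' y) \<le> t + 2 * (1/2) ^ K * v" by linarith
    then show ?thesis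
      unfolding B_def using \<pi>(1)[OF g(1)] \<pi>(1)[OF g(2)]
      by (intro image_eqI[of _ _ "(\<pi> K g, \<pi> K g')"]) auto
  qed
  have B0: "B \<noteq> {}"
  proof -
    have "emp_norm n x (\<lambda>y. g0 y - g0 y) \<le> t" using t by (simp add: emp_norm_def)
    then show ?thesis using B_mem[OF g0 g0] by blast
  qed
  have finP: "finite {(c, c') \<in> C j \<times> C k. P c c'}" for j k P
    by (rule finite_subset[OF _ finite_cartesian_product[OF C(1) C(1), of j k]]) auto
  have fin: "finite (A k)" "finite B" for k
    unfolding A_def B_def by (rule finite_imageI, rule finP)+
  have card_A: "card (A k) \<le> N k * N (Suc k)" for k
  proof -
    have "card (A k) \<le> card {(c, c') \<in> C k \<times> C (Suc k). emp_norm n x (\<lambda>y. c' y - c y) \<le> 2 * (1/2) ^ k * v}"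
      unfolding A_def by (rule card_image_le) (rule finP)
    also have "\<dots> \<le> card (C k \<times> C (Suc k))" by (intro card_mono finite_cartesian_product C(1)) auto
    also have "\<dots> \<le> N k * N (Suc k)" by (simp add: card_cartesian_product mult_le_mono C(2))
    finally show ?thesis .
  qed
  have card_B: "card B \<le> (N K)\<^sup>2"
  proof -
    have "card B \<le> card {(c, c') \<in> C K \<times> C K. emp_norm n x (\<lambda>y. c y - c' y) \<le> t + 2 * (1/2) ^ K * v}"
      unfolding B_def by (rule card_image_le) (rule finP)
    also have "\<dots> \<le> card (C K \<times> C K)" by (intro card_mono finite_cartesian_product C(1)) auto
    also have "\<dots> \<le> (N K)\<^sup>2" by (simp add: card_cartesian_product mult_le_mono C(2) power2_eq_square)
    finally show ?thesis .
  qed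
  define mA where "mA k r = Max ((\<lambda>c. \<bar>\<Sum>i<n. r i * c (x i)\<bar>) ` A k)" for k r
  define mB where "mB r = Max ((\<lambda>c. \<bar>\<Sum>i<n. r i * c (x i)\<bar>) ` B)" for r
  define S where "S r g = (\<Sum>i<n. r i * g (x i))" for r :: "nat \<Rightarrow> real" and g :: "real \<Rightarrow> real"
  have S_diff: "S r (\<lambda>y. g y - h y) = S r g - S r h" for r :: "nat \<Rightarrow> real" and g h
    by (simp add: S_def algebra_simps sum_subtractf)
  have S_mA: "\<bar>S r (\<pi> (K + J) g) - S r (\<pi> K g)\<bar> \<le> (\<Sum>j<J. mA (K + j) r)" if g: "g \<in> \<G>" for r g J
  proof (induction J)
    case (Suc J)
    have "\<bar>S r (\<lambda>y. \<pi> (Suc (K + J)) g y - \<pi> (K + J) g y)\<bar> \<le> mA (K + J) r"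
      unfolding mA_def S_def
      by (rule Max_ge[OF finite_imageI[OF fin(1)] imageI[OF A_mem[OF g], where f = "\<lambda>c. \<bar>\<Sum>i<n. r i * c (x i)\<bar>"]])
    then show ?case using Suc by (simp add: S_diff)
  qed simp
  \<comment> \<open>A crude Cauchy-Schwarz bound, the same for all sign vectors. It loses a factor
    sqrt n, but it vanishes when the level grows with \<open>n\<close> fixed.\<close>
  have S_rest: "\<bar>S r g - S r (\<pi> k g)\<bar> \<le> real n * ((1/2) ^ k * v)" if g: "g \<in> \<G>" and r: "r \<in> signs n" for r g k
  proof -
    have "\<bar>S r (\<lambda>y. g y - \<pi> k g y)\<bar> \<le> (\<Sum>i<n. \<bar>r i * (g (x i) - \<pi> k g (x i))\<bar>)"
      unfolding S_def by (rule sum_abs)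
    also have "\<dots> = (\<Sum>i<n. \<bar>g (x i) - \<pi> k g (x i)\<bar>)"
      by (intro sum.cong refl abs_sign_mult[OF r]) simp
    also have "\<dots> \<le> real n * emp_norm n x (\<lambda>y. g y - \<pi> k g y)" by (rule sum_abs_le_emp_norm)
    also have "\<dots> \<le> real n * ((1/2) ^ k * v)" using \<pi>(2)[OF g] by (intro mult_left_mono) auto
    finally show ?thesis by (simp add: S_diff)
  qed
  have S_H: "\<bar>S r h\<bar> \<le> mB r + 2 * (\<Sum>j<J. mA (K + j) r) + 2 * (real n * ((1/2) ^ (K + J) * v))"
    if "h \<in> H" and r: "r \<in> signs n" for r h J
  proof -
    obtain g g' where g: "g \<in> \<G>" "g' \<in> \<G>" and h: "h = (\<lambda>y. g y - g' y)" using H[OF \<open>h \<in> H\<close>] by blast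
    have "\<bar>S r (\<lambda>y. \<pi> K g y - \<pi> K g' y)\<bar> \<le> mB r"
      unfolding mB_def S_def using H[OF \<open>h \<in> H\<close>] h
      by (intro Max_ge[OF finite_imageI[OF fin(2)] imageI[OF B_mem[OF g], where f = "\<lambda>c. \<bar>\<Sum>i<n. r i * c (x i)\<bar>"]]) simp
    then show ?thesis
      using S_mA[OF g(1), of r J] S_mA[OF g(2), of r J] S_rest[OF g(1) r, of "K + J"] S_rest[OF g(2) r, of "K + J"]
      unfolding h S_diff by linarith
  qed
  let ?X = "2 ^ n * sqrt (real n) * ((t + 2 * (1/2) ^ K * v) * level_const N K + 4 * v * (\<Sum>k. entropy_step N (k + K)))"
  have mA_sum: "(\<Sum>r\<in>signs n. mA k r) \<le> 2 ^ n * (sqrt (real n) * (2 * v * entropy_step N k))" for k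
  proof -
    have "(\<Sum>r\<in>signs n. mA k r) \<le> 2 ^ n * (sqrt (real n) * (2 * (1/2) ^ k * v) * sqrt (2 * ln (2 * real (N k * N (Suc k)))))"
      unfolding mA_def
    proof (rule rademacher_max_net_le[OF fin(1) _ card_A _ _ n])
      show "A k \<noteq> {}" using A_mem[OF g0] by blast
      show "emp_norm n x c \<le> 2 * (1/2) ^ k * v" if "c \<in> A k" for c
        using that unfolding A_def by auto
    qed (use v in simp)
    then show ?thesis by (simp add: entropy_step_def mult_ac)
  qed
  have mB_sum: "(\<Sum>r\<in>signs n. mB r) \<le> 2 ^ n * (sqrt (real n) * ((t + 2 * (1/2) ^ K * v) * level_const N K))"
  proof -
    have "(\<Sum>r\<in>signs n. mB r) \<le> 2 ^ n * (sqrt (real n) * (t + 2 * (1/2) ^ K * v) * sqrt (2 * ln (2 * real ((N K)\<^sup>2))))"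
      unfolding mB_def
      by (rule rademacher_max_net_le[OF fin(2) B0 card_B _ _ n]) (use v t in \<open>auto simp: B_def\<close>)
    then show ?thesis by (simp add: level_const_def mult_ac)
  qed
  have bound: "(\<Sum>r\<in>signs n. SUP h\<in>H. ennreal \<bar>S r h\<bar>) \<le> ennreal (?X + 2 ^ n * (2 * (real n * ((1/2) ^ (K + J) * v))))" for J
  proof -
    have mB0: "mB r \<ge> 0" for r
      unfolding mB_def using B0 fin by (subst Max_ge_iff) auto
    have mA0: "mA k r \<ge> 0" for k r
      unfolding mA_def using A_mem[OF g0] fin by (subst Max_ge_iff) auto
    have nn: "mB r + 2 * (\<Sum>j<J. mA (K + j) r) + 2 * (real n * ((1/2) ^ (K + J) * v)) \<ge> 0" for r
      using v by (intro add_nonneg_nonneg mB0 mult_nonneg_nonneg sum_nonneg mA0) auto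
    have "(\<Sum>r\<in>signs n. SUP h\<in>H. ennreal \<bar>S r h\<bar>) \<le>
        (\<Sum>r\<in>signs n. ennreal (mB r + 2 * (\<Sum>j<J. mA (K + j) r) + 2 * (real n * ((1/2) ^ (K + J) * v))))"
      by (intro sum_mono SUP_least ennreal_leI S_H)
    also have "\<dots> = ennreal (\<Sum>r\<in>signs n. mB r + 2 * (\<Sum>j<J. mA (K + j) r) + 2 * (real n * ((1/2) ^ (K + J) * v)))"
      by (intro sum_ennreal nn)
    also have "(\<Sum>r\<in>signs n. mB r + 2 * (\<Sum>j<J. mA (K + j) r) + 2 * (real n * ((1/2) ^ (K + J) * v))) =
        (\<Sum>r\<in>signs n. mB r) + 2 * (\<Sum>j<J. \<Sum>r\<in>signs n. mA (K + j) r) + 2 ^ n * (2 * (real n * ((1/2) ^ (K + J) * v)))"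
      by (simp add: sum.distrib sum_distrib_left[symmetric]) (rule sum.swap)
    also have "\<dots> \<le> 2 ^ n * (sqrt (real n) * ((t + 2 * (1/2) ^ K * v) * level_const N K)) +
        2 * (\<Sum>j<J. 2 ^ n * (sqrt (real n) * (2 * v * entropy_step N (K + j)))) + 2 ^ n * (2 * (real n * ((1/2) ^ (K + J) * v)))"
      by (intro add_mono mB_sum mult_left_mono sum_mono mA_sum) auto
    also have "\<dots> = 2 ^ n * sqrt (real n) * ((t + 2 * (1/2) ^ K * v) * level_const N K + 4 * v * (\<Sum>j<J. entropy_step N (j + K))) +
        2 ^ n * (2 * (real n * ((1/2) ^ (K + J) * v)))"
    proof -
      have "(\<Sum>j<J. 2 ^ n * (sqrt (real n) * (2 * v * entropy_step N (K + j)))) =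
          2 ^ n * sqrt (real n) * (2 * v) * (\<Sum>j<J. entropy_step N (j + K))"
        by (simp add: sum_distrib_left mult_ac add.commute)
      then show ?thesis by (simp add: algebra_simps)
    qed
    also have "\<dots> \<le> ?X + 2 ^ n * (2 * (real n * ((1/2) ^ (K + J) * v)))"
      using v entropy_step_nonneg[OF nets] summable_entropy_step[OF nets]
      by (intro add_right_mono mult_left_mono add_left_mono sum_le_suminf) (auto simp: summable_iff_shift)
    finally show ?thesis by (simp add: ennreal_leI)
  qed
  \<comment> \<open>The sample is fixed while the length \<open>J\<close> of the chains tends to
    infinity, which removes the remainder.\<close>
  have "(\<lambda>J. ennreal (?X + 2 ^ n * (2 * (real n * ((1/2) ^ (K + J) * v))))) \<longlonglongrightarrow> ennreal (?X + 2 ^ n * (2 * (real n * (0 * v))))"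
    unfolding power_add by (intro tendsto_intros tendsto_mult_right_zero LIMSEQ_power_zero) auto
  then have "(\<Sum>r\<in>signs n. SUP h\<in>H. ennreal \<bar>S r h\<bar>) \<le> ennreal ?X"
    using bound by (intro LIMSEQ_le_const) auto
  then show ?thesis unfolding S_def v_def .
qed

text \<open>Centres of nets are arbitrary functions. Clipping a centre to the range of the envelope
  makes it bounded by \<open>V\<close> and does not increase its distance to a member of the
  class.\<close>

definition clip :: "real \<Rightarrow> real \<Rightarrow> real" where "clip v u = max (- v) (min v u)"

lemma abs_clip_le: "v \<ge> 0 \<Longrightarrow> \<bar>clip v u\<bar> \<le> v"
  and abs_diff_clip_le: "\<bar>w\<bar> \<le> v \<Longrightarrow> \<bar>w - clip v u\<bar> \<le> \<bar>w - u\<bar>"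
  by (auto simp: clip_def)

text \<open>Only an error of order o(n) is wanted, so a single net replaces the chains. Squaring is
  Lipschitz on bounded sets only: where V > L the square is bounded by 4 V^2, elsewhere it changes
  by at most 4 L times the change of the difference, and approximating both members gives 8
  L.\<close>

lemma rademacher_squared_differences:
  assumes nets: "dyadic_nets \<G> V N" and n: "n > 0" and env: "envelope V \<G>" and V0: "\<And>y. V y \<ge> 0" and L: "L \<ge> 0"
  shows "(\<Sum>r\<in>signs n. SUP h\<in>squared_differences \<G>. ennreal \<bar>\<Sum>i<n. r i * h (x i)\<bar>) \<le>
     ennreal (2 ^ n * (4 * (\<Sum>i<n. (V (x i))\<^sup>2 * indicator {y. V y > L} (x i)) + 8 * L * real n * ((1/2) ^ K * emp_norm n x V)
        + sqrt (real n) * (4 * L\<^sup>2) * level_const N K))"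
proof (cases "\<G> = {}")
  case True
  then show ?thesis by (simp add: squared_differences_def bot_ennreal)
next
  case False
  then obtain g0 where g0: "g0 \<in> \<G>" by blast
  define v where "v = emp_norm n x V"
  have v: "v \<ge> 0" unfolding v_def by simp
  obtain C \<pi> where C: "\<And>k. finite (C k)" "\<And>k. card (C k) \<le> N k"
    and \<pi>: "\<And>k g. g \<in> \<G> \<Longrightarrow> \<pi> k g \<in> C k"
      "\<And>k g. g \<in> \<G> \<Longrightarrow> emp_norm n x (\<lambda>y. g y - \<pi> k g y) \<le> (1/2) ^ k * v"
    unfolding v_def by (rule dyadic_nets_obtain_projections[OF nets n]) blast
  \<comment> \<open>Clipping by \<open>V\<close> and cutting at \<open>L\<close> makes these
    approximants bounded by 4 L^2, whatever the centres are.\<close>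
  define q where "q c c' y = (if V y \<le> L then (clip (V y) (c y) - clip (V y) (c' y))\<^sup>2 else 0)" for c c' :: "real \<Rightarrow> real" and y
  define D where "D = (\<lambda>(c, c'). q c c') ` (C K \<times> C K)"
  have D: "finite D" "D \<noteq> {}" "card D \<le> (N K)\<^sup>2"
  proof -
    show "finite D" unfolding D_def using C by simp
    show "D \<noteq> {}" unfolding D_def using \<pi>(1)[OF g0] by auto
    have "card D \<le> card (C K \<times> C K)" unfolding D_def using C by (intro card_image_le) auto
    also have "\<dots> \<le> (N K)\<^sup>2" by (simp add: card_cartesian_product mult_le_mono C(2) power2_eq_square)
    finally show "card D \<le> (N K)\<^sup>2" .
  qed
  define m where "m r = Max ((\<lambda>c. \<bar>\<Sum>i<n. r i * c (x i)\<bar>) ` D)" for r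
  have q_bound: "\<bar>q c c' y\<bar> \<le> 4 * L\<^sup>2" for c c' y
  proof (cases "V y \<le> L")
    case True
    then have "\<bar>clip (V y) (c y) - clip (V y) (c' y)\<bar> \<le> 2 * L"
      using abs_clip_le[OF V0, of y "c y"] abs_clip_le[OF V0, of y "c' y"] by linarith
    then have "(clip (V y) (c y) - clip (V y) (c' y))\<^sup>2 \<le> (2 * L)\<^sup>2"
      using L by (intro abs_le_square_iff[THEN iffD1]) auto
    then show ?thesis using True by (simp add: q_def power_mult_distrib)
  qed (simp add: q_def)
  have "emp_norm n x c \<le> 4 * L\<^sup>2" if "c \<in> D" for c
  proof -
    have "emp_norm n x c \<le> emp_norm n x (\<lambda>_. 4 * L\<^sup>2)"
      using that q_bound by (intro emp_norm_mono) (auto simp: D_def)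
    also have "\<dots> = 4 * L\<^sup>2" using n by (intro emp_norm_const) auto
    finally show ?thesis .
  qed
  then have m_sum: "(\<Sum>r\<in>signs n. m r) \<le> 2 ^ n * (sqrt (real n) * (4 * L\<^sup>2) * level_const N K)"
    unfolding m_def level_const_def using rademacher_max_net_le[OF D, of "4 * L\<^sup>2" n x] n by simp
  have m0: "m r \<ge> 0" for r
    unfolding m_def using D by (subst Max_ge_iff) auto
  define R where "R = 4 * (\<Sum>i<n. (V (x i))\<^sup>2 * indicator {y. V y > L} (x i)) + 8 * L * real n * ((1/2) ^ K * v)"
  have R0: "R \<ge> 0" unfolding R_def using L v by (intro add_nonneg_nonneg mult_nonneg_nonneg sum_nonneg) auto
  have main: "\<bar>\<Sum>i<n. r i * (g (x i) - g' (x i))\<^sup>2\<bar> \<le> m r + R"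
    if g: "g \<in> \<G>" "g' \<in> \<G>" and r: "r \<in> signs n" for r g g'
  proof -
    let ?c = "\<pi> K g" and ?c' = "\<pi> K g'"
    have pt: "\<bar>(g y - g' y)\<^sup>2 - q ?c ?c' y\<bar> \<le>
        4 * ((V y)\<^sup>2 * indicator {y. V y > L} y) + 4 * L * (\<bar>g y - ?c y\<bar> + \<bar>g' y - ?c' y\<bar>)" for y
    proof (cases "V y \<le> L")
      case True
      define a b where "a = clip (V y) (?c y)" and "b = clip (V y) (?c' y)"
      have gV: "\<bar>g y\<bar> \<le> V y" "\<bar>g' y\<bar> \<le> V y" using env g by (auto simp: envelope_def)
      have ab: "\<bar>a\<bar> \<le> V y" "\<bar>b\<bar> \<le> V y" unfolding a_def b_def using abs_clip_le[OF V0] by blast+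
      have 1: "\<bar>(g y - a) - (g' y - b)\<bar> \<le> \<bar>g y - ?c y\<bar> + \<bar>g' y - ?c' y\<bar>"
        using abs_diff_clip_le[OF gV(1), of "?c y"] abs_diff_clip_le[OF gV(2), of "?c' y"]
        unfolding a_def b_def by linarith
      have 2: "\<bar>(g y - g' y) + (a - b)\<bar> \<le> 4 * L" using gV ab True by linarith
      have "(g y - g' y)\<^sup>2 - (a - b)\<^sup>2 = ((g y - a) - (g' y - b)) * ((g y - g' y) + (a - b))"
        by (simp add: power2_eq_square algebra_simps)
      then have "\<bar>(g y - g' y)\<^sup>2 - (a - b)\<^sup>2\<bar> \<le> (\<bar>g y - ?c y\<bar> + \<bar>g' y - ?c' y\<bar>) * (4 * L)"
        using mult_mono[OF 1 2] by (simp add: abs_mult)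
      then show ?thesis using True by (simp add: q_def a_def b_def mult_ac)
    next
      case False
      have "\<bar>g y\<bar> \<le> V y" "\<bar>g' y\<bar> \<le> V y" using env g by (auto simp: envelope_def)
      then have "\<bar>g y - g' y\<bar> \<le> \<bar>2 * V y\<bar>" by linarith
      then have "(g y - g' y)\<^sup>2 \<le> 4 * (V y)\<^sup>2" by (simp add: abs_le_square_iff power_mult_distrib)
      then show ?thesis using False L by (auto simp: q_def intro: add_increasing2)
    qed
    have "\<bar>(\<Sum>i<n. r i * (g (x i) - g' (x i))\<^sup>2) - (\<Sum>i<n. r i * q ?c ?c' (x i))\<bar> =
        \<bar>\<Sum>i<n. r i * ((g (x i) - g' (x i))\<^sup>2 - q ?c ?c' (x i))\<bar>"
      by (simp add: sum_subtractf algebra_simps)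
    also have "\<dots> \<le> (\<Sum>i<n. \<bar>r i * ((g (x i) - g' (x i))\<^sup>2 - q ?c ?c' (x i))\<bar>)" by (rule sum_abs)
    also have "\<dots> = (\<Sum>i<n. \<bar>(g (x i) - g' (x i))\<^sup>2 - q ?c ?c' (x i)\<bar>)"
      by (intro sum.cong refl abs_sign_mult[OF r]) simp
    also have "\<dots> \<le> (\<Sum>i<n. 4 * ((V (x i))\<^sup>2 * indicator {y. V y > L} (x i)) +
        4 * L * (\<bar>g (x i) - ?c (x i)\<bar> + \<bar>g' (x i) - ?c' (x i)\<bar>))"
      by (intro sum_mono pt)
    also have "\<dots> = 4 * (\<Sum>i<n. (V (x i))\<^sup>2 * indicator {y. V y > L} (x i)) +
        4 * L * ((\<Sum>i<n. \<bar>g (x i) - ?c (x i)\<bar>) + (\<Sum>i<n. \<bar>g' (x i) - ?c' (x i)\<bar>))"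
      by (simp only: sum.distrib sum_distrib_left distrib_left)
    also have "\<dots> \<le> 4 * (\<Sum>i<n. (V (x i))\<^sup>2 * indicator {y. V y > L} (x i)) +
        4 * L * (real n * ((1/2) ^ K * v) + real n * ((1/2) ^ K * v))"
    proof -
      have net: "(\<Sum>i<n. \<bar>g (x i) - \<pi> K g (x i)\<bar>) \<le> real n * ((1/2) ^ K * v)" if "g \<in> \<G>" for g
        using sum_abs_le_emp_norm[of "\<lambda>y. g y - \<pi> K g y" x n] \<pi>(2)[OF that, of K]
        by (meson mult_left_mono of_nat_0_le_iff order_trans)
      show ?thesis
        using L by (intro add_left_mono mult_left_mono add_mono net g) auto
    qed
    also have "\<dots> = R" by (simp add: R_def algebra_simps)
    finally have "\<bar>(\<Sum>i<n. r i * (g (x i) - g' (x i))\<^sup>2) - (\<Sum>i<n. r i * q ?c ?c' (x i))\<bar> \<le> R" .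
    moreover have "\<bar>\<Sum>i<n. r i * q ?c ?c' (x i)\<bar> \<le> m r"
      unfolding m_def using D \<pi>(1)[OF g(1)] \<pi>(1)[OF g(2)] by (intro Max_ge) (auto simp: D_def)
    ultimately show ?thesis by linarith
  qed
  have "(\<Sum>r\<in>signs n. SUP h\<in>squared_differences \<G>. ennreal \<bar>\<Sum>i<n. r i * h (x i)\<bar>) \<le> (\<Sum>r\<in>signs n. ennreal (m r + R))"
    by (intro sum_mono SUP_least ennreal_leI) (auto simp: squared_differences_def intro: main)
  also have "\<dots> = ennreal (\<Sum>r\<in>signs n. m r + R)"
    using m0 R0 by (intro sum_ennreal) (auto intro: add_nonneg_nonneg)
  also have "\<dots> \<le> ennreal (2 ^ n * (R + sqrt (real n) * (4 * L\<^sup>2) * level_const N K))"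
    using m_sum by (intro ennreal_leI) (simp add: sum.distrib algebra_simps)
  finally show ?thesis unfolding R_def v_def .
qed

subsection \<open>Symmetrization\<close>

lemma prod_integral_component:
  fixes Q :: "'a measure" and h :: "'a \<Rightarrow> real"
  assumes "prob_space Q" "j \<in> J" "integrable Q h"
  shows "integrable (PiM J (\<lambda>_. Q)) (\<lambda>y. h (y j))" "(LINT y|PiM J (\<lambda>_. Q). h (y j)) = (LINT x|Q. h x)"
proof -
  have D: "distr (PiM J (\<lambda>_. Q)) Q (\<lambda>\<omega>. \<omega> j) = Q"
    using distr_PiM_component[of J "\<lambda>_. Q" j] assms by simp
  have m: "(\<lambda>\<omega>. \<omega> j) \<in> measurable (PiM J (\<lambda>_. Q)) Q"
    using assms by measurable
  show "integrable (PiM J (\<lambda>_. Q)) (\<lambda>y. h (y j))"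
    using integrable_distr[OF m, of h] assms D by simp
  show "(LINT y|PiM J (\<lambda>_. Q). h (y j)) = (LINT x|Q. h x)"
    using integral_distr[OF m, of h] assms D by simp
qed

text \<open>Symmetrization with a ghost sample, done on the product space with 2n coordinates: the
  expectation of \<open>h\<close> is replaced by an average over the second half, and exchanging
  \<open>i\<close> with \<open>n + i\<close> at the indices of negative sign leaves the product law
  unchanged. Since \<open>B\<close> bounds only the sum over all sign vectors, the estimate is
  averaged over them at the end.\<close>

lemma symmetrization:
  fixes Q :: "real measure" and H :: "(real \<Rightarrow> real) set"
  assumes Q: "prob_space Q" and cls: "P_measurable_class Q H"
    and H: "\<And>h. h \<in> H \<Longrightarrow> integrable Q h"
    and B: "B \<in> borel_measurable (PiM {..<n} (\<lambda>_. Q))"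
      "AE x in PiM {..<n} (\<lambda>_. Q). (\<Sum>r\<in>signs n. SUP h\<in>H. ennreal \<bar>\<Sum>i<n. r i * h (x i)\<bar>) \<le> 2 ^ n * B x"
  obtains U where "U \<in> borel_measurable (PiM {..<n} (\<lambda>_. Q))"
    "AE x in PiM {..<n} (\<lambda>_. Q). (SUP h\<in>H. ennreal \<bar>\<Sum>i<n. h (x i) - (LINT y|Q. h y)\<bar>) \<le> U x"
    "(\<integral>\<^sup>+ x. U x \<partial>PiM {..<n} (\<lambda>_. Q)) \<le> 2 * (\<integral>\<^sup>+ x. B x \<partial>PiM {..<n} (\<lambda>_. Q))"
proof -
  interpret Q: prob_space Q by fact
  interpret product_prob_space "\<lambda>_::nat. Q" by unfold_locales
  define I where "I = {..<n}"
  define J where "J = {n..<2 * n}"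
  define K where "K = {..<2 * n}"
  have IJ: "I \<inter> J = {}" "I \<union> J = K" "finite I" "finite J" "finite K"
    by (auto simp: I_def J_def K_def)
  let ?P = "\<lambda>I. PiM I (\<lambda>_::nat. Q)"
  interpret PI: prob_space "?P I" by (intro prob_space_PiM) (rule Q)
  interpret PJ: prob_space "?P J" by (intro prob_space_PiM) (rule Q)
  interpret PIJ: pair_sigma_finite "?P I" "?P J" ..
  define S where "S e m x = (SUP h\<in>H. ennreal \<bar>\<Sum>i<m. e i * h (x i)\<bar>)" for e :: "nat \<Rightarrow> real" and m :: nat and x
  have ex: "\<exists>T\<in>borel_measurable (?P {..<m}). (AE x in ?P {..<m}. S e m x = T x)" for e m
    using cls unfolding P_measurable_class_def S_def by (intro completion_ex_borel_measurable) auto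
  define e0 where "e0 i = (if i < n then 1 else - 1 :: real)" for i
  \<comment> \<open>The supremum is measurable only for the completion; \<open>T\<close> is a Borel
    version of it. Products and Fubini are applied to \<open>T\<close>, and the exceptional null set
    is carried along.\<close>
  obtain T where T[measurable]: "T \<in> borel_measurable (?P K)" and ST: "AE z in ?P K. S e0 (2 * n) z = T z"
    using ex[of "2 * n" e0] unfolding K_def by blast
  have merge_m[measurable]: "merge I J \<in> measurable (?P I \<Otimes>\<^sub>M ?P J) (?P K)"
    using measurable_merge[of I J "\<lambda>_. Q"] by (simp add: IJ)
  have "AE z in ?P I \<Otimes>\<^sub>M ?P J. S e0 (2 * n) (merge I J z) = T (merge I J z)"
    by (rule AE_distrD[OF merge_m]) (subst distr_merge[OF IJ(1,3,4), unfolded IJ(2)], rule ST)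
  then have ST2: "AE x in ?P I. AE y in ?P J. S e0 (2 * n) (merge I J (x, y)) = T (merge I J (x, y))"
    by (rule PIJ.AE_pair)
  \<comment> \<open>The ghost sample is integrated out. For each \<open>h\<close> separately the
    centred sum is the mean over the ghost sample of a difference of two sums, so its absolute value
    is at most the mean of the supremum; the exceptional null set of \<open>x\<close> comes from
    \<open>T\<close> and is common to all \<open>h\<close>.\<close>
  define U where "U x = (\<integral>\<^sup>+ y. T (merge I J (x, y)) \<partial>?P J)" for x
  have U_m: "U \<in> borel_measurable (?P I)"
    unfolding U_def by measurable
  have sum_merge: "(\<Sum>i<2 * n. e0 i * h (merge I J (x, y) i)) = (\<Sum>i\<in>I. h (x i)) - (\<Sum>j\<in>J. h (y j))" for h :: "real \<Rightarrow> real" and x y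
  proof -
    have "(\<Sum>i\<in>I \<union> J. e0 i * h (merge I J (x, y) i)) =
        (\<Sum>i\<in>I. e0 i * h (merge I J (x, y) i)) + (\<Sum>i\<in>J. e0 i * h (merge I J (x, y) i))"
      using IJ by (intro sum.union_disjoint) auto
    also have "(\<Sum>i\<in>I. e0 i * h (merge I J (x, y) i)) = (\<Sum>i\<in>I. h (x i))"
      by (intro sum.cong) (auto simp: e0_def I_def merge_def)
    also have "(\<Sum>i\<in>J. e0 i * h (merge I J (x, y) i)) = (\<Sum>i\<in>J. - h (y i))"
      by (intro sum.cong) (auto simp: e0_def I_def J_def merge_def)
    finally show ?thesis by (simp add: IJ K_def sum_negf)
  qed
  have U_ge: "AE x in ?P I. (SUP h\<in>H. ennreal \<bar>\<Sum>i<n. h (x i) - (LINT y|Q. h y)\<bar>) \<le> U x"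
    using ST2
  proof eventually_elim
    fix x assume x: "AE y in ?P J. S e0 (2 * n) (merge I J (x, y)) = T (merge I J (x, y))"
    show "(SUP h\<in>H. ennreal \<bar>\<Sum>i<n. h (x i) - (LINT y|Q. h y)\<bar>) \<le> U x"
    proof (rule SUP_least)
      fix h assume h: "h \<in> H"
      define a where "a = (\<Sum>i\<in>I. h (x i))"
      have comp: "integrable (?P J) (\<lambda>y. h (y j))" "(LINT y|?P J. h (y j)) = (LINT x|Q. h x)" if "j \<in> J" for j
        using prod_integral_component[OF Q that H[OF h]] by auto
      have int: "integrable (?P J) (\<lambda>y. a - (\<Sum>j\<in>J. h (y j)))"
        using comp by auto
      have "(LINT y|?P J. a - (\<Sum>j\<in>J. h (y j))) = a - (\<Sum>j\<in>J. LINT x|Q. h x)"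
        using comp by (subst Bochner_Integration.integral_diff) (auto simp: PJ.prob_space)
      also have "\<dots> = (\<Sum>i<n. h (x i) - (LINT y|Q. h y))"
        by (simp add: a_def sum_subtractf I_def J_def)
      finally have "ennreal \<bar>\<Sum>i<n. h (x i) - (LINT y|Q. h y)\<bar> = ennreal (norm (LINT y|?P J. a - (\<Sum>j\<in>J. h (y j))))"
        by simp
      also have "\<dots> \<le> (\<integral>\<^sup>+ y. ennreal (norm (a - (\<Sum>j\<in>J. h (y j)))) \<partial>?P J)"
        by (rule integral_norm_bound_ennreal[OF int])
      also have "\<dots> \<le> (\<integral>\<^sup>+ y. T (merge I J (x, y)) \<partial>?P J)"
        using x
      proof (intro nn_integral_mono_AE, eventually_elim)
        fix y assume "S e0 (2 * n) (merge I J (x, y)) = T (merge I J (x, y))"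
        moreover have "ennreal (norm (a - (\<Sum>j\<in>J. h (y j)))) \<le> S e0 (2 * n) (merge I J (x, y))"
          unfolding S_def by (rule SUP_upper2[OF h]) (simp only: sum_merge a_def, simp)
        ultimately show "ennreal (norm (a - (\<Sum>j\<in>J. h (y j)))) \<le> T (merge I J (x, y))" by simp
      qed
      finally show "ennreal \<bar>\<Sum>i<n. h (x i) - (LINT y|Q. h y)\<bar> \<le> U x" unfolding U_def .
    qed
  qed
  have U_int: "(\<integral>\<^sup>+ x. U x \<partial>?P I) = (\<integral>\<^sup>+ z. T z \<partial>?P K)"
    unfolding U_def using product_nn_integral_fold[OF IJ(1,3,4), of T] T by (simp add: IJ)
  \<comment> \<open>The left side is free of \<open>r\<close>, so one inequality per sign vector may
    be summed over \<open>signs n\<close>.\<close>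
  have T_le: "(\<integral>\<^sup>+ z. T z \<partial>?P K) \<le> 2 * (\<integral>\<^sup>+ x. S r n x \<partial>?P I)" if r: "r \<in> signs n" for r
  proof -
    \<comment> \<open>The involution exchanging \<open>i\<close> and \<open>n + i\<close> whenever
      the sign of \<open>i\<close> is negative. It turns the pattern \<open>e0\<close>, plus on the
      sample and minus on the ghost sample, into \<open>r\<close> and \<open>- r\<close>.\<close>
    define f where "f i = (if i < n then (if r i = 1 then i else n + i) else (if r (i - n) = 1 then i else i - n))" for i
    have r1: "r i = 1 \<or> r i = - 1" if "i < n" for i using r that by (auto simp: signs_def)
    have f_K: "f i \<in> K" if "i \<in> K" for i using that by (auto simp: f_def K_def)
    have f_f: "f (f i) = i" if "i \<in> K" for i using that by (auto simp: f_def K_def)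
    have f_inj: "inj_on f K" by (rule inj_on_inverseI) (rule f_f)
    have bij: "bij_betw f K K" by (rule bij_betw_byWitness[where f' = f]) (use f_K f_f in auto)
    have e0f: "e0 (f i) = (if i < n then r i else - r (i - n))" if "i \<in> K" for i
      using r1[of i] r1[of "i - n"] that by (auto simp: e0_def f_def K_def)
    define \<phi> where "\<phi> z = (\<lambda>i\<in>K. z (f i))" for z :: "nat \<Rightarrow> real"
    define \<psi>1 where "\<psi>1 z = (\<lambda>i\<in>I. z i)" for z :: "nat \<Rightarrow> real"
    define \<psi>2 where "\<psi>2 z = (\<lambda>i\<in>I. z (n + i))" for z :: "nat \<Rightarrow> real"
    have \<phi>_m[measurable]: "\<phi> \<in> measurable (?P K) (?P K)"
      unfolding \<phi>_def using f_K by (intro measurable_restrict measurable_component_singleton) auto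
    have \<psi>1_m[measurable]: "\<psi>1 \<in> measurable (?P K) (?P I)"
      unfolding \<psi>1_def by (intro measurable_restrict measurable_component_singleton) (auto simp: I_def K_def)
    have \<psi>2_m[measurable]: "\<psi>2 \<in> measurable (?P K) (?P I)"
      unfolding \<psi>2_def by (intro measurable_restrict measurable_component_singleton) (auto simp: I_def K_def)
    have D: "distr (?P K) (?P K) \<phi> = ?P K" "distr (?P K) (?P I) \<psi>1 = ?P I" "distr (?P K) (?P I) \<psi>2 = ?P I"
      using distr_PiM_reindex[of K "\<lambda>_. Q" f K] distr_PiM_reindex[of K "\<lambda>_. Q" "\<lambda>i. i" I]
        distr_PiM_reindex[of K "\<lambda>_. Q" "\<lambda>i. n + i" I] f_inj f_K Q
      unfolding \<phi>_def \<psi>1_def \<psi>2_def by (auto simp: I_def K_def)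
    obtain R where R[measurable]: "R \<in> borel_measurable (?P I)" and SR: "AE x in ?P I. S r n x = R x"
      using ex[of n r] unfolding I_def by blast
    have 0: "AE z in ?P K. S e0 (2 * n) (\<phi> z) = T (\<phi> z)"
      by (rule AE_distrD[OF \<phi>_m]) (subst D, rule ST)
    have 1: "AE z in ?P K. S r n (\<psi>1 z) = R (\<psi>1 z)"
      by (rule AE_distrD[OF \<psi>1_m]) (subst D, rule SR)
    have 2: "AE z in ?P K. S r n (\<psi>2 z) = R (\<psi>2 z)"
      by (rule AE_distrD[OF \<psi>2_m]) (subst D, rule SR)
    have pt: "S e0 (2 * n) (\<phi> z) \<le> S r n (\<psi>1 z) + S r n (\<psi>2 z)" for z
      unfolding S_def
    proof (rule SUP_least)
      fix h assume h: "h \<in> H"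
      have "(\<Sum>i<2 * n. e0 i * h (\<phi> z i)) = (\<Sum>i\<in>K. e0 (f (f i)) * h (z (f i)))"
        by (intro sum.cong) (auto simp: K_def[symmetric] \<phi>_def f_f)
      also have "\<dots> = (\<Sum>i\<in>K. e0 (f i) * h (z i))"
        by (rule sum.reindex_bij_betw[OF bij])
      also have "\<dots> = (\<Sum>i\<in>I \<union> J. (if i < n then r i else - r (i - n)) * h (z i))"
        by (intro sum.cong) (auto simp: e0f IJ)
      also have "\<dots> = (\<Sum>i\<in>I. (if i < n then r i else - r (i - n)) * h (z i)) + (\<Sum>i\<in>J. (if i < n then r i else - r (i - n)) * h (z i))"
        using IJ by (intro sum.union_disjoint) auto
      also have "(\<Sum>i\<in>J. (if i < n then r i else - r (i - n)) * h (z i)) = (\<Sum>i<n. - r i * h (z (n + i)))"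
        by (rule sum.reindex_bij_witness[of _ "\<lambda>i. n + i" "\<lambda>i. i - n"]) (auto simp: J_def)
      also have "(\<Sum>i\<in>I. (if i < n then r i else - r (i - n)) * h (z i)) = (\<Sum>i<n. r i * h (\<psi>1 z i))"
        by (intro sum.cong) (auto simp: I_def \<psi>1_def)
      also have "(\<Sum>i<n. - r i * h (z (n + i))) = - (\<Sum>i<n. r i * h (\<psi>2 z i))"
        by (subst sum_negf[symmetric], intro sum.cong) (auto simp: I_def \<psi>2_def)
      finally have "ennreal \<bar>\<Sum>i<2 * n. e0 i * h (\<phi> z i)\<bar> \<le>
          ennreal (\<bar>\<Sum>i<n. r i * h (\<psi>1 z i)\<bar> + \<bar>\<Sum>i<n. r i * h (\<psi>2 z i)\<bar>)"
        by (intro ennreal_leI) linarith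
      also have "\<dots> = ennreal \<bar>\<Sum>i<n. r i * h (\<psi>1 z i)\<bar> + ennreal \<bar>\<Sum>i<n. r i * h (\<psi>2 z i)\<bar>"
        by (intro ennreal_plus) auto
      also have "\<dots> \<le> (SUP h\<in>H. ennreal \<bar>\<Sum>i<n. r i * h (\<psi>1 z i)\<bar>) + (SUP h\<in>H. ennreal \<bar>\<Sum>i<n. r i * h (\<psi>2 z i)\<bar>)"
        by (intro add_mono SUP_upper h)
      finally show "ennreal \<bar>\<Sum>i<2 * n. e0 i * h (\<phi> z i)\<bar> \<le> \<dots>" .
    qed
    have "(\<integral>\<^sup>+ z. T z \<partial>?P K) = (\<integral>\<^sup>+ z. T (\<phi> z) \<partial>?P K)"
      by (subst D(1)[symmetric], rule nn_integral_distr) auto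
    also have "\<dots> \<le> (\<integral>\<^sup>+ z. R (\<psi>1 z) + R (\<psi>2 z) \<partial>?P K)"
      using 0 1 2 by (intro nn_integral_mono_AE, eventually_elim) (metis pt)
    also have "\<dots> = (\<integral>\<^sup>+ z. R (\<psi>1 z) \<partial>?P K) + (\<integral>\<^sup>+ z. R (\<psi>2 z) \<partial>?P K)"
      by (intro nn_integral_add) auto
    also have "(\<integral>\<^sup>+ z. R (\<psi>1 z) \<partial>?P K) = (\<integral>\<^sup>+ x. R x \<partial>?P I)"
      using nn_integral_distr[OF \<psi>1_m, of R] R by (simp add: D)
    also have "(\<integral>\<^sup>+ z. R (\<psi>2 z) \<partial>?P K) = (\<integral>\<^sup>+ x. R x \<partial>?P I)"
      using nn_integral_distr[OF \<psi>2_m, of R] R by (simp add: D)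
    also have "(\<integral>\<^sup>+ x. R x \<partial>?P I) = (\<integral>\<^sup>+ x. S r n x \<partial>?P I)"
      using SR by (intro nn_integral_cong_AE) (auto simp: eq_commute)
    finally show ?thesis by (simp add: mult_2)
  qed
  have S_m: "S r n \<in> borel_measurable (completion (?P I))" for r
    using cls unfolding P_measurable_class_def S_def I_def by auto
  have "2 ^ n * (\<integral>\<^sup>+ x. U x \<partial>?P I) = (\<Sum>r\<in>signs n. \<integral>\<^sup>+ x. U x \<partial>?P I)"
    by simp
  also have "\<dots> \<le> (\<Sum>r\<in>signs n. 2 * (\<integral>\<^sup>+ x. S r n x \<partial>?P I))"
    unfolding U_int by (intro sum_mono T_le)
  also have "\<dots> = 2 * (\<Sum>r\<in>signs n. \<integral>\<^sup>+ x. S r n x \<partial>?P I)"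
    by (simp add: sum_distrib_left)
  finally have 1: "2 ^ n * (\<integral>\<^sup>+ x. U x \<partial>?P I) \<le> 2 * (\<Sum>r\<in>signs n. \<integral>\<^sup>+ x. S r n x \<partial>?P I)" .
  have "(\<Sum>r\<in>signs n. \<integral>\<^sup>+ x. S r n x \<partial>?P I) = (\<integral>\<^sup>+ x. (\<Sum>r\<in>signs n. S r n x) \<partial>completion (?P I))"
    using S_m by (subst nn_integral_sum) (auto simp: nn_integral_completion)
  also have "\<dots> \<le> (\<integral>\<^sup>+ x. 2 ^ n * B x \<partial>?P I)"
    unfolding nn_integral_completion using B(2) unfolding I_def by (intro nn_integral_mono_AE) (simp add: S_def)
  also have "\<dots> = 2 ^ n * (\<integral>\<^sup>+ x. B x \<partial>?P I)"
    using B(1) by (intro nn_integral_cmult) (simp add: I_def)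
  finally have "2 * (\<Sum>r\<in>signs n. \<integral>\<^sup>+ x. S r n x \<partial>?P I) \<le> 2 * (2 ^ n * (\<integral>\<^sup>+ x. B x \<partial>?P I))"
    by (rule mult_left_mono) simp
  from order_trans[OF 1 this]
  have "2 ^ n * (\<integral>\<^sup>+ x. U x \<partial>?P I) \<le> 2 ^ n * (2 * (\<integral>\<^sup>+ x. B x \<partial>?P I))"
    by (simp only: mult.left_commute[of 2 "2 ^ n"])
  then have "(\<integral>\<^sup>+ x. U x \<partial>?P I) \<le> 2 * (\<integral>\<^sup>+ x. B x \<partial>?P I)"
    by (subst (asm) ennreal_mult_le_mult_iff) (auto simp: power_eq_top_ennreal)
  then show ?thesis
    using that[of U] U_m U_ge unfolding I_def by blast
qed

text \<open>A finite mean makes the majorant finite almost everywhere, hence real valued after a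
  change on a null set, and the supremum becomes a bound for all \<open>h\<close> outside one null
  set.\<close>

lemma symmetrization_real:
  fixes Q :: "real measure" and H :: "(real \<Rightarrow> real) set"
  assumes Q: "prob_space Q" and cls: "P_measurable_class Q H"
    and H: "\<And>h. h \<in> H \<Longrightarrow> integrable Q h"
    and B: "integrable (PiM {..<n} (\<lambda>_. Q)) B" "\<And>x. B x \<ge> 0"
      "AE x in PiM {..<n} (\<lambda>_. Q). (\<Sum>r\<in>signs n. SUP h\<in>H. ennreal \<bar>\<Sum>i<n. r i * h (x i)\<bar>) \<le> ennreal (2 ^ n * B x)"
  obtains U where "integrable (PiM {..<n} (\<lambda>_. Q)) U" "\<And>x. U x \<ge> 0"
    "AE x in PiM {..<n} (\<lambda>_. Q). \<forall>h\<in>H. \<bar>\<Sum>i<n. h (x i) - (LINT y|Q. h y)\<bar> \<le> U x"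
    "(LINT x|PiM {..<n} (\<lambda>_. Q). U x) \<le> 2 * (LINT x|PiM {..<n} (\<lambda>_. Q). B x)"
proof -
  let ?P = "PiM {..<n} (\<lambda>_. Q)"
  have "ennreal (2 ^ n * B x) = 2 ^ n * ennreal (B x)" for x
    using B(2)[of x] by (simp add: ennreal_mult ennreal_power[symmetric])
  then have B': "AE x in ?P. (\<Sum>r\<in>signs n. SUP h\<in>H. ennreal \<bar>\<Sum>i<n. r i * h (x i)\<bar>) \<le> 2 ^ n * ennreal (B x)"
    using B(3) by simp
  have [measurable]: "B \<in> borel_measurable ?P" using B(1) by (rule borel_measurable_integrable)
  obtain U where U[measurable]: "U \<in> borel_measurable ?P"
    and AE: "AE x in ?P. (SUP h\<in>H. ennreal \<bar>\<Sum>i<n. h (x i) - (LINT y|Q. h y)\<bar>) \<le> U x"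
    and U_le: "(\<integral>\<^sup>+ x. U x \<partial>?P) \<le> 2 * (\<integral>\<^sup>+ x. ennreal (B x) \<partial>?P)"
    by (rule symmetrization[OF Q cls H _ B']) measurable
  have "2 * (\<integral>\<^sup>+ x. ennreal (B x) \<partial>?P) = ennreal (2 * (LINT x|?P. B x))"
    using B by (subst nn_integral_eq_integral) (auto simp: ennreal_mult)
  then have le: "(\<integral>\<^sup>+ x. U x \<partial>?P) \<le> ennreal (2 * (LINT x|?P. B x))"
    using U_le by simp
  then have fin: "AE x in ?P. U x \<noteq> \<infinity>"
    by (intro nn_integral_PInf_AE) (auto simp: top_unique)
  have eq: "(\<integral>\<^sup>+ x. ennreal (enn2real (U x)) \<partial>?P) = (\<integral>\<^sup>+ x. U x \<partial>?P)"
    using fin by (intro nn_integral_cong_AE) (auto simp: less_top)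
  have int: "integrable ?P (\<lambda>x. enn2real (U x))"
    using le by (intro integrableI_nonneg) (auto simp: eq intro: le_less_trans)
  show ?thesis
  proof (rule that[OF int])
    have "ennreal (LINT x|?P. enn2real (U x)) \<le> ennreal (2 * (LINT x|?P. B x))"
      using le nn_integral_eq_integral[OF int] by (simp add: eq)
    then show "(LINT x|?P. enn2real (U x)) \<le> 2 * (LINT x|?P. B x)"
      using B(2) by (subst (asm) ennreal_le_iff) (auto intro: integral_nonneg)
    show "AE x in ?P. \<forall>h\<in>H. \<bar>\<Sum>i<n. h (x i) - (LINT y|Q. h y)\<bar> \<le> enn2real (U x)"
      using AE fin
    proof eventually_elim
      fix x assume *: "(SUP h\<in>H. ennreal \<bar>\<Sum>i<n. h (x i) - (LINT y|Q. h y)\<bar>) \<le> U x" "U x \<noteq> \<infinity>"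
      show "\<forall>h\<in>H. \<bar>\<Sum>i<n. h (x i) - (LINT y|Q. h y)\<bar> \<le> enn2real (U x)"
      proof
        fix h assume "h \<in> H"
        then have "ennreal \<bar>\<Sum>i<n. h (x i) - (LINT y|Q. h y)\<bar> \<le> U x"
          by (intro order_trans[OF SUP_upper *(1)])
        also have "U x = ennreal (enn2real (U x))" using *(2) by (simp add: less_top)
        finally show "\<bar>\<Sum>i<n. h (x i) - (LINT y|Q. h y)\<bar> \<le> enn2real (U x)"
          by (subst (asm) ennreal_le_iff) auto
      qed
    qed
  qed simp
qed

section \<open>Change of the law of the sample\<close>

text \<open>Checked on boxes, where the integral of the product density factorizes. It serves twice:
  to change the law of a sample and to present a product of normal laws by its density.\<close>

lemma PiM_density_eq:
  fixes P :: "'i \<Rightarrow> 'a measure" and w :: "'i \<Rightarrow> 'a \<Rightarrow> ennreal"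
  assumes "product_sigma_finite P" "product_sigma_finite (\<lambda>i. density (P i) (w i))" "finite I"
    and [measurable]: "\<And>i. w i \<in> borel_measurable (P i)"
  shows "PiM I (\<lambda>i. density (P i) (w i)) = density (PiM I P) (\<lambda>x. \<Prod>i\<in>I. w i (x i))"
proof -
  interpret P: product_sigma_finite P by fact
  interpret Q: product_sigma_finite "\<lambda>i. density (P i) (w i)" by fact
  show ?thesis
  proof (rule Q.PiM_eqI[symmetric, OF \<open>finite I\<close>])
    show "sets (density (PiM I P) (\<lambda>x. \<Prod>i\<in>I. w i (x i))) = sets (PiM I (\<lambda>i. density (P i) (w i)))"
      by (simp cong: sets_PiM_cong)
    fix A assume "\<And>i. i \<in> I \<Longrightarrow> A i \<in> sets (density (P i) (w i))"
    then have A[measurable]: "\<And>i. i \<in> I \<Longrightarrow> A i \<in> sets (P i)" by simp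
    have w_m: "(\<lambda>x. \<Prod>i\<in>I. w i (x i)) \<in> borel_measurable (PiM I P)"
      using assms by (intro borel_measurable_prod_ennreal measurable_compose[OF measurable_component_singleton]) auto
    have "emeasure (density (PiM I P) (\<lambda>x. \<Prod>i\<in>I. w i (x i))) (PiE I A) =
        (\<integral>\<^sup>+ x. (\<Prod>i\<in>I. w i (x i)) * indicator (PiE I A) x \<partial>PiM I P)"
      using assms A by (intro emeasure_density w_m sets_PiM_I_finite) auto
    also have "\<dots> = (\<integral>\<^sup>+ x. (\<Prod>i\<in>I. w i (x i) * indicator (A i) (x i)) \<partial>PiM I P)"
    proof (rule nn_integral_cong)
      fix x assume x: "x \<in> space (PiM I P)"
      have "indicator (PiE I A) x = (\<Prod>i\<in>I. indicator (A i) (x i) :: ennreal)"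
      proof (cases "x \<in> PiE I A")
        case True
        then have "indicator (A i) (x i) = (1::ennreal)" if "i \<in> I" for i using that by (auto simp: PiE_iff)
        then show ?thesis using True by simp
      next
        case False
        then obtain i where "i \<in> I" "x i \<notin> A i" using x by (auto simp: PiE_iff space_PiM)
        then have "(\<Prod>i\<in>I. indicator (A i) (x i) :: ennreal) = 0"
          using \<open>finite I\<close> by (intro prod_zero bexI[of _ i]) auto
        then show ?thesis using False by simp
      qed
      then show "(\<Prod>i\<in>I. w i (x i)) * indicator (PiE I A) x = (\<Prod>i\<in>I. w i (x i) * indicator (A i) (x i))"
        by (simp add: prod.distrib)
    qed
    also have "\<dots> = (\<Prod>i\<in>I. \<integral>\<^sup>+ x. w i x * indicator (A i) x \<partial>P i)"
      using \<open>finite I\<close> by (intro P.product_nn_integral_prod) auto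
    also have "\<dots> = (\<Prod>i\<in>I. emeasure (density (P i) (w i)) (A i))"
      by (intro prod.cong) (auto simp: emeasure_density)
    finally show "emeasure (density (PiM I P) (\<lambda>x. \<Prod>i\<in>I. w i (x i))) (PiE I A) = (\<Prod>i\<in>I. emeasure (density (P i) (w i)) (A i))" .
  qed
qed

lemma borel_measurable_completion_AE:
  fixes T :: "'a \<Rightarrow> ennreal"
  assumes "T \<in> borel_measurable N" "AE x in N. S x = T x"
  shows "S \<in> borel_measurable (completion N)"
proof (rule measurableI)
  fix A :: "ennreal set" assume A: "A \<in> sets borel"
  have T: "T \<in> borel_measurable (completion N)" using assms(1) by (rule measurable_completion)
  show "S -` A \<inter> space (completion N) \<in> sets (completion N)"
  proof (rule completion.in_sets_AE[OF _ measurable_sets[OF T A]])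
    show "AE x in completion N. (x \<in> T -` A \<inter> space (completion N)) = (x \<in> S -` A \<inter> space (completion N))"
      by (rule AE_completion) (use assms(2) in \<open>auto elim: eventually_mono\<close>)
  qed simp
qed simp

text \<open>Null sets of the product of \<open>P\<close> stay null for the product of a law with a
  density relative to \<open>P\<close>, so a Borel version of the supremum remains a
  version.\<close>

lemma P_measurable_class_density:
  fixes w :: "real \<Rightarrow> ennreal"
  assumes cls: "P_measurable_class P H" and P: "sigma_finite_measure P" "sigma_finite_measure (density P w)"
    and w: "w \<in> borel_measurable P"
  shows "P_measurable_class (density P w) H"
  unfolding P_measurable_class_def
proof (intro allI)
  fix n :: nat and e :: "nat \<Rightarrow> real"
  let ?S = "\<lambda>x. SUP h\<in>H. ennreal \<bar>\<Sum>i<n. e i * h (x i)\<bar>"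
  have "?S \<in> borel_measurable (completion (PiM {..<n} (\<lambda>_. P)))"
    using cls unfolding P_measurable_class_def by blast
  then obtain T where T: "T \<in> borel_measurable (PiM {..<n} (\<lambda>_. P))" "AE x in PiM {..<n} (\<lambda>_. P). ?S x = T x"
    using completion_ex_borel_measurable by blast
  have PS: "product_sigma_finite (\<lambda>_::nat. P)" "product_sigma_finite (\<lambda>_::nat. density P w)"
    using P by (simp_all add: product_sigma_finite_def)
  have w_m: "(\<lambda>x. \<Prod>i<n. w (x i)) \<in> borel_measurable (PiM {..<n} (\<lambda>_. P))"
    using w by (intro borel_measurable_prod_ennreal measurable_compose[OF measurable_component_singleton]) auto
  show "?S \<in> borel_measurable (completion (PiM {..<n} (\<lambda>_. density P w)))"
    unfolding PiM_density_eq[of "\<lambda>_. P" "\<lambda>_. w", OF PS finite_lessThan w]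
  proof (rule borel_measurable_completion_AE)
    show "T \<in> borel_measurable (density (PiM {..<n} (\<lambda>_. P)) (\<lambda>x. \<Prod>i<n. w (x i)))" using T by simp
    show "AE x in density (PiM {..<n} (\<lambda>_. P)) (\<lambda>x. \<Prod>i<n. w (x i)). ?S x = T x"
      using T(2) by (subst AE_density[OF w_m]) (auto elim: eventually_mono)
  qed
qed

subsection \<open>Asymptotic equicontinuity\<close>

locale entropy_class =
  fixes f V :: "real \<Rightarrow> real" and \<G> :: "(real \<Rightarrow> real) set" and N :: "nat \<Rightarrow> nat" and P :: "real measure"
  defines "P \<equiv> density lborel (\<lambda>y. ennreal (f y))"
  assumes f_meas [measurable]: "f \<in> borel_measurable borel" and f_pos: "\<And>y. f y > 0" and f_int: "integrable lborel f" "(LINT y|lborel. f y) = 1"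
    and G_meas: "\<And>g. g \<in> \<G> \<Longrightarrow> g \<in> borel_measurable borel"
    and suitable: "suitably_measurable_class P \<G>" and nets: "dyadic_nets \<G> V N" and env: "envelope V \<G>"
    and V_nonneg: "\<And>y. V y \<ge> 0" and V_meas [measurable]: "V \<in> borel_measurable borel"
    and V_sq: "integrable P (\<lambda>y. (V y)\<^sup>2)"
begin

text \<open>Two instances matter: \<open>f\<close> itself and, for small bandwidth,
  \<open>conv f \<kappa>\<close>. Integrability of V^2 under \<open>q\<close> is part of the
  definition because it does not follow from that under \<open>f\<close>.\<close>

definition admissible :: "(real \<Rightarrow> real) \<Rightarrow> bool" where
  "admissible q \<longleftrightarrow> q \<in> borel_measurable borel \<and> (\<forall>y. q y \<ge> 0) \<and> integrable lborel q \<and> (LINT y|lborel. q y) = 1 \<and>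
     integrable lborel (\<lambda>y. (V y)\<^sup>2 * q y)"

definition law :: "(real \<Rightarrow> real) \<Rightarrow> real measure" where
  "law q = density lborel (\<lambda>y. ennreal (q y))"

text \<open>The weight V^2 makes this distance dominate the change of expectation of every function
  of size V^2 when \<open>f\<close> is replaced by \<open>q\<close>; squared differences of members
  and the tail of V^2 are of this kind (\<open>law_diff_le\<close>).\<close>

definition env_dist :: "(real \<Rightarrow> real) \<Rightarrow> real" where
  "env_dist q = (LINT y|lborel. (V y)\<^sup>2 * \<bar>q y - f y\<bar>)"

lemma P_eq: "P = law f" by (simp add: P_def law_def)

lemma sets_law [simp, measurable_cong]: "sets (law q) = sets borel"
  and space_law [simp]: "space (law q) = UNIV"
  by (simp_all add: law_def)

lemma sets_P [simp, measurable_cong]: "sets P = sets borel"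
  and space_P [simp]: "space P = UNIV"
  by (simp_all add: P_eq)

lemma integral_law:
  assumes "admissible q" "h \<in> borel_measurable borel"
  shows "integrable (law q) h \<longleftrightarrow> integrable lborel (\<lambda>y. h y * q y)" "(LINT y|law q. h y) = (LINT y|lborel. h y * q y)"
  using assms unfolding law_def admissible_def
  by (simp_all add: integrable_density integral_density mult.commute)

lemma prob_space_law: "admissible q \<Longrightarrow> prob_space (law q)"
  unfolding law_def admissible_def
  by (rule prob_spaceI) (simp add: emeasure_density nn_integral_eq_integral)

lemma admissible_f: "admissible f"
proof -
  have "integrable lborel (\<lambda>y. (V y)\<^sup>2 * f y)"
    using V_sq f_pos unfolding P_def by (subst (asm) integrable_density) (auto simp: mult.commute less_imp_le)
  then show ?thesis using f_pos f_int by (auto simp: admissible_def less_imp_le)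
qed

sublocale P: prob_space P
  unfolding P_eq by (rule prob_space_law[OF admissible_f])

lemma env_dist_integrable: "admissible q \<Longrightarrow> integrable lborel (\<lambda>y. (V y)\<^sup>2 * \<bar>q y - f y\<bar>)"
proof -
  assume q: "admissible q"
  then have [measurable]: "q \<in> borel_measurable borel" by (simp add: admissible_def)
  have "integrable lborel (\<lambda>y. (V y)\<^sup>2 * q y + (V y)\<^sup>2 * f y)"
    using q admissible_f unfolding admissible_def by (intro Bochner_Integration.integrable_add) auto
  then show ?thesis
  proof (rule Bochner_Integration.integrable_bound)
    show "AE y in lborel. norm ((V y)\<^sup>2 * \<bar>q y - f y\<bar>) \<le> norm ((V y)\<^sup>2 * q y + (V y)\<^sup>2 * f y)"
    proof (rule AE_I2)
      fix y
      have "\<bar>q y - f y\<bar> \<le> q y + f y" using q f_pos[of y] by (auto simp: admissible_def abs_le_iff intro: add_increasing)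
      then have "(V y)\<^sup>2 * \<bar>q y - f y\<bar> \<le> (V y)\<^sup>2 * (q y + f y)" by (intro mult_left_mono) auto
      then show "norm ((V y)\<^sup>2 * \<bar>q y - f y\<bar>) \<le> norm ((V y)\<^sup>2 * q y + (V y)\<^sup>2 * f y)"
        by (simp add: algebra_simps abs_mult)
    qed
  qed measurable
qed

lemma env_dist_nonneg: "env_dist q \<ge> 0"
  unfolding env_dist_def by (intro Bochner_Integration.integral_nonneg) auto

lemma env_dist_f: "env_dist f = 0" by (simp add: env_dist_def)

lemma law_diff_le:
  assumes q: "admissible q" and h: "h \<in> borel_measurable borel" "\<And>y. \<bar>h y\<bar> \<le> c * (V y)\<^sup>2" and c: "c \<ge> 0"
  shows "integrable (law q) h" "\<bar>(LINT y|law q. h y) - (LINT y|P. h y)\<bar> \<le> c * env_dist q"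
proof -
  note [measurable] = h(1)
  have [measurable]: "q \<in> borel_measurable borel" using q by (simp add: admissible_def)
  have int: "integrable (law q) h" if q: "admissible q" for q
  proof -
    have [measurable]: "q \<in> borel_measurable borel" using q by (simp add: admissible_def)
    have "integrable lborel (\<lambda>y. c * ((V y)\<^sup>2 * q y))" using q by (auto simp: admissible_def)
    then have "integrable lborel (\<lambda>y. h y * q y)"
    proof (rule Bochner_Integration.integrable_bound)
      show "AE y in lborel. norm (h y * q y) \<le> norm (c * ((V y)\<^sup>2 * q y))"
      proof (rule AE_I2)
        fix y
        have "\<bar>h y\<bar> * q y \<le> c * (V y)\<^sup>2 * q y" using q h(2)[of y] by (intro mult_right_mono) (auto simp: admissible_def)
        then show "norm (h y * q y) \<le> norm (c * ((V y)\<^sup>2 * q y))" using q c by (simp add: abs_mult admissible_def mult_ac)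
      qed
    qed measurable
    then show ?thesis using integral_law[OF q h(1)] by simp
  qed
  show "integrable (law q) h" by (rule int[OF q])
  have 1: "integrable lborel (\<lambda>y. h y * q y)" "integrable lborel (\<lambda>y. h y * f y)"
    using int[OF q] int[OF admissible_f] integral_law[OF q h(1)] integral_law[OF admissible_f h(1)] by auto
  have "(LINT y|law q. h y) - (LINT y|P. h y) = (LINT y|lborel. h y * q y - h y * f y)"
    unfolding P_eq using 1 integral_law[OF q h(1)] integral_law[OF admissible_f h(1)] by simp
  also have "\<bar>\<dots>\<bar> \<le> (LINT y|lborel. c * ((V y)\<^sup>2 * \<bar>q y - f y\<bar>))"
  proof (rule integral_abs_bound_integral)
    fix y
    have "\<bar>h y\<bar> * \<bar>q y - f y\<bar> \<le> c * (V y)\<^sup>2 * \<bar>q y - f y\<bar>" by (intro mult_right_mono h(2)) auto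
    then show "\<bar>h y * q y - h y * f y\<bar> \<le> c * ((V y)\<^sup>2 * \<bar>q y - f y\<bar>)"
      by (simp add: abs_mult[symmetric] right_diff_distrib mult_ac)
  qed (use 1 env_dist_integrable[OF q] in auto)
  also have "\<dots> = c * env_dist q" unfolding env_dist_def by simp
  finally show "\<bar>(LINT y|law q. h y) - (LINT y|P. h y)\<bar> \<le> c * env_dist q" .
qed

lemma P_measurable_class_law:
  assumes q: "admissible q" and "P_measurable_class P H"
  shows "P_measurable_class (law q) H"
proof -
  have [measurable]: "q \<in> borel_measurable borel" using q by (simp add: admissible_def)
  have "density P (\<lambda>y. ennreal (q y / f y)) = density lborel (\<lambda>y. ennreal (f y) * ennreal (q y / f y))"
    unfolding P_def by (subst density_density_eq) auto
  also have "\<dots> = law q"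
    unfolding law_def
  proof (rule density_cong)
    show "AE y in lborel. ennreal (f y) * ennreal (q y / f y) = ennreal (q y)"
      using f_pos q by (intro AE_I2) (auto simp: admissible_def less_imp_le less_imp_neq[THEN not_sym] simp flip: ennreal_mult)
  qed auto
  finally have eq: "density P (\<lambda>y. ennreal (q y / f y)) = law q" .
  interpret Q: prob_space "law q" by (rule prob_space_law[OF q])
  show ?thesis
    using P_measurable_class_density[OF assms(2), of "\<lambda>y. ennreal (q y / f y)"] P.sigma_finite_measure_axioms Q.sigma_finite_measure_axioms
    unfolding eq by simp
qed

lemma abs_diff_le_V: "g \<in> \<G> \<Longrightarrow> g' \<in> \<G> \<Longrightarrow> \<bar>g y - g' y\<bar> \<le> 2 * V y"
  using env unfolding envelope_def by (smt (verit, ccfv_threshold))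

lemma diff_sq_le_V: "g \<in> \<G> \<Longrightarrow> g' \<in> \<G> \<Longrightarrow> (g y - g' y)\<^sup>2 \<le> 4 * (V y)\<^sup>2"
  using power_mono[OF abs_diff_le_V, of g g' y 2] by (simp add: power_mult_distrib)

definition V_second :: "(real \<Rightarrow> real) \<Rightarrow> real" where "V_second q = (LINT y|law q. (V y)\<^sup>2)"
definition V_tail :: "real \<Rightarrow> (real \<Rightarrow> real) \<Rightarrow> real" where "V_tail L q = (LINT y|law q. (V y)\<^sup>2 * indicator {y. V y > L} y)"

lemma V_second_le: "admissible q \<Longrightarrow> \<bar>V_second q - V_second f\<bar> \<le> env_dist q"
  using law_diff_le(2)[of q "\<lambda>y. (V y)\<^sup>2" 1] by (simp add: V_second_def P_eq)

lemma V_second_nonneg: "V_second q \<ge> 0" unfolding V_second_def by (intro Bochner_Integration.integral_nonneg) auto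

lemma V_tail_le: "admissible q \<Longrightarrow> \<bar>V_tail L q - V_tail L f\<bar> \<le> env_dist q"
  using law_diff_le(2)[of q "\<lambda>y. (V y)\<^sup>2 * indicator {y. V y > L} y" 1]
  by (simp add: V_tail_def P_eq indicator_def)

lemma V_tail_tendsto: "(\<lambda>L. V_tail (real L) f) \<longlonglongrightarrow> 0"
proof -
  have "(\<lambda>L. LINT y|P. (V y)\<^sup>2 * indicator {y. V y > real L} y) \<longlonglongrightarrow> (LINT y|P. 0)"
  proof (rule integral_dominated_convergence[where w = "\<lambda>y. (V y)\<^sup>2"])
    show "AE y in P. (\<lambda>L. (V y)\<^sup>2 * indicator {y. V y > real L} y) \<longlonglongrightarrow> 0"
    proof (rule AE_I2)
      fix y
      obtain L0 where "V y \<le> real L0" using real_arch_simple by blast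
      then have "eventually (\<lambda>L. (V y)\<^sup>2 * indicator {y. V y > real L} y = 0) sequentially"
        by (intro eventually_sequentiallyI[of L0]) (auto simp: indicator_def)
      then show "(\<lambda>L. (V y)\<^sup>2 * indicator {y. V y > real L} y) \<longlonglongrightarrow> 0"
        by (rule tendsto_eventually)
    qed
  qed (use V_sq in \<open>auto simp: indicator_def\<close>)
  then show ?thesis by (simp add: V_tail_def P_eq)
qed

text \<open>Replaces the norm by its square, using v <= 1 + v^2, so that the expectation becomes an
  average of second moments.\<close>

lemma emp_norm_le_1_plus: "n > 0 \<Longrightarrow> emp_norm n x V \<le> 1 + (\<Sum>i<n. (V (x i))\<^sup>2) / real n"
proof -
  assume n: "n > 0"
  define v where "v = emp_norm n x V"
  have "v \<le> 1 + v\<^sup>2"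
    using zero_le_power2[of "v - 1/2"] by (simp add: power2_eq_square algebra_simps)
  then show ?thesis using emp_norm_sq[OF n, of V x] n by (simp add: v_def field_simps)
qed

lemma sum_component_integral:
  assumes "admissible q" "integrable (law q) h"
  shows "integrable (PiM {..<n} (\<lambda>_. law q)) (\<lambda>x. \<Sum>i<n. h (x i))"
    "(LINT x|PiM {..<n} (\<lambda>_. law q). (\<Sum>i<n. h (x i))) = real n * (LINT y|law q. h y)"
  using prod_integral_component[OF prob_space_law[OF assms(1)] _ assms(2), of _ "{..<n}"]
  by (auto simp: Bochner_Integration.integral_sum)

lemma integrable_V_law:
  assumes "admissible q"
  shows "integrable (law q) (\<lambda>y. (V y)\<^sup>2)" "integrable (law q) (\<lambda>y. (V y)\<^sup>2 * indicator {y. V y > L} y)"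
  by (rule law_diff_le(1)[OF assms, where c = 1]; simp add: indicator_def)+

text \<open>A uniform law of large numbers for squared differences in explicit form. Of the three
  error terms the first is made small by \<open>L\<close>, the second by \<open>K\<close> for given
  \<open>L\<close>, and the third by \<open>n\<close> for given \<open>L\<close> and
  \<open>K\<close>.\<close>

lemma squared_differences_deviation:
  assumes q: "admissible q" and n: "n > 0" and L: "L \<ge> 0"
  obtains Z where "integrable (PiM {..<n} (\<lambda>_. law q)) Z" "\<And>x. Z x \<ge> 0"
    "AE x in PiM {..<n} (\<lambda>_. law q). \<forall>g\<in>\<G>. \<forall>g'\<in>\<G>.
       \<bar>(\<Sum>i<n. (g (x i) - g' (x i))\<^sup>2) - real n * (LINT y|law q. (g y - g' y)\<^sup>2)\<bar> \<le> real n * Z x"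
    "(LINT x|PiM {..<n} (\<lambda>_. law q). Z x) \<le>
       2 * (4 * V_tail L q + 8 * L * (1/2) ^ K * (1 + V_second q) + 4 * L\<^sup>2 * level_const N K / sqrt (real n))"
proof -
  let ?Q = "PiM {..<n} (\<lambda>_. law q)"
  interpret Q: prob_space "law q" by (rule prob_space_law[OF q])
  interpret QQ: prob_space ?Q by (intro prob_space_PiM) (rule Q.prob_space_axioms)
  define B where "B x = 4 * (\<Sum>i<n. (V (x i))\<^sup>2 * indicator {y. V y > L} (x i)) +
      8 * L * real n * ((1/2) ^ K * (1 + (\<Sum>i<n. (V (x i))\<^sup>2) / real n)) + sqrt (real n) * (4 * L\<^sup>2) * level_const N K" for x
  note VL = sum_component_integral[OF q integrable_V_law(2)[OF q, of L], of n]
  note VV = sum_component_integral[OF q integrable_V_law(1)[OF q], of n]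
  have B_int: "integrable ?Q B"
    unfolding B_def using VL(1) VV(1)
    by (intro Bochner_Integration.integrable_add Bochner_Integration.integrable_mult_right Bochner_Integration.integrable_divide QQ.integrable_const) auto
  have "(LINT x|?Q. B x) = 4 * (real n * V_tail L q) + 8 * L * real n * ((1/2) ^ K * (1 + real n * V_second q / real n)) + sqrt (real n) * (4 * L\<^sup>2) * level_const N K"
    unfolding B_def using VL VV by (simp add: QQ.prob_space V_tail_def V_second_def)
  then have B_eq: "(LINT x|?Q. B x) = real n * (4 * V_tail L q + 8 * L * (1/2) ^ K * (1 + V_second q) + 4 * L\<^sup>2 * level_const N K / sqrt (real n))"
    using n by (simp add: field_simps)
  have B_nonneg: "B x \<ge> 0" for x
    unfolding B_def using L level_const_nonneg[OF nets, of K] by (intro add_nonneg_nonneg mult_nonneg_nonneg sum_nonneg divide_nonneg_nonneg) auto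
  have bound: "AE x in ?Q. (\<Sum>r\<in>signs n. SUP h\<in>squared_differences \<G>. ennreal \<bar>\<Sum>i<n. r i * h (x i)\<bar>) \<le> ennreal (2 ^ n * B x)"
  proof (rule AE_I2)
    fix x
    have "(\<Sum>r\<in>signs n. SUP h\<in>squared_differences \<G>. ennreal \<bar>\<Sum>i<n. r i * h (x i)\<bar>) \<le>
        ennreal (2 ^ n * (4 * (\<Sum>i<n. (V (x i))\<^sup>2 * indicator {y. V y > L} (x i)) + 8 * L * real n * ((1/2) ^ K * emp_norm n x V)
          + sqrt (real n) * (4 * L\<^sup>2) * level_const N K))"
      by (rule rademacher_squared_differences[OF nets n env V_nonneg L])
    also have "\<dots> \<le> ennreal (2 ^ n * B x)"
      unfolding B_def using L emp_norm_le_1_plus[OF n, of x]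
      by (intro ennreal_leI mult_left_mono add_right_mono add_left_mono) auto
    finally show "(\<Sum>r\<in>signs n. SUP h\<in>squared_differences \<G>. ennreal \<bar>\<Sum>i<n. r i * h (x i)\<bar>) \<le> ennreal (2 ^ n * B x)" .
  qed
  have cls: "P_measurable_class (law q) (squared_differences \<G>)"
    using suitable by (intro P_measurable_class_law[OF q]) (simp add: suitably_measurable_class_def)
  have int: "integrable (law q) h" if h: "h \<in> squared_differences \<G>" for h
  proof -
    obtain g g' where g: "g \<in> \<G>" "g' \<in> \<G>" and h_eq: "h = (\<lambda>y. (g y - g' y)\<^sup>2)"
      using h by (auto simp: squared_differences_def)
    show ?thesis unfolding h_eq
      by (rule law_diff_le(1)[OF q, where c = 4]) (use diff_sq_le_V[OF g] G_meas g in auto)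
  qed
  obtain U where U: "integrable ?Q U" "\<And>x. U x \<ge> 0"
    "AE x in ?Q. \<forall>h\<in>squared_differences \<G>. \<bar>\<Sum>i<n. h (x i) - (LINT y|law q. h y)\<bar> \<le> U x"
    "(LINT x|?Q. U x) \<le> 2 * (LINT x|?Q. B x)"
    using symmetrization_real[OF Q.prob_space_axioms cls int B_int B_nonneg bound] by blast
  show ?thesis
  proof (rule that[of "\<lambda>x. U x / real n"])
    show "AE x in ?Q. \<forall>g\<in>\<G>. \<forall>g'\<in>\<G>.
       \<bar>(\<Sum>i<n. (g (x i) - g' (x i))\<^sup>2) - real n * (LINT y|law q. (g y - g' y)\<^sup>2)\<bar> \<le> real n * (U x / real n)"
      using U(3)
    proof eventually_elim
      fix x assume *: "\<forall>h\<in>squared_differences \<G>. \<bar>\<Sum>i<n. h (x i) - (LINT y|law q. h y)\<bar> \<le> U x"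
      show "\<forall>g\<in>\<G>. \<forall>g'\<in>\<G>.
       \<bar>(\<Sum>i<n. (g (x i) - g' (x i))\<^sup>2) - real n * (LINT y|law q. (g y - g' y)\<^sup>2)\<bar> \<le> real n * (U x / real n)"
      proof (intro ballI)
        fix g g' assume g: "g \<in> \<G>" "g' \<in> \<G>"
        have "(\<lambda>y. (g y - g' y)\<^sup>2) \<in> squared_differences \<G>" using g by (auto simp: squared_differences_def)
        from bspec[OF * this] show "\<bar>(\<Sum>i<n. (g (x i) - g' (x i))\<^sup>2) - real n * (LINT y|law q. (g y - g' y)\<^sup>2)\<bar> \<le> real n * (U x / real n)"
          using n by (simp add: sum_subtractf)
      qed
    qed
    show "(LINT x|?Q. U x / real n) \<le>
       2 * (4 * V_tail L q + 8 * L * (1/2) ^ K * (1 + V_second q) + 4 * L\<^sup>2 * level_const N K / sqrt (real n))"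
      using U(4) n unfolding B_eq by (simp add: field_simps)
  qed (use U n in auto)
qed


text \<open>A substitute for the square root that is affine in \<open>s\<close>, so that
  expectations can be taken of a bound with random \<open>s\<close>.\<close>

lemma le_plus_divide: "(a::real) \<le> t + s / t" if "a\<^sup>2 \<le> s" "t > 0" "a \<ge> 0"
proof (cases "a \<le> t")
  case True
  have "0 \<le> s" using that(1) by (meson order_trans zero_le_power2)
  then show ?thesis using True that by (intro add_increasing2) auto
next
  case False
  have "a * t \<le> a\<^sup>2" using False that by (simp add: power2_eq_square)
  then have "a \<le> s / t" using that by (simp add: pos_le_divide_eq)
  then show ?thesis using that by linarith
qed

definition chaining_tail :: "nat \<Rightarrow> real" where "chaining_tail K = (\<Sum>k. entropy_step N (k + K))"

lemma chaining_tail_nonneg: "chaining_tail K \<ge> 0"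
  unfolding chaining_tail_def
  using summable_entropy_step[OF nets] entropy_step_nonneg[OF nets] by (intro suminf_nonneg) (auto simp: summable_iff_shift)

lemma chaining_tail_tendsto: "chaining_tail \<longlonglongrightarrow> 0"
  unfolding chaining_tail_def using suminf_exist_split2[OF summable_entropy_step[OF nets]] .

text \<open>Up to a geometric term this is twice the general term of the convergent entropy sum,
  because ln (2 N^2) = ln 2 + 2 ln N.\<close>

lemma level_const_tendsto: "(\<lambda>K. (1/2) ^ K * level_const N K) \<longlonglongrightarrow> 0"
proof (rule tendsto_sandwich[OF _ _ tendsto_const])
  have N: "real (N k) \<ge> 1" for k using dyadic_nets_ge_1[OF nets, of k] by simp
  show "eventually (\<lambda>K. 0 \<le> (1/2) ^ K * level_const N K) sequentially"
    using level_const_nonneg[OF nets] by simp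
  show "eventually (\<lambda>K. (1/2) ^ K * level_const N K \<le> sqrt (2 * ln 2) * (1/2) ^ K + 2 * ((1/2) ^ K * sqrt (ln (real (N K))))) sequentially"
  proof (rule always_eventually, rule allI)
    fix K
    have "2 * ln (2 * (real (N K))\<^sup>2) = 2 * ln 2 + 4 * ln (real (N K))"
      using N[of K] by (simp add: ln_mult power2_eq_square)
    then have "level_const N K \<le> sqrt (2 * ln 2) + sqrt (4 * ln (real (N K)))"
      unfolding level_const_def using N[of K] by (simp, intro sqrt_add_le_add_sqrt) auto
    then have "(1/2) ^ K * level_const N K \<le> (1/2) ^ K * (sqrt (2 * ln 2) + sqrt (4 * ln (real (N K))))"
      by (intro mult_left_mono) auto
    then show "(1/2) ^ K * level_const N K \<le> sqrt (2 * ln 2) * (1/2) ^ K + 2 * ((1/2) ^ K * sqrt (ln (real (N K))))"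
      by (simp add: real_sqrt_mult algebra_simps)
  qed
  have "(\<lambda>K. sqrt (2 * ln 2) * (1/2) ^ K + 2 * ((1/2) ^ K * sqrt (ln (real (N K))))) \<longlonglongrightarrow> sqrt (2 * ln 2) * 0 + 2 * 0"
    using nets summable_LIMSEQ_zero unfolding dyadic_nets_def
    by (intro tendsto_add tendsto_mult_left LIMSEQ_power_zero) auto
  then show "(\<lambda>K. sqrt (2 * ln 2) * (1/2) ^ K + 2 * ((1/2) ^ K * sqrt (ln (real (N K))))) \<longlonglongrightarrow> 0" by simp
qed

lemma L2_seminorm_law_sq: "(L2_seminorm Q g)\<^sup>2 = (LINT y|Q. (g y)\<^sup>2)"
  unfolding L2_seminorm_def by (subst real_sqrt_pow2) (auto intro!: Bochner_Integration.integral_nonneg)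

text \<open>A difference smaller than \<open>d\<close> in L2 of \<open>P\<close> has squared norm at
  most d^2 + 4 \<open>env_dist q\<close> under \<open>q\<close>, and at most \<open>Z x\<close> more
  under the empirical measure. Chaining is then applied with a radius that depends on the
  sample.\<close>

lemma L2_differences_deviation:
  assumes q: "admissible q" and n: "n > 0" and t: "t > 0" and d: "d > 0"
    and Z: "integrable (PiM {..<n} (\<lambda>_. law q)) Z" "\<And>x. Z x \<ge> 0"
    "AE x in PiM {..<n} (\<lambda>_. law q). \<forall>g\<in>\<G>. \<forall>g'\<in>\<G>.
       \<bar>(\<Sum>i<n. (g (x i) - g' (x i))\<^sup>2) - real n * (LINT y|law q. (g y - g' y)\<^sup>2)\<bar> \<le> real n * Z x"
    "(LINT x|PiM {..<n} (\<lambda>_. law q). Z x) \<le> z"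
  obtains U where "integrable (PiM {..<n} (\<lambda>_. law q)) U" "\<And>x. U x \<ge> 0"
    "AE x in PiM {..<n} (\<lambda>_. law q). \<forall>h\<in>L2_differences P d \<G>. \<bar>\<Sum>i<n. h (x i) - (LINT y|law q. h y)\<bar> \<le> sqrt (real n) * U x"
    "(LINT x|PiM {..<n} (\<lambda>_. law q). U x) \<le>
      2 * ((t + (d\<^sup>2 + 4 * env_dist q + z) / t + 2 * (1/2) ^ K * (1 + V_second q)) * level_const N K + 4 * (1 + V_second q) * chaining_tail K)"
proof -
  let ?Q = "PiM {..<n} (\<lambda>_. law q)"
  interpret Q: prob_space "law q" by (rule prob_space_law[OF q])
  interpret QQ: prob_space ?Q by (intro prob_space_PiM) (rule Q.prob_space_axioms)
  define c where "c = level_const N K"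
  have c: "c \<ge> 0" unfolding c_def by (rule level_const_nonneg[OF nets])
  note VV = sum_component_integral[OF q integrable_V_law(1)[OF q], of n]
  \<comment> \<open>The random chaining radius, from \<open>le_plus_divide\<close>; being affine in
    \<open>Z x\<close>, it is integrable and its mean involves only the mean of
    \<open>Z\<close>.\<close>
  define th where "th x = t + (d\<^sup>2 + 4 * env_dist q + Z x) / t" for x
  define W where "W x = 1 + (\<Sum>i<n. (V (x i))\<^sup>2) / real n" for x
  define B where "B x = sqrt (real n) * ((th x + 2 * (1/2) ^ K * W x) * c + 4 * W x * chaining_tail K)" for x
  have W_nonneg: "W x \<ge> 0" for x unfolding W_def by (intro add_nonneg_nonneg divide_nonneg_nonneg sum_nonneg) auto
  have th_nonneg: "th x \<ge> 0" for x unfolding th_def using t env_dist_nonneg[of q] Z(2)[of x] by (intro add_nonneg_nonneg divide_nonneg_nonneg) auto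
  have int: "integrable ?Q W" "integrable ?Q th"
    unfolding W_def th_def using VV(1) Z(1) by auto
  have EW: "(LINT x|?Q. W x) = 1 + V_second q"
    unfolding W_def using VV n by (simp add: QQ.prob_space V_second_def)
  have Eth: "(LINT x|?Q. th x) = t + (d\<^sup>2 + 4 * env_dist q + (LINT x|?Q. Z x)) / t"
    unfolding th_def using Z(1) by (simp add: QQ.prob_space)
  have B_int: "integrable ?Q B" unfolding B_def using int by auto
  have "(LINT x|?Q. B x) = sqrt (real n) * (((LINT x|?Q. th x) + 2 * (1/2) ^ K * (1 + V_second q)) * c + 4 * (1 + V_second q) * chaining_tail K)"
    unfolding B_def using int by (simp add: EW)
  also have "\<dots> \<le> sqrt (real n) * ((t + (d\<^sup>2 + 4 * env_dist q + z) / t + 2 * (1/2) ^ K * (1 + V_second q)) * c + 4 * (1 + V_second q) * chaining_tail K)"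
    unfolding Eth using Z(4) t c by (intro mult_left_mono add_right_mono mult_right_mono add_left_mono divide_right_mono) auto
  finally have B_le: "(LINT x|?Q. B x) \<le> sqrt (real n) * ((t + (d\<^sup>2 + 4 * env_dist q + z) / t + 2 * (1/2) ^ K * (1 + V_second q)) * c + 4 * (1 + V_second q) * chaining_tail K)" .
  have B_nonneg: "B x \<ge> 0" for x
    unfolding B_def using c W_nonneg th_nonneg chaining_tail_nonneg by (intro add_nonneg_nonneg mult_nonneg_nonneg) auto
  have small: "emp_norm n x h \<le> th x"
    if h: "h \<in> L2_differences P d \<G>" and x: "\<forall>g\<in>\<G>. \<forall>g'\<in>\<G>.
       \<bar>(\<Sum>i<n. (g (x i) - g' (x i))\<^sup>2) - real n * (LINT y|law q. (g y - g' y)\<^sup>2)\<bar> \<le> real n * Z x" for x h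
  proof -
    obtain g g' where g: "g \<in> \<G>" "g' \<in> \<G>" and h_eq: "h = (\<lambda>y. g y - g' y)" and hd: "L2_seminorm P (\<lambda>y. g y - g' y) < d"
      using h by (auto simp: L2_differences_def)
    have "(L2_seminorm P (\<lambda>y. g y - g' y))\<^sup>2 \<le> d\<^sup>2"
      using hd by (intro power_mono) (auto simp: L2_seminorm_def)
    then have 1: "(LINT y|P. (g y - g' y)\<^sup>2) \<le> d\<^sup>2" by (simp add: L2_seminorm_law_sq)
    have 2: "\<bar>(LINT y|law q. (g y - g' y)\<^sup>2) - (LINT y|P. (g y - g' y)\<^sup>2)\<bar> \<le> 4 * env_dist q"
      by (rule law_diff_le(2)[OF q, where c = 4]) (use diff_sq_le_V[OF g] G_meas g in auto)
    have "(\<Sum>i<n. (g (x i) - g' (x i))\<^sup>2) \<le> real n * (LINT y|law q. (g y - g' y)\<^sup>2) + real n * Z x"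
      using x g by (force simp: abs_le_iff)
    also have "\<dots> \<le> real n * (d\<^sup>2 + 4 * env_dist q + Z x)"
      unfolding distrib_left[symmetric] using 1 2 by (intro mult_left_mono) (auto simp: abs_le_iff)
    finally have "(emp_norm n x h)\<^sup>2 \<le> d\<^sup>2 + 4 * env_dist q + Z x"
      using emp_norm_sq[OF n, of h x] n by (simp add: h_eq)
    from le_plus_divide[OF this t emp_norm_nonneg] show ?thesis unfolding th_def .
  qed
  have bound: "AE x in ?Q. (\<Sum>r\<in>signs n. SUP h\<in>L2_differences P d \<G>. ennreal \<bar>\<Sum>i<n. r i * h (x i)\<bar>) \<le> ennreal (2 ^ n * B x)"
    using Z(3)
  proof eventually_elim
    fix x assume x: "\<forall>g\<in>\<G>. \<forall>g'\<in>\<G>.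
       \<bar>(\<Sum>i<n. (g (x i) - g' (x i))\<^sup>2) - real n * (LINT y|law q. (g y - g' y)\<^sup>2)\<bar> \<le> real n * Z x"
    have "(\<Sum>r\<in>signs n. SUP h\<in>L2_differences P d \<G>. ennreal \<bar>\<Sum>i<n. r i * h (x i)\<bar>) \<le>
       ennreal (2 ^ n * sqrt (real n) * ((th x + 2 * (1/2) ^ K * emp_norm n x V) * level_const N K +
        4 * emp_norm n x V * (\<Sum>k. entropy_step N (k + K))))"
    proof (rule rademacher_chaining[OF nets n th_nonneg])
      fix h assume h: "h \<in> L2_differences P d \<G>"
      then have "\<exists>g\<in>\<G>. \<exists>g'\<in>\<G>. h = (\<lambda>y. g y - g' y)" by (auto simp: L2_differences_def)
      then show "(\<exists>g\<in>\<G>. \<exists>g'\<in>\<G>. h = (\<lambda>y. g y - g' y)) \<and> emp_norm n x h \<le> th x"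
        using small[OF h x] by blast
    qed
    also have "\<dots> \<le> ennreal (2 ^ n * B x)"
      unfolding B_def c_def[symmetric] chaining_tail_def[symmetric] mult.assoc
      using c chaining_tail_nonneg[of K] emp_norm_le_1_plus[OF n, of x]
      by (intro ennreal_leI mult_left_mono add_mono mult_right_mono) (auto simp: W_def)
    finally show "(\<Sum>r\<in>signs n. SUP h\<in>L2_differences P d \<G>. ennreal \<bar>\<Sum>i<n. r i * h (x i)\<bar>) \<le> ennreal (2 ^ n * B x)" .
  qed
  have cls: "P_measurable_class (law q) (L2_differences P d \<G>)"
    using suitable d by (intro P_measurable_class_law[OF q]) (simp add: suitably_measurable_class_def)
  have intH: "integrable (law q) h" if h: "h \<in> L2_differences P d \<G>" for h
  proof -
    obtain g g' where g: "g \<in> \<G>" "g' \<in> \<G>" and h_eq: "h = (\<lambda>y. g y - g' y)"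
      using h by (auto simp: L2_differences_def)
    have h_m: "h \<in> borel_measurable (law q)" unfolding h_eq measurable_cong_sets[OF sets_law refl] using g G_meas by (intro borel_measurable_diff)
    have "integrable (law q) (\<lambda>y. (h y)\<^sup>2)" unfolding h_eq
      by (rule law_diff_le(1)[OF q, where c = 4]) (use diff_sq_le_V[OF g] G_meas g in auto)
    then show ?thesis by (rule Q.square_integrable_imp_integrable[OF h_m])
  qed
  obtain U where U: "integrable ?Q U" "\<And>x. U x \<ge> 0"
    "AE x in ?Q. \<forall>h\<in>L2_differences P d \<G>. \<bar>\<Sum>i<n. h (x i) - (LINT y|law q. h y)\<bar> \<le> U x"
    "(LINT x|?Q. U x) \<le> 2 * (LINT x|?Q. B x)"
    using symmetrization_real[OF Q.prob_space_axioms cls intH B_int B_nonneg bound] by blast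
  show ?thesis
  proof (rule that[of "\<lambda>x. U x / sqrt (real n)"])
    have "(LINT x|?Q. U x) / sqrt (real n) \<le> 2 * (LINT x|?Q. B x) / sqrt (real n)"
      using U(4) by (intro divide_right_mono) auto
    also have "\<dots> \<le> 2 * (sqrt (real n) * ((t + (d\<^sup>2 + 4 * env_dist q + z) / t + 2 * (1/2) ^ K * (1 + V_second q)) * c + 4 * (1 + V_second q) * chaining_tail K)) / sqrt (real n)"
      using B_le by (intro divide_right_mono mult_left_mono) auto
    also have "\<dots> = 2 * ((t + (d\<^sup>2 + 4 * env_dist q + z) / t + 2 * (1/2) ^ K * (1 + V_second q)) * c + 4 * (1 + V_second q) * chaining_tail K)"
      using n by simp
    finally show "(LINT x|?Q. U x / sqrt (real n)) \<le>
       2 * ((t + (d\<^sup>2 + 4 * env_dist q + z) / t + 2 * (1/2) ^ K * (1 + V_second q)) * level_const N K + 4 * (1 + V_second q) * chaining_tail K)"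
      unfolding c_def by simp
    show "AE x in ?Q. \<forall>h\<in>L2_differences P d \<G>. \<bar>\<Sum>i<n. h (x i) - (LINT y|law q. h y)\<bar> \<le> sqrt (real n) * (U x / sqrt (real n))"
      using U(3) n by simp
  qed (use U n in auto)
qed

text \<open>The parameters are fixed in the order \<open>L\<close>, \<open>K\<close>,
  \<open>n\<close>, before \<open>q\<close> is known. For \<open>env_dist q\<close> at most z' the
  tail of V^2 under \<open>q\<close> is at most 2 z', and the three terms add up to 2 (8 + 1 + 1)
  z', which is below z = 32 z'.\<close>

lemma squared_differences_deviation_small:
  assumes z: "z > 0"
  obtains \<eta> n0 where "\<eta> > 0" "n0 > 0" "\<And>n q. n \<ge> n0 \<Longrightarrow> admissible q \<Longrightarrow> env_dist q \<le> \<eta> \<Longrightarrow>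
    (\<exists>Z. integrable (PiM {..<n} (\<lambda>_. law q)) Z \<and> (\<forall>x. Z x \<ge> 0) \<and>
    (AE x in PiM {..<n} (\<lambda>_. law q). \<forall>g\<in>\<G>. \<forall>g'\<in>\<G>.
       \<bar>(\<Sum>i<n. (g (x i) - g' (x i))\<^sup>2) - real n * (LINT y|law q. (g y - g' y)\<^sup>2)\<bar> \<le> real n * Z x) \<and>
    (LINT x|PiM {..<n} (\<lambda>_. law q). Z x) \<le> z)"
proof -
  define z' where "z' = z / 32"
  have z': "z' > 0" using z by (simp add: z'_def)
  have "eventually (\<lambda>L. V_tail (real L) f < z') sequentially"
    using V_tail_tendsto z' by (rule order_tendstoD)
  then obtain L0 :: nat where L0: "V_tail (real L0) f < z'" by (auto simp: eventually_sequentially)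
  define L where "L = real L0"
  \<comment> \<open>Bounds \<open>1 + V_second q\<close> for all \<open>q\<close> with
    \<open>env_dist q \<le> 1\<close>.\<close>
  define A where "A = 2 + V_second f"
  have "(\<lambda>K. 8 * L * (1/2) ^ K * A) \<longlonglongrightarrow> 8 * L * 0 * A"
    by (intro tendsto_intros LIMSEQ_power_zero) auto
  then have "eventually (\<lambda>K. 8 * L * (1/2) ^ K * A < z') sequentially"
    using z' by (intro order_tendstoD(2)) auto
  then obtain K where K: "8 * L * (1/2) ^ K * A < z'" by (auto simp: eventually_sequentially)
  have "(\<lambda>n. 4 * L\<^sup>2 * level_const N K / sqrt (real n)) \<longlonglongrightarrow> 0"
    by (intro real_tendsto_divide_at_top[OF tendsto_const] filterlim_compose[OF sqrt_at_top filterlim_real_sequentially])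
  then have "eventually (\<lambda>n. 4 * L\<^sup>2 * level_const N K / sqrt (real n) < z') sequentially"
    using z' by (rule order_tendstoD)
  then obtain n0 where n0: "\<And>n. n \<ge> n0 \<Longrightarrow> 4 * L\<^sup>2 * level_const N K / sqrt (real n) < z'"
    by (auto simp: eventually_sequentially)
  show ?thesis
  proof (rule that[of "min 1 z'" "max 1 n0"])
    fix n q assume n: "max 1 n0 \<le> n" and q: "admissible q" and e: "env_dist q \<le> min 1 z'"
    have V1: "V_tail L q \<le> 2 * z'" using V_tail_le[OF q, of L] e L0 by (auto simp: L_def)
    have V2: "1 + V_second q \<le> A" using V_second_le[OF q] e by (auto simp: A_def)
    have "8 * L * (1/2) ^ K * (1 + V_second q) \<le> 8 * L * (1/2) ^ K * A"
      using V2 by (intro mult_left_mono) (auto simp: L_def)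
    then have le: "2 * (4 * V_tail L q + 8 * L * (1/2) ^ K * (1 + V_second q) + 4 * L\<^sup>2 * level_const N K / sqrt (real n)) \<le> z"
      using V1 K n0[of n] n z' unfolding z'_def by auto
    obtain Z where "integrable (PiM {..<n} (\<lambda>_. law q)) Z" "\<And>x. Z x \<ge> 0"
      "AE x in PiM {..<n} (\<lambda>_. law q). \<forall>g\<in>\<G>. \<forall>g'\<in>\<G>.
         \<bar>(\<Sum>i<n. (g (x i) - g' (x i))\<^sup>2) - real n * (LINT y|law q. (g y - g' y)\<^sup>2)\<bar> \<le> real n * Z x"
      "(LINT x|PiM {..<n} (\<lambda>_. law q). Z x) \<le>
         2 * (4 * V_tail L q + 8 * L * (1/2) ^ K * (1 + V_second q) + 4 * L\<^sup>2 * level_const N K / sqrt (real n))"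
      by (rule squared_differences_deviation[OF q, of n L K]) (use n in \<open>auto simp: L_def\<close>)
    then show "\<exists>Z. integrable (PiM {..<n} (\<lambda>_. law q)) Z \<and> (\<forall>x. Z x \<ge> 0) \<and>
      (AE x in PiM {..<n} (\<lambda>_. law q). \<forall>g\<in>\<G>. \<forall>g'\<in>\<G>.
         \<bar>(\<Sum>i<n. (g (x i) - g' (x i))\<^sup>2) - real n * (LINT y|law q. (g y - g' y)\<^sup>2)\<bar> \<le> real n * Z x) \<and>
      (LINT x|PiM {..<n} (\<lambda>_. law q). Z x) \<le> z"
      using le by (intro exI[of _ Z]) auto
  qed (use z' in auto)
qed

text \<open>The starting level \<open>K\<close> is fixed first and takes care of the chaining sum
  and of the radius of the coarsest net. Only then are the radius \<open>t\<close>, the distance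
  \<open>d\<close> and the deviation of the squared differences chosen, since they are multiplied by
  the possibly large \<open>level_const N K\<close>.\<close>

lemma asymptotic_equicontinuity:
  assumes e: "e > 0"
  obtains d \<eta> n0 where "d > 0" "\<eta> > 0" "n0 > 0" "\<And>n q. n \<ge> n0 \<Longrightarrow> admissible q \<Longrightarrow> env_dist q \<le> \<eta> \<Longrightarrow>
    (\<exists>U. integrable (PiM {..<n} (\<lambda>_. law q)) U \<and> (\<forall>x. U x \<ge> 0) \<and>
    (AE x in PiM {..<n} (\<lambda>_. law q). \<forall>h\<in>L2_differences P d \<G>. \<bar>\<Sum>i<n. h (x i) - (LINT y|law q. h y)\<bar> \<le> sqrt (real n) * U x) \<and>
    (LINT x|PiM {..<n} (\<lambda>_. law q). U x) \<le> e)"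
proof -
  define A where "A = 2 + V_second f"
  have A: "A \<ge> 2" unfolding A_def using V_second_nonneg by simp
  have "(\<lambda>K. 2 * (2 * A * ((1/2) ^ K * level_const N K) + 4 * A * chaining_tail K)) \<longlonglongrightarrow> 2 * (2 * A * 0 + 4 * A * 0)"
    by (intro tendsto_intros level_const_tendsto chaining_tail_tendsto)
  then have "eventually (\<lambda>K. 2 * (2 * A * ((1/2) ^ K * level_const N K) + 4 * A * chaining_tail K) < e / 2) sequentially"
    using e by (intro order_tendstoD(2)) auto
  then obtain K where K: "2 * (2 * A * ((1/2) ^ K * level_const N K) + 4 * A * chaining_tail K) < e / 2"
    by (auto simp: eventually_sequentially)
  define c where "c = level_const N K"
  have c: "c \<ge> 0" unfolding c_def by (rule level_const_nonneg[OF nets])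
  \<comment> \<open>The share of the radius 2 t is 4 t c, at most e / 3; \<open>c + 1\<close> avoids
    a division by zero. Below, \<open>s\<close> is t^2 / 6 because d^2, 4 \<open>env_dist q\<close>
    and the deviation contribute (1 + 4 + 1) s.\<close>
  define t where "t = e / (12 * (c + 1))"
  have t: "t > 0" using e c by (simp add: t_def)
  define s where "s = t\<^sup>2 / 6"
  have s: "s > 0" using t by (simp add: s_def)
  have tc: "2 * (2 * t * c) \<le> e / 2"
  proof -
    have "t * c \<le> t * (c + 1)" using t by simp
    also have "\<dots> = e / 12" using c by (simp add: t_def field_simps)
    finally show ?thesis using e by linarith
  qed
  obtain \<eta> n0 where \<eta>: "\<eta> > 0" "n0 > 0" and Zex: "\<And>n q. n \<ge> n0 \<Longrightarrow> admissible q \<Longrightarrow> env_dist q \<le> \<eta> \<Longrightarrow>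
    (\<exists>Z. integrable (PiM {..<n} (\<lambda>_. law q)) Z \<and> (\<forall>x. Z x \<ge> 0) \<and>
    (AE x in PiM {..<n} (\<lambda>_. law q). \<forall>g\<in>\<G>. \<forall>g'\<in>\<G>.
       \<bar>(\<Sum>i<n. (g (x i) - g' (x i))\<^sup>2) - real n * (LINT y|law q. (g y - g' y)\<^sup>2)\<bar> \<le> real n * Z x) \<and>
    (LINT x|PiM {..<n} (\<lambda>_. law q). Z x) \<le> s)"
    using squared_differences_deviation_small[OF s] by blast
  show ?thesis
  proof (rule that[of "sqrt s" "min (min 1 s) \<eta>" n0])
    fix n q assume n: "n0 \<le> n" and q: "admissible q" and ed: "env_dist q \<le> min (min 1 s) \<eta>"
    obtain Z where Z: "integrable (PiM {..<n} (\<lambda>_. law q)) Z" "\<And>x. Z x \<ge> 0"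
      "AE x in PiM {..<n} (\<lambda>_. law q). \<forall>g\<in>\<G>. \<forall>g'\<in>\<G>.
       \<bar>(\<Sum>i<n. (g (x i) - g' (x i))\<^sup>2) - real n * (LINT y|law q. (g y - g' y)\<^sup>2)\<bar> \<le> real n * Z x"
      "(LINT x|PiM {..<n} (\<lambda>_. law q). Z x) \<le> s"
      using Zex[OF n q] ed by auto
    have n_pos: "n > 0" using n \<eta> by linarith
    have s_sqrt: "sqrt s > 0" using s by simp
    obtain U where U: "integrable (PiM {..<n} (\<lambda>_. law q)) U" "\<And>x. U x \<ge> 0"
      "AE x in PiM {..<n} (\<lambda>_. law q). \<forall>h\<in>L2_differences P (sqrt s) \<G>. \<bar>\<Sum>i<n. h (x i) - (LINT y|law q. h y)\<bar> \<le> sqrt (real n) * U x"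
      "(LINT x|PiM {..<n} (\<lambda>_. law q). U x) \<le>
        2 * ((t + ((sqrt s)\<^sup>2 + 4 * env_dist q + s) / t + 2 * (1/2) ^ K * (1 + V_second q)) * level_const N K + 4 * (1 + V_second q) * chaining_tail K)"
      using L2_differences_deviation[OF q n_pos t s_sqrt Z, of K] by blast
    have V2: "1 + V_second q \<le> A" using V_second_le[OF q] ed by (auto simp: A_def)
    have "((sqrt s)\<^sup>2 + 4 * env_dist q + s) / t \<le> 6 * s / t"
      using s ed t by (intro divide_right_mono) auto
    also have "\<dots> = t" using t by (simp add: s_def power2_eq_square)
    finally have 1: "t + ((sqrt s)\<^sup>2 + 4 * env_dist q + s) / t \<le> 2 * t" by simp
    have "2 * ((t + ((sqrt s)\<^sup>2 + 4 * env_dist q + s) / t + 2 * (1/2) ^ K * (1 + V_second q)) * c + 4 * (1 + V_second q) * chaining_tail K) \<le>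
        2 * ((2 * t + 2 * (1/2) ^ K * A) * c + 4 * A * chaining_tail K)"
      using V2 1 c chaining_tail_nonneg[of K]
      by (intro mult_left_mono add_mono mult_right_mono) auto
    also have "\<dots> = 2 * (2 * t * c) + 2 * (2 * A * ((1/2) ^ K * c) + 4 * A * chaining_tail K)"
      by (simp add: algebra_simps)
    also have "\<dots> \<le> e" using tc K unfolding c_def by linarith
    finally have "(LINT x|PiM {..<n} (\<lambda>_. law q). U x) \<le> e" using U(4) unfolding c_def by linarith
    then show "\<exists>U. integrable (PiM {..<n} (\<lambda>_. law q)) U \<and> (\<forall>x. U x \<ge> 0) \<and>
      (AE x in PiM {..<n} (\<lambda>_. law q). \<forall>h\<in>L2_differences P (sqrt s) \<G>. \<bar>\<Sum>i<n. h (x i) - (LINT y|law q. h y)\<bar> \<le> sqrt (real n) * U x) \<and>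
      (LINT x|PiM {..<n} (\<lambda>_. law q). U x) \<le> e"
      using U by blast
  qed (use s \<eta> in auto)
qed

text \<open>The entropy condition speaks of discrete measures, so a net for \<open>P\<close> is
  taken from a single sample at which empirical and true squared distances agree up to a small
  error, simultaneously for all pairs.\<close>

lemma totally_bounded:
  assumes r: "r > 0"
  obtains F where "finite F" "F \<subseteq> \<G>" "\<And>g. g \<in> \<G> \<Longrightarrow> \<exists>g0\<in>F. L2_seminorm P (\<lambda>y. g y - g0 y) < r"
proof -
  define s where "s = r\<^sup>2 / 4"
  have s: "s > 0" using r by (simp add: s_def)
  define A where "A = 1 + V_second f"
  have A: "A \<ge> 1" unfolding A_def using V_second_nonneg by simp
  have s4: "s / 4 > 0" using s by simp
  obtain \<eta> n where \<eta>: "\<eta> > 0" and n: "n > 0" and Zex: "\<And>m q. m \<ge> n \<Longrightarrow> admissible q \<Longrightarrow> env_dist q \<le> \<eta> \<Longrightarrow>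
    (\<exists>Z. integrable (PiM {..<m} (\<lambda>_. law q)) Z \<and> (\<forall>x. Z x \<ge> 0) \<and>
    (AE x in PiM {..<m} (\<lambda>_. law q). \<forall>g\<in>\<G>. \<forall>g'\<in>\<G>.
       \<bar>(\<Sum>i<m. (g (x i) - g' (x i))\<^sup>2) - real m * (LINT y|law q. (g y - g' y)\<^sup>2)\<bar> \<le> real m * Z x) \<and>
    (LINT x|PiM {..<m} (\<lambda>_. law q). Z x) \<le> s / 4)"
    using squared_differences_deviation_small[OF s4] by blast
  have "env_dist f \<le> \<eta>" using \<eta> env_dist_f by simp
  from Zex[OF order_refl admissible_f this] obtain Z where Z: "integrable (PiM {..<n} (\<lambda>_. P)) Z" "\<And>x. Z x \<ge> 0"
      "AE x in PiM {..<n} (\<lambda>_. P). \<forall>g\<in>\<G>. \<forall>g'\<in>\<G>.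
       \<bar>(\<Sum>i<n. (g (x i) - g' (x i))\<^sup>2) - real n * (LINT y|P. (g y - g' y)\<^sup>2)\<bar> \<le> real n * Z x"
      "(LINT x|PiM {..<n} (\<lambda>_. P). Z x) \<le> s / 4"
    unfolding P_eq[symmetric] by blast
  let ?P = "PiM {..<n} (\<lambda>_. P)"
  interpret PP: prob_space ?P by (intro prob_space_PiM) (rule P.prob_space_axioms)
  define W where "W x = Z x / s + (\<Sum>i<n. (V (x i))\<^sup>2) / real n / (4 * A)" for x
  note VV = sum_component_integral[OF admissible_f integrable_V_law(1)[OF admissible_f], of n, folded P_eq]
  have W_int: "integrable ?P W" unfolding W_def using Z VV by auto
  have "(LINT x|?P. W x) = (LINT x|?P. Z x) / s + V_second f / (4 * A)"
    unfolding W_def using Z VV n by (simp add: V_second_def P_eq)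
  also have "\<dots> \<le> (s / 4) / s + A / (4 * A)"
    using Z(4) s A by (intro add_mono divide_right_mono) (auto simp: A_def)
  also have "\<dots> < 1" using s A by simp
  finally have EW: "(LINT x|?P. W x) < 1" .
  \<comment> \<open>Existence by the mean: if almost every sample had \<open>W x > 1\<close>, the
    mean of \<open>W\<close> could not be below 1. The bound \<open>W x \<le> 1\<close> yields
    \<open>Z x \<le> s\<close>.\<close>
  have "\<exists>x. (\<forall>g\<in>\<G>. \<forall>g'\<in>\<G>.
       \<bar>(\<Sum>i<n. (g (x i) - g' (x i))\<^sup>2) - real n * (LINT y|P. (g y - g' y)\<^sup>2)\<bar> \<le> real n * Z x) \<and> W x \<le> 1"
  proof (rule ccontr)
    assume "\<not> ?thesis"
    note neg = this
    have "AE x in ?P. 1 \<le> W x"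
      using Z(3)
    proof eventually_elim
      fix x assume "\<forall>g\<in>\<G>. \<forall>g'\<in>\<G>.
       \<bar>(\<Sum>i<n. (g (x i) - g' (x i))\<^sup>2) - real n * (LINT y|P. (g y - g' y)\<^sup>2)\<bar> \<le> real n * Z x"
      then have "\<not> W x \<le> 1" using neg by blast
      then show "1 \<le> W x" by simp
    qed
    then have "(LINT x|?P. 1) \<le> (LINT x|?P. W x)" using W_int by (intro integral_mono_AE) auto
    then show False using EW by (simp add: PP.prob_space)
  qed
  then obtain x where x: "\<And>g g'. g \<in> \<G> \<Longrightarrow> g' \<in> \<G> \<Longrightarrow>
       \<bar>(\<Sum>i<n. (g (x i) - g' (x i))\<^sup>2) - real n * (LINT y|P. (g y - g' y)\<^sup>2)\<bar> \<le> real n * Z x" and Wx: "W x \<le> 1" by blast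
  have V_part: "(\<Sum>i<n. (V (x i))\<^sup>2) / real n / (4 * A) \<ge> 0" using A by (intro divide_nonneg_nonneg sum_nonneg) auto
  have Zx: "Z x \<le> s"
  proof -
    have "Z x / s \<le> 1" using Wx V_part unfolding W_def by linarith
    then show ?thesis using s by (simp add: divide_le_eq)
  qed
  define v where "v = emp_norm n x V"
  have "(\<lambda>k. (2 * (1/2) ^ k * v)\<^sup>2) \<longlonglongrightarrow> (2 * 0 * v)\<^sup>2"
    by (intro tendsto_intros LIMSEQ_power_zero) auto
  then have "eventually (\<lambda>k. (2 * (1/2) ^ k * v)\<^sup>2 < s) sequentially"
    using s by (intro order_tendstoD(2)) auto
  then obtain k where k: "(2 * (1/2) ^ k * v)\<^sup>2 < s" by (auto simp: eventually_sequentially)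
  obtain C \<pi> where C: "\<And>k. finite (C k)"
    and \<pi>: "\<And>k g. g \<in> \<G> \<Longrightarrow> \<pi> k g \<in> C k"
      "\<And>k g. g \<in> \<G> \<Longrightarrow> emp_norm n x (\<lambda>y. g y - \<pi> k g y) \<le> (1/2) ^ k * v"
    unfolding v_def by (rule dyadic_nets_obtain_projections[OF nets n]) blast
  \<comment> \<open>Centres need not belong to the class; each centre in use is replaced by some
    member projected onto it, which doubles the radius.\<close>
  define rep where "rep c = (SOME g. g \<in> \<G> \<and> \<pi> k g = c)" for c
  define F where "F = rep ` (\<pi> k ` \<G>)"
  have rep: "rep (\<pi> k g) \<in> \<G> \<and> \<pi> k (rep (\<pi> k g)) = \<pi> k g" if "g \<in> \<G>" for g
    unfolding rep_def by (rule someI[of _ g]) (use that in simp)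
  show ?thesis
  proof (rule that[of F])
    have "finite (\<pi> k ` \<G>)" by (rule finite_subset[OF _ C[of k]]) (use \<pi>(1) in auto)
    then show "finite F" unfolding F_def by (rule finite_imageI)
    show "F \<subseteq> \<G>" unfolding F_def using rep by auto
    fix g assume g: "g \<in> \<G>"
    define g0 where "g0 = rep (\<pi> k g)"
    have g0: "g0 \<in> \<G>" "\<pi> k g0 = \<pi> k g" unfolding g0_def using rep[OF g] by auto
    have "emp_norm n x (\<lambda>y. g y - g0 y) \<le> emp_norm n x (\<lambda>y. g y - \<pi> k g y) + emp_norm n x (\<lambda>y. \<pi> k g y - g0 y)"
      by (rule emp_norm_diff_le)
    also have "\<dots> \<le> (1/2) ^ k * v + (1/2) ^ k * v"
      using \<pi>(2)[OF g, of k] \<pi>(2)[OF g0(1), of k] unfolding g0(2) emp_norm_minus_commute[of n x "\<pi> k g" g0] by linarith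
    finally have "emp_norm n x (\<lambda>y. g y - g0 y) \<le> 2 * (1/2) ^ k * v" by linarith
    then have "(emp_norm n x (\<lambda>y. g y - g0 y))\<^sup>2 \<le> (2 * (1/2) ^ k * v)\<^sup>2" by (intro power_mono) auto
    then have "(emp_norm n x (\<lambda>y. g y - g0 y))\<^sup>2 < s" using k by linarith
    moreover have "real n * (LINT y|P. (g y - g0 y)\<^sup>2) \<le> real n * ((emp_norm n x (\<lambda>y. g y - g0 y))\<^sup>2 + Z x)"
      using x[OF g g0(1)] emp_norm_sq[OF n, of "\<lambda>y. g y - g0 y" x] by (simp add: distrib_left abs_le_iff)
    ultimately have "(LINT y|P. (g y - g0 y)\<^sup>2) < 2 * s" using n Zx by simp
    also have "\<dots> \<le> r\<^sup>2" by (simp add: s_def)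
    finally have "(L2_seminorm P (\<lambda>y. g y - g0 y))\<^sup>2 < r\<^sup>2" unfolding L2_seminorm_law_sq .
    then have "L2_seminorm P (\<lambda>y. g y - g0 y) < r" using r by (auto intro: power_less_imp_less_base)
    then show "\<exists>g0\<in>F. L2_seminorm P (\<lambda>y. g y - g0 y) < r" using g g0_def F_def by blast
  qed
qed

end

subsection \<open>Continuity of translations\<close>

lemma lborel_translation:
  fixes u :: "real \<Rightarrow> real"
  shows "integrable lborel (\<lambda>y. u (y + s)) \<longleftrightarrow> integrable lborel u" "(LINT y|lborel. u (y + s)) = (LINT y|lborel. u y)"
  using lborel_integrable_real_affine_iff[of 1 u s] lborel_integral_real_affine[of 1 u s] by (simp_all add: add.commute)

definition translation_error :: "(real \<Rightarrow> real) \<Rightarrow> real \<Rightarrow> real" where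
  "translation_error u s = (LINT y|lborel. \<bar>u (y + s) - u y\<bar>)"

lemma translation_error_nonneg: "translation_error u s \<ge> 0"
  unfolding translation_error_def by (intro Bochner_Integration.integral_nonneg) auto

text \<open>Continuity of translations in L1, by induction over integrable functions. Indicators are
  handled by outer regularity: an open superset absorbs small translations of each of its points,
  and the excess measure is translation invariant.\<close>

lemma translation_error_tendsto:
  fixes u :: "real \<Rightarrow> real" and s :: "nat \<Rightarrow> real"
  assumes "integrable lborel u" and s: "s \<longlonglongrightarrow> 0"
  shows "(\<lambda>n. translation_error u (s n)) \<longlonglongrightarrow> 0"
  using assms(1)
proof (induction rule: integrable_induct)
  case (base A c)
  have A[measurable]: "A \<in> sets borel" and fin: "emeasure lborel A < \<infinity>" using base by auto
  have int1: "integrable lborel (indicator A :: real \<Rightarrow> real)" using A fin by (simp add: integrable_indicator_iff)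
  \<comment> \<open>The part of \<open>A\<close> leaving \<open>A\<close> under the shift and the
    part entering it have equal measure, by translation invariance; hence the factor 2.\<close>
  define D where "D s = (LINT y|lborel. indicator A y * (1 - indicator A (y + s)) :: real)" for s
  have eq: "translation_error (\<lambda>x. indicator A x *\<^sub>R c) s = \<bar>c\<bar> * (2 * D s)" for s
  proof -
    have int2: "integrable lborel (\<lambda>y. indicator A (y + s) :: real)"
      using int1 by (subst lborel_translation(1)[of "indicator A"])
    have int3: "integrable lborel (\<lambda>y. indicator A y * (1 - indicator A (y + s)) :: real)"
      by (rule Bochner_Integration.integrable_bound[OF int1]) (auto simp: indicator_def)
    have "translation_error (\<lambda>x. indicator A x *\<^sub>R c) s =
        (LINT y|lborel. \<bar>c\<bar> * (2 * (indicator A y * (1 - indicator A (y + s))) + (indicator A (y + s) - indicator A y)))"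
      unfolding translation_error_def by (intro Bochner_Integration.integral_cong) (auto simp: indicator_def)
    also have "\<dots> = \<bar>c\<bar> * (2 * D s + ((LINT y|lborel. indicator A (y + s)) - (LINT y|lborel. indicator A y)))"
      using int1 int2 int3 by (simp add: D_def)
    also have "(LINT y|lborel. indicator A (y + s)) = (LINT y|lborel. indicator A y :: real)"
      by (rule lborel_translation(2))
    finally show ?thesis by simp
  qed
  have D_nonneg: "D s \<ge> 0" for s
    unfolding D_def by (intro Bochner_Integration.integral_nonneg) (auto simp: indicator_def)
  have "(\<lambda>n. D (s n)) \<longlonglongrightarrow> 0"
  proof (rule tendstoI)
    fix e :: real assume e: "e > 0"
    obtain U where U: "open U" "A \<subseteq> U" "emeasure lborel (U - A) < ennreal (e / 2)"
      using outer_regular_lborel[OF A, of "e / 2"] e by auto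
    have [measurable]: "U \<in> sets borel" using U(1) by simp
    have int_UA: "integrable lborel (indicator (U - A) :: real \<Rightarrow> real)"
      using U(3) by (subst integrable_indicator_iff) (auto intro: less_trans[OF _ ennreal_less_top])
    have UA: "(LINT y|lborel. indicator (U - A) y :: real) < e / 2"
    proof -
      have "ennreal (measure lborel (U - A)) < ennreal (e / 2)"
        using U(3) by (subst emeasure_eq_ennreal_measure[symmetric]) auto
      then show ?thesis using e by (simp add: ennreal_less_iff)
    qed
    have lim: "(\<lambda>n. LINT y|lborel. indicator A y * (1 - indicator U (y + s n)) :: real) \<longlonglongrightarrow> (LINT y|(lborel :: real measure). 0 :: real)"
    proof (rule integral_dominated_convergence[where w = "indicat_real A"])
      show "AE y in lborel. (\<lambda>n. indicator A y * (1 - indicator U (y + s n)) :: real) \<longlonglongrightarrow> 0"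
      proof (rule AE_I2)
        fix y :: real
        show "(\<lambda>n. indicator A y * (1 - indicator U (y + s n)) :: real) \<longlonglongrightarrow> 0"
        proof (cases "y \<in> A")
          case True
          have "(\<lambda>n. y + s n) \<longlonglongrightarrow> y + 0" by (intro tendsto_intros s)
          then have "eventually (\<lambda>n. y + s n \<in> U) sequentially"
            using U True by (intro topological_tendstoD) auto
          then have "eventually (\<lambda>n. indicator A y * (1 - indicator U (y + s n)) = (0 :: real)) sequentially"
            by eventually_elim simp
          then show ?thesis by (rule tendsto_eventually)
        qed simp
      qed
    qed (use int1 in \<open>auto simp: indicator_def\<close>)
    then have "eventually (\<lambda>n. (LINT y|lborel. indicator A y * (1 - indicator U (y + s n)) :: real) < e / 2) sequentially"
      using e by (intro order_tendstoD(2)[OF lim]) auto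
    then show "eventually (\<lambda>n. dist (D (s n)) 0 < e) sequentially"
    proof eventually_elim
      fix n assume *: "(LINT y|lborel. indicator A y * (1 - indicator U (y + s n)) :: real) < e / 2"
      have intU: "integrable lborel (\<lambda>y. indicator A y * (1 - indicator U (y + s n)) :: real)"
        by (rule Bochner_Integration.integrable_bound[OF int1]) (auto simp: indicator_def)
      have intUA: "integrable lborel (\<lambda>y. indicator (U - A) (y + s n) :: real)"
        using int_UA by (subst lborel_translation(1)[of "indicator (U - A)"])
      have "D (s n) \<le> (LINT y|lborel. indicator A y * (1 - indicator U (y + s n)) + indicator (U - A) (y + s n))"
        unfolding D_def
      proof (rule integral_mono)
        show "integrable lborel (\<lambda>y. indicator A y * (1 - indicator A (y + s n)) :: real)"
          by (rule Bochner_Integration.integrable_bound[OF int1]) (auto simp: indicator_def)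
      qed (use intU intUA U in \<open>auto simp: indicator_def\<close>)
      also have "\<dots> = (LINT y|lborel. indicator A y * (1 - indicator U (y + s n))) + (LINT y|lborel. indicator (U - A) (y + s n))"
        by (intro Bochner_Integration.integral_add intU intUA)
      also have "(LINT y|lborel. indicator (U - A) (y + s n) :: real) = (LINT y|lborel. indicator (U - A) y)"
        by (rule lborel_translation(2))
      finally show "dist (D (s n)) 0 < e" using * UA D_nonneg[of "s n"] by simp
    qed
  qed
  then have "(\<lambda>n. \<bar>c\<bar> * (2 * D (s n))) \<longlonglongrightarrow> \<bar>c\<bar> * (2 * 0)" by (intro tendsto_intros)
  then show ?case unfolding eq by simp
next
  case (add f g)
  have le: "translation_error (\<lambda>y. f y + g y) t \<le> translation_error f t + translation_error g t" for t
  proof -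
    have int: "integrable lborel (\<lambda>y. \<bar>u (y + t) - u y\<bar>)" if "integrable lborel u" for u :: "real \<Rightarrow> real"
      using that lborel_translation(1)[of u t] by simp
    have "translation_error (\<lambda>y. f y + g y) t \<le> (LINT y|lborel. \<bar>f (y + t) - f y\<bar> + \<bar>g (y + t) - g y\<bar>)"
      unfolding translation_error_def
      using int[OF Bochner_Integration.integrable_add[OF add(1,2)]] int[OF add(1)] int[OF add(2)]
      by (intro integral_mono) auto
    then show ?thesis unfolding translation_error_def using int[OF add(1)] int[OF add(2)] by simp
  qed
  have "(\<lambda>n. translation_error f (s n) + translation_error g (s n)) \<longlonglongrightarrow> 0 + 0"
    using add by (intro tendsto_add)
  then have lim: "(\<lambda>n. translation_error f (s n) + translation_error g (s n)) \<longlonglongrightarrow> 0" by simp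
  show ?case
    by (rule tendsto_sandwich[OF _ _ tendsto_const lim]) (simp_all add: le translation_error_nonneg)
next
  case (lim f t)
  show ?case
  proof (rule tendstoI)
    fix e :: real assume e: "e > 0"
    have int_i: "integrable lborel (t i)" for i using lim by simp
    have L: "(\<lambda>i. LINT y|lborel. \<bar>t i y - f y\<bar>) \<longlonglongrightarrow> (LINT y|(lborel :: real measure). 0)"
    \<comment> \<open>The approximants satisfy |t i| <= 2 |f|, which gives the dominating function 3
      |f|.\<close>
    proof (rule integral_dominated_convergence[where w = "\<lambda>y. 3 * \<bar>f y\<bar>"])
      show "AE y in lborel. (\<lambda>i. \<bar>t i y - f y\<bar>) \<longlonglongrightarrow> 0"
        using lim(2) by (auto intro!: AE_I2 tendsto_rabs_zero simp: LIM_zero_iff)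
      show "AE y in lborel. norm \<bar>t i y - f y\<bar> \<le> 3 * \<bar>f y\<bar>" for i
      proof (rule AE_I2)
        fix y show "norm \<bar>t i y - f y\<bar> \<le> 3 * \<bar>f y\<bar>" using lim(3)[of y i] by simp
      qed
    qed (use lim int_i in auto)
    then have "eventually (\<lambda>i. (LINT y|lborel. \<bar>t i y - f y\<bar>) < e / 4) sequentially"
      using e by (intro order_tendstoD(2)) auto
    then obtain i where i: "(LINT y|lborel. \<bar>t i y - f y\<bar>) < e / 4" by (auto simp: eventually_sequentially)
    have "eventually (\<lambda>n. translation_error (t i) (s n) < e / 2) sequentially"
      using lim(5)[of i] e by (intro order_tendstoD(2)) auto
    then show "eventually (\<lambda>n. dist (translation_error f (s n)) 0 < e) sequentially"
    proof eventually_elim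
      fix n assume *: "translation_error (t i) (s n) < e / 2"
      have int: "integrable lborel (\<lambda>y. \<bar>u (y + s n) - u y\<bar>)" if "integrable lborel u" for u :: "real \<Rightarrow> real"
        using that lborel_translation(1)[of u "s n"] by simp
      have d: "integrable lborel (\<lambda>y. \<bar>t i y - f y\<bar>)" using lim int_i by simp
      then have d': "integrable lborel (\<lambda>y. \<bar>t i (y + s n) - f (y + s n)\<bar>)"
        using lborel_translation(1)[of "\<lambda>y. \<bar>t i y - f y\<bar>" "s n"] by simp
      have "translation_error f (s n) \<le> (LINT y|lborel. \<bar>t i (y + s n) - f (y + s n)\<bar> + \<bar>t i y - f y\<bar> + \<bar>t i (y + s n) - t i y\<bar>)"
        unfolding translation_error_def
        using int[OF lim(4)] int[OF int_i[of i]] d d' by (intro integral_mono) auto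
      also have "\<dots> = (LINT y|lborel. \<bar>t i (y + s n) - f (y + s n)\<bar>) + (LINT y|lborel. \<bar>t i y - f y\<bar>) + translation_error (t i) (s n)"
        using int[OF int_i[of i]] d d' by (simp add: translation_error_def)
      also have "(LINT y|lborel. \<bar>t i (y + s n) - f (y + s n)\<bar>) = (LINT y|lborel. \<bar>t i y - f y\<bar>)"
        by (rule lborel_translation(2))
      finally show "dist (translation_error f (s n)) 0 < e" using * i translation_error_nonneg[of f "s n"] by simp
    qed
  qed
qed

lemma translation_error_small:
  fixes u :: "real \<Rightarrow> real"
  assumes "integrable lborel u" "e > 0"
  obtains d where "d > 0" "\<And>s. \<bar>s\<bar> < d \<Longrightarrow> translation_error u s < e"
proof -
  have "(translation_error u \<longlongrightarrow> 0) (at 0)"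
    using translation_error_tendsto[OF assms(1)] unfolding tendsto_at_iff_sequentially comp_def by blast
  then have "eventually (\<lambda>s. translation_error u s < e) (at 0)"
    using assms(2) by (rule order_tendstoD)
  then obtain d where d: "d > 0" "\<And>s. s \<noteq> 0 \<Longrightarrow> \<bar>s\<bar> < d \<Longrightarrow> translation_error u s < e"
    by (auto simp: eventually_at)
  have "translation_error u 0 = 0" by (simp add: translation_error_def)
  then have "translation_error u s < e" if "\<bar>s\<bar> < d" for s
    using d(2)[of s] assms(2) that by (cases "s = 0") auto
  then show ?thesis using that d(1) by blast
qed

section \<open>Shifts of the envelope and of the members of the class\<close>

locale shift_continuous_envelope = entropy_class +
  assumes V_shift: "((\<lambda>s. \<integral>\<^sup>+ y. ennreal ((V (y + s) - V y)\<^sup>2 * f y) \<partial>lborel) \<longlongrightarrow> 0) (at 0)"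
begin

lemma f_nonneg: "f y \<ge> 0" using f_pos[of y] by simp

lemma V_shift_small:
  assumes e: "e > 0"
  obtains d where "d > 0" "\<And>s. \<bar>s\<bar> < d \<Longrightarrow> integrable lborel (\<lambda>y. (V (y + s) - V y)\<^sup>2 * f y)"
    "\<And>s. \<bar>s\<bar> < d \<Longrightarrow> (LINT y|lborel. (V (y + s) - V y)\<^sup>2 * f y) < e"
proof -
  have "eventually (\<lambda>s. (\<integral>\<^sup>+ y. ennreal ((V (y + s) - V y)\<^sup>2 * f y) \<partial>lborel) < ennreal e) (at 0)"
    using V_shift e by (intro order_tendstoD(2)) auto
  then obtain d where d: "d > 0" "\<And>s. s \<noteq> 0 \<Longrightarrow> \<bar>s\<bar> < d \<Longrightarrow> (\<integral>\<^sup>+ y. ennreal ((V (y + s) - V y)\<^sup>2 * f y) \<partial>lborel) < ennreal e"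
    by (auto simp: eventually_at)
  have *: "(\<integral>\<^sup>+ y. ennreal ((V (y + s) - V y)\<^sup>2 * f y) \<partial>lborel) < ennreal e" if "\<bar>s\<bar> < d" for s
    using d(2)[of s] that e by (cases "s = 0") auto
  have int: "integrable lborel (\<lambda>y. (V (y + s) - V y)\<^sup>2 * f y)" if "\<bar>s\<bar> < d" for s
    using *[OF that] f_nonneg by (intro integrableI_nonneg) (auto intro: less_trans[OF _ ennreal_less_top])
  show ?thesis
  proof (rule that[OF d(1) int])
    fix s assume s: "\<bar>s\<bar> < d"
    show "(LINT y|lborel. (V (y + s) - V y)\<^sup>2 * f y) < e"
      using *[OF s] nn_integral_eq_integral[OF int[OF s]] e f_nonneg
      by (simp add: ennreal_less_iff Bochner_Integration.integral_nonneg)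
  qed
qed

text \<open>Young's inequality with weight \<open>t\<close> for the cross term of a^2 - b^2 = (a -
  b)^2 + 2 b (a - b).\<close>

lemma sq_diff_bound: "\<bar>(a::real)\<^sup>2 - b\<^sup>2\<bar> \<le> (1 + 1 / t) * (a - b)\<^sup>2 + t * b\<^sup>2" if "t > 0"
proof -
  have 1: "2 * \<bar>b * (a - b)\<bar> \<le> (a - b)\<^sup>2 / t + t * b\<^sup>2"
  proof -
    have "0 \<le> (\<bar>a - b\<bar> / sqrt t - sqrt t * \<bar>b\<bar>)\<^sup>2" by simp
    also have "\<dots> = (a - b)\<^sup>2 / t + t * b\<^sup>2 - 2 * \<bar>b * (a - b)\<bar>"
      using that by (simp add: power2_diff power_divide power_mult_distrib abs_mult)
    finally show ?thesis by simp
  qed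
  have "a\<^sup>2 - b\<^sup>2 = (a - b)\<^sup>2 + 2 * (b * (a - b))" by (simp add: power2_eq_square algebra_simps)
  then have "\<bar>a\<^sup>2 - b\<^sup>2\<bar> \<le> (a - b)\<^sup>2 + 2 * \<bar>b * (a - b)\<bar>" using abs_triangle_ineq[of "(a - b)\<^sup>2" "2 * (b * (a - b))"] by (simp add: abs_mult)
  then show ?thesis using 1 by (simp add: algebra_simps)
qed

lemma V_second_pos_part: "integrable lborel (\<lambda>y. (V y)\<^sup>2 * f y)" "(LINT y|lborel. (V y)\<^sup>2 * f y) = V_second f"
  using admissible_f integral_law[OF admissible_f, of "\<lambda>y. (V y)\<^sup>2"] by (auto simp: admissible_def V_second_def)

text \<open>A substitution moves the shift from the density to the envelope, where the hypothesis
  applies. The weight \<open>t\<close> of Young's inequality is chosen first, then the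
  shift.\<close>

lemma V_sq_translate_small:
  assumes e: "e > 0"
  obtains d where "d > 0" "\<And>s. \<bar>s\<bar> < d \<Longrightarrow> integrable lborel (\<lambda>y. (V y)\<^sup>2 * f (y - s))"
    "\<And>s. \<bar>s\<bar> < d \<Longrightarrow> \<bar>(LINT y|lborel. (V y)\<^sup>2 * f (y - s)) - V_second f\<bar> < e"
proof -
  define A where "A = 1 + V_second f"
  have A: "A > 0" using V_second_nonneg[of f] by (simp add: A_def)
  define t where "t = e / (2 * A)"
  have t: "t > 0" using e A by (simp add: t_def)
  have tA: "t * V_second f \<le> e / 2"
  proof -
    have "t * V_second f \<le> t * A" using t by (simp add: A_def)
    also have "\<dots> = e / 2" using A by (simp add: t_def)
    finally show ?thesis .
  qed
  define e' where "e' = e / (2 * (1 + 1 / t))"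
  have e': "e' > 0" using e t by (auto simp: e'_def intro!: divide_pos_pos mult_pos_pos add_pos_pos)
  obtain d where d: "d > 0" "\<And>s. \<bar>s\<bar> < d \<Longrightarrow> integrable lborel (\<lambda>y. (V (y + s) - V y)\<^sup>2 * f y)"
    "\<And>s. \<bar>s\<bar> < d \<Longrightarrow> (LINT y|lborel. (V (y + s) - V y)\<^sup>2 * f y) < e'"
    using V_shift_small[OF e'] by blast
  have main: "integrable lborel (\<lambda>y. (V y)\<^sup>2 * f (y - s)) \<and> \<bar>(LINT y|lborel. (V y)\<^sup>2 * f (y - s)) - V_second f\<bar> < e" if s: "\<bar>s\<bar> < d" for s
  proof -
    have bnd: "integrable lborel (\<lambda>y. (1 + 1 / t) * ((V (y + s) - V y)\<^sup>2 * f y) + t * ((V y)\<^sup>2 * f y))"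
      using d(2)[OF s] V_second_pos_part(1) by auto
    have pt: "\<bar>(V (y + s))\<^sup>2 * f y - (V y)\<^sup>2 * f y\<bar> \<le> (1 + 1 / t) * ((V (y + s) - V y)\<^sup>2 * f y) + t * ((V y)\<^sup>2 * f y)" for y
    proof -
      have "\<bar>(V (y + s))\<^sup>2 - (V y)\<^sup>2\<bar> * f y \<le> ((1 + 1 / t) * (V (y + s) - V y)\<^sup>2 + t * (V y)\<^sup>2) * f y"
        using f_nonneg by (intro mult_right_mono sq_diff_bound t) auto
      moreover have "\<bar>(V (y + s))\<^sup>2 * f y - (V y)\<^sup>2 * f y\<bar> = \<bar>(V (y + s))\<^sup>2 - (V y)\<^sup>2\<bar> * f y"
        using f_nonneg[of y] by (simp add: abs_mult flip: left_diff_distrib)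
      ultimately show ?thesis by (simp add: algebra_simps)
    qed
    have int_d: "integrable lborel (\<lambda>y. (V (y + s))\<^sup>2 * f y - (V y)\<^sup>2 * f y)"
    proof (rule Bochner_Integration.integrable_bound[OF bnd])
      show "AE y in lborel. norm ((V (y + s))\<^sup>2 * f y - (V y)\<^sup>2 * f y) \<le> norm ((1 + 1 / t) * ((V (y + s) - V y)\<^sup>2 * f y) + t * ((V y)\<^sup>2 * f y))"
        using pt by (intro AE_I2) (simp add: order_trans[OF _ abs_ge_self])
    qed measurable
    from Bochner_Integration.integrable_add[OF int_d V_second_pos_part(1)]
    have int_s: "integrable lborel (\<lambda>y. (V (y + s))\<^sup>2 * f y)" by simp
    have tr: "(\<lambda>y. (V (y + s))\<^sup>2 * f y) = (\<lambda>y. (\<lambda>z. (V z)\<^sup>2 * f (z - s)) (y + s))" by simp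
    have int_s': "integrable lborel (\<lambda>y. (V y)\<^sup>2 * f (y - s))"
      using int_s unfolding tr by (subst (asm) lborel_translation(1))
    have eq: "(LINT y|lborel. (V y)\<^sup>2 * f (y - s)) = (LINT y|lborel. (V (y + s))\<^sup>2 * f y)"
      unfolding tr by (subst lborel_translation(2)) simp
    have "\<bar>(LINT y|lborel. (V y)\<^sup>2 * f (y - s)) - V_second f\<bar> = \<bar>LINT y|lborel. (V (y + s))\<^sup>2 * f y - (V y)\<^sup>2 * f y\<bar>"
      using int_s V_second_pos_part by (simp add: eq)
    also have "\<dots> \<le> (LINT y|lborel. (1 + 1 / t) * ((V (y + s) - V y)\<^sup>2 * f y) + t * ((V y)\<^sup>2 * f y))"
      by (rule integral_abs_bound_integral[OF int_d bnd pt])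
    also have "\<dots> = (1 + 1 / t) * (LINT y|lborel. (V (y + s) - V y)\<^sup>2 * f y) + t * V_second f"
      using d(2)[OF s] V_second_pos_part by simp
    also have "\<dots> < (1 + 1 / t) * e' + e / 2"
      using d(3)[OF s] t tA by (intro add_less_le_mono mult_strict_left_mono) (auto intro: add_pos_pos)
    also have "(1 + 1 / t) * e' = e / 2"
    proof -
      have "B * (e / (2 * B)) = e / 2" if "B > 0" for B :: real using that by simp
      moreover have "1 + 1 / t > 0" using t by (intro add_pos_pos) auto
      ultimately show ?thesis unfolding e'_def by blast
    qed
    finally show ?thesis using int_s' by simp
  qed
  show ?thesis using that[OF d(1)] main by blast
qed

text \<open>A Scheffe argument. Writing the absolute value as twice the negative part plus the
  signed difference leaves two integrals: the signed one is small by
  \<open>V_sq_translate_small\<close>, and the negative part is at most \<open>f\<close>, so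
  truncation at \<open>V > L\<close> together with L1 continuity of translations of \<open>f\<close>
  controls it.\<close>

lemma env_shift_small:
  assumes e: "e > 0"
  obtains d where "d > 0" "\<And>s. \<bar>s\<bar> < d \<Longrightarrow> integrable lborel (\<lambda>y. (V y)\<^sup>2 * \<bar>f (y - s) - f y\<bar>)"
    "\<And>s. \<bar>s\<bar> < d \<Longrightarrow> (LINT y|lborel. (V y)\<^sup>2 * \<bar>f (y - s) - f y\<bar>) < e"
proof -
  have e8: "e / 8 > 0" using e by simp
  have "eventually (\<lambda>L. V_tail (real L) f < e / 8) sequentially"
    using V_tail_tendsto e8 by (rule order_tendstoD)
  then obtain L0 :: nat where L0: "V_tail (real L0) f < e / 8" by (auto simp: eventually_sequentially)
  \<comment> \<open>The summand 1 makes \<open>L\<close> positive for the division by L^2; the tail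
    only decreases.\<close>
  define L where "L = real L0 + 1"
  have L: "L > 0" by (simp add: L_def)
  have int_tail: "integrable lborel (\<lambda>y. (V y)\<^sup>2 * indicator {y. V y > L} y * f y)"
    and tail_eq: "V_tail L f = (LINT y|lborel. (V y)\<^sup>2 * indicator {y. V y > L} y * f y)"
    using integral_law[OF admissible_f, of "\<lambda>y. (V y)\<^sup>2 * indicator {y. V y > L} y"] integrable_V_law(2)[OF admissible_f, of L]
    by (auto simp: V_tail_def)
  have tail_L: "V_tail L f < e / 8"
  proof -
    have "V_tail L f \<le> V_tail (real L0) f"
      unfolding V_tail_def
      by (intro integral_mono integrable_V_law(2) admissible_f) (auto simp: indicator_def L_def)
    then show ?thesis using L0 by simp
  qed
  have e_L: "e / (8 * L\<^sup>2) > 0" using e L by simp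
  obtain d1 where d1: "d1 > 0" "\<And>s. \<bar>s\<bar> < d1 \<Longrightarrow> translation_error f s < e / (8 * L\<^sup>2)"
    using translation_error_small[OF f_int(1) e_L] by blast
  have e4: "e / 4 > 0" using e by simp
  obtain d2 where d2: "d2 > 0" "\<And>s. \<bar>s\<bar> < d2 \<Longrightarrow> integrable lborel (\<lambda>y. (V y)\<^sup>2 * f (y - s))"
    "\<And>s. \<bar>s\<bar> < d2 \<Longrightarrow> \<bar>(LINT y|lborel. (V y)\<^sup>2 * f (y - s)) - V_second f\<bar> < e / 4"
    using V_sq_translate_small[OF e4] by blast
  have main: "integrable lborel (\<lambda>y. (V y)\<^sup>2 * \<bar>f (y - s) - f y\<bar>) \<and> (LINT y|lborel. (V y)\<^sup>2 * \<bar>f (y - s) - f y\<bar>) < e"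
    if s: "\<bar>s\<bar> < min d1 d2" for s
  proof -
    note int_s = d2(2)[of s]
    have s2: "\<bar>s\<bar> < d2" and s1: "\<bar>- s\<bar> < d1" using s by auto
    have int_f: "integrable lborel (\<lambda>y. \<bar>f (y + - s) - f y\<bar>)"
      using f_int(1) lborel_translation(1)[of f "- s"] by (simp del: add_uminus_conv_diff)
    have int_pos: "integrable lborel (\<lambda>y. (V y)\<^sup>2 * max 0 (f y - f (y - s)))"
    proof (rule Bochner_Integration.integrable_bound[OF V_second_pos_part(1)])
      show "AE y in lborel. norm ((V y)\<^sup>2 * max 0 (f y - f (y - s))) \<le> norm ((V y)\<^sup>2 * f y)"
        using f_nonneg by (intro AE_I2) (auto simp: abs_mult intro!: mult_left_mono)
    qed measurable
    have pos_le: "(LINT y|lborel. (V y)\<^sup>2 * max 0 (f y - f (y - s))) \<le> (LINT y|lborel. L\<^sup>2 * \<bar>f (y + - s) - f y\<bar> + (V y)\<^sup>2 * indicator {y. V y > L} y * f y)"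
    proof (rule integral_mono[OF int_pos])
      show "integrable lborel (\<lambda>y. L\<^sup>2 * \<bar>f (y + - s) - f y\<bar> + (V y)\<^sup>2 * indicator {y. V y > L} y * f y)"
        using int_f int_tail by (intro Bochner_Integration.integrable_add Bochner_Integration.integrable_mult_right) auto
      fix y :: real
      show "(V y)\<^sup>2 * max 0 (f y - f (y - s)) \<le> L\<^sup>2 * \<bar>f (y + - s) - f y\<bar> + (V y)\<^sup>2 * indicator {y. V y > L} y * f y"
      proof (cases "V y > L")
        case True
        have "(V y)\<^sup>2 * max 0 (f y - f (y - s)) \<le> (V y)\<^sup>2 * f y" using f_nonneg by (intro mult_left_mono) auto
        then show ?thesis using True by (intro add_increasing) auto
      next
        case False
        have "(V y)\<^sup>2 * max 0 (f y - f (y - s)) \<le> L\<^sup>2 * \<bar>f (y + - s) - f y\<bar>"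
          using False V_nonneg[of y] L by (intro mult_mono power_mono) auto
        then show ?thesis using False by simp
      qed
    qed
    also have "\<dots> = L\<^sup>2 * translation_error f (- s) + V_tail L f"
      unfolding tail_eq translation_error_def using int_f int_tail
      by (subst Bochner_Integration.integral_add) auto
    also have "\<dots> < e / 8 + e / 8"
      using d1(2)[OF s1] tail_L L by (intro add_strict_mono) (auto simp: field_simps)
    finally have pos: "(LINT y|lborel. (V y)\<^sup>2 * max 0 (f y - f (y - s))) < e / 4" by simp
    have decomp: "(V y)\<^sup>2 * \<bar>f (y - s) - f y\<bar> = 2 * ((V y)\<^sup>2 * max 0 (f y - f (y - s))) + ((V y)\<^sup>2 * f (y - s) - (V y)\<^sup>2 * f y)" for y
      by (auto simp: max_def abs_if algebra_simps)
    have "(LINT y|lborel. (V y)\<^sup>2 * \<bar>f (y - s) - f y\<bar>) =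
        2 * (LINT y|lborel. (V y)\<^sup>2 * max 0 (f y - f (y - s))) + ((LINT y|lborel. (V y)\<^sup>2 * f (y - s)) - V_second f)"
      unfolding decomp using int_pos int_s[OF s2] V_second_pos_part by simp
    also have "\<dots> < e" using pos d2(3)[OF s2] by linarith
    finally show ?thesis
      unfolding decomp using int_pos int_s[OF s2] V_second_pos_part(1) by auto
  qed
  show ?thesis using that[of "min d1 d2"] d1(1) d2(1) main by auto
qed


text \<open>A member of the class is merely measurable and dominated by \<open>V\<close>. Its
  bounded part \<open>h\<close>, where V <= L, is made integrable by the factor \<open>f\<close> and
  then treated by L1 continuity of translations; the rest is dominated by the tail of V^2, whose
  shift is controlled by \<open>env_shift_small\<close>.\<close>

lemma shift_L2_small:
  assumes g[measurable]: "g \<in> borel_measurable borel" and gV: "\<And>y. \<bar>g y\<bar> \<le> V y" and e: "e > 0"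
  obtains d where "d > 0" "\<And>s. \<bar>s\<bar> < d \<Longrightarrow> integrable lborel (\<lambda>y. (g (y + s) - g y)\<^sup>2 * f y)"
    "\<And>s. \<bar>s\<bar> < d \<Longrightarrow> (LINT y|lborel. (g (y + s) - g y)\<^sup>2 * f y) < e"
proof -
  \<comment> \<open>15 = 3 (1 + 1 + 2 + 1): four error terms, and the factor 3 from (a + b + c)^2 <=
    3 (a^2 + b^2 + c^2).\<close>
  define e' where "e' = e / 15"
  have e': "e' > 0" using e by (simp add: e'_def)
  have "eventually (\<lambda>L. V_tail (real L) f < e') sequentially"
    using V_tail_tendsto e' by (rule order_tendstoD)
  then obtain L0 :: nat where L0: "\<And>L. L \<ge> L0 \<Longrightarrow> V_tail (real L) f < e'" by (auto simp: eventually_sequentially)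
  define L where "L = real (Suc L0)"
  have L: "L > 0" "V_tail L f < e'" using L0[of "Suc L0"] by (auto simp: L_def)
  define r where "r y = (V y)\<^sup>2 * indicator {y. V y > L} y" for y
  define h where "h y = g y * indicator {y. V y \<le> L} y" for y
  define u where "u y = h y * f y" for y
  have [measurable]: "r \<in> borel_measurable borel" "h \<in> borel_measurable borel" "u \<in> borel_measurable borel"
    unfolding r_def h_def u_def by measurable
  have h_L: "\<bar>h y\<bar> \<le> L" for y using gV[of y] L by (auto simp: h_def indicator_def)
  have r_nonneg: "r y \<ge> 0" for y by (simp add: r_def indicator_def)
  have u_int: "integrable lborel u"
  proof (rule Bochner_Integration.integrable_bound)
    show "integrable lborel (\<lambda>y. L * f y)" using f_int by simp
    show "AE y in lborel. norm (u y) \<le> norm (L * f y)"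
      using h_L f_nonneg L by (intro AE_I2) (auto simp: u_def abs_mult intro!: mult_right_mono)
  qed simp
  have r_int: "integrable lborel (\<lambda>y. r y * f y)" and r_eq: "(LINT y|lborel. r y * f y) = V_tail L f"
    using integral_law[OF admissible_f, of r] integrable_V_law(2)[OF admissible_f, of L]
    unfolding V_tail_def r_def by auto
  have pos: "e' / (2 * L) > 0" "e' / (2 * L\<^sup>2) > 0" using e' L by auto
  obtain d1 where d1: "d1 > 0" "\<And>s. \<bar>s\<bar> < d1 \<Longrightarrow> translation_error u s < e' / (2 * L)"
    using translation_error_small[OF u_int pos(1)] by blast
  obtain d2 where d2: "d2 > 0" "\<And>s. \<bar>s\<bar> < d2 \<Longrightarrow> translation_error f s < e' / (2 * L\<^sup>2)"
    using translation_error_small[OF f_int(1) pos(2)] by blast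
  obtain d3 where d3: "d3 > 0" "\<And>s. \<bar>s\<bar> < d3 \<Longrightarrow> integrable lborel (\<lambda>y. (V y)\<^sup>2 * \<bar>f (y - s) - f y\<bar>)"
    "\<And>s. \<bar>s\<bar> < d3 \<Longrightarrow> (LINT y|lborel. (V y)\<^sup>2 * \<bar>f (y - s) - f y\<bar>) < e'"
    using env_shift_small[OF e'] by blast
  have main: "integrable lborel (\<lambda>y. (g (y + s) - g y)\<^sup>2 * f y) \<and> (LINT y|lborel. (g (y + s) - g y)\<^sup>2 * f y) < e"
    if s: "\<bar>s\<bar> < min d1 (min d2 d3)" for s
  proof -
    have s1: "\<bar>s\<bar> < d1" and s2: "\<bar>s\<bar> < d2" and s3: "\<bar>s\<bar> < d3" using s by auto
    have int_u: "integrable lborel (\<lambda>y. \<bar>u (y + s) - u y\<bar>)" and int_f: "integrable lborel (\<lambda>y. \<bar>f (y + s) - f y\<bar>)"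
      using u_int f_int(1) lborel_translation(1)[of u s] lborel_translation(1)[of f s] by auto
    have rV: "r y * \<bar>f (y - s) - f y\<bar> \<le> (V y)\<^sup>2 * \<bar>f (y - s) - f y\<bar>" for y
      by (intro mult_right_mono) (auto simp: r_def indicator_def)
    have int_rd: "integrable lborel (\<lambda>y. r y * \<bar>f (y - s) - f y\<bar>)"
    proof (rule Bochner_Integration.integrable_bound[OF d3(2)[OF s3]])
      show "AE y in lborel. norm (r y * \<bar>f (y - s) - f y\<bar>) \<le> norm ((V y)\<^sup>2 * \<bar>f (y - s) - f y\<bar>)"
        using rV r_nonneg by (intro AE_I2) (simp add: abs_mult)
    qed measurable
    have int_rs: "integrable lborel (\<lambda>y. r y * f (y - s))"
    proof (rule Bochner_Integration.integrable_bound[OF Bochner_Integration.integrable_add[OF int_rd r_int]])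
      show "AE y in lborel. norm (r y * f (y - s)) \<le> norm (r y * \<bar>f (y - s) - f y\<bar> + r y * f y)"
      proof (rule AE_I2)
        fix y
        have "r y * f (y - s) \<le> r y * (\<bar>f (y - s) - f y\<bar> + f y)" using r_nonneg by (intro mult_left_mono) auto
        then show "norm (r y * f (y - s)) \<le> norm (r y * \<bar>f (y - s) - f y\<bar> + r y * f y)"
          using r_nonneg f_nonneg by (simp add: distrib_left abs_mult)
      qed
    qed measurable
    have "(LINT y|lborel. r y * f (y - s)) \<le> (LINT y|lborel. (V y)\<^sup>2 * \<bar>f (y - s) - f y\<bar> + r y * f y)"
    proof (rule integral_mono[OF int_rs])
      show "integrable lborel (\<lambda>y. (V y)\<^sup>2 * \<bar>f (y - s) - f y\<bar> + r y * f y)" using d3(2)[OF s3] r_int by auto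
      fix y
      have "r y * f (y - s) \<le> r y * (\<bar>f (y - s) - f y\<bar> + f y)" using r_nonneg by (intro mult_left_mono) auto
      then show "r y * f (y - s) \<le> (V y)\<^sup>2 * \<bar>f (y - s) - f y\<bar> + r y * f y"
        using rV[of y] by (simp add: distrib_left)
    qed
    also have "\<dots> < e' + e'" using d3(2,3)[OF s3] r_int r_eq L by simp
    finally have rs_le: "(LINT y|lborel. r y * f (y - s)) < 2 * e'" by simp
    have tr: "(\<lambda>y. r (y + s) * f y) = (\<lambda>y. (\<lambda>z. r z * f (z - s)) (y + s))" by simp
    have int_rs': "integrable lborel (\<lambda>y. r (y + s) * f y)"
      unfolding tr by (subst lborel_translation(1)) (rule int_rs)
    have rs': "(LINT y|lborel. r (y + s) * f y) = (LINT y|lborel. r y * f (y - s))"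
      unfolding tr by (rule lborel_translation(2))
    define R where "R y = 3 * (2 * L * \<bar>u (y + s) - u y\<bar> + 2 * L\<^sup>2 * \<bar>f (y + s) - f y\<bar> + r (y + s) * f y + r y * f y)" for y
    have R_int: "integrable lborel R" unfolding R_def using int_u int_f int_rs' r_int by auto
    have pt: "(g (y + s) - g y)\<^sup>2 * f y \<le> R y" for y
    proof -
      define k where "k y = g y * indicator {y. V y > L} y" for y
      have gk: "g y = h y + k y" for y by (auto simp: h_def k_def indicator_def)
      have kr: "(k y)\<^sup>2 \<le> r y" for y
        using gV[of y] V_nonneg[of y] by (auto simp: k_def r_def indicator_def abs_le_square_iff[symmetric])
      have sq3: "(a + b + c)\<^sup>2 \<le> 3 * (a\<^sup>2 + b\<^sup>2 + c\<^sup>2)" for a b c :: real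
      proof -
        have "0 \<le> (a - b)\<^sup>2 + (b - c)\<^sup>2 + (a - c)\<^sup>2" by simp
        then show ?thesis by (simp add: power2_eq_square algebra_simps)
      qed
      have "(g (y + s) - g y)\<^sup>2 = ((h (y + s) - h y) + k (y + s) + - k y)\<^sup>2"
        by (simp add: gk algebra_simps)
      also have "\<dots> \<le> 3 * ((h (y + s) - h y)\<^sup>2 + (k (y + s))\<^sup>2 + (- k y)\<^sup>2)" by (rule sq3)
      also have "\<dots> \<le> 3 * (2 * L * \<bar>h (y + s) - h y\<bar> + r (y + s) + r y)"
      proof -
        have "\<bar>h (y + s) - h y\<bar> \<le> 2 * L" using h_L[of y] h_L[of "y + s"] by linarith
        then have "\<bar>h (y + s) - h y\<bar> * \<bar>h (y + s) - h y\<bar> \<le> 2 * L * \<bar>h (y + s) - h y\<bar>" by (intro mult_right_mono) auto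
        then show ?thesis using kr[of y] kr[of "y + s"] by (simp add: power2_eq_square)
      qed
      finally have "(g (y + s) - g y)\<^sup>2 * f y \<le> 3 * (2 * L * \<bar>h (y + s) - h y\<bar> + r (y + s) + r y) * f y"
        using f_nonneg by (intro mult_right_mono)
      also have "\<dots> = 3 * (2 * L * (\<bar>h (y + s) - h y\<bar> * f y) + r (y + s) * f y + r y * f y)" by (simp add: algebra_simps)
      also have "\<dots> \<le> 3 * (2 * L * (\<bar>u (y + s) - u y\<bar> + L * \<bar>f (y + s) - f y\<bar>) + r (y + s) * f y + r y * f y)"
      proof -
        \<comment> \<open>Moves the density inside the shift: the price is a translation of
          \<open>f\<close>, multiplied by the bounded function \<open>h\<close>.\<close>
        have "(h (y + s) - h y) * f y = (u (y + s) - u y) + h (y + s) * (f y - f (y + s))" by (simp add: u_def algebra_simps)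
        then have "\<bar>h (y + s) - h y\<bar> * f y \<le> \<bar>u (y + s) - u y\<bar> + \<bar>h (y + s)\<bar> * \<bar>f y - f (y + s)\<bar>"
          using f_nonneg[of y] by (metis abs_mult abs_of_nonneg abs_triangle_ineq)
        also have "\<dots> \<le> \<bar>u (y + s) - u y\<bar> + L * \<bar>f (y + s) - f y\<bar>"
          using h_L by (intro add_left_mono) (auto simp: abs_minus_commute intro!: mult_right_mono)
        finally show ?thesis using L by (intro mult_left_mono add_right_mono) auto
      qed
      also have "\<dots> = R y" by (simp add: R_def power2_eq_square algebra_simps)
      finally show ?thesis .
    qed
    have int: "integrable lborel (\<lambda>y. (g (y + s) - g y)\<^sup>2 * f y)"
    proof (rule Bochner_Integration.integrable_bound[OF R_int])
      show "AE y in lborel. norm ((g (y + s) - g y)\<^sup>2 * f y) \<le> norm (R y)"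
      proof (rule AE_I2)
        fix y show "norm ((g (y + s) - g y)\<^sup>2 * f y) \<le> norm (R y)" using pt[of y] f_nonneg[of y] by (simp add: abs_mult)
      qed
    qed measurable
    have "(LINT y|lborel. (g (y + s) - g y)\<^sup>2 * f y) \<le> (LINT y|lborel. R y)"
      by (rule integral_mono[OF int R_int pt])
    also have "\<dots> = 3 * (2 * L * translation_error u s + 2 * L\<^sup>2 * translation_error f s + (LINT y|lborel. r (y + s) * f y) + (LINT y|lborel. r y * f y))"
      unfolding R_def translation_error_def using int_u int_f int_rs' r_int by simp
    also have "\<dots> < 3 * (e' + e' + 2 * e' + e')"
    proof -
      have "2 * L * translation_error u s < e'" using d1(2)[OF s1] L by (simp add: field_simps)
      moreover have "2 * L\<^sup>2 * translation_error f s < e'" using d2(2)[OF s2] L by (simp add: field_simps)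
      ultimately show ?thesis
        using rs_le L(2) unfolding rs' r_eq by (intro mult_strict_left_mono add_strict_mono) auto
    qed
    also have "\<dots> = e" by (simp add: e'_def)
    finally show ?thesis using int by simp
  qed
  show ?thesis using that[of "min d1 (min d2 d3)"] d1(1) d2(1) d3(1) main by auto
qed

section \<open>Convolution with a compactly supported density\<close>

text \<open>What is kept of the scaled kernel. Boundedness makes the convolution integral exist at
  every point, and the support restricts the shifts to at most \<open>b\<close>.\<close>

definition kernel_density :: "(real \<Rightarrow> real) \<Rightarrow> real \<Rightarrow> bool" where
  "kernel_density \<kappa> b \<longleftrightarrow> \<kappa> \<in> borel_measurable borel \<and> (\<forall>v. 0 \<le> \<kappa> v) \<and> (\<exists>B. \<forall>v. \<kappa> v \<le> B) \<and>
     integrable lborel \<kappa> \<and> (LINT v|lborel. \<kappa> v) = 1 \<and> (\<forall>v. \<bar>v\<bar> > b \<longrightarrow> \<kappa> v = 0)"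

lemma nn_integral_kernel: "kernel_density \<kappa> b \<Longrightarrow> (\<integral>\<^sup>+ v. ennreal (\<kappa> v) \<partial>lborel) = 1"
  unfolding kernel_density_def by (subst nn_integral_eq_integral) auto

lemma conv_integrable:
  assumes "kernel_density \<kappa> b"
  shows "integrable lborel (\<lambda>x. f x * \<kappa> (y - x))"
proof -
  obtain B where B: "\<And>v. \<kappa> v \<le> B" and \<kappa>: "\<And>v. 0 \<le> \<kappa> v" and [measurable]: "\<kappa> \<in> borel_measurable borel"
    using assms unfolding kernel_density_def by blast
  have B0: "B \<ge> 0" using order_trans[OF \<kappa> B] .
  have "integrable lborel (\<lambda>x. f x * B)" using f_int by simp
  then show ?thesis
  proof (rule Bochner_Integration.integrable_bound)
    show "AE x in lborel. norm (f x * \<kappa> (y - x)) \<le> norm (f x * B)"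
    proof (rule AE_I2)
      fix x
      have "f x * \<kappa> (y - x) \<le> f x * B" using f_nonneg B by (intro mult_left_mono)
      then show "norm (f x * \<kappa> (y - x)) \<le> norm (f x * B)" using f_nonneg[of x] \<kappa> B0 by (simp add: abs_mult)
    qed
  qed measurable
qed

lemma conv_nonneg: "kernel_density \<kappa> b \<Longrightarrow> conv f \<kappa> y \<ge> 0"
  unfolding conv_def kernel_density_def using f_nonneg by (intro Bochner_Integration.integral_nonneg) auto

lemma ennreal_conv:
  assumes "kernel_density \<kappa> b"
  shows "ennreal (conv f \<kappa> y) = (\<integral>\<^sup>+ x. ennreal (f x * \<kappa> (y - x)) \<partial>lborel)"
  unfolding conv_def using assms f_nonneg conv_integrable[OF assms, of y]
  by (subst nn_integral_eq_integral) (auto simp: kernel_density_def)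

lemma conv_measurable [measurable]:
  assumes "kernel_density \<kappa> b"
  shows "conv f \<kappa> \<in> borel_measurable borel"
proof -
  have [measurable]: "\<kappa> \<in> borel_measurable borel" using assms by (simp add: kernel_density_def)
  show ?thesis unfolding conv_def by measurable
qed

lemma nn_integral_conv:
  assumes \<kappa>: "kernel_density \<kappa> b" and [measurable]: "\<phi> \<in> borel_measurable borel"
  shows "(\<integral>\<^sup>+ y. \<phi> y * ennreal (conv f \<kappa> y) \<partial>lborel) = (\<integral>\<^sup>+ x. ennreal (f x) * (\<integral>\<^sup>+ v. ennreal (\<kappa> v) * \<phi> (x + v) \<partial>lborel) \<partial>lborel)"
proof -
  have [measurable]: "\<kappa> \<in> borel_measurable borel" and \<kappa>0: "\<And>v. 0 \<le> \<kappa> v" using \<kappa> by (simp_all add: kernel_density_def)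
  have "(\<integral>\<^sup>+ y. \<phi> y * ennreal (conv f \<kappa> y) \<partial>lborel) = (\<integral>\<^sup>+ y. \<integral>\<^sup>+ x. \<phi> y * (ennreal (f x) * ennreal (\<kappa> (y - x))) \<partial>lborel \<partial>lborel)"
    using f_nonneg \<kappa>0 by (simp add: ennreal_conv[OF \<kappa>] nn_integral_cmult ennreal_mult)
  also have "\<dots> = (\<integral>\<^sup>+ x. \<integral>\<^sup>+ y. \<phi> y * (ennreal (f x) * ennreal (\<kappa> (y - x))) \<partial>lborel \<partial>lborel)"
    by (rule lborel_pair.Fubini') measurable
  also have "\<dots> = (\<integral>\<^sup>+ x. ennreal (f x) * (\<integral>\<^sup>+ v. ennreal (\<kappa> v) * \<phi> (x + v) \<partial>lborel) \<partial>lborel)"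
  proof (rule nn_integral_cong)
    fix x
    have "(\<integral>\<^sup>+ y. \<phi> y * (ennreal (f x) * ennreal (\<kappa> (y - x))) \<partial>lborel) = (\<integral>\<^sup>+ y. ennreal (f x) * (\<phi> y * ennreal (\<kappa> (y - x))) \<partial>lborel)"
      by (simp add: mult_ac)
    also have "\<dots> = ennreal (f x) * (\<integral>\<^sup>+ y. \<phi> y * ennreal (\<kappa> (y - x)) \<partial>lborel)"
      by (rule nn_integral_cmult) measurable
    also have "(\<integral>\<^sup>+ y. \<phi> y * ennreal (\<kappa> (y - x)) \<partial>lborel) = (\<integral>\<^sup>+ v. ennreal (\<kappa> v) * \<phi> (x + v) \<partial>lborel)"
      using nn_integral_real_affine[of "\<lambda>y. \<phi> y * ennreal (\<kappa> (y - x))" 1 x] by (simp add: mult.commute)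
    finally show "(\<integral>\<^sup>+ y. \<phi> y * (ennreal (f x) * ennreal (\<kappa> (y - x))) \<partial>lborel) = ennreal (f x) * (\<integral>\<^sup>+ v. ennreal (\<kappa> v) * \<phi> (x + v) \<partial>lborel)" .
  qed
  finally show ?thesis .
qed

lemma conv_prob:
  assumes \<kappa>: "kernel_density \<kappa> b"
  shows "integrable lborel (conv f \<kappa>)" "(LINT y|lborel. conv f \<kappa> y) = 1"
proof -
  have "(\<integral>\<^sup>+ y. ennreal (conv f \<kappa> y) \<partial>lborel) = (\<integral>\<^sup>+ x. ennreal (f x) \<partial>lborel)"
    using nn_integral_conv[OF \<kappa>, of "\<lambda>_. 1"] nn_integral_kernel[OF \<kappa>] by simp
  also have "\<dots> = 1" using f_int f_nonneg by (subst nn_integral_eq_integral) auto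
  finally have 1: "(\<integral>\<^sup>+ y. ennreal (conv f \<kappa> y) \<partial>lborel) = 1" .
  show int: "integrable lborel (conv f \<kappa>)"
    by (rule integrableI_nonneg) (use 1 conv_nonneg[OF \<kappa>] conv_measurable[OF \<kappa>] in auto)
  show "(LINT y|lborel. conv f \<kappa> y) = 1"
    using 1 nn_integral_eq_integral[OF int] conv_nonneg[OF \<kappa>] by simp
qed

text \<open>Since the kernel has mass one, the convolution minus \<open>f\<close> is an average of
  the shift differences of \<open>f\<close>.\<close>

lemma conv_diff_le:
  assumes \<kappa>: "kernel_density \<kappa> b"
  shows "ennreal \<bar>conv f \<kappa> y - f y\<bar> \<le> (\<integral>\<^sup>+ v. ennreal (\<kappa> v) * ennreal \<bar>f (y - v) - f y\<bar> \<partial>lborel)"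
proof -
  have [measurable]: "\<kappa> \<in> borel_measurable borel" and \<kappa>0: "\<And>v. 0 \<le> \<kappa> v"
    and \<kappa>1: "integrable lborel \<kappa>" "(LINT v|lborel. \<kappa> v) = 1"
    using \<kappa> by (simp_all add: kernel_density_def)
  have eq: "conv f \<kappa> y = (LINT v|lborel. f (y - v) * \<kappa> v)"
    unfolding conv_def using lborel_integral_real_affine[of "-1" "\<lambda>x. f x * \<kappa> (y - x)" y] by simp
  have int: "integrable lborel (\<lambda>v. f (y - v) * \<kappa> v)"
    using conv_integrable[OF \<kappa>, of y] lborel_integrable_real_affine_iff[of "-1" "\<lambda>x. f x * \<kappa> (y - x)" y] by simp
  have "conv f \<kappa> y - f y = (LINT v|lborel. f (y - v) * \<kappa> v - f y * \<kappa> v)"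
    using int \<kappa>1 by (simp add: eq)
  then have "ennreal \<bar>conv f \<kappa> y - f y\<bar> \<le> (\<integral>\<^sup>+ v. ennreal (norm (f (y - v) * \<kappa> v - f y * \<kappa> v)) \<partial>lborel)"
    using integral_norm_bound_ennreal[of lborel "\<lambda>v. f (y - v) * \<kappa> v - f y * \<kappa> v"] int \<kappa>1 by simp
  also have "\<dots> = (\<integral>\<^sup>+ v. ennreal (\<kappa> v) * ennreal \<bar>f (y - v) - f y\<bar> \<partial>lborel)"
  proof (rule nn_integral_cong)
    fix v
    have "norm (f (y - v) * \<kappa> v - f y * \<kappa> v) = \<kappa> v * \<bar>f (y - v) - f y\<bar>"
      using \<kappa>0[of v] unfolding left_diff_distrib[symmetric] by (simp add: abs_mult)
    then show "ennreal (norm (f (y - v) * \<kappa> v - f y * \<kappa> v)) = ennreal (\<kappa> v) * ennreal \<bar>f (y - v) - f y\<bar>"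
      using \<kappa>0[of v] by (simp add: ennreal_mult)
  qed
  finally show ?thesis .
qed

text \<open>The convolution is a mixture of shifts of \<open>f\<close> by at most \<open>b\<close>.
  By Tonelli its weighted distance to \<open>f\<close> is at most the average of those of the
  shifts, all below \<open>e\<close>. The distance depends on the kernel only through its support,
  so \<open>d\<close> serves all kernels.\<close>

lemma conv_admissible_small:
  assumes e: "e > 0"
  obtains d where "d > 0" "\<And>b \<kappa>. b < d \<Longrightarrow> kernel_density \<kappa> b \<Longrightarrow> admissible (conv f \<kappa>) \<and> env_dist (conv f \<kappa>) \<le> e"
proof -
  obtain d where d: "d > 0" "\<And>s. \<bar>s\<bar> < d \<Longrightarrow> integrable lborel (\<lambda>y. (V y)\<^sup>2 * \<bar>f (y - s) - f y\<bar>)"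
    "\<And>s. \<bar>s\<bar> < d \<Longrightarrow> (LINT y|lborel. (V y)\<^sup>2 * \<bar>f (y - s) - f y\<bar>) < e"
    using env_shift_small[OF e] by blast
  have main: "admissible (conv f \<kappa>) \<and> env_dist (conv f \<kappa>) \<le> e" if b: "b < d" and \<kappa>: "kernel_density \<kappa> b" for b \<kappa>
  proof -
    have [measurable]: "\<kappa> \<in> borel_measurable borel" and \<kappa>b: "\<And>v. \<bar>v\<bar> > b \<Longrightarrow> \<kappa> v = 0"
      using \<kappa> by (simp_all add: kernel_density_def)
    note [measurable] = conv_measurable[OF \<kappa>]
    have "(\<integral>\<^sup>+ y. ennreal ((V y)\<^sup>2 * \<bar>conv f \<kappa> y - f y\<bar>) \<partial>lborel) \<le>
        (\<integral>\<^sup>+ y. ennreal ((V y)\<^sup>2) * (\<integral>\<^sup>+ v. ennreal (\<kappa> v) * ennreal \<bar>f (y - v) - f y\<bar> \<partial>lborel) \<partial>lborel)"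
      by (intro nn_integral_mono) (auto simp: ennreal_mult intro!: mult_left_mono conv_diff_le[OF \<kappa>])
    also have "\<dots> = (\<integral>\<^sup>+ y. \<integral>\<^sup>+ v. ennreal ((V y)\<^sup>2) * (ennreal (\<kappa> v) * ennreal \<bar>f (y - v) - f y\<bar>) \<partial>lborel \<partial>lborel)"
      by (intro nn_integral_cong nn_integral_cmult[symmetric]) measurable
    also have "\<dots> = (\<integral>\<^sup>+ v. \<integral>\<^sup>+ y. ennreal ((V y)\<^sup>2) * (ennreal (\<kappa> v) * ennreal \<bar>f (y - v) - f y\<bar>) \<partial>lborel \<partial>lborel)"
      by (rule lborel_pair.Fubini') measurable
    also have "\<dots> = (\<integral>\<^sup>+ v. ennreal (\<kappa> v) * (\<integral>\<^sup>+ y. ennreal ((V y)\<^sup>2 * \<bar>f (y - v) - f y\<bar>) \<partial>lborel) \<partial>lborel)"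
    proof (rule nn_integral_cong)
      fix v
      have "(\<integral>\<^sup>+ y. ennreal ((V y)\<^sup>2) * (ennreal (\<kappa> v) * ennreal \<bar>f (y - v) - f y\<bar>) \<partial>lborel) =
          (\<integral>\<^sup>+ y. ennreal (\<kappa> v) * ennreal ((V y)\<^sup>2 * \<bar>f (y - v) - f y\<bar>) \<partial>lborel)"
        by (intro nn_integral_cong) (simp add: ennreal_mult mult_ac)
      also have "\<dots> = ennreal (\<kappa> v) * (\<integral>\<^sup>+ y. ennreal ((V y)\<^sup>2 * \<bar>f (y - v) - f y\<bar>) \<partial>lborel)"
        by (rule nn_integral_cmult) measurable
      finally show "(\<integral>\<^sup>+ y. ennreal ((V y)\<^sup>2) * (ennreal (\<kappa> v) * ennreal \<bar>f (y - v) - f y\<bar>) \<partial>lborel) = \<dots>" .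
    qed
    also have "\<dots> \<le> (\<integral>\<^sup>+ v. ennreal (\<kappa> v) * ennreal e \<partial>lborel)"
    proof (rule nn_integral_mono)
      fix v :: real
      show "ennreal (\<kappa> v) * (\<integral>\<^sup>+ y. ennreal ((V y)\<^sup>2 * \<bar>f (y - v) - f y\<bar>) \<partial>lborel) \<le> ennreal (\<kappa> v) * ennreal e"
      proof (cases "\<bar>v\<bar> > b")
        case False
        then have v: "\<bar>v\<bar> < d" using b by simp
        have "(\<integral>\<^sup>+ y. ennreal ((V y)\<^sup>2 * \<bar>f (y - v) - f y\<bar>) \<partial>lborel) \<le> ennreal e"
          using nn_integral_eq_integral[OF d(2)[OF v]] d(3)[OF v] by (auto intro!: ennreal_leI)
        then show ?thesis by (intro mult_left_mono) auto
      qed (simp add: \<kappa>b)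
    qed
    also have "\<dots> = ennreal e"
      by (subst nn_integral_multc) (auto simp: nn_integral_kernel[OF \<kappa>])
    finally have le: "(\<integral>\<^sup>+ y. ennreal ((V y)\<^sup>2 * \<bar>conv f \<kappa> y - f y\<bar>) \<partial>lborel) \<le> ennreal e" .
    have int: "integrable lborel (\<lambda>y. (V y)\<^sup>2 * \<bar>conv f \<kappa> y - f y\<bar>)"
      using le by (intro integrableI_nonneg) (auto intro: le_less_trans)
    have "integrable lborel (\<lambda>y. (V y)\<^sup>2 * conv f \<kappa> y)"
    proof (rule Bochner_Integration.integrable_bound[OF Bochner_Integration.integrable_add[OF int V_second_pos_part(1)]])
      show "AE y in lborel. norm ((V y)\<^sup>2 * conv f \<kappa> y) \<le> norm ((V y)\<^sup>2 * \<bar>conv f \<kappa> y - f y\<bar> + (V y)\<^sup>2 * f y)"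
      proof (rule AE_I2)
        fix y
        have "(V y)\<^sup>2 * conv f \<kappa> y \<le> (V y)\<^sup>2 * (\<bar>conv f \<kappa> y - f y\<bar> + f y)" by (intro mult_left_mono) auto
        then show "norm ((V y)\<^sup>2 * conv f \<kappa> y) \<le> norm ((V y)\<^sup>2 * \<bar>conv f \<kappa> y - f y\<bar> + (V y)\<^sup>2 * f y)"
          using f_nonneg[of y] conv_nonneg[OF \<kappa>, of y] by (simp add: distrib_left abs_mult)
      qed
    qed measurable
    then have "admissible (conv f \<kappa>)"
      unfolding admissible_def using conv_prob[OF \<kappa>] conv_nonneg[OF \<kappa>] by auto
    moreover have "env_dist (conv f \<kappa>) \<le> e"
      using le nn_integral_eq_integral[OF int] e unfolding env_dist_def by (simp add: ennreal_le_iff)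
    ultimately show ?thesis by blast
  qed
  show ?thesis using that[OF d(1)] main by blast
qed

end

subsection \<open>Smoothing by a kernel\<close>

lemma indep_vars_PiM_coordinates:
  fixes Q :: "'a measure" and I :: "'i set"
  assumes Q: "prob_space Q" and I: "I \<noteq> {}"
  shows "prob_space.indep_vars (PiM I (\<lambda>_. Q)) (\<lambda>_. Q) (\<lambda>i x. x i) I"
proof -
  interpret P: prob_space "PiM I (\<lambda>_. Q)" by (intro prob_space_PiM Q)
  have "distr (PiM I (\<lambda>_. Q)) (PiM I (\<lambda>_. Q)) (\<lambda>x. \<lambda>i\<in>I. x i) = distr (PiM I (\<lambda>_. Q)) (PiM I (\<lambda>_. Q)) (\<lambda>x. x)"
    by (rule distr_cong) (auto simp: space_PiM PiE_restrict)
  also have "\<dots> = PiM I (\<lambda>i. distr (PiM I (\<lambda>_. Q)) Q (\<lambda>x. x i))"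
    by (simp add: distr_PiM_component[of I "\<lambda>_. Q", OF Q] cong: PiM_cong)
  finally show ?thesis
    by (subst P.indep_vars_iff_distr_eq_PiM'[OF I]) auto
qed

text \<open>Off-diagonal products have mean zero by independence of the coordinates, so only the
  \<open>n\<close> squares remain.\<close>

lemma integral_square_sum_PiM:
  fixes w :: "'a \<Rightarrow> real"
  assumes Q: "prob_space Q" and w: "w \<in> borel_measurable Q" "integrable Q (\<lambda>y. (w y)\<^sup>2)" "(LINT y|Q. w y) = 0" and n: "n > 0"
  shows "integrable (PiM {..<n} (\<lambda>_. Q)) (\<lambda>x. (\<Sum>i<n. w (x i))\<^sup>2)"
    "(LINT x|PiM {..<n} (\<lambda>_. Q). (\<Sum>i<n. w (x i))\<^sup>2) = real n * (LINT y|Q. (w y)\<^sup>2)"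
proof -
  let ?P = "PiM {..<n} (\<lambda>_. Q)"
  interpret Q: prob_space Q by fact
  interpret P: prob_space ?P by (intro prob_space_PiM Q)
  have ne: "{..<n} \<noteq> {}" using n by auto
  have w_int: "integrable Q w" by (rule Q.square_integrable_imp_integrable[OF w(1,2)])
  have ind: "P.indep_vars (\<lambda>_. borel) (\<lambda>i x. w (x i)) {..<n}"
    using P.indep_vars_compose2[OF indep_vars_PiM_coordinates[OF Q ne], of "\<lambda>_. w" "\<lambda>_. borel"] w by simp
  note c = prod_integral_component[OF Q _ w_int] and c2 = prod_integral_component[OF Q _ w(2)]
  have prod: "integrable ?P (\<lambda>x. w (x i) * w (x j)) \<and> (LINT x|?P. w (x i) * w (x j)) = (if i = j then (LINT y|Q. (w y)\<^sup>2) else 0)"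
    if "i < n" "j < n" for i j
  proof (cases "i = j")
    case True
    then show ?thesis using c2[of i "{..<n}"] that by (simp add: power2_eq_square)
  next
    case False
    have ind2: "P.indep_vars (\<lambda>_. borel) (\<lambda>i x. w (x i)) {i, j}"
      by (rule P.indep_vars_subset[OF ind]) (use that in auto)
    have "integrable ?P (\<lambda>x. w (x k))" if "k \<in> {i, j}" for k
      using c[of k "{..<n}"] that \<open>i < n\<close> \<open>j < n\<close> by auto
    from P.indep_vars_integrable[OF _ ind2 this] P.indep_vars_lebesgue_integral[OF _ ind2 this]
    show ?thesis using c[of i "{..<n}"] c[of j "{..<n}"] that False w(3) by simp
  qed
  have eq: "(\<Sum>i<n. w (x i))\<^sup>2 = (\<Sum>i<n. \<Sum>j<n. w (x i) * w (x j))" for x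
    by (simp add: power2_eq_square sum_product)
  show "integrable ?P (\<lambda>x. (\<Sum>i<n. w (x i))\<^sup>2)"
    unfolding eq using prod by (intro Bochner_Integration.integrable_sum) auto
  have "(LINT x|?P. (\<Sum>i<n. w (x i))\<^sup>2) = (\<Sum>i<n. \<Sum>j<n. LINT x|?P. w (x i) * w (x j))"
    unfolding eq using prod by (subst Bochner_Integration.integral_sum) (auto intro!: sum.cong Bochner_Integration.integral_sum)
  also have "\<dots> = (\<Sum>i<n. \<Sum>j<n. if i = j then (LINT y|Q. (w y)\<^sup>2) else 0)"
    using prod by (intro sum.cong) auto
  also have "\<dots> = real n * (LINT y|Q. (w y)\<^sup>2)" by simp
  finally show "(LINT x|?P. (\<Sum>i<n. w (x i))\<^sup>2) = real n * (LINT y|Q. (w y)\<^sup>2)" .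
qed

context shift_continuous_envelope
begin

definition kernel_law :: "(real \<Rightarrow> real) \<Rightarrow> real measure" where
  "kernel_law \<kappa> = density lborel (\<lambda>v. ennreal (\<kappa> v))"

text \<open>The conditional mean of \<open>g\<close> after adding kernel noise to \<open>x\<close>.
  Averaged over the sample it is the integral of \<open>g\<close> against the kernel density
  estimator (\<open>kde_integral\<close>). At points where the integral does not exist its value is
  0; such points form a null set.\<close>

definition smooth :: "(real \<Rightarrow> real) \<Rightarrow> (real \<Rightarrow> real) \<Rightarrow> real \<Rightarrow> real" where
  "smooth \<kappa> g x = (LINT v|kernel_law \<kappa>. g (x + v))"

lemma sets_kernel_law [simp, measurable_cong]: "sets (kernel_law \<kappa>) = sets borel"
  and space_kernel_law [simp]: "space (kernel_law \<kappa>) = UNIV"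
  by (simp_all add: kernel_law_def)

lemma prob_space_kernel_law:
  assumes "kernel_density \<kappa> b" shows "prob_space (kernel_law \<kappa>)"
proof -
  have [measurable]: "\<kappa> \<in> borel_measurable borel" using assms by (simp add: kernel_density_def)
  show ?thesis
    unfolding kernel_law_def
    by (rule prob_spaceI) (simp add: emeasure_density nn_integral_kernel[OF assms])
qed

lemma nn_integral_law_conv:
  assumes \<kappa>: "kernel_density \<kappa> b" and [measurable]: "\<phi> \<in> borel_measurable borel"
  shows "(\<integral>\<^sup>+ y. \<phi> y \<partial>law (conv f \<kappa>)) = (\<integral>\<^sup>+ x. (\<integral>\<^sup>+ v. \<phi> (x + v) \<partial>kernel_law \<kappa>) \<partial>P)"
proof -
  have [measurable]: "\<kappa> \<in> borel_measurable borel" using \<kappa> by (simp add: kernel_density_def)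
  note [measurable] = conv_measurable[OF \<kappa>]
  have "(\<integral>\<^sup>+ y. \<phi> y \<partial>law (conv f \<kappa>)) = (\<integral>\<^sup>+ y. \<phi> y * ennreal (conv f \<kappa> y) \<partial>lborel)"
    unfolding law_def by (subst nn_integral_density) (auto simp: mult.commute)
  also have "\<dots> = (\<integral>\<^sup>+ x. ennreal (f x) * (\<integral>\<^sup>+ v. ennreal (\<kappa> v) * \<phi> (x + v) \<partial>lborel) \<partial>lborel)"
    by (rule nn_integral_conv[OF \<kappa>]) measurable
  also have "\<dots> = (\<integral>\<^sup>+ x. ennreal (f x) * (\<integral>\<^sup>+ v. \<phi> (x + v) \<partial>kernel_law \<kappa>) \<partial>lborel)"
    unfolding kernel_law_def by (intro nn_integral_cong, subst nn_integral_density) auto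
  also have "\<dots> = (\<integral>\<^sup>+ x. (\<integral>\<^sup>+ v. \<phi> (x + v) \<partial>kernel_law \<kappa>) \<partial>P)"
  proof -
    interpret K: prob_space "kernel_law \<kappa>" by (rule prob_space_kernel_law[OF \<kappa>])
    show ?thesis unfolding P_def by (subst nn_integral_density) auto
  qed
  finally show ?thesis .
qed

lemma law_conv_eq_distr:
  assumes \<kappa>: "kernel_density \<kappa> b"
  shows "law (conv f \<kappa>) = distr (P \<Otimes>\<^sub>M kernel_law \<kappa>) borel (\<lambda>(x, v). x + v)"
proof (rule measure_eqI)
  interpret K: prob_space "kernel_law \<kappa>" by (rule prob_space_kernel_law[OF \<kappa>])
  interpret PK: pair_sigma_finite P "kernel_law \<kappa>" ..
  fix A assume "A \<in> sets (law (conv f \<kappa>))"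
  then have A[measurable]: "A \<in> sets borel" by simp
  have "emeasure (law (conv f \<kappa>)) A = (\<integral>\<^sup>+ y. indicator A y \<partial>law (conv f \<kappa>))" by simp
  also have "\<dots> = (\<integral>\<^sup>+ x. (\<integral>\<^sup>+ v. indicator A (x + v) \<partial>kernel_law \<kappa>) \<partial>P)"
    by (rule nn_integral_law_conv[OF \<kappa>]) measurable
  also have "\<dots> = (\<integral>\<^sup>+ z. indicator A (case z of (x, v) \<Rightarrow> x + v) \<partial>(P \<Otimes>\<^sub>M kernel_law \<kappa>))"
    using K.nn_integral_fst[of "\<lambda>z. indicator A (case z of (x, v) \<Rightarrow> x + v)" P] by simp
  also have "\<dots> = (\<integral>\<^sup>+ y. indicator A y \<partial>distr (P \<Otimes>\<^sub>M kernel_law \<kappa>) borel (\<lambda>(x, v). x + v))"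
    by (subst nn_integral_distr) auto
  finally show "emeasure (law (conv f \<kappa>)) A = emeasure (distr (P \<Otimes>\<^sub>M kernel_law \<kappa>) borel (\<lambda>(x, v). x + v)) A" by simp
qed simp

definition add_coords :: "nat \<Rightarrow> (nat \<Rightarrow> real) \<times> (nat \<Rightarrow> real) \<Rightarrow> nat \<Rightarrow> real" where
  "add_coords n z = (\<lambda>i\<in>{..<n}. fst z i + snd z i)"

lemma add_coords_measurable:
  "add_coords n \<in> measurable (PiM {..<n} (\<lambda>_. P) \<Otimes>\<^sub>M PiM {..<n} (\<lambda>_. kernel_law \<kappa>)) (PiM {..<n} (\<lambda>_. law q))"
proof -
  have "(\<lambda>z. \<lambda>i\<in>{..<n}. fst z i + snd z i) \<in> measurable (PiM {..<n} (\<lambda>_. borel) \<Otimes>\<^sub>M PiM {..<n} (\<lambda>_. borel)) (PiM {..<n} (\<lambda>_. borel :: real measure))"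
    by measurable
  then show ?thesis
    unfolding add_coords_def
    by (subst measurable_cong_sets[OF sets_pair_measure_cong[OF sets_PiM_cong sets_PiM_cong] sets_PiM_cong]) auto
qed

text \<open>The coupling between the two samples: adding independent kernel noise to every
  coordinate of a sample from \<open>P\<close> gives a sample from the convolution. It is checked on
  boxes.\<close>

lemma distr_add_coords:
  assumes \<kappa>: "kernel_density \<kappa> b" and q: "admissible (conv f \<kappa>)"
  shows "distr (PiM {..<n} (\<lambda>_. P) \<Otimes>\<^sub>M PiM {..<n} (\<lambda>_. kernel_law \<kappa>)) (PiM {..<n} (\<lambda>_. law (conv f \<kappa>))) (add_coords n)
    = PiM {..<n} (\<lambda>_. law (conv f \<kappa>))"
proof -
  let ?q = "law (conv f \<kappa>)" and ?K = "kernel_law \<kappa>"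
  let ?PP = "PiM {..<n} (\<lambda>_. P)" and ?KK = "PiM {..<n} (\<lambda>_. ?K)"
  interpret K: prob_space ?K by (rule prob_space_kernel_law[OF \<kappa>])
  interpret q: prob_space ?q by (rule prob_space_law[OF q])
  interpret PP: product_sigma_finite "\<lambda>_::nat. P" by unfold_locales
  interpret KK: product_sigma_finite "\<lambda>_::nat. ?K" by unfold_locales
  interpret QQ: product_sigma_finite "\<lambda>_::nat. ?q" by unfold_locales
  interpret PPp: prob_space ?PP by (intro prob_space_PiM P.prob_space_axioms)
  interpret KKp: prob_space ?KK by (intro prob_space_PiM K.prob_space_axioms)
  note m[measurable] = add_coords_measurable[of n \<kappa> "conv f \<kappa>"]
  show ?thesis
  proof (rule QQ.PiM_eqI)
    fix A assume "\<And>i. i \<in> {..<n} \<Longrightarrow> A i \<in> sets ?q"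
    then have A[measurable]: "\<And>i. i \<in> {..<n} \<Longrightarrow> A i \<in> sets borel" by simp
    have box: "PiE {..<n} A \<in> sets (PiM {..<n} (\<lambda>_. ?q))" using A by (intro sets_PiM_I_finite) auto
    have "emeasure (distr (?PP \<Otimes>\<^sub>M ?KK) (PiM {..<n} (\<lambda>_. ?q)) (add_coords n)) (PiE {..<n} A) =
        (\<integral>\<^sup>+ y. indicator (PiE {..<n} A) y \<partial>distr (?PP \<Otimes>\<^sub>M ?KK) (PiM {..<n} (\<lambda>_. ?q)) (add_coords n))"
      using box by simp
    also have "\<dots> = (\<integral>\<^sup>+ z. indicator (PiE {..<n} A) (add_coords n z) \<partial>(?PP \<Otimes>\<^sub>M ?KK))"
      using box by (intro nn_integral_distr m) auto
    also have "\<dots> = (\<integral>\<^sup>+ x. \<integral>\<^sup>+ v. indicator (PiE {..<n} A) (add_coords n (x, v)) \<partial>?KK \<partial>?PP)"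
      by (intro KKp.nn_integral_fst[symmetric] measurable_compose[OF m borel_measurable_indicator[OF box]])
    also have "\<dots> = (\<integral>\<^sup>+ x. \<integral>\<^sup>+ v. (\<Prod>i<n. indicator (A i) (x i + v i)) \<partial>?KK \<partial>?PP)"
    proof (intro nn_integral_cong)
      fix x v
      show "indicator (PiE {..<n} A) (add_coords n (x, v)) = (\<Prod>i<n. indicator (A i) (x i + v i) :: ennreal)"
      proof (cases "\<forall>i<n. x i + v i \<in> A i")
        case True
        then show ?thesis by (simp add: add_coords_def PiE_iff extensional_def restrict_def)
      next
        case False
        then obtain i where i: "i < n" "x i + v i \<notin> A i" by blast
        then have "(\<Prod>i<n. indicator (A i) (x i + v i) :: ennreal) = 0"
          by (intro prod_zero bexI[of _ i]) auto
        moreover have "add_coords n (x, v) \<notin> PiE {..<n} A"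
          using i by (auto simp: add_coords_def PiE_iff)
        ultimately show ?thesis by simp
      qed
    qed
    also have "\<dots> = (\<integral>\<^sup>+ x. (\<Prod>i<n. \<integral>\<^sup>+ v. indicator (A i) (x i + v) \<partial>?K) \<partial>?PP)"
    proof (rule nn_integral_cong)
      fix x
      show "(\<integral>\<^sup>+ v. (\<Prod>i<n. indicator (A i) (x i + v i)) \<partial>?KK) = (\<Prod>i<n. \<integral>\<^sup>+ v. indicator (A i) (x i + v) \<partial>?K)"
        by (rule KK.product_nn_integral_prod[of "{..<n}" "\<lambda>i v. indicator (A i) (x i + v)"]) (use A in measurable)
    qed
    also have "\<dots> = (\<Prod>i<n. \<integral>\<^sup>+ x. \<integral>\<^sup>+ v. indicator (A i) (x + v) \<partial>?K \<partial>P)"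
      by (rule PP.product_nn_integral_prod[of "{..<n}" "\<lambda>i x. \<integral>\<^sup>+ v. indicator (A i) (x + v) \<partial>?K"]) (use A in measurable)
    also have "\<dots> = (\<Prod>i<n. emeasure ?q (A i))"
    proof (rule prod.cong)
      fix i assume "i \<in> {..<n}"
      then have [measurable]: "A i \<in> sets borel" by (rule A)
      show "(\<integral>\<^sup>+ x. \<integral>\<^sup>+ v. indicator (A i) (x + v) \<partial>?K \<partial>P) = emeasure ?q (A i)"
        by (subst nn_integral_law_conv[OF \<kappa>, symmetric]) auto
    qed simp
    finally show "emeasure (distr (?PP \<Otimes>\<^sub>M ?KK) (PiM {..<n} (\<lambda>_. ?q)) (add_coords n)) (PiE {..<n} A) = (\<Prod>i<n. emeasure ?q (A i))" .
  qed auto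
qed

lemma V_integrable: "admissible q \<Longrightarrow> integrable (law q) V"
proof -
  assume q: "admissible q"
  interpret Q: prob_space "law q" by (rule prob_space_law[OF q])
  show ?thesis by (rule Q.square_integrable_imp_integrable[OF _ integrable_V_law(1)[OF q]]) simp
qed

lemma integrable_law_of_le_V:
  assumes "admissible q" "h \<in> borel_measurable borel" "\<And>y. \<bar>h y\<bar> \<le> c * V y"
  shows "integrable (law q) h"
proof (rule Bochner_Integration.integrable_bound[of _ "\<lambda>y. c * V y"])
  show "integrable (law q) (\<lambda>y. c * V y)" using V_integrable[OF assms(1)] by simp
  show "AE y in law q. norm (h y) \<le> norm (c * V y)"
    using assms(3) by (intro AE_I2) (auto intro: order_trans[OF _ abs_ge_self])
qed (use assms in simp)

text \<open>Stated for the envelope so that one null set serves all members of the class, by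
  domination.\<close>

lemma AE_smooth_integrable:
  assumes \<kappa>: "kernel_density \<kappa> b" and q: "admissible (conv f \<kappa>)"
  shows "AE x in P. integrable (kernel_law \<kappa>) (\<lambda>v. V (x + v))"
proof -
  interpret K: prob_space "kernel_law \<kappa>" by (rule prob_space_kernel_law[OF \<kappa>])
  interpret PK: pair_sigma_finite P "kernel_law \<kappa>" ..
  have "integrable (P \<Otimes>\<^sub>M kernel_law \<kappa>) (\<lambda>z. V (case z of (x, v) \<Rightarrow> x + v))"
    using V_integrable[OF q] unfolding law_conv_eq_distr[OF \<kappa>] by (subst (asm) integrable_distr_eq) auto
  from PK.AE_integrable_fst'[OF this] show ?thesis by simp
qed

lemma smooth_integrable_of_le_V:
  assumes \<kappa>: "kernel_density \<kappa> b" and h: "h \<in> borel_measurable borel" "\<And>y. \<bar>h y\<bar> \<le> c * V y"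
    and x: "integrable (kernel_law \<kappa>) (\<lambda>v. V (x + v))"
  shows "integrable (kernel_law \<kappa>) (\<lambda>v. h (x + v))"
proof (rule Bochner_Integration.integrable_bound[of _ "\<lambda>v. c * V (x + v)"])
  show "integrable (kernel_law \<kappa>) (\<lambda>v. c * V (x + v))" using x by simp
  show "AE v in kernel_law \<kappa>. norm (h (x + v)) \<le> norm (c * V (x + v))"
    using h(2) by (intro AE_I2) (auto intro: order_trans[OF _ abs_ge_self])
qed (use h in measurable)

lemma integral_smooth:
  assumes \<kappa>: "kernel_density \<kappa> b" and q: "admissible (conv f \<kappa>)"
    and h: "h \<in> borel_measurable borel" "\<And>y. \<bar>h y\<bar> \<le> c * V y"
  shows "integrable P (smooth \<kappa> h)" "(LINT x|P. smooth \<kappa> h x) = (LINT y|law (conv f \<kappa>). h y)"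
proof -
  interpret K: prob_space "kernel_law \<kappa>" by (rule prob_space_kernel_law[OF \<kappa>])
  interpret PK: pair_sigma_finite P "kernel_law \<kappa>" ..
  note [measurable] = h(1)
  have int: "integrable (P \<Otimes>\<^sub>M kernel_law \<kappa>) (\<lambda>z. h (case z of (x, v) \<Rightarrow> x + v))"
    using integrable_law_of_le_V[OF q h] unfolding law_conv_eq_distr[OF \<kappa>] by (subst (asm) integrable_distr_eq) auto
  show "integrable P (smooth \<kappa> h)"
    using PK.integrable_fst'[OF int] by (simp add: smooth_def[abs_def])
  have "(LINT x|P. smooth \<kappa> h x) = (LINT z|(P \<Otimes>\<^sub>M kernel_law \<kappa>). h (case z of (x, v) \<Rightarrow> x + v))"
    using PK.integral_fst'[OF int] by (simp add: smooth_def)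
  also have "\<dots> = (LINT y|law (conv f \<kappa>). h y)"
    unfolding law_conv_eq_distr[OF \<kappa>] by (subst integral_distr) auto
  finally show "(LINT x|P. smooth \<kappa> h x) = (LINT y|law (conv f \<kappa>). h y)" .
qed

text \<open>Given the sample \<open>x\<close>, the mean of the deviation of the noisy sample is the
  deviation of the smoothed functions. Averaging the majorant over the noise therefore gives a
  majorant for the latter, for all \<open>h\<close> at once and with the same expectation.\<close>

lemma smoothed_deviation:
  fixes n :: nat
  assumes \<kappa>: "kernel_density \<kappa> b" and q: "admissible (conv f \<kappa>)"
    and H: "\<And>h. h \<in> H \<Longrightarrow> h \<in> borel_measurable borel" "\<And>h y. h \<in> H \<Longrightarrow> \<bar>h y\<bar> \<le> c * V y"
    and U: "integrable (PiM {..<n} (\<lambda>_. law (conv f \<kappa>))) U" "\<And>x. U x \<ge> 0"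
      "AE x in PiM {..<n} (\<lambda>_. law (conv f \<kappa>)). \<forall>h\<in>H. \<bar>\<Sum>i<n. h (x i) - (LINT y|law (conv f \<kappa>). h y)\<bar> \<le> U x"
  obtains U' where "integrable (PiM {..<n} (\<lambda>_. P)) U'" "\<And>x. U' x \<ge> 0"
    "AE x in PiM {..<n} (\<lambda>_. P). \<forall>h\<in>H. \<bar>\<Sum>i<n. smooth \<kappa> h (x i) - (LINT y|law (conv f \<kappa>). h y)\<bar> \<le> U' x"
    "(LINT x|PiM {..<n} (\<lambda>_. P). U' x) = (LINT x|PiM {..<n} (\<lambda>_. law (conv f \<kappa>)). U x)"
proof -
  let ?q = "law (conv f \<kappa>)" and ?K = "kernel_law \<kappa>"
  let ?PP = "PiM {..<n} (\<lambda>_. P)" and ?KK = "PiM {..<n} (\<lambda>_. ?K)"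
  interpret K: prob_space ?K by (rule prob_space_kernel_law[OF \<kappa>])
  interpret PPp: prob_space ?PP by (intro prob_space_PiM P.prob_space_axioms)
  interpret KKp: prob_space ?KK by (intro prob_space_PiM K.prob_space_axioms)
  interpret PK: pair_sigma_finite ?PP ?KK ..
  note m = add_coords_measurable[of n \<kappa> "conv f \<kappa>"]
  note D = distr_add_coords[OF \<kappa> q, of n]
  define U' where "U' x = (LINT v|?KK. U (add_coords n (x, v)))" for x
  have int: "integrable (?PP \<Otimes>\<^sub>M ?KK) (\<lambda>z. U (add_coords n z))"
    by (rule integrable_distr[OF m]) (simp add: D U(1))
  have int_eq: "(LINT z|(?PP \<Otimes>\<^sub>M ?KK). U (add_coords n z)) = (LINT x|PiM {..<n} (\<lambda>_. ?q). U x)"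
    using integral_distr[OF m, of U] U(1) by (simp add: D)
  have "AE z in ?PP \<Otimes>\<^sub>M ?KK. \<forall>h\<in>H. \<bar>\<Sum>i<n. h (add_coords n z i) - (LINT y|?q. h y)\<bar> \<le> U (add_coords n z)"
    by (rule AE_distrD[OF m]) (subst D, rule U(3))
  then have AE1: "AE x in ?PP. AE v in ?KK. \<forall>h\<in>H. \<bar>\<Sum>i<n. h (add_coords n (x, v) i) - (LINT y|?q. h y)\<bar> \<le> U (add_coords n (x, v))"
    by (rule PK.AE_pair)
  have AE2: "AE x in ?PP. integrable ?KK (\<lambda>v. U (add_coords n (x, v)))"
    using PK.AE_integrable_fst'[OF int] by simp
  have AE3: "AE x in ?PP. \<forall>i\<in>{..<n}. integrable ?K (\<lambda>v. V (x i + v))"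
    by (intro AE_finite_allI AE_PiM_component P.prob_space_axioms AE_smooth_integrable[OF \<kappa> q]) auto
  show ?thesis
  proof (rule that[of U'])
    show "integrable ?PP U'" unfolding U'_def using PK.integrable_fst'[OF int] by simp
    show "U' x \<ge> 0" for x unfolding U'_def using U(2) by (intro Bochner_Integration.integral_nonneg) auto
    show "(LINT x|?PP. U' x) = (LINT x|PiM {..<n} (\<lambda>_. ?q). U x)"
      unfolding U'_def using PK.integral_fst'[OF int] int_eq by simp
    show "AE x in ?PP. \<forall>h\<in>H. \<bar>\<Sum>i<n. smooth \<kappa> h (x i) - (LINT y|?q. h y)\<bar> \<le> U' x"
      using AE1 AE2 AE3
    proof eventually_elim
      fix x assume x1: "AE v in ?KK. \<forall>h\<in>H. \<bar>\<Sum>i<n. h (add_coords n (x, v) i) - (LINT y|?q. h y)\<bar> \<le> U (add_coords n (x, v))"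
        and x2: "integrable ?KK (\<lambda>v. U (add_coords n (x, v)))" and x3: "\<forall>i\<in>{..<n}. integrable ?K (\<lambda>v. V (x i + v))"
      show "\<forall>h\<in>H. \<bar>\<Sum>i<n. smooth \<kappa> h (x i) - (LINT y|?q. h y)\<bar> \<le> U' x"
      proof
        fix h assume h: "h \<in> H"
        have int_h: "integrable ?K (\<lambda>v. h (x i + v))" if "i < n" for i
          by (rule smooth_integrable_of_le_V[OF \<kappa> H(1)[OF h] H(2)[OF h]]) (use x3 that in auto)
        have comp: "integrable ?KK (\<lambda>v. h (x i + v i))" "(LINT v|?KK. h (x i + v i)) = smooth \<kappa> h (x i)" if "i < n" for i
          using prod_integral_component[OF K.prob_space_axioms _ int_h[OF that], of i "{..<n}"] that by (auto simp: smooth_def)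
        have int_s: "integrable ?KK (\<lambda>v. \<Sum>i<n. h (x i + v i) - (LINT y|?q. h y))"
          using comp by auto
        have "(\<Sum>i<n. smooth \<kappa> h (x i) - (LINT y|?q. h y)) = (LINT v|?KK. (\<Sum>i<n. h (x i + v i) - (LINT y|?q. h y)))"
          using comp by (subst Bochner_Integration.integral_sum) (auto simp: KKp.prob_space)
        also have "\<bar>\<dots>\<bar> \<le> (LINT v|?KK. \<bar>\<Sum>i<n. h (x i + v i) - (LINT y|?q. h y)\<bar>)"
          by (rule integral_abs_bound)
        also have "\<dots> \<le> (LINT v|?KK. U (add_coords n (x, v)))"
        proof (rule integral_mono_AE[OF integrable_abs[OF int_s] x2])
          show "AE v in ?KK. \<bar>\<Sum>i<n. h (x i + v i) - (LINT y|?q. h y)\<bar> \<le> U (add_coords n (x, v))"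
            using x1
          proof eventually_elim
            fix v assume "\<forall>h\<in>H. \<bar>\<Sum>i<n. h (add_coords n (x, v) i) - (LINT y|?q. h y)\<bar> \<le> U (add_coords n (x, v))"
            from bspec[OF this h] show "\<bar>\<Sum>i<n. h (x i + v i) - (LINT y|?q. h y)\<bar> \<le> U (add_coords n (x, v))"
              by (simp add: add_coords_def)
          qed
        qed
        finally show "\<bar>\<Sum>i<n. smooth \<kappa> h (x i) - (LINT y|?q. h y)\<bar> \<le> U' x" unfolding U'_def .
      qed
    qed
  qed
qed


text \<open>Jensen's inequality in the noise, then Fubini: the error is at most an average of the
  shift errors of \<open>g\<close> over the support of the kernel.\<close>

lemma smooth_L2_error_le:
  assumes \<kappa>: "kernel_density \<kappa> b" and q: "admissible (conv f \<kappa>)" and b: "b < d" and e: "e \<ge> 0"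
    and g: "g \<in> borel_measurable borel" "\<And>y. \<bar>g y\<bar> \<le> V y"
    and d: "\<And>s. \<bar>s\<bar> < d \<Longrightarrow> integrable lborel (\<lambda>y. (g (y + s) - g y)\<^sup>2 * f y)"
    "\<And>s. \<bar>s\<bar> < d \<Longrightarrow> (LINT y|lborel. (g (y + s) - g y)\<^sup>2 * f y) < e"
  shows "integrable P (\<lambda>x. (smooth \<kappa> g x - g x)\<^sup>2)" "(LINT x|P. (smooth \<kappa> g x - g x)\<^sup>2) \<le> e"
proof -
  let ?K = "kernel_law \<kappa>"
  note [measurable] = g(1)
  have \<kappa>m[measurable]: "\<kappa> \<in> borel_measurable borel" and \<kappa>b: "\<And>v. \<bar>v\<bar> > b \<Longrightarrow> \<kappa> v = 0"
    using \<kappa> by (simp_all add: kernel_density_def)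
  interpret K: prob_space ?K by (rule prob_space_kernel_law[OF \<kappa>])
  interpret PK: pair_sigma_finite P ?K ..
  have sm_m[measurable]: "smooth \<kappa> g \<in> borel_measurable borel"
    unfolding smooth_def by measurable
  have g1: "\<bar>g y\<bar> \<le> 1 * V y" for y using g(2) by simp
  have jensen: "AE x in P. ennreal ((smooth \<kappa> g x - g x)\<^sup>2) \<le> (\<integral>\<^sup>+ v. ennreal ((g (x + v) - g x)\<^sup>2) \<partial>?K)"
    using AE_smooth_integrable[OF \<kappa> q]
  proof eventually_elim
    fix x assume x: "integrable ?K (\<lambda>v. V (x + v))"
    have int: "integrable ?K (\<lambda>v. g (x + v))" by (rule smooth_integrable_of_le_V[OF \<kappa> g(1) g1 x])
    show "ennreal ((smooth \<kappa> g x - g x)\<^sup>2) \<le> (\<integral>\<^sup>+ v. ennreal ((g (x + v) - g x)\<^sup>2) \<partial>?K)"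
    proof (cases "(\<integral>\<^sup>+ v. ennreal ((g (x + v) - g x)\<^sup>2) \<partial>?K) < \<infinity>")
      case True
      have int2: "integrable ?K (\<lambda>v. (g (x + v) - g x)\<^sup>2)"
        using True by (intro integrableI_nonneg) auto
      have int3: "integrable ?K (\<lambda>v. g (x + v) - g x)" using int by simp
      have "smooth \<kappa> g x - g x = (LINT v|?K. g (x + v) - g x)"
        unfolding smooth_def using int K.prob_space by simp
      moreover have "(LINT v|?K. g (x + v) - g x)\<^sup>2 \<le> (LINT v|?K. (g (x + v) - g x)\<^sup>2)"
        using K.variance_positive[of "\<lambda>v. g (x + v) - g x"] K.variance_eq[OF int3 int2] by simp
      ultimately show ?thesis
        using nn_integral_eq_integral[OF int2] by (simp add: ennreal_leI)
    qed (simp add: not_less top_unique)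
  qed
  have "(\<integral>\<^sup>+ x. ennreal ((smooth \<kappa> g x - g x)\<^sup>2) \<partial>P) \<le> (\<integral>\<^sup>+ x. \<integral>\<^sup>+ v. ennreal ((g (x + v) - g x)\<^sup>2) \<partial>?K \<partial>P)"
    by (rule nn_integral_mono_AE[OF jensen])
  also have "\<dots> = (\<integral>\<^sup>+ v. \<integral>\<^sup>+ x. ennreal ((g (x + v) - g x)\<^sup>2) \<partial>P \<partial>?K)"
    by (rule PK.Fubini'[symmetric]) measurable
  also have "\<dots> = (\<integral>\<^sup>+ v. ennreal (\<kappa> v) * (\<integral>\<^sup>+ x. ennreal ((g (x + v) - g x)\<^sup>2) \<partial>P) \<partial>lborel)"
    unfolding kernel_law_def by (subst nn_integral_density) auto
  also have "\<dots> \<le> (\<integral>\<^sup>+ v. ennreal (\<kappa> v) * ennreal e \<partial>lborel)"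
  proof (rule nn_integral_mono)
    fix v :: real
    show "ennreal (\<kappa> v) * (\<integral>\<^sup>+ x. ennreal ((g (x + v) - g x)\<^sup>2) \<partial>P) \<le> ennreal (\<kappa> v) * ennreal e"
    proof (cases "\<bar>v\<bar> > b")
      case False
      then have v: "\<bar>v\<bar> < d" using b by simp
      have "(\<integral>\<^sup>+ x. ennreal ((g (x + v) - g x)\<^sup>2) \<partial>P) = (\<integral>\<^sup>+ x. ennreal ((g (x + v) - g x)\<^sup>2 * f x) \<partial>lborel)"
        unfolding P_def using f_nonneg by (subst nn_integral_density) (auto simp: ennreal_mult mult.commute)
      also have "\<dots> = ennreal (LINT x|lborel. (g (x + v) - g x)\<^sup>2 * f x)"
        using d(1)[OF v] f_nonneg by (intro nn_integral_eq_integral) auto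
      also have "\<dots> \<le> ennreal e" using d(2)[OF v] by (intro ennreal_leI) simp
      finally show ?thesis by (intro mult_left_mono) auto
    qed (simp add: \<kappa>b)
  qed
  also have "\<dots> = ennreal e" by (subst nn_integral_multc) (auto simp: nn_integral_kernel[OF \<kappa>])
  finally have le: "(\<integral>\<^sup>+ x. ennreal ((smooth \<kappa> g x - g x)\<^sup>2) \<partial>P) \<le> ennreal e" .
  show int: "integrable P (\<lambda>x. (smooth \<kappa> g x - g x)\<^sup>2)"
    using le by (intro integrableI_nonneg) (auto intro: le_less_trans)
  show "(LINT x|P. (smooth \<kappa> g x - g x)\<^sup>2) \<le> e"
    using le nn_integral_eq_integral[OF int] e by (simp add: ennreal_le_iff)
qed

text \<open>The normalized sum has second moment at most e^2, and |T| <= e + T^2 / e has mean at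
  most 2 e.\<close>

lemma expectation_abs_centered_sum_le:
  fixes u :: "real \<Rightarrow> real"
  assumes u: "u \<in> borel_measurable borel" "integrable P (\<lambda>y. (u y)\<^sup>2)" "(LINT y|P. (u y)\<^sup>2) \<le> e\<^sup>2" and e: "e > 0" and n: "n > 0"
  shows "integrable (PiM {..<n} (\<lambda>_. P)) (\<lambda>x. \<bar>\<Sum>i<n. u (x i) - (LINT y|P. u y)\<bar> / sqrt (real n))"
    "(LINT x|PiM {..<n} (\<lambda>_. P). \<bar>\<Sum>i<n. u (x i) - (LINT y|P. u y)\<bar> / sqrt (real n)) \<le> 2 * e"
proof -
  let ?P = "PiM {..<n} (\<lambda>_. P)"
  interpret PP: prob_space ?P by (intro prob_space_PiM P.prob_space_axioms)
  define w where "w y = u y - (LINT y|P. u y)" for y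
  have u_m: "u \<in> borel_measurable P" using u(1) by simp
  have u_int: "integrable P u" by (rule P.square_integrable_imp_integrable[OF u_m u(2)])
  have w_m: "w \<in> borel_measurable P" unfolding w_def using u_m by measurable
  have w_mean: "(LINT y|P. w y) = 0" unfolding w_def using u_int P.prob_space by simp
  have "integrable P (\<lambda>y. (u y)\<^sup>2 - 2 * (LINT y|P. u y) * u y + (LINT y|P. u y)\<^sup>2)"
    using u(2) u_int by auto
  then have w_sq: "integrable P (\<lambda>y. (w y)\<^sup>2)"
    by (simp add: w_def power2_diff algebra_simps)
  have w_var: "(LINT y|P. (w y)\<^sup>2) \<le> e\<^sup>2"
    unfolding w_def using P.variance_eq[OF u_int u(2)] u(3) by (simp add: order_trans[rotated])
  note S = integral_square_sum_PiM[OF P.prob_space_axioms w_m w_sq w_mean n]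
  define T where "T x = (\<Sum>i<n. w (x i)) / sqrt (real n)" for x
  have "(\<lambda>x. w (x i)) \<in> borel_measurable ?P" if "i < n" for i
    using measurable_compose[OF measurable_component_singleton[of i "{..<n}" "\<lambda>_. P"] w_m] that by simp
  then have T_m: "T \<in> borel_measurable ?P"
    unfolding T_def by (intro borel_measurable_divide borel_measurable_sum) auto
  have T_sq: "integrable ?P (\<lambda>x. (T x)\<^sup>2)" "(LINT x|?P. (T x)\<^sup>2) \<le> e\<^sup>2"
    using S w_var n by (auto simp: T_def power_divide)
  have T_int: "integrable ?P T" by (rule PP.square_integrable_imp_integrable[OF T_m T_sq(1)])
  have eq: "\<bar>\<Sum>i<n. u (x i) - (LINT y|P. u y)\<bar> / sqrt (real n) = \<bar>T x\<bar>" for x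
    by (simp add: T_def w_def)
  show "integrable ?P (\<lambda>x. \<bar>\<Sum>i<n. u (x i) - (LINT y|P. u y)\<bar> / sqrt (real n))"
    unfolding eq using T_int by simp
  have "(LINT x|?P. \<bar>T x\<bar>) \<le> (LINT x|?P. e + (T x)\<^sup>2 / e)"
  proof (rule integral_mono)
    show "\<bar>T x\<bar> \<le> e + (T x)\<^sup>2 / e" for x
      by (rule le_plus_divide) (use e in auto)
  qed (use T_int T_sq in auto)
  also have "\<dots> = e + (LINT x|?P. (T x)\<^sup>2) / e" using T_sq by (simp add: PP.prob_space)
  also have "\<dots> \<le> e + e\<^sup>2 / e" using T_sq(2) e by (intro add_left_mono divide_right_mono) auto
  also have "\<dots> = 2 * e" using e by (simp add: power2_eq_square)
  finally show "(LINT x|?P. \<bar>\<Sum>i<n. u (x i) - (LINT y|P. u y)\<bar> / sqrt (real n)) \<le> 2 * e"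
    unfolding eq .
qed

lemma G_le_V: "g \<in> \<G> \<Longrightarrow> \<bar>g y\<bar> \<le> V y"
  using env by (auto simp: envelope_def)

lemma G_le_1_V: "g \<in> \<G> \<Longrightarrow> \<bar>g y\<bar> \<le> 1 * V y"
  using env by (auto simp: envelope_def)

text \<open>
  The smoothed minus the raw empirical process is uniformly small: up to finitely many functions
  both processes are controlled by asymptotic equicontinuity, for the laws \<open>f * k_b\<close> and \<open>f\<close>
  respectively, and each of these functions contributes a variance that tends to zero.
\<close>

lemma smoothing_error_small:
  assumes e: "e > 0"
  obtains d n0 where "d > 0" "n0 > 0" "\<And>n b \<kappa>. n \<ge> n0 \<Longrightarrow> b < d \<Longrightarrow> kernel_density \<kappa> b \<Longrightarrow>
    admissible (conv f \<kappa>) \<and>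
    (\<exists>W. integrable (PiM {..<n} (\<lambda>_. P)) W \<and> (\<forall>x. W x \<ge> 0) \<and>
    (AE x in PiM {..<n} (\<lambda>_. P). \<forall>g\<in>\<G>. \<bar>(\<Sum>i<n. smooth \<kappa> g (x i) - g (x i)) -
        real n * ((LINT y|law (conv f \<kappa>). g y) - (LINT y|P. g y))\<bar> \<le> sqrt (real n) * W x) \<and>
    (LINT x|PiM {..<n} (\<lambda>_. P). W x) \<le> e)"
proof -
  define e' where "e' = e / 4"
  have e': "e' > 0" using e by (simp add: e'_def)
  obtain r \<eta> n0 where r: "r > 0" and \<eta>: "\<eta> > 0" and n0: "n0 > 0" and ae: "\<And>n q. n \<ge> n0 \<Longrightarrow> admissible q \<Longrightarrow> env_dist q \<le> \<eta> \<Longrightarrow>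
    (\<exists>U. integrable (PiM {..<n} (\<lambda>_. law q)) U \<and> (\<forall>x. U x \<ge> 0) \<and>
    (AE x in PiM {..<n} (\<lambda>_. law q). \<forall>h\<in>L2_differences P r \<G>. \<bar>\<Sum>i<n. h (x i) - (LINT y|law q. h y)\<bar> \<le> sqrt (real n) * U x) \<and>
    (LINT x|PiM {..<n} (\<lambda>_. law q). U x) \<le> e')"
    using asymptotic_equicontinuity[OF e'] by blast
  obtain F where F: "finite F" "F \<subseteq> \<G>" "\<And>g. g \<in> \<G> \<Longrightarrow> \<exists>g0\<in>F. L2_seminorm P (\<lambda>y. g y - g0 y) < r"
    using totally_bounded[OF r] by blast
  \<comment> \<open>Each function of the net contributes 2 t, altogether at most 2 e'; the two
    majorants from equicontinuity contribute e' each, and e = 4 e'.\<close>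
  define t where "t = e' / (real (card F) + 1)"
  have t: "t > 0" unfolding t_def using e' by (intro divide_pos_pos add_nonneg_pos) auto
  obtain d1 where d1: "d1 > 0" and adm: "\<And>b \<kappa>. b < d1 \<Longrightarrow> kernel_density \<kappa> b \<Longrightarrow> admissible (conv f \<kappa>) \<and> env_dist (conv f \<kappa>) \<le> \<eta>"
    using conv_admissible_small[OF \<eta>] by blast
  have "\<forall>g\<in>F. \<exists>d. d > 0 \<and> (\<forall>s. \<bar>s\<bar> < d \<longrightarrow> integrable lborel (\<lambda>y. (g (y + s) - g y)\<^sup>2 * f y) \<and>
      (LINT y|lborel. (g (y + s) - g y)\<^sup>2 * f y) < t\<^sup>2)"
  proof
    fix g assume "g \<in> F"
    then have g: "g \<in> \<G>" using F by auto
    have t2: "t\<^sup>2 > 0" using t by simp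
    obtain d where "d > 0" "\<And>s. \<bar>s\<bar> < d \<Longrightarrow> integrable lborel (\<lambda>y. (g (y + s) - g y)\<^sup>2 * f y)"
      "\<And>s. \<bar>s\<bar> < d \<Longrightarrow> (LINT y|lborel. (g (y + s) - g y)\<^sup>2 * f y) < t\<^sup>2"
      using shift_L2_small[OF G_meas[OF g] G_le_V[OF g] t2] by blast
    then show "\<exists>d. d > 0 \<and> (\<forall>s. \<bar>s\<bar> < d \<longrightarrow> integrable lborel (\<lambda>y. (g (y + s) - g y)\<^sup>2 * f y) \<and>
      (LINT y|lborel. (g (y + s) - g y)\<^sup>2 * f y) < t\<^sup>2)" by (intro exI[of _ d]) blast
  qed
  from bchoice[OF this] obtain dd where dd': "\<forall>g\<in>F. dd g > 0 \<and> (\<forall>s. \<bar>s\<bar> < dd g \<longrightarrow> integrable lborel (\<lambda>y. (g (y + s) - g y)\<^sup>2 * f y) \<and>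
      (LINT y|lborel. (g (y + s) - g y)\<^sup>2 * f y) < t\<^sup>2)" by blast
  then have dd: "\<And>g. g \<in> F \<Longrightarrow> dd g > 0"
    "\<And>g s. g \<in> F \<Longrightarrow> \<bar>s\<bar> < dd g \<Longrightarrow> integrable lborel (\<lambda>y. (g (y + s) - g y)\<^sup>2 * f y) \<and> (LINT y|lborel. (g (y + s) - g y)\<^sup>2 * f y) < t\<^sup>2"
    by auto
  define d where "d = Min (insert d1 (dd ` F))"
  have d: "d > 0" "d \<le> d1" "\<And>g. g \<in> F \<Longrightarrow> d \<le> dd g"
    unfolding d_def using F(1) d1 dd(1) by auto
  show ?thesis
  proof (rule that[OF d(1) n0])
    fix n b \<kappa> assume n: "n \<ge> n0" and b: "b < d" and \<kappa>: "kernel_density \<kappa> b"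
    have n_pos: "n > 0" using n n0 by simp
    have b1: "b < d1" using b d by simp
    have q: "admissible (conv f \<kappa>)" "env_dist (conv f \<kappa>) \<le> \<eta>" using adm[OF b1 \<kappa>] by auto
    let ?q = "law (conv f \<kappa>)" and ?P = "PiM {..<n} (\<lambda>_. P)"
    obtain U1 where U1: "integrable (PiM {..<n} (\<lambda>_. ?q)) U1" "\<And>x. U1 x \<ge> 0"
      "AE x in PiM {..<n} (\<lambda>_. ?q). \<forall>h\<in>L2_differences P r \<G>. \<bar>\<Sum>i<n. h (x i) - (LINT y|?q. h y)\<bar> \<le> sqrt (real n) * U1 x"
      "(LINT x|PiM {..<n} (\<lambda>_. ?q). U1 x) \<le> e'"
      using ae[OF n q] by blast
    have f_ok: "env_dist f \<le> \<eta>" using \<eta> env_dist_f by simp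
    obtain U2 where U2: "integrable ?P U2" "\<And>x. U2 x \<ge> 0"
      "AE x in ?P. \<forall>h\<in>L2_differences P r \<G>. \<bar>\<Sum>i<n. h (x i) - (LINT y|P. h y)\<bar> \<le> sqrt (real n) * U2 x"
      "(LINT x|?P. U2 x) \<le> e'"
      using ae[OF n admissible_f f_ok] unfolding P_eq[symmetric] by blast
    have Hm: "h \<in> borel_measurable borel" "\<And>y. \<bar>h y\<bar> \<le> 2 * V y" if "h \<in> L2_differences P r \<G>" for h
      using that G_meas abs_diff_le_V by (auto simp: L2_differences_def)
    have i1: "integrable (PiM {..<n} (\<lambda>_. ?q)) (\<lambda>x. sqrt (real n) * U1 x)" using U1(1) by simp
    have nn1: "0 \<le> sqrt (real n) * U1 x" for x using U1(2) by simp
    have "\<exists>U3. integrable ?P U3 \<and> (\<forall>x. U3 x \<ge> 0) \<and>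
      (AE x in ?P. \<forall>h\<in>L2_differences P r \<G>. \<bar>\<Sum>i<n. smooth \<kappa> h (x i) - (LINT y|?q. h y)\<bar> \<le> U3 x) \<and>
      (LINT x|?P. U3 x) = (LINT x|PiM {..<n} (\<lambda>_. ?q). sqrt (real n) * U1 x)"
    proof (rule smoothed_deviation[where n = n and \<kappa> = \<kappa> and b = b and H = "L2_differences P r \<G>" and U = "\<lambda>x. sqrt (real n) * U1 x" and c = 2])
      fix U3 assume "integrable ?P U3" "\<And>x. U3 x \<ge> 0"
        "AE x in ?P. \<forall>h\<in>L2_differences P r \<G>. \<bar>\<Sum>i<n. smooth \<kappa> h (x i) - (LINT y|?q. h y)\<bar> \<le> U3 x"
        "(LINT x|?P. U3 x) = (LINT x|PiM {..<n} (\<lambda>_. ?q). sqrt (real n) * U1 x)"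
      then show ?thesis by (intro exI[of _ U3]) blast
    qed (use \<kappa> q(1) Hm i1 nn1 U1(3) in blast)+
    then obtain U3 where U3: "integrable ?P U3" "\<And>x. U3 x \<ge> 0"
      "AE x in ?P. \<forall>h\<in>L2_differences P r \<G>. \<bar>\<Sum>i<n. smooth \<kappa> h (x i) - (LINT y|?q. h y)\<bar> \<le> U3 x"
      "(LINT x|?P. U3 x) = (LINT x|PiM {..<n} (\<lambda>_. ?q). sqrt (real n) * U1 x)"
      by blast
    define u where "u g x = smooth \<kappa> g x - g x" for g x
    define A where "A g x = \<bar>\<Sum>i<n. u g (x i) - (LINT y|P. u g y)\<bar> / sqrt (real n)" for g x
    interpret K: prob_space "kernel_law \<kappa>" by (rule prob_space_kernel_law[OF \<kappa>])
    have sm_m: "smooth \<kappa> g \<in> borel_measurable borel" if [measurable]: "g \<in> borel_measurable borel" for g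
      unfolding smooth_def by measurable
    have A: "integrable ?P (A g)" "(LINT x|?P. A g x) \<le> 2 * t" if g: "g \<in> F" for g
    proof -
      have gG: "g \<in> \<G>" using g F by auto
      have bd: "b < dd g" using b d(3)[OF g] by simp
      have t2: "t\<^sup>2 \<ge> 0" by simp
      note L2 = smooth_L2_error_le[OF \<kappa> q(1) bd t2 G_meas[OF gG] G_le_V[OF gG] conjunct1[OF dd(2)[OF g]] conjunct2[OF dd(2)[OF g]]]
      have um: "u g \<in> borel_measurable borel" unfolding u_def using G_meas[OF gG] sm_m by measurable
      show "integrable ?P (A g)" "(LINT x|?P. A g x) \<le> 2 * t"
        unfolding A_def
        using expectation_abs_centered_sum_le[OF um _ _ t n_pos] L2 unfolding u_def by auto
    qed
    define W where "W x = U3 x / sqrt (real n) + U2 x + (\<Sum>g\<in>F. A g x)" for x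
    have A_nonneg: "A g x \<ge> 0" for g x by (simp add: A_def)
    have W_int: "integrable ?P W" unfolding W_def using U3(1) U2(1) A(1) by auto
    have "(LINT x|?P. W x) = (LINT x|?P. U3 x) / sqrt (real n) + (LINT x|?P. U2 x) + (\<Sum>g\<in>F. LINT x|?P. A g x)"
      unfolding W_def using U3(1) U2(1) A(1) by simp
    also have "\<dots> \<le> e' + e' + (\<Sum>g\<in>F. 2 * t)"
      using U3(4) U1 U2(4) A(2) n_pos by (intro add_mono sum_mono) auto
    also have "(\<Sum>g\<in>F. 2 * t) = 2 * (real (card F) * t)" by simp
    also have "real (card F) * t \<le> (real (card F) + 1) * t" using t by (intro mult_right_mono) auto
    also have "(real (card F) + 1) * t = e'" unfolding t_def by (simp add: add_nonneg_eq_0_iff)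
    finally have W_le: "(LINT x|?P. W x) \<le> e" by (simp add: e'_def)
    have AE3: "AE x in ?P. \<forall>i\<in>{..<n}. integrable (kernel_law \<kappa>) (\<lambda>v. V (x i + v))"
      by (intro AE_finite_allI AE_PiM_component P.prob_space_axioms AE_smooth_integrable[OF \<kappa> q(1)]) auto
    have "AE x in ?P. \<forall>g\<in>\<G>. \<bar>(\<Sum>i<n. smooth \<kappa> g (x i) - g (x i)) -
        real n * ((LINT y|?q. g y) - (LINT y|P. g y))\<bar> \<le> sqrt (real n) * W x"
      using U3(3) U2(3) AE3
    proof eventually_elim
      fix x assume x1: "\<forall>h\<in>L2_differences P r \<G>. \<bar>\<Sum>i<n. smooth \<kappa> h (x i) - (LINT y|?q. h y)\<bar> \<le> U3 x"
        and x2: "\<forall>h\<in>L2_differences P r \<G>. \<bar>\<Sum>i<n. h (x i) - (LINT y|P. h y)\<bar> \<le> sqrt (real n) * U2 x"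
        and x3: "\<forall>i\<in>{..<n}. integrable (kernel_law \<kappa>) (\<lambda>v. V (x i + v))"
      show "\<forall>g\<in>\<G>. \<bar>(\<Sum>i<n. smooth \<kappa> g (x i) - g (x i)) -
        real n * ((LINT y|?q. g y) - (LINT y|P. g y))\<bar> \<le> sqrt (real n) * W x"
      proof
        fix g assume g: "g \<in> \<G>"
        obtain g0 where g0: "g0 \<in> F" "L2_seminorm P (\<lambda>y. g y - g0 y) < r" using F(3)[OF g] by blast
        have g0G: "g0 \<in> \<G>" using g0 F by auto
        define h where "h y = g y - g0 y" for y
        have h: "h \<in> L2_differences P r \<G>"
          using g g0G g0(2) unfolding L2_differences_def h_def by blast
        have sm_h: "smooth \<kappa> h (x i) = smooth \<kappa> g (x i) - smooth \<kappa> g0 (x i)" if "i < n" for i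
        proof -
          have V: "integrable (kernel_law \<kappa>) (\<lambda>v. V (x i + v))" using x3 that by auto
          show ?thesis unfolding smooth_def h_def
            by (intro Bochner_Integration.integral_diff smooth_integrable_of_le_V[OF \<kappa> _ G_le_1_V V] G_meas g g0G)
        qed
        have int_h: "(LINT y|?q. h y) = (LINT y|?q. g y) - (LINT y|?q. g0 y)" "(LINT y|P. h y) = (LINT y|P. g y) - (LINT y|P. g0 y)"
          unfolding h_def P_eq using g g0G
          by (auto intro!: Bochner_Integration.integral_diff integrable_law_of_le_V[OF q(1) _ G_le_1_V] integrable_law_of_le_V[OF admissible_f _ G_le_1_V] G_meas)
        have int_u: "(LINT y|P. u g0 y) = (LINT y|?q. g0 y) - (LINT y|P. g0 y)"
          unfolding u_def using integral_smooth[OF \<kappa> q(1) G_meas[OF g0G] G_le_1_V[OF g0G]]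
            integrable_law_of_le_V[OF admissible_f G_meas[OF g0G] G_le_1_V[OF g0G]]
          unfolding P_eq by (subst Bochner_Integration.integral_diff) auto
        have "(\<Sum>i<n. smooth \<kappa> g (x i) - g (x i)) - real n * ((LINT y|?q. g y) - (LINT y|P. g y)) =
            (\<Sum>i<n. (smooth \<kappa> g (x i) - g (x i)) - ((LINT y|?q. g y) - (LINT y|P. g y)))"
          by (simp add: sum_subtractf)
        \<comment> \<open>With \<open>h\<close> the difference of \<open>g\<close> and its net point
          \<open>g0\<close>: the smoothed process at \<open>h\<close>, minus the raw process at
          \<open>h\<close>, plus the centred smoothing error of \<open>g0\<close> alone.\<close>
        also have "\<dots> = (\<Sum>i<n. (smooth \<kappa> h (x i) - (LINT y|?q. h y)) - (h (x i) - (LINT y|P. h y)) + (u g0 (x i) - (LINT y|P. u g0 y)))"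
        proof (rule sum.cong)
          fix i assume "i \<in> {..<n}"
          then have i: "i < n" by simp
          show "(smooth \<kappa> g (x i) - g (x i)) - ((LINT y|?q. g y) - (LINT y|P. g y)) =
            (smooth \<kappa> h (x i) - (LINT y|?q. h y)) - (h (x i) - (LINT y|P. h y)) + (u g0 (x i) - (LINT y|P. u g0 y))"
            unfolding sm_h[OF i] int_h int_u by (simp add: u_def h_def)
        qed simp
        also have "\<dots> = (\<Sum>i<n. smooth \<kappa> h (x i) - (LINT y|?q. h y)) - (\<Sum>i<n. h (x i) - (LINT y|P. h y)) + (\<Sum>i<n. u g0 (x i) - (LINT y|P. u g0 y))"
          by (simp only: sum.distrib sum_subtractf)
        finally have "\<bar>(\<Sum>i<n. smooth \<kappa> g (x i) - g (x i)) - real n * ((LINT y|?q. g y) - (LINT y|P. g y))\<bar> \<le>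
            U3 x + sqrt (real n) * U2 x + \<bar>\<Sum>i<n. u g0 (x i) - (LINT y|P. u g0 y)\<bar>"
          using bspec[OF x1 h] bspec[OF x2 h] by linarith
        also have "\<bar>\<Sum>i<n. u g0 (x i) - (LINT y|P. u g0 y)\<bar> = sqrt (real n) * A g0 x"
          using n_pos by (simp add: A_def)
        also have "sqrt (real n) * A g0 x \<le> sqrt (real n) * (\<Sum>g\<in>F. A g x)"
          using g0(1) F(1) A_nonneg by (intro mult_left_mono member_le_sum) auto
        finally have "\<bar>(\<Sum>i<n. smooth \<kappa> g (x i) - g (x i)) - real n * ((LINT y|?q. g y) - (LINT y|P. g y))\<bar> \<le>
            U3 x + sqrt (real n) * U2 x + sqrt (real n) * (\<Sum>g\<in>F. A g x)" by simp
        also have "\<dots> = sqrt (real n) * W x" using n_pos by (simp add: W_def distrib_left)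
        finally show "\<bar>(\<Sum>i<n. smooth \<kappa> g (x i) - g (x i)) - real n * ((LINT y|?q. g y) - (LINT y|P. g y))\<bar> \<le> sqrt (real n) * W x" .
      qed
    qed
    moreover have "\<forall>x. W x \<ge> 0" unfolding W_def using U3(2) U2(2) A_nonneg by (auto intro!: add_nonneg_nonneg sum_nonneg)
    ultimately show "admissible (conv f \<kappa>) \<and>
    (\<exists>W. integrable (PiM {..<n} (\<lambda>_. P)) W \<and> (\<forall>x. W x \<ge> 0) \<and>
    (AE x in PiM {..<n} (\<lambda>_. P). \<forall>g\<in>\<G>. \<bar>(\<Sum>i<n. smooth \<kappa> g (x i) - g (x i)) -
        real n * ((LINT y|law (conv f \<kappa>). g y) - (LINT y|P. g y))\<bar> \<le> sqrt (real n) * W x) \<and>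
    (LINT x|PiM {..<n} (\<lambda>_. P). W x) \<le> e)"
      using q(1) W_int W_le by blast
  qed
qed

end

subsection \<open>Convergence of characteristic functions\<close>

definition gauss_prod :: "real \<Rightarrow> 'i set \<Rightarrow> ('i \<Rightarrow> real) \<Rightarrow> ('i \<Rightarrow> real) \<Rightarrow> real" where
  "gauss_prod \<sigma> I x y = (\<Prod>i\<in>I. normal_density (x i) \<sigma> (y i))"

lemma gauss_prod_nonneg: "gauss_prod \<sigma> I x y \<ge> 0"
  unfolding gauss_prod_def by (intro prod_nonneg) simp

text \<open>The Gaussian is its own Fourier transform up to constants: the exponential factor is the
  characteristic function of the standard normal law at (m - y) / \<sigma>.\<close>

lemma normal_density_Fourier:
  assumes "\<sigma> > 0"
  shows "complex_of_real (normal_density m \<sigma> y) =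
    complex_of_real (1 / sqrt (2 * pi * \<sigma>\<^sup>2)) * (CLINT t|std_normal_distribution. iexp (t * ((m - y) / \<sigma>)))"
proof -
  have "(CLINT t|std_normal_distribution. iexp (t * ((m - y) / \<sigma>))) = char std_normal_distribution ((m - y) / \<sigma>)"
    by (simp add: char_def mult.commute)
  also have "\<dots> = complex_of_real (exp (- ((m - y) / \<sigma>)\<^sup>2 / 2))"
    by (simp add: char_std_normal_distribution)
  finally show ?thesis
    unfolding normal_density_def of_real_mult[symmetric]
    by (simp add: power_divide power2_commute[of m y])
qed

lemma gauss_prod_Fourier:
  assumes \<sigma>: "\<sigma> > 0" and I: "finite I"
  shows "complex_of_real (gauss_prod \<sigma> I x y) = complex_of_real ((1 / sqrt (2 * pi * \<sigma>\<^sup>2)) ^ card I) *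
    (CLINT T|PiM I (\<lambda>_. std_normal_distribution). iexp (\<Sum>i\<in>I. T i / \<sigma> * x i) * iexp (- (\<Sum>i\<in>I. T i / \<sigma> * y i)))"
proof -
  interpret std: real_distribution std_normal_distribution by (rule real_dist_normal_dist)
  interpret product_sigma_finite "\<lambda>_. std_normal_distribution" by unfold_locales
  have "complex_of_real (gauss_prod \<sigma> I x y) = (\<Prod>i\<in>I. complex_of_real (1 / sqrt (2 * pi * \<sigma>\<^sup>2)) *
      (CLINT t|std_normal_distribution. iexp (t * ((x i - y i) / \<sigma>))))"
    unfolding gauss_prod_def of_real_prod using normal_density_Fourier[OF \<sigma>] by (intro prod.cong) auto
  also have "\<dots> = complex_of_real ((1 / sqrt (2 * pi * \<sigma>\<^sup>2)) ^ card I) *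
      (\<Prod>i\<in>I. CLINT t|std_normal_distribution. iexp (t * ((x i - y i) / \<sigma>)))"
    by (simp only: prod.distrib prod_constant of_real_power)
  also have "(\<Prod>i\<in>I. CLINT t|std_normal_distribution. iexp (t * ((x i - y i) / \<sigma>))) =
      (CLINT T|PiM I (\<lambda>_. std_normal_distribution). (\<Prod>i\<in>I. iexp (T i * ((x i - y i) / \<sigma>))))"
    by (rule product_integral_prod[symmetric, OF I]) (intro std.integrable_const_bound[of _ 1], auto)
  also have "\<dots> = (CLINT T|PiM I (\<lambda>_. std_normal_distribution). iexp (\<Sum>i\<in>I. T i / \<sigma> * x i) * iexp (- (\<Sum>i\<in>I. T i / \<sigma> * y i)))"
  proof (rule Bochner_Integration.integral_cong)
    fix T
    have "(\<Prod>i\<in>I. iexp (T i * ((x i - y i) / \<sigma>))) = exp (\<Sum>i\<in>I. \<i> * complex_of_real (T i * ((x i - y i) / \<sigma>)))"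
      using I by (simp add: exp_sum)
    also have "(\<Sum>i\<in>I. \<i> * complex_of_real (T i * ((x i - y i) / \<sigma>))) =
        \<i> * complex_of_real (\<Sum>i\<in>I. T i / \<sigma> * x i) + \<i> * complex_of_real (- (\<Sum>i\<in>I. T i / \<sigma> * y i))"
      unfolding distrib_left[symmetric] of_real_add[symmetric] sum_distrib_left[symmetric] of_real_sum[symmetric]
      by (simp add: sum_subtractf[symmetric] diff_divide_distrib right_diff_distrib)
    finally show "(\<Prod>i\<in>I. iexp (T i * ((x i - y i) / \<sigma>))) =
        iexp (\<Sum>i\<in>I. T i / \<sigma> * x i) * iexp (- (\<Sum>i\<in>I. T i / \<sigma> * y i))"
      by (simp only: exp_add)
  qed simp
  finally show ?thesis .
qed

lemma measurable_gauss_prod: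
  assumes "\<And>i. i \<in> I \<Longrightarrow> a i \<in> borel_measurable N" "\<And>i. i \<in> I \<Longrightarrow> b i \<in> borel_measurable N"
  shows "(\<lambda>z. gauss_prod \<sigma> I (\<lambda>i. a i z) (\<lambda>i. b i z)) \<in> borel_measurable N"
  unfolding gauss_prod_def normal_density_def using assms by measurable

text \<open>The Fourier form separates \<open>x\<close> from \<open>y\<close>, and Fubini brings the
  expectation onto the exponential in \<open>x\<close>. Thus the left side depends on the law of
  \<open>Z\<close> only through its characteristic function at the points T / \<sigma>.\<close>

lemma expectation_gauss_prod:
  assumes \<sigma>: "\<sigma> > 0" and I: "finite I" and N: "prob_space N" and Z: "\<And>i. i \<in> I \<Longrightarrow> Z i \<in> borel_measurable N"
  shows "complex_of_real (LINT \<omega>|N. gauss_prod \<sigma> I (\<lambda>i. Z i \<omega>) y) = complex_of_real ((1 / sqrt (2 * pi * \<sigma>\<^sup>2)) ^ card I) *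
    (CLINT T|PiM I (\<lambda>_. std_normal_distribution).
      (CLINT \<omega>|N. iexp (\<Sum>i\<in>I. T i / \<sigma> * Z i \<omega>)) * iexp (- (\<Sum>i\<in>I. T i / \<sigma> * y i)))"
proof -
  let ?S = "PiM I (\<lambda>_. std_normal_distribution)"
  interpret std: real_distribution std_normal_distribution by (rule real_dist_normal_dist)
  interpret N: prob_space N by fact
  interpret S: prob_space ?S by (intro prob_space_PiM) (rule std.prob_space_axioms)
  interpret NS: pair_sigma_finite ?S N ..
  interpret NSp: prob_space "?S \<Otimes>\<^sub>M N" by (rule prob_space_pair) unfold_locales
  have T_m[measurable]: "(\<lambda>T. T i) \<in> borel_measurable ?S" if "i \<in> I" for i
    using measurable_component_singleton[OF that, of "\<lambda>_. std_normal_distribution"] by simp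
  note Z[measurable]
  have int: "integrable (?S \<Otimes>\<^sub>M N) (\<lambda>(T, \<omega>). iexp (\<Sum>i\<in>I. T i / \<sigma> * Z i \<omega>) * iexp (- (\<Sum>i\<in>I. T i / \<sigma> * y i)))"
    by (rule NSp.integrable_const_bound[of _ 1]) (auto simp: norm_mult split_beta)
  have "complex_of_real (LINT \<omega>|N. gauss_prod \<sigma> I (\<lambda>i. Z i \<omega>) y) = (CLINT \<omega>|N. complex_of_real (gauss_prod \<sigma> I (\<lambda>i. Z i \<omega>) y))"
    by simp
  also have "\<dots> = complex_of_real ((1 / sqrt (2 * pi * \<sigma>\<^sup>2)) ^ card I) *
      (CLINT \<omega>|N. CLINT T|?S. iexp (\<Sum>i\<in>I. T i / \<sigma> * Z i \<omega>) * iexp (- (\<Sum>i\<in>I. T i / \<sigma> * y i)))"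
    unfolding gauss_prod_Fourier[OF \<sigma> I] by (rule integral_mult_right_zero)
  also have "(CLINT \<omega>|N. CLINT T|?S. iexp (\<Sum>i\<in>I. T i / \<sigma> * Z i \<omega>) * iexp (- (\<Sum>i\<in>I. T i / \<sigma> * y i))) =
      (CLINT T|?S. CLINT \<omega>|N. iexp (\<Sum>i\<in>I. T i / \<sigma> * Z i \<omega>) * iexp (- (\<Sum>i\<in>I. T i / \<sigma> * y i)))"
    by (rule NS.Fubini_integral[OF int])
  also have "\<dots> = (CLINT T|?S. (CLINT \<omega>|N. iexp (\<Sum>i\<in>I. T i / \<sigma> * Z i \<omega>)) * iexp (- (\<Sum>i\<in>I. T i / \<sigma> * y i)))"
    by (rule Bochner_Integration.integral_cong) (rule refl, rule integral_mult_left_zero)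
  finally show ?thesis .
qed

lemma nn_integral_gauss_prod:
  assumes "\<sigma> > 0" "finite I"
  shows "(\<integral>\<^sup>+ y. ennreal (gauss_prod \<sigma> I x y) \<partial>PiM I (\<lambda>_. lborel)) = 1"
proof -
  interpret product_sigma_finite "\<lambda>_. lborel :: real measure" by unfold_locales
  have "(\<integral>\<^sup>+ y. ennreal (gauss_prod \<sigma> I x y) \<partial>PiM I (\<lambda>_. lborel)) = (\<integral>\<^sup>+ y. (\<Prod>i\<in>I. ennreal (normal_density (x i) \<sigma> (y i))) \<partial>PiM I (\<lambda>_. lborel))"
    by (simp add: gauss_prod_def prod_ennreal)
  also have "\<dots> = (\<Prod>i\<in>I. \<integral>\<^sup>+ y. ennreal (normal_density (x i) \<sigma> y) \<partial>lborel)"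
    using assms by (intro product_nn_integral_prod) auto
  also have "\<dots> = 1"
  proof (rule prod.neutral, rule ballI)
    fix i
    have "(\<integral>\<^sup>+ y. ennreal (normal_density (x i) \<sigma> y) \<partial>lborel) = ennreal (LINT y|lborel. normal_density (x i) \<sigma> y)"
      by (rule nn_integral_eq_integral) (auto simp: assms)
    then show "(\<integral>\<^sup>+ y. ennreal (normal_density (x i) \<sigma> y) \<partial>lborel) = 1" using assms by simp
  qed
  finally show ?thesis .
qed

lemma density_gauss_prod:
  assumes \<sigma>: "\<sigma> > 0" and I: "finite I"
  shows "density (PiM I (\<lambda>_. lborel)) (\<lambda>y. ennreal (gauss_prod \<sigma> I x y)) =
    PiM I (\<lambda>i. density lborel (\<lambda>y. ennreal (normal_density (x i) \<sigma> y)))"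
proof -
  have "product_sigma_finite (\<lambda>i. density lborel (\<lambda>y. ennreal (normal_density (x i) \<sigma> y)))"
    unfolding product_sigma_finite_def using prob_space_normal_density[OF \<sigma>] prob_space_imp_sigma_finite by blast
  moreover have "product_sigma_finite (\<lambda>_. lborel :: real measure)"
    unfolding product_sigma_finite_def using sigma_finite_lborel by blast
  ultimately show ?thesis
    by (subst PiM_density_eq[OF _ _ I]) (auto simp: gauss_prod_def prod_ennreal)
qed

lemma abs_integral_le:
  fixes f g :: "'a \<Rightarrow> real"
  assumes "integrable N f" "integrable N g" "\<And>x. \<bar>f x\<bar> \<le> g x"
  shows "\<bar>LINT x|N. f x\<bar> \<le> (LINT x|N. g x)"
proof -
  have "\<bar>LINT x|N. f x\<bar> \<le> (LINT x|N. \<bar>f x\<bar>)" by (rule integral_abs_bound)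
  also have "\<dots> \<le> (LINT x|N. g x)" using assms by (intro integral_mono) auto
  finally show ?thesis .
qed

text \<open>A normal variable has mean absolute deviation \<sigma> sqrt (2 / pi), which is at most
  \<sigma>; the Lipschitz bound sums this over the coordinates.\<close>

lemma gaussian_smoothing_error:
  assumes \<sigma>: "\<sigma> > 0" and I: "finite I" and \<phi>: "\<phi> \<in> borel_measurable (PiM I (\<lambda>_. borel))"
    and lip: "\<And>x y. \<bar>\<phi> x - \<phi> y\<bar> \<le> C * (\<Sum>i\<in>I. \<bar>x i - y i\<bar>)" and C: "C \<ge> 0" and B: "\<And>x. \<bar>\<phi> x\<bar> \<le> B"
  shows "\<bar>\<phi> x - (LINT y|PiM I (\<lambda>_. lborel). \<phi> y * gauss_prod \<sigma> I x y)\<bar> \<le> C * (real (card I) * \<sigma>)"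
proof -
  define D where "D i = density lborel (\<lambda>y. ennreal (normal_density (x i) \<sigma> y))" for i
  have D: "prob_space (D i)" for i unfolding D_def by (rule prob_space_normal_density[OF \<sigma>])
  have sets_D: "sets (D i) = sets borel" for i by (simp add: D_def)
  interpret P: prob_space "PiM I D" by (intro prob_space_PiM D)
  have sets_P: "sets (PiM I D) = sets (PiM I (\<lambda>_. borel))" by (intro sets_PiM_cong) (auto simp: sets_D)
  have \<phi>D[measurable]: "\<phi> \<in> borel_measurable (PiM I D)" using \<phi> by (subst measurable_cong_sets[OF sets_P refl])
  have \<phi>L: "\<phi> \<in> borel_measurable (PiM I (\<lambda>_. lborel))"
    using \<phi> by (subst measurable_cong_sets[OF sets_PiM_cong[OF refl] refl]) auto
  have gm: "(\<lambda>y. gauss_prod \<sigma> I x y) \<in> borel_measurable (PiM I (\<lambda>_. lborel))"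
    using measurable_gauss_prod[of I "\<lambda>i y. x i" "PiM I (\<lambda>_. lborel)" "\<lambda>i y. y i" \<sigma>]
      measurable_component_singleton[of _ I "\<lambda>_. lborel :: real measure"] by simp
  have mom: "has_bochner_integral lborel (\<lambda>y. normal_density (x i) \<sigma> y * \<bar>y - x i\<bar>) (\<sigma> * sqrt (2 / pi))" for i
    using normal_moment_abs_odd[OF \<sigma>, of "x i" 0] by simp
  have comp: "integrable (PiM I D) (\<lambda>y. \<bar>x i - y i\<bar>)" "(LINT y|PiM I D. \<bar>x i - y i\<bar>) = \<sigma> * sqrt (2 / pi)" if i: "i \<in> I" for i
  proof -
    have m: "(\<lambda>y. y i) \<in> measurable (PiM I D) (D i)" using i by measurable
    have dist: "distr (PiM I D) (D i) (\<lambda>y. y i) = D i" by (rule distr_PiM_component[OF D i])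
    have intD: "integrable (D i) (\<lambda>y. \<bar>x i - y\<bar>)" "(LINT y|D i. \<bar>x i - y\<bar>) = \<sigma> * sqrt (2 / pi)"
      using mom[of i] unfolding D_def
      by (auto simp: integrable_density integral_density has_bochner_integral_iff abs_minus_commute)
    have bm: "(\<lambda>y. \<bar>x i - y\<bar>) \<in> borel_measurable (D i)" by (simp add: D_def)
    show "integrable (PiM I D) (\<lambda>y. \<bar>x i - y i\<bar>)"
      using integrable_distr_eq[OF m bm] intD(1) by (simp add: dist)
    show "(LINT y|PiM I D. \<bar>x i - y i\<bar>) = \<sigma> * sqrt (2 / pi)"
      using integral_distr[OF m bm] intD(2) by (simp add: dist)
  qed
  have "(LINT y|PiM I (\<lambda>_. lborel). \<phi> y * gauss_prod \<sigma> I x y) = (LINT y|PiM I D. \<phi> y)"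
    unfolding D_def density_gauss_prod[OF \<sigma> I, symmetric] using \<phi>L gm gauss_prod_nonneg
    by (subst integral_density) (auto intro!: AE_I2 simp: mult.commute)
  then have "\<phi> x - (LINT y|PiM I (\<lambda>_. lborel). \<phi> y * gauss_prod \<sigma> I x y) = (LINT y|PiM I D. \<phi> x - \<phi> y)"
    using P.integrable_const_bound[of \<phi> B] B by (simp add: P.prob_space)
  also have "\<bar>\<dots>\<bar> \<le> (LINT y|PiM I D. C * (\<Sum>i\<in>I. \<bar>x i - y i\<bar>))"
  proof (rule abs_integral_le)
    show "integrable (PiM I D) (\<lambda>y. C * (\<Sum>i\<in>I. \<bar>x i - y i\<bar>))" using comp by auto
    show "integrable (PiM I D) (\<lambda>y. \<phi> x - \<phi> y)" using P.integrable_const_bound[of \<phi> B] B by auto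
    show "\<bar>\<phi> x - \<phi> y\<bar> \<le> C * (\<Sum>i\<in>I. \<bar>x i - y i\<bar>)" for y by (rule lip)
  qed
  also have "\<dots> = C * (real (card I) * (\<sigma> * sqrt (2 / pi)))"
    using comp by simp
  also have "\<dots> \<le> C * (real (card I) * \<sigma>)"
  proof -
    have "sqrt (2 / pi) \<le> 1" using pi_ge_two by simp
    then have "\<sigma> * sqrt (2 / pi) \<le> \<sigma> * 1" using \<sigma> by (intro mult_left_mono) auto
    then show ?thesis using C by (intro mult_left_mono) auto
  qed
  finally show ?thesis .
qed

text \<open>Here \<open>p\<close> is the density of \<open>Z\<close> plus independent Gaussian
  noise. Existence of this density is what allows laws without any density to be compared in
  L1.\<close>

lemma smoothed_expectation:
  fixes Z :: "'i \<Rightarrow> 'a \<Rightarrow> real"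
  assumes \<sigma>: "\<sigma> > 0" and I: "finite I" and N: "prob_space N" and Z: "\<And>i. i \<in> I \<Longrightarrow> Z i \<in> borel_measurable N"
  defines "p \<equiv> \<lambda>y. LINT \<omega>|N. gauss_prod \<sigma> I (\<lambda>i. Z i \<omega>) y"
  shows "integrable (PiM I (\<lambda>_. lborel)) p" "\<And>y. p y \<ge> 0" "(\<integral>\<^sup>+ y. ennreal (p y) \<partial>PiM I (\<lambda>_. lborel)) = 1"
    "\<lbrakk>\<phi> \<in> borel_measurable (PiM I (\<lambda>_. borel)); \<And>x y. \<bar>\<phi> x - \<phi> y\<bar> \<le> C * (\<Sum>i\<in>I. \<bar>x i - y i\<bar>); C \<ge> 0; \<And>x. \<bar>\<phi> x\<bar> \<le> B\<rbrakk> \<Longrightarrow>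
      \<bar>(LINT \<omega>|N. \<phi> (\<lambda>i. Z i \<omega>)) - (LINT y|PiM I (\<lambda>_. lborel). \<phi> y * p y)\<bar> \<le> C * (real (card I) * \<sigma>)"
proof -
  let ?L = "PiM I (\<lambda>_. lborel :: real measure)"
  interpret N: prob_space N by fact
  interpret L: product_sigma_finite "\<lambda>_. lborel :: real measure" by unfold_locales
  interpret L: sigma_finite_measure ?L by (rule L.sigma_finite[OF I])
  interpret NL: pair_sigma_finite N ?L ..
  let ?g = "\<lambda>(\<omega>, y). gauss_prod \<sigma> I (\<lambda>i. Z i \<omega>) y"
  have g_m: "?g \<in> borel_measurable (N \<Otimes>\<^sub>M ?L)"
  proof -
    have 1: "(\<lambda>z. Z i (fst z)) \<in> borel_measurable (N \<Otimes>\<^sub>M ?L)" if "i \<in> I" for i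
      using measurable_compose[OF measurable_fst[of N ?L] Z[OF that]] by simp
    have 2: "(\<lambda>z. snd z i) \<in> borel_measurable (N \<Otimes>\<^sub>M ?L)" if "i \<in> I" for i
      using measurable_compose[OF measurable_snd[of N ?L] measurable_component_singleton[OF that, of "\<lambda>_. lborel :: real measure"]] by simp
    have "(\<lambda>z. gauss_prod \<sigma> I (\<lambda>i. Z i (fst z)) (\<lambda>i. snd z i)) \<in> borel_measurable (N \<Otimes>\<^sub>M ?L)"
      by (rule measurable_gauss_prod) (use 1 2 in auto)
    then show ?thesis by (simp add: split_beta)
  qed
  have "(\<integral>\<^sup>+ z. ennreal (?g z) \<partial>(N \<Otimes>\<^sub>M ?L)) = (\<integral>\<^sup>+ \<omega>. \<integral>\<^sup>+ y. ennreal (?g (\<omega>, y)) \<partial>?L \<partial>N)"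
    using g_m by (intro L.nn_integral_fst[symmetric]) auto
  also have "\<dots> = 1" by (simp add: nn_integral_gauss_prod[OF \<sigma> I] N.emeasure_space_1)
  finally have g1: "(\<integral>\<^sup>+ z. ennreal (?g z) \<partial>(N \<Otimes>\<^sub>M ?L)) = 1" .
  have g_int: "integrable (N \<Otimes>\<^sub>M ?L) ?g"
    by (rule integrableI_nonneg[OF g_m]) (auto simp: g1 gauss_prod_nonneg)
  show p_nonneg: "p y \<ge> 0" for y
    unfolding p_def by (intro Bochner_Integration.integral_nonneg gauss_prod_nonneg)
  show p_int: "integrable ?L p"
    unfolding p_def using NL.integrable_snd[of "\<lambda>\<omega> y. gauss_prod \<sigma> I (\<lambda>i. Z i \<omega>) y"] g_int by simp
  have "(LINT y|?L. p y) = (LINT z|(N \<Otimes>\<^sub>M ?L). ?g z)"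
    unfolding p_def using NL.integral_snd[of "\<lambda>\<omega> y. gauss_prod \<sigma> I (\<lambda>i. Z i \<omega>) y"] g_int by simp
  also have "\<dots> = 1"
  proof -
    have "AE z in N \<Otimes>\<^sub>M ?L. 0 \<le> ?g z" by (intro AE_I2) (auto simp: split_beta gauss_prod_nonneg)
    from nn_integral_eq_integral[OF g_int this] show ?thesis unfolding g1 by simp
  qed
  finally show "(\<integral>\<^sup>+ y. ennreal (p y) \<partial>?L) = 1"
    using nn_integral_eq_integral[OF p_int] p_nonneg by simp
  assume \<phi>: "\<phi> \<in> borel_measurable (PiM I (\<lambda>_. borel))" and lip: "\<And>x y. \<bar>\<phi> x - \<phi> y\<bar> \<le> C * (\<Sum>i\<in>I. \<bar>x i - y i\<bar>)"
    and C: "C \<ge> 0" and B: "\<And>x. \<bar>\<phi> x\<bar> \<le> B"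
  have \<phi>L: "\<phi> \<in> borel_measurable ?L"
    using \<phi> by (subst measurable_cong_sets[OF sets_PiM_cong[OF refl] refl]) auto
  have \<phi>_snd: "(\<lambda>z. \<phi> (snd z)) \<in> borel_measurable (N \<Otimes>\<^sub>M ?L)"
    by (rule measurable_compose[OF measurable_snd \<phi>L])
  have \<phi>g_int: "integrable (N \<Otimes>\<^sub>M ?L) (\<lambda>(\<omega>, y). \<phi> y * gauss_prod \<sigma> I (\<lambda>i. Z i \<omega>) y)"
  proof (rule Bochner_Integration.integrable_bound[of _ "\<lambda>z. B * ?g z"])
    show "integrable (N \<Otimes>\<^sub>M ?L) (\<lambda>z. B * ?g z)" using g_int by simp
    show "(\<lambda>(\<omega>, y). \<phi> y * gauss_prod \<sigma> I (\<lambda>i. Z i \<omega>) y) \<in> borel_measurable (N \<Otimes>\<^sub>M ?L)"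
      using borel_measurable_times[OF \<phi>_snd g_m] by (simp add: split_beta)
    have "0 \<le> B" using B[of undefined] by linarith
    then show "AE z in N \<Otimes>\<^sub>M ?L. norm (case z of (\<omega>, y) \<Rightarrow> \<phi> y * gauss_prod \<sigma> I (\<lambda>i. Z i \<omega>) y) \<le> norm (B * ?g z)"
      using B gauss_prod_nonneg by (intro AE_I2) (auto simp: abs_mult split_beta intro!: mult_right_mono)
  qed
  have "(LINT y|?L. \<phi> y * p y) = (LINT y|?L. LINT \<omega>|N. \<phi> y * gauss_prod \<sigma> I (\<lambda>i. Z i \<omega>) y)"
    unfolding p_def by simp
  also have "\<dots> = (LINT \<omega>|N. LINT y|?L. \<phi> y * gauss_prod \<sigma> I (\<lambda>i. Z i \<omega>) y)"
    by (rule NL.Fubini_integral[OF \<phi>g_int])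
  finally have eq: "(LINT y|?L. \<phi> y * p y) = (LINT \<omega>|N. LINT y|?L. \<phi> y * gauss_prod \<sigma> I (\<lambda>i. Z i \<omega>) y)" .
  have int1: "integrable N (\<lambda>\<omega>. LINT y|?L. \<phi> y * gauss_prod \<sigma> I (\<lambda>i. Z i \<omega>) y)"
    using NL.integrable_fst'[OF \<phi>g_int] by simp
  \<comment> \<open>The Lipschitz bound involves only the coordinates in \<open>I\<close>, so it
    forces the test function to ignore all others; this links functions on the whole index type with
    the extensional functions of \<open>PiM\<close>.\<close>
  have \<phi>Z: "\<phi> (\<lambda>i. Z i \<omega>) = \<phi> (\<lambda>i\<in>I. Z i \<omega>)" for \<omega>
  proof -
    have "(\<Sum>i\<in>I. \<bar>Z i \<omega> - (\<lambda>i\<in>I. Z i \<omega>) i\<bar>) = 0" by (intro sum.neutral) auto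
    then show ?thesis using lip[of "\<lambda>i. Z i \<omega>" "\<lambda>i\<in>I. Z i \<omega>"] by simp
  qed
  have "(\<lambda>\<omega>. \<phi> (\<lambda>i. Z i \<omega>)) \<in> borel_measurable N"
    unfolding \<phi>Z by (rule measurable_compose[OF measurable_restrict \<phi>]) (use Z in auto)
  then have int2: "integrable N (\<lambda>\<omega>. \<phi> (\<lambda>i. Z i \<omega>))"
    using B by (intro N.integrable_const_bound[of _ B]) auto
  have "\<bar>(LINT \<omega>|N. \<phi> (\<lambda>i. Z i \<omega>)) - (LINT y|?L. \<phi> y * p y)\<bar> =
      \<bar>LINT \<omega>|N. \<phi> (\<lambda>i. Z i \<omega>) - (LINT y|?L. \<phi> y * gauss_prod \<sigma> I (\<lambda>i. Z i \<omega>) y)\<bar>"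
    unfolding eq using int1 int2 by simp
  also have "\<dots> \<le> (LINT \<omega>|N. C * (real (card I) * \<sigma>))"
    by (rule abs_integral_le[OF Bochner_Integration.integrable_diff[OF int2 int1]])
       (simp_all add: gaussian_smoothing_error[OF \<sigma> I \<phi> lip C B])
  also have "\<dots> = C * (real (card I) * \<sigma>)" by (simp add: N.prob_space)
  finally show "\<bar>(LINT \<omega>|N. \<phi> (\<lambda>i. Z i \<omega>)) - (LINT y|?L. \<phi> y * p y)\<bar> \<le> C * (real (card I) * \<sigma>)" .
qed

text \<open>
  The Cramer-Wold device for Lipschitz test functions: after smoothing by an independent small
  Gaussian vector the laws have densities that are Fourier integrals of the characteristic
  functions, so these densities converge pointwise and, by Scheffe, in \<open>L\<^sup>1\<close>.
\<close>

lemma lipschitz_expectation_tendsto: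
  fixes X :: "nat \<Rightarrow> 'i \<Rightarrow> 'a \<Rightarrow> real" and Y :: "'i \<Rightarrow> 'b \<Rightarrow> real"
  assumes I: "finite I" and M: "\<And>n. prob_space (M n)" "\<And>n i. i \<in> I \<Longrightarrow> X n i \<in> borel_measurable (M n)"
    and M': "prob_space M'" "\<And>i. i \<in> I \<Longrightarrow> Y i \<in> borel_measurable M'"
    and char_lim: "\<And>t :: 'i \<Rightarrow> real. (\<lambda>n. CLINT \<omega>|M n. iexp (\<Sum>i\<in>I. t i * X n i \<omega>)) \<longlonglongrightarrow> (CLINT \<omega>|M'. iexp (\<Sum>i\<in>I. t i * Y i \<omega>))"
    and \<phi>: "\<phi> \<in> borel_measurable (PiM I (\<lambda>_. borel))"
    and lip: "\<And>x y. \<bar>\<phi> x - \<phi> y\<bar> \<le> C * (\<Sum>i\<in>I. \<bar>x i - y i\<bar>)" and C: "C \<ge> 0" and B: "\<And>x. \<bar>\<phi> x\<bar> \<le> B"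
  shows "(\<lambda>n. LINT \<omega>|M n. \<phi> (\<lambda>i. X n i \<omega>)) \<longlonglongrightarrow> (LINT \<omega>|M'. \<phi> (\<lambda>i. Y i \<omega>))"
proof (rule tendstoI)
  fix e :: real assume e: "e > 0"
  let ?L = "PiM I (\<lambda>_. lborel :: real measure)" and ?S = "PiM I (\<lambda>_. std_normal_distribution)"
  define A where "A = C * real (card I) + 1"
  have A: "A > 0" unfolding A_def using C by (intro add_nonneg_pos mult_nonneg_nonneg) auto
  \<comment> \<open>Smoothing costs at most e / 4 for each of the two laws, and the L1 distance of
    the smoothed densities will cost another e / 4.\<close>
  define \<sigma> where "\<sigma> = e / (4 * A)"
  have \<sigma>: "\<sigma> > 0" unfolding \<sigma>_def using e A by simp
  have err: "C * (real (card I) * \<sigma>) \<le> e / 4"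
  proof -
    have "C * (real (card I) * \<sigma>) \<le> A * \<sigma>" using \<sigma> by (simp add: A_def algebra_simps)
    also have "\<dots> = e / 4" using A by (simp add: \<sigma>_def)
    finally show ?thesis .
  qed
  interpret std: real_distribution std_normal_distribution by (rule real_dist_normal_dist)
  interpret S: prob_space ?S by (intro prob_space_PiM) (rule std.prob_space_axioms)
  define p where "p n y = (LINT \<omega>|M n. gauss_prod \<sigma> I (\<lambda>i. X n i \<omega>) y)" for n y
  define p' where "p' y = (LINT \<omega>|M'. gauss_prod \<sigma> I (\<lambda>i. Y i \<omega>) y)" for y
  note P = smoothed_expectation[where N = "M n" and Z = "X n" for n, OF \<sigma> I M, folded p_def]
  note P' = smoothed_expectation[where N = M' and Z = Y, OF \<sigma> I M', folded p'_def]
  have P1: "integrable ?L (p n)" for n by (rule P(1))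
  have P2: "0 \<le> p n y" for n y by (rule P(2))
  have P3: "(\<integral>\<^sup>+ y. ennreal (p n y) \<partial>?L) = 1" for n by (rule P(3))
  have P'1: "integrable ?L p'" using P'(1) by simp
  have P'2: "0 \<le> p' y" for y using P'(2) by simp
  have P'3: "(\<integral>\<^sup>+ y. ennreal (p' y) \<partial>?L) = 1" using P'(3) by simp
  have P'4: "\<bar>(LINT \<omega>|M'. \<phi> (\<lambda>i. Y i \<omega>)) - (LINT y|?L. \<phi> y * p' y)\<bar> \<le> C * (real (card I) * \<sigma>)"
    by (rule P'(4)[OF _ \<phi> lip C B])
  have P4: "\<bar>(LINT \<omega>|M n. \<phi> (\<lambda>i. X n i \<omega>)) - (LINT y|?L. \<phi> y * p n y)\<bar> \<le> C * (real (card I) * \<sigma>)" for n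
    by (rule P(4)[OF _ \<phi> lip C B])
  have p_lim: "(\<lambda>n. p n y) \<longlonglongrightarrow> p' y" for y
  proof -
    have T_m: "(\<lambda>T. T i) \<in> borel_measurable ?S" if "i \<in> I" for i
      using measurable_component_singleton[OF that, of "\<lambda>_. std_normal_distribution"] by simp
    let ?F = "\<lambda>N Z T. (CLINT \<omega>|N. iexp (\<Sum>i\<in>I. T i / \<sigma> * Z i \<omega>)) * iexp (- (\<Sum>i\<in>I. T i / \<sigma> * y i))"
    have F_m: "?F N Z \<in> borel_measurable ?S" if N: "prob_space N" and Z[measurable]: "\<And>i. i \<in> I \<Longrightarrow> Z i \<in> borel_measurable N" for N :: "'c measure" and Z
    proof -
      interpret N: prob_space N by fact
      note T_m[measurable]
      show ?thesis by measurable
    qed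
    have F_b: "norm (?F N Z T) \<le> 1" if "prob_space N" for N :: "'c measure" and Z T
    proof -
      interpret N: prob_space N by fact
      have "norm (CLINT \<omega>|N. iexp (\<Sum>i\<in>I. T i / \<sigma> * Z i \<omega>)) \<le> 1"
      proof (cases "integrable N (\<lambda>\<omega>. iexp (\<Sum>i\<in>I. T i / \<sigma> * Z i \<omega>))")
        case True
        have "norm (CLINT \<omega>|N. iexp (\<Sum>i\<in>I. T i / \<sigma> * Z i \<omega>)) \<le> (LINT \<omega>|N. norm (iexp (\<Sum>i\<in>I. T i / \<sigma> * Z i \<omega>)))"
          by (rule integral_norm_bound)
        then show ?thesis by (simp add: N.prob_space)
      qed (simp add: not_integrable_integral_eq)
      then show ?thesis by (simp add: norm_mult)
    qed
    have "(\<lambda>n. CLINT T|?S. ?F (M n) (X n) T) \<longlonglongrightarrow> (CLINT T|?S. ?F M' Y T)"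
    proof (rule integral_dominated_convergence[where w = "\<lambda>_. 1"])
      show "AE T in ?S. (\<lambda>n. ?F (M n) (X n) T) \<longlonglongrightarrow> ?F M' Y T"
        by (intro AE_I2 tendsto_mult_right char_lim)
      show "?F M' Y \<in> borel_measurable ?S" "\<And>n. ?F (M n) (X n) \<in> borel_measurable ?S"
        using F_m M M' by blast+
      show "AE T in ?S. norm (?F (M n) (X n) T) \<le> 1" for n using F_b[OF M(1)] by (intro AE_I2)
    qed simp
    then have lim: "(\<lambda>n. complex_of_real ((1 / sqrt (2 * pi * \<sigma>\<^sup>2)) ^ card I) * (CLINT T|?S. ?F (M n) (X n) T)) \<longlonglongrightarrow>
        complex_of_real ((1 / sqrt (2 * pi * \<sigma>\<^sup>2)) ^ card I) * (CLINT T|?S. ?F M' Y T)"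
      by (rule tendsto_mult_left)
    have p_eq: "complex_of_real (p n y) = complex_of_real ((1 / sqrt (2 * pi * \<sigma>\<^sup>2)) ^ card I) * (CLINT T|?S. ?F (M n) (X n) T)" for n
      unfolding p_def by (rule expectation_gauss_prod[where N = "M n" and Z = "X n", OF \<sigma> I M])
    have p'_eq: "complex_of_real (p' y) = complex_of_real ((1 / sqrt (2 * pi * \<sigma>\<^sup>2)) ^ card I) * (CLINT T|?S. ?F M' Y T)"
      unfolding p'_def by (rule expectation_gauss_prod[OF \<sigma> I M'(1) M'(2)])
    have "(\<lambda>n. complex_of_real (p n y)) \<longlonglongrightarrow> complex_of_real (p' y)"
      using lim unfolding p_eq p'_eq .
    then show ?thesis by (simp only: tendsto_of_real_iff)
  qed
  have L1: "(\<lambda>n. \<integral>\<^sup>+ y. ennreal (norm (p n y - p' y)) \<partial>?L) \<longlonglongrightarrow> 0"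
  proof (rule Scheffe_lemma2)
    show "p n \<in> borel_measurable ?L" for n using P1 by (rule borel_measurable_integrable)
    show "integrable ?L p'" by (rule P'1)
    show "AE y in ?L. (\<lambda>n. p n y) \<longlonglongrightarrow> p' y" using p_lim by simp
    show "(\<integral>\<^sup>+ y. ennreal (norm (p n y)) \<partial>?L) \<le> (\<integral>\<^sup>+ y. ennreal (norm (p' y)) \<partial>?L)" for n
      using P2 P3 P'2 P'3 by simp
  qed
  have B0: "0 \<le> B" using B[of undefined] by linarith
  have "eventually (\<lambda>n. (\<integral>\<^sup>+ y. ennreal (norm (p n y - p' y)) \<partial>?L) < ennreal (e / (4 * (B + 1)))) sequentially"
    using L1 e B0 by (intro order_tendstoD(2)) auto
  then show "eventually (\<lambda>n. dist (LINT \<omega>|M n. \<phi> (\<lambda>i. X n i \<omega>)) (LINT \<omega>|M'. \<phi> (\<lambda>i. Y i \<omega>)) < e) sequentially"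
  proof eventually_elim
    fix n assume n: "(\<integral>\<^sup>+ y. ennreal (norm (p n y - p' y)) \<partial>?L) < ennreal (e / (4 * (B + 1)))"
    have int_d: "integrable ?L (\<lambda>y. \<bar>p n y - p' y\<bar>)" using P1[of n] P'1 by auto
    have d: "(LINT y|?L. \<bar>p n y - p' y\<bar>) < e / (4 * (B + 1))"
      using n nn_integral_eq_integral[OF int_d] e B0 by (simp add: ennreal_less_iff Bochner_Integration.integral_nonneg)
    have \<phi>L: "\<phi> \<in> borel_measurable ?L"
      using \<phi> by (subst measurable_cong_sets[OF sets_PiM_cong[OF refl] refl]) auto
    have int_\<phi>: "integrable ?L (\<lambda>y. \<phi> y * q y)" if q: "integrable ?L q" for q :: "('i \<Rightarrow> real) \<Rightarrow> real"
    proof (rule Bochner_Integration.integrable_bound[of _ "\<lambda>y. B * q y"])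
      show "(\<lambda>y. \<phi> y * q y) \<in> borel_measurable ?L" using \<phi>L q by auto
      show "AE y in ?L. norm (\<phi> y * q y) \<le> norm (B * q y)"
        using B B0 by (intro AE_I2) (auto simp: abs_mult intro!: mult_right_mono)
    qed (use q in simp)
    have "\<bar>(LINT y|?L. \<phi> y * p n y) - (LINT y|?L. \<phi> y * p' y)\<bar> = \<bar>LINT y|?L. \<phi> y * p n y - \<phi> y * p' y\<bar>"
      using int_\<phi>[OF P1] int_\<phi>[OF P'1] by simp
    also have "\<dots> \<le> (LINT y|?L. B * \<bar>p n y - p' y\<bar>)"
    proof (rule abs_integral_le)
      fix y
      show "\<bar>\<phi> y * p n y - \<phi> y * p' y\<bar> \<le> B * \<bar>p n y - p' y\<bar>"
        using B[of y] unfolding right_diff_distrib[symmetric] abs_mult by (intro mult_right_mono) auto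
    qed (use int_d int_\<phi>[OF P1] int_\<phi>[OF P'1] in auto)
    also have "\<dots> = B * (LINT y|?L. \<bar>p n y - p' y\<bar>)" by simp
    also have "\<dots> \<le> (B + 1) * (e / (4 * (B + 1)))"
      using d B0 by (intro mult_mono) (auto intro!: Bochner_Integration.integral_nonneg)
    also have "\<dots> = e / 4"
    proof -
      have "D * (e / (4 * D)) = e / 4" if "D > 0" for D :: real using that by simp
      moreover have "B + 1 > 0" using B0 by simp
      ultimately show ?thesis by blast
    qed
    finally have "\<bar>(LINT y|?L. \<phi> y * p n y) - (LINT y|?L. \<phi> y * p' y)\<bar> \<le> e / 4" .
    moreover have "\<bar>(LINT \<omega>|M n. \<phi> (\<lambda>i. X n i \<omega>)) - (LINT y|?L. \<phi> y * p n y)\<bar> \<le> e / 4"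
      using P4[of n] err by linarith
    moreover have "\<bar>(LINT \<omega>|M'. \<phi> (\<lambda>i. Y i \<omega>)) - (LINT y|?L. \<phi> y * p' y)\<bar> \<le> e / 4"
      using P'4 err by linarith
    ultimately show "dist (LINT \<omega>|M n. \<phi> (\<lambda>i. X n i \<omega>)) (LINT \<omega>|M'. \<phi> (\<lambda>i. Y i \<omega>)) < e"
      unfolding dist_real_def using e by linarith
  qed
qed

text \<open>Rounding the coordinates down to multiples of 1 / (k + 1) factors through a countable
  discrete product, on which every function is measurable; the Lipschitz bound makes the rounded
  functions converge.\<close>

lemma measurable_PiM_lipschitz:
  fixes \<phi> :: "('i \<Rightarrow> real) \<Rightarrow> real"
  assumes I: "finite I" and lip: "\<And>x y. \<bar>\<phi> x - \<phi> y\<bar> \<le> C * (\<Sum>i\<in>I. \<bar>x i - y i\<bar>)" and C: "C \<ge> 0"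
  shows "\<phi> \<in> borel_measurable (PiM I (\<lambda>_. borel))"
proof -
  let ?a = "\<lambda>k (x :: 'i \<Rightarrow> real). \<lambda>i\<in>I. \<lfloor>real (Suc k) * x i\<rfloor>"
  let ?r = "\<lambda>k (z :: 'i \<Rightarrow> int) i. real_of_int (z i) / real (Suc k)"
  have lim: "(\<lambda>k. \<phi> (?r k (?a k x))) \<longlonglongrightarrow> \<phi> x" for x
  proof (rule LIM_zero_cancel, rule tendsto_rabs_zero_cancel, rule tendsto_sandwich[OF _ _ tendsto_const])
    show "eventually (\<lambda>k. 0 \<le> \<bar>\<phi> (?r k (?a k x)) - \<phi> x\<bar>) sequentially" by simp
    show "eventually (\<lambda>k. \<bar>\<phi> (?r k (?a k x)) - \<phi> x\<bar> \<le> C * real (card I) * (1 / real (Suc k))) sequentially"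
    proof (rule always_eventually, rule allI)
      fix k
      have "\<bar>?r k (?a k x) i - x i\<bar> \<le> 1 / real (Suc k)" if "i \<in> I" for i
      proof -
        have "?r k (?a k x) i - x i = (real_of_int \<lfloor>real (Suc k) * x i\<rfloor> - real (Suc k) * x i) / real (Suc k)"
          using that by (simp add: diff_divide_distrib del: of_nat_Suc)
        then have eq: "\<bar>?r k (?a k x) i - x i\<bar> = \<bar>real_of_int \<lfloor>real (Suc k) * x i\<rfloor> - real (Suc k) * x i\<bar> / real (Suc k)"
          by (simp only: abs_divide abs_of_nat)
        have "\<bar>real_of_int \<lfloor>real (Suc k) * x i\<rfloor> - real (Suc k) * x i\<bar> \<le> 1" by linarith
        then show ?thesis unfolding eq by (rule divide_right_mono) simp
      qed
      then have "C * (\<Sum>i\<in>I. \<bar>?r k (?a k x) i - x i\<bar>) \<le> C * (\<Sum>i\<in>I. 1 / real (Suc k))"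
        using C by (intro mult_left_mono sum_mono) auto
      then show "\<bar>\<phi> (?r k (?a k x)) - \<phi> x\<bar> \<le> C * real (card I) * (1 / real (Suc k))"
        using lip[of "?r k (?a k x)" x] by simp
    qed
    show "(\<lambda>k. C * real (card I) * (1 / real (Suc k))) \<longlonglongrightarrow> 0"
      using tendsto_mult_right_zero[OF LIMSEQ_inverse_real_of_nat, of "C * real (card I)"] by (simp add: inverse_eq_divide)
  qed
  have meas: "(\<lambda>x. \<phi> (?r k (?a k x))) \<in> borel_measurable (PiM I (\<lambda>_. borel))" for k
  proof -
    have 1: "?a k \<in> measurable (PiM I (\<lambda>_. borel)) (PiM I (\<lambda>_. count_space (UNIV :: int set)))"
      by (intro measurable_restrict) measurable
    have 2: "(\<lambda>z. \<phi> (?r k z)) \<in> borel_measurable (PiM I (\<lambda>_. count_space (UNIV :: int set)))"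
      by (subst count_space_PiM_finite[OF I]) auto
    show ?thesis by (rule measurable_compose[OF 1 2])
  qed
  show ?thesis
    by (rule borel_measurable_LIMSEQ_real[OF lim meas])
qed

subsection \<open>Gaussian sequences\<close>

locale semi_inner_product =
  fixes S :: "('a \<Rightarrow> real) set" and B :: "('a \<Rightarrow> real) \<Rightarrow> ('a \<Rightarrow> real) \<Rightarrow> real"
  assumes lin_comb: "g \<in> S \<Longrightarrow> h \<in> S \<Longrightarrow> (\<lambda>x. a * g x + c * h x) \<in> S"
    and zero: "(\<lambda>_. 0) \<in> S"
    and B_linear: "g \<in> S \<Longrightarrow> h \<in> S \<Longrightarrow> u \<in> S \<Longrightarrow> B (\<lambda>x. a * g x + c * h x) u = a * B g u + c * B h u"
    and B_sym: "B g h = B h g"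
    and B_nonneg: "g \<in> S \<Longrightarrow> B g g \<ge> 0"
begin

lemma B_zero: "u \<in> S \<Longrightarrow> B (\<lambda>_. 0) u = 0"
  using B_linear[OF zero zero, of u 0 0] by simp

lemma sum_mem: "finite J \<Longrightarrow> (\<And>j. j \<in> J \<Longrightarrow> h j \<in> S) \<Longrightarrow> (\<lambda>x. \<Sum>j\<in>J. a j * h j x) \<in> S"
proof (induction J rule: finite_induct)
  case (insert j J)
  then show ?case using lin_comb[of "h j" "\<lambda>x. \<Sum>j\<in>J. a j * h j x" "a j" 1] by simp
qed (simp add: zero)

lemma B_sum: "finite J \<Longrightarrow> (\<And>j. j \<in> J \<Longrightarrow> h j \<in> S) \<Longrightarrow> u \<in> S \<Longrightarrow> B (\<lambda>x. \<Sum>j\<in>J. a j * h j x) u = (\<Sum>j\<in>J. a j * B (h j) u)"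
proof (induction J rule: finite_induct)
  case (insert j J)
  then show ?case using B_linear[of "h j" "\<lambda>x. \<Sum>j\<in>J. a j * h j x" u "a j" 1] sum_mem[of J h a] by simp
qed (simp add: B_zero)

text \<open>The degenerate case of Cauchy-Schwarz: a nonzero value would make the form negative
  along the line through \<open>h\<close> in direction \<open>r\<close>, and \<open>t\<close> is
  chosen to give the value -1.\<close>

lemma B_null:
  assumes r: "r \<in> S" "B r r = 0" and h: "h \<in> S" shows "B r h = 0"
proof (rule ccontr)
  assume ne: "B r h \<noteq> 0"
  define t where "t = - (B h h + 1) / (2 * B r h)"
  have mem: "(\<lambda>x. t * r x + 1 * h x) \<in> S" by (rule lin_comb[OF r(1) h])
  have "0 \<le> B (\<lambda>x. t * r x + 1 * h x) (\<lambda>x. t * r x + 1 * h x)" by (rule B_nonneg[OF mem])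
  also have "\<dots> = t * B (\<lambda>x. t * r x + 1 * h x) r + 1 * B (\<lambda>x. t * r x + 1 * h x) h"
    by (subst B_linear[OF r(1) h mem]) (simp add: B_sym[of r "\<lambda>x. t * r x + h x"] B_sym[of h "\<lambda>x. t * r x + h x"])
  also have "\<dots> = 2 * t * B r h + B h h"
    unfolding B_linear[OF r(1) h r(1)] B_linear[OF r(1) h h] using r(2) by (simp add: B_sym[of h r])
  also have "\<dots> = - 1" using ne by (simp add: t_def field_simps)
  finally show False by simp
qed

context
  fixes g :: "nat \<Rightarrow> 'a \<Rightarrow> real"
  assumes g: "\<And>k. g k \<in> S"
begin

text \<open>If the residual has norm zero, division by zero makes the new vector the zero function
  instead of a unit vector. This convention spares a selection of independent vectors.\<close>

fun gram_schmidt :: "nat \<Rightarrow> 'a \<Rightarrow> real" where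
  "gram_schmidt k = (let r = (\<lambda>x. g k x - (\<Sum>j<k. B (g k) (gram_schmidt j) * gram_schmidt j x)) in (\<lambda>x. r x / sqrt (B r r)))"

declare gram_schmidt.simps [simp del]

definition residual :: "nat \<Rightarrow> 'a \<Rightarrow> real" where
  "residual k = (\<lambda>x. g k x - (\<Sum>j<k. B (g k) (gram_schmidt j) * gram_schmidt j x))"

lemma gram_schmidt_eq: "gram_schmidt k = (\<lambda>x. (1 / sqrt (B (residual k) (residual k))) * residual k x)"
  by (subst gram_schmidt.simps) (simp add: residual_def Let_def)

lemma gram_schmidt_mem: "gram_schmidt k \<in> S \<and> residual k \<in> S"
proof (induction k rule: less_induct)
  case (less k)
  have "(\<lambda>x. \<Sum>j<k. B (g k) (gram_schmidt j) * gram_schmidt j x) \<in> S" using less by (intro sum_mem) auto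
  from lin_comb[OF g this, of 1 k "- 1"] have r: "residual k \<in> S" by (simp add: residual_def)
  from lin_comb[OF r r, of "1 / sqrt (B (residual k) (residual k))" 0] have "gram_schmidt k \<in> S" by (simp add: gram_schmidt_eq)
  with r show ?case by simp
qed

lemmas e_mem = conjunct1[OF gram_schmidt_mem] and r_mem = conjunct2[OF gram_schmidt_mem]

lemma B_gram_schmidt: "u \<in> S \<Longrightarrow> B (gram_schmidt k) u = B (residual k) u / sqrt (B (residual k) (residual k))"
  using B_linear[OF r_mem r_mem, of u "1 / sqrt (B (residual k) (residual k))" k 0 k] by (simp add: gram_schmidt_eq)

lemma B_residual: "u \<in> S \<Longrightarrow> B (residual k) u = B (g k) u - (\<Sum>j<k. B (g k) (gram_schmidt j) * B (gram_schmidt j) u)"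
proof -
  assume u: "u \<in> S"
  have "(\<lambda>x. \<Sum>j<k. B (g k) (gram_schmidt j) * gram_schmidt j x) \<in> S" using e_mem by (intro sum_mem) auto
  from B_linear[OF g this u, of 1 k "- 1"] show ?thesis
    using B_sum[of "{..<k}" gram_schmidt u "\<lambda>j. B (g k) (gram_schmidt j)"] e_mem u by (simp add: residual_def)
qed

lemma gram_schmidt_norm: "B (gram_schmidt k) (gram_schmidt k) = 1 \<or> (\<forall>u\<in>S. B (residual k) u = 0 \<and> B (gram_schmidt k) u = 0)"
proof (cases "B (residual k) (residual k) = 0")
  case True
  then have "B (residual k) u = 0" if "u \<in> S" for u by (rule B_null[OF r_mem _ that])
  then show ?thesis using B_gram_schmidt by simp
next
  case False
  then have pos: "B (residual k) (residual k) > 0" using B_nonneg[OF r_mem, of k] by simp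
  have "B (gram_schmidt k) (gram_schmidt k) = B (residual k) (residual k) / sqrt (B (residual k) (residual k)) / sqrt (B (residual k) (residual k))"
    using B_gram_schmidt[OF e_mem, of k k] B_gram_schmidt[OF r_mem, of k k] by (simp add: B_sym[of "residual k" "gram_schmidt k"])
  also have "\<dots> = 1" using pos by (simp add: real_div_sqrt)
  finally show ?thesis by simp
qed

lemma gram_schmidt_orthogonal: "i < j \<Longrightarrow> B (gram_schmidt j) (gram_schmidt i) = 0"
proof (induction j arbitrary: i rule: less_induct)
  case (less j)
  have "(\<Sum>l<j. B (g j) (gram_schmidt l) * B (gram_schmidt l) (gram_schmidt i)) = B (g j) (gram_schmidt i) * B (gram_schmidt i) (gram_schmidt i)"
  proof -
    have zero: "B (gram_schmidt l) (gram_schmidt i) = 0" if "l < j" "l \<noteq> i" for l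
      using less(1)[of l i] less(1)[of i l] that less(2) B_sym by (cases "l < i") (auto simp: not_less)
    have "(\<Sum>l<j. B (g j) (gram_schmidt l) * B (gram_schmidt l) (gram_schmidt i)) =
        (\<Sum>l\<in>{i}. B (g j) (gram_schmidt l) * B (gram_schmidt l) (gram_schmidt i))"
      by (rule sum.mono_neutral_right) (use less(2) zero in auto)
    then show ?thesis by simp
  qed
  then have "B (residual j) (gram_schmidt i) = B (g j) (gram_schmidt i) * (1 - B (gram_schmidt i) (gram_schmidt i))"
    using B_residual[OF e_mem, of j i] by (simp add: algebra_simps)
  also have "\<dots> = 0"
    using gram_schmidt_norm[of i] g[of j] B_sym[of "g j" "gram_schmidt i"] by auto
  finally show ?case by (simp add: B_gram_schmidt[OF e_mem])
qed

text \<open>The residual is a multiple of the new vector, and the coefficient of \<open>g k\<close>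
  along that vector is the norm of the residual. If this norm vanishes, \<open>B_null\<close> makes
  both sides vanish.\<close>

lemma gram_schmidt_expansion: "u \<in> S \<Longrightarrow> B (g k) u = (\<Sum>j\<le>k. B (g k) (gram_schmidt j) * B (gram_schmidt j) u)"
proof -
  assume u: "u \<in> S"
  have "B (residual k) u = B (g k) (gram_schmidt k) * B (gram_schmidt k) u"
  proof -
    have "(\<Sum>j<k. B (g k) (gram_schmidt j) * B (gram_schmidt j) (gram_schmidt k)) = 0"
      using gram_schmidt_orthogonal B_sym by (intro sum.neutral) auto
    then have "B (g k) (gram_schmidt k) = B (residual k) (gram_schmidt k)"
      using B_residual[OF e_mem, of k k] by simp
    also have "\<dots> = B (residual k) (residual k) / sqrt (B (residual k) (residual k))"
      using B_gram_schmidt[OF r_mem, of k k] by (simp add: B_sym[of "residual k" "gram_schmidt k"])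
    also have "\<dots> = sqrt (B (residual k) (residual k))" using B_nonneg[OF r_mem] by (simp add: real_div_sqrt)
    finally have s: "B (g k) (gram_schmidt k) = sqrt (B (residual k) (residual k))" .
    show ?thesis
    proof (cases "B (residual k) (residual k) = 0")
      case True
      then show ?thesis using B_null[OF r_mem True u] s by simp
    next
      case False
      then show ?thesis unfolding s B_gram_schmidt[OF u] by simp
    qed
  qed
  then show ?thesis
    using B_residual[OF u, of k] by (simp add: lessThan_Suc_atMost[symmetric])
qed

text \<open>The Gram matrix as a lower triangular matrix times its transpose.\<close>

lemma cholesky: "B (g k) (g l) = (\<Sum>j\<le>k. B (g k) (gram_schmidt j) * B (g l) (gram_schmidt j))"
  using gram_schmidt_expansion[OF g, of k l] by (simp add: B_sym[of _ "g l"])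

lemma gram_schmidt_coeff_zero: "j > l \<Longrightarrow> B (g l) (gram_schmidt j) = 0"
  using gram_schmidt_expansion[OF e_mem, of l j] gram_schmidt_orthogonal[of _ j] B_sym
  by (simp add: sum.neutral)

end

text \<open>The lower triangular factor of the covariance applied to independent standard normal
  variables. Each \<open>W k\<close> is a finite linear combination, so its characteristic function
  is a finite product.\<close>

lemma gaussian_sequence:
  fixes g :: "nat \<Rightarrow> 'a \<Rightarrow> real"
  assumes g: "\<And>k. g k \<in> S"
  obtains W :: "nat \<Rightarrow> (nat \<Rightarrow> real) \<Rightarrow> real" where
    "\<And>k. W k \<in> borel_measurable (PiM UNIV (\<lambda>_. std_normal_distribution))"
    "\<And>(J :: nat set) t. finite J \<Longrightarrow> (CLINT \<omega>|PiM UNIV (\<lambda>_. std_normal_distribution). iexp (\<Sum>k\<in>J. t k * W k \<omega>)) =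
       complex_of_real (exp (- (\<Sum>k\<in>J. \<Sum>l\<in>J. t k * t l * B (g k) (g l)) / 2))"
proof -
  interpret std: real_distribution std_normal_distribution by (rule real_dist_normal_dist)
  let ?\<Omega> = "PiM UNIV (\<lambda>_ :: nat. std_normal_distribution)"
  interpret \<Omega>: prob_space ?\<Omega> by (intro prob_space_PiM) (rule std.prob_space_axioms)
  define A where "A k j = B (g k) (gram_schmidt g j)" for k j
  define W where "W k \<omega> = (\<Sum>j\<le>k. A k j * \<omega> j)" for k and \<omega> :: "nat \<Rightarrow> real"
  have comp[measurable]: "(\<lambda>\<omega>. \<omega> j) \<in> borel_measurable ?\<Omega>" for j
    using measurable_component_singleton[of j UNIV "\<lambda>_. std_normal_distribution"] by simp
  have comp_law: "distr ?\<Omega> borel (\<lambda>\<omega>. \<omega> j) = std_normal_distribution" for j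
  proof -
    have "distr ?\<Omega> borel (\<lambda>\<omega>. \<omega> j) = distr ?\<Omega> std_normal_distribution (\<lambda>\<omega>. \<omega> j)"
      by (rule distr_cong) auto
    also have "\<dots> = std_normal_distribution"
      by (rule distr_PiM_component) (auto intro: std.prob_space_axioms)
    finally show ?thesis .
  qed
  have indep: "\<Omega>.indep_vars (\<lambda>_. borel) (\<lambda>j \<omega>. \<omega> j) UNIV"
    using \<Omega>.indep_vars_compose2[OF indep_vars_PiM_coordinates[OF std.prob_space_axioms UNIV_not_empty], of "\<lambda>_ x. x" "\<lambda>_. borel"] by simp
  show ?thesis
  proof (rule that[of W])
    show "W k \<in> borel_measurable ?\<Omega>" for k unfolding W_def by measurable
    fix J :: "nat set" and t :: "nat \<Rightarrow> real" assume J: "finite J"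
    \<comment> \<open>A common length for all rows in \<open>J\<close>; beyond the diagonal the
      coefficients are zero.\<close>
    define m where "m = Suc (Max (insert 0 J))"
    have m: "k < m" if "k \<in> J" for k using J that by (auto simp: m_def less_Suc_eq_le)
    define s where "s j = (\<Sum>k\<in>J. t k * A k j)" for j
    have W_m: "W k \<omega> = (\<Sum>j<m. A k j * \<omega> j)" if "k \<in> J" for k \<omega>
      unfolding W_def using m[OF that] gram_schmidt_coeff_zero[where g = g and l = k, OF g]
      by (intro sum.mono_neutral_left) (auto simp: A_def)
    have "(\<Sum>k\<in>J. t k * W k \<omega>) = (\<Sum>j<m. s j * \<omega> j)" for \<omega>
    proof -
      have "(\<Sum>k\<in>J. t k * W k \<omega>) = (\<Sum>k\<in>J. \<Sum>j<m. t k * A k j * \<omega> j)"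
        by (intro sum.cong) (auto simp: W_m sum_distrib_left mult_ac)
      also have "\<dots> = (\<Sum>j<m. s j * \<omega> j)" unfolding s_def sum_distrib_right by (rule sum.swap)
      finally show ?thesis .
    qed
    then have "(CLINT \<omega>|?\<Omega>. iexp (\<Sum>k\<in>J. t k * W k \<omega>)) = (CLINT \<omega>|?\<Omega>. iexp (1 * (\<Sum>j<m. s j * \<omega> j)))" by simp
    also have "\<dots> = char (distr ?\<Omega> borel (\<lambda>\<omega>. \<Sum>j<m. s j * \<omega> j)) 1"
      unfolding char_def by (subst integral_distr) auto
    also have "\<dots> = (\<Prod>j<m. char (distr ?\<Omega> borel (\<lambda>\<omega>. s j * \<omega> j)) 1)"
    proof (rule \<Omega>.char_distr_sum)
      have "\<Omega>.indep_vars (\<lambda>_. borel) (\<lambda>j \<omega>. \<omega> j) {..<m}" by (rule \<Omega>.indep_vars_subset[OF indep]) auto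
      then show "\<Omega>.indep_vars (\<lambda>_. borel) (\<lambda>j \<omega>. s j * \<omega> j) {..<m}"
        by (rule \<Omega>.indep_vars_compose2) auto
    qed
    also have "\<dots> = (\<Prod>j<m. complex_of_real (exp (- (s j)\<^sup>2 / 2)))"
    proof (rule prod.cong)
      fix j
      have "char (distr ?\<Omega> borel (\<lambda>\<omega>. s j * \<omega> j)) 1 = char (distr ?\<Omega> borel (\<lambda>\<omega>. \<omega> j)) (s j)"
        unfolding char_def by (subst (1 2) integral_distr) auto
      then show "char (distr ?\<Omega> borel (\<lambda>\<omega>. s j * \<omega> j)) 1 = complex_of_real (exp (- (s j)\<^sup>2 / 2))"
        by (simp add: comp_law char_std_normal_distribution)
    qed simp
    also have "\<dots> = complex_of_real (exp (- (\<Sum>j<m. (s j)\<^sup>2) / 2))"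
      by (simp add: exp_sum[symmetric] sum_negf sum_divide_distrib flip: of_real_prod)
    also have "(\<Sum>j<m. (s j)\<^sup>2) = (\<Sum>k\<in>J. \<Sum>l\<in>J. t k * t l * B (g k) (g l))"
    proof -
      have "(\<Sum>j<m. (s j)\<^sup>2) = (\<Sum>j<m. \<Sum>k\<in>J. \<Sum>l\<in>J. t k * t l * (A k j * A l j))"
        by (simp add: s_def power2_eq_square sum_product mult_ac)
      also have "\<dots> = (\<Sum>k\<in>J. \<Sum>l\<in>J. \<Sum>j<m. t k * t l * (A k j * A l j))"
        by (subst sum.swap) (intro sum.cong refl sum.swap)
      also have "\<dots> = (\<Sum>k\<in>J. \<Sum>l\<in>J. t k * t l * B (g k) (g l))"
      proof (intro sum.cong refl)
        fix k l assume "k \<in> J" "l \<in> J"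
        have "B (g k) (g l) = (\<Sum>j\<le>k. A k j * A l j)" unfolding A_def by (rule cholesky[where g = g, OF g])
        also have "\<dots> = (\<Sum>j<m. A k j * A l j)"
          using m[OF \<open>k \<in> J\<close>] gram_schmidt_coeff_zero[where g = g and l = k, OF g]
          by (intro sum.mono_neutral_left) (auto simp: A_def)
        finally show "(\<Sum>j<m. t k * t l * (A k j * A l j)) = t k * t l * B (g k) (g l)"
          by (simp add: sum_distrib_left)
      qed
      finally show ?thesis .
    qed
    finally show "(CLINT \<omega>|?\<Omega>. iexp (\<Sum>k\<in>J. t k * W k \<omega>)) =
       complex_of_real (exp (- (\<Sum>k\<in>J. \<Sum>l\<in>J. t k * t l * B (g k) (g l)) / 2))" .
  qed
qed

end

subsection \<open>The empirical process\<close>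

locale empirical_sample = shift_continuous_envelope f V \<G> N P + M: prob_space M
  for f V :: "real \<Rightarrow> real" and \<G> :: "(real \<Rightarrow> real) set" and N :: "nat \<Rightarrow> nat" and P :: "real measure" and M :: "'w measure" +
  fixes eps :: "nat \<Rightarrow> 'w \<Rightarrow> real"
  assumes indep: "M.indep_vars (\<lambda>_. borel) eps UNIV" and eps_law: "\<And>i. distr M borel (eps i) = P"
begin

lemma eps_measurable [measurable]: "eps i \<in> borel_measurable M"
  using indep by (auto simp: M.indep_vars_def)

definition sample :: "nat \<Rightarrow> 'w \<Rightarrow> nat \<Rightarrow> real" where "sample n \<omega> = (\<lambda>i\<in>{..<n}. eps i \<omega>)"

lemma sample_measurable: "sample n \<in> measurable M (PiM {..<n} (\<lambda>_. P))"
proof -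
  have "(\<lambda>\<omega>. \<lambda>i\<in>{..<n}. eps i \<omega>) \<in> measurable M (PiM {..<n} (\<lambda>_. borel))" by measurable
  then show ?thesis
    unfolding sample_def by (subst measurable_cong_sets[OF refl sets_PiM_cong]) auto
qed

lemma distr_sample: "n > 0 \<Longrightarrow> distr M (PiM {..<n} (\<lambda>_. P)) (sample n) = PiM {..<n} (\<lambda>_. P)"
proof -
  assume n: "n > 0"
  have "M.indep_vars (\<lambda>_. borel) eps {..<n}" by (rule M.indep_vars_subset[OF indep]) auto
  then have "distr M (PiM {..<n} (\<lambda>_. borel)) (\<lambda>x. \<lambda>i\<in>{..<n}. eps i x) = PiM {..<n} (\<lambda>i. distr M borel (eps i))"
    by (subst (asm) M.indep_vars_iff_distr_eq_PiM) (use n in auto)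
  moreover have "distr M (PiM {..<n} (\<lambda>_. P)) (sample n) = distr M (PiM {..<n} (\<lambda>_. borel)) (\<lambda>x. \<lambda>i\<in>{..<n}. eps i x)"
    by (rule distr_cong) (auto simp: sample_def intro!: sets_PiM_cong)
  ultimately show ?thesis by (simp add: eps_law)
qed

lemma AE_sample:
  assumes "n > 0" "AE x in PiM {..<n} (\<lambda>_. P). Q x" shows "AE \<omega> in M. Q (sample n \<omega>)"
  by (rule AE_distrD[OF sample_measurable]) (subst distr_sample[OF assms(1)], rule assms(2))

lemma integral_sample:
  fixes U :: "(nat \<Rightarrow> real) \<Rightarrow> real"
  assumes n: "n > 0" and U: "integrable (PiM {..<n} (\<lambda>_. P)) U"
  shows "integrable M (\<lambda>\<omega>. U (sample n \<omega>))" "(LINT \<omega>|M. U (sample n \<omega>)) = (LINT x|PiM {..<n} (\<lambda>_. P). U x)"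
proof -
  have m: "U \<in> borel_measurable (PiM {..<n} (\<lambda>_. P))" using U by (rule borel_measurable_integrable)
  show "integrable M (\<lambda>\<omega>. U (sample n \<omega>))"
    using integrable_distr_eq[OF sample_measurable m] U by (simp add: distr_sample[OF n])
  show "(LINT \<omega>|M. U (sample n \<omega>)) = (LINT x|PiM {..<n} (\<lambda>_. P). U x)"
    using integral_distr[OF sample_measurable m] by (simp add: distr_sample[OF n])
qed

lemma sample_app [simp]: "i < n \<Longrightarrow> sample n \<omega> i = eps i \<omega>"
  by (simp add: sample_def)

definition emp :: "nat \<Rightarrow> (real \<Rightarrow> real) \<Rightarrow> 'w \<Rightarrow> real" where
  "emp n g \<omega> = (\<Sum>i<n. g (eps i \<omega>) - (LINT y|P. g y)) / sqrt (real n)"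

lemma G_integrable: "g \<in> \<G> \<Longrightarrow> integrable P g"
  unfolding P_eq by (rule integrable_law_of_le_V[OF admissible_f G_meas G_le_1_V])

lemma G_measurable_emp: "g \<in> \<G> \<Longrightarrow> emp n g \<in> borel_measurable M"
proof -
  assume "g \<in> \<G>"
  then have [measurable]: "g \<in> borel_measurable borel" by (rule G_meas)
  show ?thesis unfolding emp_def by measurable
qed

lemma emp_equicontinuous:
  assumes e: "e > 0"
  obtains d n0 where "d > 0" "n0 > 0" "\<And>n. n \<ge> n0 \<Longrightarrow>
    (\<exists>U. integrable M U \<and> (\<forall>\<omega>. U \<omega> \<ge> 0) \<and> (LINT \<omega>|M. U \<omega>) \<le> e \<and>
    (AE \<omega> in M. \<forall>g\<in>\<G>. \<forall>g'\<in>\<G>. L2_seminorm P (\<lambda>y. g y - g' y) < d \<longrightarrow> \<bar>emp n g \<omega> - emp n g' \<omega>\<bar> \<le> U \<omega>))"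
proof -
  obtain d \<eta> n0 where d: "d > 0" and \<eta>: "\<eta> > 0" and n0: "n0 > 0" and ae: "\<And>n q. n \<ge> n0 \<Longrightarrow> admissible q \<Longrightarrow> env_dist q \<le> \<eta> \<Longrightarrow>
    (\<exists>U. integrable (PiM {..<n} (\<lambda>_. law q)) U \<and> (\<forall>x. U x \<ge> 0) \<and>
    (AE x in PiM {..<n} (\<lambda>_. law q). \<forall>h\<in>L2_differences P d \<G>. \<bar>\<Sum>i<n. h (x i) - (LINT y|law q. h y)\<bar> \<le> sqrt (real n) * U x) \<and>
    (LINT x|PiM {..<n} (\<lambda>_. law q). U x) \<le> e)"
    using asymptotic_equicontinuity[OF e] by blast
  have ef: "env_dist f \<le> \<eta>" using \<eta> env_dist_f by simp
  show ?thesis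
  proof (rule that[OF d n0])
    fix n assume n: "n \<ge> n0"
    then have n_pos: "n > 0" using n0 by simp
    obtain U where U: "integrable (PiM {..<n} (\<lambda>_. P)) U" "\<forall>x. U x \<ge> 0"
      "AE x in PiM {..<n} (\<lambda>_. P). \<forall>h\<in>L2_differences P d \<G>. \<bar>\<Sum>i<n. h (x i) - (LINT y|P. h y)\<bar> \<le> sqrt (real n) * U x"
      "(LINT x|PiM {..<n} (\<lambda>_. P). U x) \<le> e"
      using ae[OF n admissible_f ef] unfolding P_eq[symmetric] by blast
    have "AE \<omega> in M. \<forall>h\<in>L2_differences P d \<G>. \<bar>\<Sum>i<n. h (sample n \<omega> i) - (LINT y|P. h y)\<bar> \<le> sqrt (real n) * U (sample n \<omega>)"
      by (rule AE_sample[OF n_pos U(3)])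
    then have "AE \<omega> in M. \<forall>g\<in>\<G>. \<forall>g'\<in>\<G>. L2_seminorm P (\<lambda>y. g y - g' y) < d \<longrightarrow> \<bar>emp n g \<omega> - emp n g' \<omega>\<bar> \<le> U (sample n \<omega>)"
    proof eventually_elim
      fix \<omega> assume *: "\<forall>h\<in>L2_differences P d \<G>. \<bar>\<Sum>i<n. h (sample n \<omega> i) - (LINT y|P. h y)\<bar> \<le> sqrt (real n) * U (sample n \<omega>)"
      show "\<forall>g\<in>\<G>. \<forall>g'\<in>\<G>. L2_seminorm P (\<lambda>y. g y - g' y) < d \<longrightarrow> \<bar>emp n g \<omega> - emp n g' \<omega>\<bar> \<le> U (sample n \<omega>)"
      proof (intro ballI impI)
        fix g g' assume g: "g \<in> \<G>" "g' \<in> \<G>" and "L2_seminorm P (\<lambda>y. g y - g' y) < d"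
        then have "(\<lambda>y. g y - g' y) \<in> L2_differences P d \<G>" unfolding L2_differences_def by blast
        from bspec[OF * this] have "\<bar>\<Sum>i<n. g (sample n \<omega> i) - g' (sample n \<omega> i) - (LINT y|P. g y - g' y)\<bar> \<le> sqrt (real n) * U (sample n \<omega>)" .
        moreover have "(\<Sum>i<n. g (sample n \<omega> i) - g' (sample n \<omega> i) - (LINT y|P. g y - g' y)) =
            (\<Sum>i<n. g (eps i \<omega>) - (LINT y|P. g y)) - (\<Sum>i<n. g' (eps i \<omega>) - (LINT y|P. g' y))"
          using G_integrable[OF g(1)] G_integrable[OF g(2)]
          by (subst sum_subtractf[symmetric], intro sum.cong) auto
        ultimately have "\<bar>(\<Sum>i<n. g (eps i \<omega>) - (LINT y|P. g y)) - (\<Sum>i<n. g' (eps i \<omega>) - (LINT y|P. g' y))\<bar> / sqrt (real n) \<le> U (sample n \<omega>)"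
          using n_pos by (simp add: divide_le_eq mult.commute)
        then show "\<bar>emp n g \<omega> - emp n g' \<omega>\<bar> \<le> U (sample n \<omega>)"
          unfolding emp_def diff_divide_distrib[symmetric] using n_pos by (simp add: abs_divide)
      qed
    qed
    then show "\<exists>U. integrable M U \<and> (\<forall>\<omega>. U \<omega> \<ge> 0) \<and> (LINT \<omega>|M. U \<omega>) \<le> e \<and>
      (AE \<omega> in M. \<forall>g\<in>\<G>. \<forall>g'\<in>\<G>. L2_seminorm P (\<lambda>y. g y - g' y) < d \<longrightarrow> \<bar>emp n g \<omega> - emp n g' \<omega>\<bar> \<le> U \<omega>)"
      using U integral_sample[OF n_pos U(1)] by (intro exI[of _ "\<lambda>\<omega>. U (sample n \<omega>)"]) auto
  qed
qed

definition square_integrable :: "(real \<Rightarrow> real) set" where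
  "square_integrable = {g \<in> borel_measurable borel. integrable P (\<lambda>y. (g y)\<^sup>2)}"

lemma G_square_integrable: "\<G> \<subseteq> square_integrable"
proof
  fix g assume g: "g \<in> \<G>"
  note [measurable] = G_meas[OF g]
  have "integrable P (\<lambda>y. (g y)\<^sup>2)"
  proof (rule Bochner_Integration.integrable_bound[OF V_sq])
    show "AE y in P. norm ((g y)\<^sup>2) \<le> norm ((V y)\<^sup>2)"
      using G_le_V[OF g] by (intro AE_I2) (auto simp: abs_le_square_iff[symmetric] intro: order_trans[OF _ abs_ge_self])
  qed measurable
  then show "g \<in> square_integrable" using G_meas[OF g] by (simp add: square_integrable_def)
qed

lemma integrable_product:
  assumes "g \<in> square_integrable" "h \<in> square_integrable"
  shows "integrable P (\<lambda>y. g y * h y)"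
proof (rule Bochner_Integration.integrable_bound[of _ "\<lambda>y. (g y)\<^sup>2 + (h y)\<^sup>2"])
  show "integrable P (\<lambda>y. (g y)\<^sup>2 + (h y)\<^sup>2)" using assms by (auto simp: square_integrable_def)
  show "AE y in P. norm (g y * h y) \<le> norm ((g y)\<^sup>2 + (h y)\<^sup>2)"
  proof (rule AE_I2)
    fix y
    have "0 \<le> (\<bar>g y\<bar> - \<bar>h y\<bar>)\<^sup>2 + (g y)\<^sup>2 + (h y)\<^sup>2" by simp
    then have "2 * (\<bar>g y\<bar> * \<bar>h y\<bar>) \<le> 2 * ((g y)\<^sup>2 + (h y)\<^sup>2)" by (simp add: power2_diff)
    then show "norm (g y * h y) \<le> norm ((g y)\<^sup>2 + (h y)\<^sup>2)" by (simp add: abs_mult)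
  qed
qed (use assms in \<open>auto simp: square_integrable_def\<close>)

lemma square_integrable_imp_integrable: "g \<in> square_integrable \<Longrightarrow> integrable P g"
  unfolding square_integrable_def by (auto intro: P.square_integrable_imp_integrable)

sublocale semi_inner_product square_integrable "bridge_cov P"
proof
  fix g h :: "real \<Rightarrow> real" and a c :: real
  show sym: "bridge_cov P g h = bridge_cov P h g" for g h by (simp add: bridge_cov_def mult.commute)
  show "(\<lambda>_. 0) \<in> square_integrable" by (simp add: square_integrable_def)
  assume g: "g \<in> square_integrable"
  show "bridge_cov P g g \<ge> 0"
  proof -
    have "bridge_cov P g g = P.variance g"
      using P.variance_eq[OF square_integrable_imp_integrable[OF g]] g
      by (simp add: bridge_cov_def square_integrable_def power2_eq_square)
    then show ?thesis by (simp add: P.variance_positive)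
  qed
  assume h: "h \<in> square_integrable"
  have "integrable P (\<lambda>x. a\<^sup>2 * (g x)\<^sup>2 + 2 * a * c * (g x * h x) + c\<^sup>2 * (h x)\<^sup>2)"
    using g h integrable_product[OF g h] by (auto simp: square_integrable_def)
  moreover have "(\<lambda>x. a * g x + c * h x) \<in> borel_measurable borel"
    using g h by (auto simp: square_integrable_def intro!: borel_measurable_add borel_measurable_times)
  ultimately show "(\<lambda>x. a * g x + c * h x) \<in> square_integrable"
    unfolding square_integrable_def by (simp add: power2_sum power_mult_distrib algebra_simps)
  fix u assume u: "u \<in> square_integrable"
  show "bridge_cov P (\<lambda>x. a * g x + c * h x) u = a * bridge_cov P g u + c * bridge_cov P h u"
    unfolding bridge_cov_def
    using integrable_product[OF g u] integrable_product[OF h u] square_integrable_imp_integrable[OF g] square_integrable_imp_integrable[OF h]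
    by (simp add: distrib_right mult.assoc algebra_simps)
qed

lemma bridge_cov_double_sum:
  assumes I: "finite I" "I \<subseteq> square_integrable"
  shows "bridge_cov P (\<lambda>x. \<Sum>g\<in>I. t g * g x) (\<lambda>x. \<Sum>g\<in>I. t g * g x) = (\<Sum>g\<in>I. \<Sum>h\<in>I. t g * t h * bridge_cov P g h)"
proof -
  have mem: "(\<lambda>x. \<Sum>g\<in>I. t g * g x) \<in> square_integrable" using I by (intro sum_mem[of I "\<lambda>g. g"]) auto
  have "bridge_cov P (\<lambda>x. \<Sum>g\<in>I. t g * g x) (\<lambda>x. \<Sum>g\<in>I. t g * g x) = (\<Sum>g\<in>I. t g * bridge_cov P g (\<lambda>x. \<Sum>g\<in>I. t g * g x))"
    using I mem by (intro B_sum[of I "\<lambda>g. g"]) auto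
  also have "\<dots> = (\<Sum>g\<in>I. t g * (\<Sum>h\<in>I. t h * bridge_cov P h g))"
  proof (rule sum.cong)
    fix g assume "g \<in> I"
    then show "t g * bridge_cov P g (\<lambda>x. \<Sum>g\<in>I. t g * g x) = t g * (\<Sum>h\<in>I. t h * bridge_cov P h g)"
      unfolding B_sym[of g] using I by (subst B_sum[of I "\<lambda>g. g"]) auto
  qed simp
  also have "\<dots> = (\<Sum>g\<in>I. \<Sum>h\<in>I. t g * t h * bridge_cov P g h)"
    by (simp add: sum_distrib_left mult.assoc B_sym)
  finally show ?thesis .
qed

text \<open>The central limit theorem normalizes by the standard deviation; evaluating the
  characteristic functions at \<sigma> undoes this. Variance zero is excluded there and treated
  separately, where the process vanishes almost surely.\<close>

lemma emp_char_tendsto: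
  assumes u: "u \<in> square_integrable"
  shows "(\<lambda>n. CLINT \<omega>|M. iexp (emp n u \<omega>)) \<longlonglongrightarrow> complex_of_real (exp (- bridge_cov P u u / 2))"
proof -
  define v where "v = bridge_cov P u u"
  define w where "w x = u x - (LINT y|P. u y)" for x
  have u_m[measurable]: "u \<in> borel_measurable borel" and u_sq: "integrable P (\<lambda>y. (u y)\<^sup>2)" using u by (auto simp: square_integrable_def)
  have u_int: "integrable P u" by (rule square_integrable_imp_integrable[OF u])
  have w_m[measurable]: "w \<in> borel_measurable borel" unfolding w_def by measurable
  have Pu: "P.prob UNIV = 1" using P.prob_space by simp
  have w_mean: "(LINT y|P. w y) = 0" unfolding w_def using u_int Pu by simp
  have w_sq: "integrable P (\<lambda>y. (w y)\<^sup>2)"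
    unfolding w_def power2_diff using u_int u_sq by auto
  have w_var: "(LINT y|P. (w y)\<^sup>2) = v"
    using P.variance_eq[OF u_int u_sq] by (simp add: w_def v_def bridge_cov_def power2_eq_square)
  have v0: "v \<ge> 0" using w_var[symmetric] by (simp add: Bochner_Integration.integral_nonneg)
  have transfer: "integrable M (\<lambda>\<omega>. h (eps i \<omega>)) = integrable P h" "(LINT \<omega>|M. h (eps i \<omega>)) = (LINT y|P. h y)"
    if [measurable]: "h \<in> borel_measurable borel" for h :: "real \<Rightarrow> real" and i
    using integrable_distr_eq[OF eps_measurable[of i], of h] integral_distr[OF eps_measurable[of i], of h] by (simp_all add: eps_law)
  have emp_eq: "emp n u \<omega> = (\<Sum>i<n. w (eps i \<omega>)) / sqrt (real n)" for n \<omega>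
    by (simp add: emp_def w_def)
  show ?thesis
  proof (cases "v = 0")
    case True
    have "AE y in P. (w y)\<^sup>2 = 0" using integral_nonneg_eq_0_iff_AE[OF w_sq] w_var True by simp
    then have "AE y in P. w y = 0" by simp
    then have "AE \<omega> in M. w (eps i \<omega>) = 0" for i
      unfolding eps_law[of i, symmetric] by (subst (asm) AE_distr_iff) auto
    then have "AE \<omega> in M. \<forall>i. w (eps i \<omega>) = 0" by (subst AE_all_countable) auto
    then have "(CLINT \<omega>|M. iexp (emp n u \<omega>)) = (CLINT \<omega>|M. 1)" for n
      unfolding emp_eq by (intro integral_cong_AE) auto
    then show ?thesis using True by (simp add: v_def M.prob_space)
  next
    case False
    then have v_pos: "v > 0" using v0 by simp
    define \<sigma> where "\<sigma> = sqrt v"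
    have \<sigma>: "\<sigma> > 0" "\<sigma>\<^sup>2 = v" using v_pos by (auto simp: \<sigma>_def)
    have ind: "M.indep_vars (\<lambda>_. borel) (\<lambda>i \<omega>. w (eps i \<omega>)) UNIV"
      by (rule M.indep_vars_compose2[OF indep]) auto
    have "weak_conv_m (\<lambda>n. distr M borel (\<lambda>\<omega>. (\<Sum>i<n. w (eps i \<omega>)) / sqrt (real n * \<sigma>\<^sup>2))) std_normal_distribution"
    proof (rule M.central_limit_theorem_zero_mean[OF ind _ \<sigma>(1), where \<mu> = "distr P borel w"])
      show "M.expectation (\<lambda>\<omega>. w (eps i \<omega>)) = 0" for i using transfer(2)[OF w_m, of i] w_mean by simp
      show "integrable M (\<lambda>\<omega>. (w (eps i \<omega>))\<^sup>2)" for i using transfer(1)[of "\<lambda>y. (w y)\<^sup>2" i] w_sq by simp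
      show "M.variance (\<lambda>\<omega>. w (eps i \<omega>)) = \<sigma>\<^sup>2" for i
        using transfer(2)[of w i] transfer(2)[of "\<lambda>y. (w y)\<^sup>2" i] w_mean w_var \<sigma> by simp
      show "distr M borel (\<lambda>\<omega>. w (eps i \<omega>)) = distr P borel w" for i
        using distr_distr[OF w_m eps_measurable[of i]] by (simp add: eps_law comp_def)
    qed
    then have "(\<lambda>n. char (distr M borel (\<lambda>\<omega>. (\<Sum>i<n. w (eps i \<omega>)) / sqrt (real n * \<sigma>\<^sup>2))) \<sigma>) \<longlonglongrightarrow> char std_normal_distribution \<sigma>"
      by (intro levy_continuity1 real_dist_normal_dist M.real_distribution_distr) measurable
    moreover have "char (distr M borel (\<lambda>\<omega>. (\<Sum>i<n. w (eps i \<omega>)) / sqrt (real n * \<sigma>\<^sup>2))) \<sigma> = (CLINT \<omega>|M. iexp (emp n u \<omega>))" for n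
    proof -
      have "char (distr M borel (\<lambda>\<omega>. (\<Sum>i<n. w (eps i \<omega>)) / sqrt (real n * \<sigma>\<^sup>2))) \<sigma> =
          (CLINT \<omega>|M. iexp (\<sigma> * ((\<Sum>i<n. w (eps i \<omega>)) / sqrt (real n * \<sigma>\<^sup>2))))"
        unfolding char_def by (subst integral_distr) auto
      moreover have "\<sigma> * ((\<Sum>i<n. w (eps i \<omega>)) / sqrt (real n * \<sigma>\<^sup>2)) = emp n u \<omega>" for \<omega>
        unfolding emp_eq using \<sigma>(1) by (simp add: real_sqrt_mult)
      ultimately show ?thesis by (simp only:)
    qed
    ultimately show ?thesis using \<sigma>(2) by (simp add: char_std_normal_distribution v_def)
  qed
qed

text \<open>The Cramer-Wold reduction: a linear combination of the empirical process is the
  empirical process at one square integrable function.\<close>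

lemma emp_char_sum_tendsto:
  assumes I: "finite I" "I \<subseteq> square_integrable"
  shows "(\<lambda>n. CLINT \<omega>|M. iexp (\<Sum>g\<in>I. t g * emp n g \<omega>)) \<longlonglongrightarrow>
    complex_of_real (exp (- (\<Sum>g\<in>I. \<Sum>h\<in>I. t g * t h * bridge_cov P g h) / 2))"
proof -
  let ?u = "\<lambda>x. \<Sum>g\<in>I. t g * g x"
  have mem: "?u \<in> square_integrable" using I by (intro sum_mem[of I "\<lambda>g. g"]) auto
  have int: "integrable P g" if "g \<in> I" for g using I that square_integrable_imp_integrable by auto
  have "(LINT y|P. ?u y) = (\<Sum>g\<in>I. t g * (LINT y|P. g y))" using int by simp
  then have "emp n ?u \<omega> = (\<Sum>g\<in>I. t g * emp n g \<omega>)" for n \<omega>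
  proof -
    have "(\<Sum>i<n. (\<Sum>g\<in>I. t g * g (eps i \<omega>)) - (\<Sum>g\<in>I. t g * (LINT y|P. g y))) =
        (\<Sum>i<n. \<Sum>g\<in>I. t g * (g (eps i \<omega>) - (LINT y|P. g y)))"
      by (simp add: sum_subtractf right_diff_distrib)
    also have "\<dots> = (\<Sum>g\<in>I. t g * (\<Sum>i<n. g (eps i \<omega>) - (LINT y|P. g y)))"
      by (subst sum.swap) (simp add: sum_distrib_left)
    finally show ?thesis
      unfolding emp_def \<open>(LINT y|P. ?u y) = _\<close> by (simp only: sum_divide_distrib[of _ I] times_divide_eq_right)
  qed
  then show ?thesis using emp_char_tendsto[OF mem] bridge_cov_double_sum[OF I, of t] by simp
qed

end

subsection \<open>Weak convergence in metric spaces\<close>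

text \<open>The bounds by \<open>B\<close> guarantee that the infimum is taken over a nonempty set
  bounded below; \<open>Inf\<close> on the reals is monotone only under this proviso.\<close>

lemma (in prob_space) outer_expectation_mono:
  assumes "AE \<omega> in M. T \<omega> \<le> T' \<omega>" "AE \<omega> in M. - B \<le> T \<omega>" "AE \<omega> in M. T' \<omega> \<le> B"
  shows "outer_expectation M T \<le> outer_expectation M T'"
  unfolding outer_expectation_def
proof (rule cInf_superset_mono)
  show "{LINT \<omega>|M. U \<omega> |U. integrable M U \<and> (AE \<omega> in M. T' \<omega> \<le> U \<omega>)} \<noteq> {}"
    using assms(3) by (auto intro!: exI[of _ "\<lambda>_. B"])
  show "bdd_below {LINT \<omega>|M. U \<omega> |U. integrable M U \<and> (AE \<omega> in M. T \<omega> \<le> U \<omega>)}"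
  proof (rule bdd_belowI[of _ "- B"], clarify)
    fix U assume U: "integrable M U" "AE \<omega> in M. T \<omega> \<le> U \<omega>"
    have "(LINT \<omega>|M. - B) \<le> (LINT \<omega>|M. U \<omega>)"
      by (rule integral_mono_AE) (use U assms(2) in auto)
    then show "- B \<le> (LINT \<omega>|M. U \<omega>)" by (simp add: prob_space)
  qed
  show "{LINT \<omega>|M. U \<omega> |U. integrable M U \<and> (AE \<omega> in M. T' \<omega> \<le> U \<omega>)} \<subseteq> {LINT \<omega>|M. U \<omega> |U. integrable M U \<and> (AE \<omega> in M. T \<omega> \<le> U \<omega>)}"
  proof clarify
    fix U assume U: "integrable M U" "AE \<omega> in M. T' \<omega> \<le> U \<omega>"
    have "AE \<omega> in M. T \<omega> \<le> U \<omega>" using U(2) assms(1) by eventually_elim simp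
    then show "\<exists>U'. (LINT \<omega>|M. U \<omega>) = (LINT \<omega>|M. U' \<omega>) \<and> integrable M U' \<and> (AE \<omega> in M. T \<omega> \<le> U' \<omega>)"
      using U by blast
  qed
qed

text \<open>Links the outer expectation of a possibly nonmeasurable \<open>T\<close> with an
  ordinary one: every integrable majorant of \<open>T\<close> lies above S - U, and S + U is such a
  majorant.\<close>

lemma (in prob_space) outer_expectation_close:
  assumes S: "integrable M S" and U: "integrable M U" and close: "AE \<omega> in M. \<bar>T \<omega> - S \<omega>\<bar> \<le> U \<omega>"
  shows "\<bar>outer_expectation M T - (LINT \<omega>|M. S \<omega>)\<bar> \<le> (LINT \<omega>|M. U \<omega>)"
proof -
  let ?A = "{LINT \<omega>|M. W \<omega> |W. integrable M W \<and> (AE \<omega> in M. T \<omega> \<le> W \<omega>)}"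
  have lower: "(LINT \<omega>|M. S \<omega>) - (LINT \<omega>|M. U \<omega>) \<le> a" if h: "a \<in> ?A" for a
  proof -
    obtain W where W: "a = (LINT \<omega>|M. W \<omega>)" "integrable M W" "AE \<omega> in M. T \<omega> \<le> W \<omega>" using h by blast
    have "(LINT \<omega>|M. S \<omega> - U \<omega>) \<le> (LINT \<omega>|M. W \<omega>)"
    proof (rule integral_mono_AE)
      show "AE \<omega> in M. S \<omega> - U \<omega> \<le> W \<omega>" using W(3) close by eventually_elim auto
    qed (use S U W in auto)
    then show ?thesis using W S U by simp
  qed
  have mem: "(LINT \<omega>|M. S \<omega> + U \<omega>) \<in> ?A"
  proof -
    have "AE \<omega> in M. T \<omega> \<le> S \<omega> + U \<omega>" using close by eventually_elim auto
    then show ?thesis using S U by blast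
  qed
  have "(LINT \<omega>|M. S \<omega>) - (LINT \<omega>|M. U \<omega>) \<le> Inf ?A" by (rule cInf_greatest) (use mem lower in blast)+
  moreover have "Inf ?A \<le> (LINT \<omega>|M. S \<omega> + U \<omega>)" by (rule cInf_lower[OF mem bdd_belowI]) (rule lower)
  ultimately show ?thesis using S U by (simp add: outer_expectation_def abs_le_iff)
qed

definition lipschitz_bounded :: "'b metric \<Rightarrow> ('b \<Rightarrow> real) \<Rightarrow> real \<Rightarrow> real \<Rightarrow> bool" where
  "lipschitz_bounded m h C B \<longleftrightarrow> C \<ge> 0 \<and> (\<forall>z\<in>mspace m. \<bar>h z\<bar> \<le> B) \<and>
     (\<forall>z\<in>mspace m. \<forall>w\<in>mspace m. \<bar>h z - h w\<bar> \<le> C * mdist m z w)"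

lemma openin_mtopology_of:
  "openin (mtopology_of m) U \<longleftrightarrow> U \<subseteq> mspace m \<and> (\<forall>x\<in>U. \<exists>r>0. \<forall>y\<in>mspace m. mdist m x y < r \<longrightarrow> y \<in> U)"
proof -
  interpret Metric_space "mspace m" "mdist m" by simp
  show ?thesis unfolding mtopology_of_def openin_mtopology subset_iff in_mball by blast
qed

lemma borel_measurable_of_continuous_map:
  assumes "space L = mspace m" "sets L = borel_sets_of m" "continuous_map (mtopology_of m) euclideanreal h"
  shows "h \<in> borel_measurable L"
proof (rule borel_measurableI)
  fix S :: "real set" assume "open S"
  then have "openin (mtopology_of m) {z \<in> topspace (mtopology_of m). h z \<in> S}"
    using assms(3) by (intro openin_continuous_map_preimage) auto
  then have "{z \<in> mspace m. h z \<in> S} \<in> borel_sets_of m"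
    unfolding borel_sets_of_def by (intro sigma_sets.Basic) simp
  moreover have "h -` S \<inter> space L = {z \<in> mspace m. h z \<in> S}" using assms(1) by auto
  ultimately show "h -` S \<inter> space L \<in> sets L" using assms(2) by simp
qed

lemma continuous_map_metric_real:
  assumes "continuous_map (mtopology_of m) euclideanreal h" "z \<in> mspace m" "e > 0"
  obtains r where "r > 0" "\<And>w. w \<in> mspace m \<Longrightarrow> mdist m z w < r \<Longrightarrow> \<bar>h w - h z\<bar> < e"
proof -
  have "openin (mtopology_of m) {w \<in> topspace (mtopology_of m). h w \<in> ball (h z) e}"
    using assms(1) by (intro openin_continuous_map_preimage) auto
  then obtain r where "r > 0" "\<forall>y\<in>mspace m. mdist m z y < r \<longrightarrow> h y \<in> ball (h z) e"
    unfolding openin_mtopology_of using assms by auto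
  then show ?thesis using that by (auto simp: dist_real_def abs_minus_commute)
qed

lemma continuous_map_lipschitz:
  assumes "lipschitz_bounded m h C B"
  shows "continuous_map (mtopology_of m) euclideanreal h"
proof (rule continuous_map[THEN iffD2], intro conjI allI impI)
  fix U assume "openin euclideanreal U"
  then have U: "open U" by simp
  show "openin (mtopology_of m) {z \<in> topspace (mtopology_of m). h z \<in> U}"
    unfolding openin_mtopology_of
  proof (intro conjI ballI)
    fix z assume z: "z \<in> {z \<in> topspace (mtopology_of m). h z \<in> U}"
    then obtain e where e: "e > 0" "ball (h z) e \<subseteq> U" using U by (auto simp: open_contains_ball)
    have C: "C \<ge> 0" using assms by (simp add: lipschitz_bounded_def)
    show "\<exists>r>0. \<forall>y\<in>mspace m. mdist m z y < r \<longrightarrow> y \<in> {z \<in> topspace (mtopology_of m). h z \<in> U}"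
    proof (intro exI conjI ballI impI)
      show "e / (C + 1) > 0" using e C by simp
      fix y assume y: "y \<in> mspace m" "mdist m z y < e / (C + 1)"
      have "\<bar>h z - h y\<bar> \<le> C * mdist m z y" using assms y z by (simp add: lipschitz_bounded_def)
      also have "\<dots> \<le> (C + 1) * mdist m z y" by (simp add: mult_right_mono)
      also have "\<dots> < e" using y C by (simp add: field_simps)
      finally have "h y \<in> ball (h z) e" by (simp add: dist_real_def)
      then show "y \<in> {z \<in> topspace (mtopology_of m). h z \<in> U}" using e y by auto
    qed
  qed auto
qed simp

text \<open>The infimal convolution of \<open>h\<close> with \<open>j\<close> times the distance. It
  is \<open>j\<close>-Lipschitz, lies below \<open>h\<close>, and keeps the bound
  \<open>B\<close>.\<close>

lemma lipschitz_approximation_below: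
  fixes h :: "'b \<Rightarrow> real"
  assumes cont: "continuous_map (mtopology_of m) euclideanreal h" and B: "\<And>z. z \<in> mspace m \<Longrightarrow> \<bar>h z\<bar> \<le> B"
  obtains hl where "\<And>j. lipschitz_bounded m (hl j) (real j) B" "\<And>j z. z \<in> mspace m \<Longrightarrow> hl j z \<le> h z"
    "\<And>z. z \<in> mspace m \<Longrightarrow> (\<lambda>j. hl j z) \<longlonglongrightarrow> h z"
proof -
  define hl where "hl j z = (INF w\<in>mspace m. h w + real j * mdist m z w)" for j :: nat and z
  have bdd: "bdd_below ((\<lambda>w. h w + real j * mdist m z w) ` mspace m)" for j z
  proof (rule bdd_belowI2[of _ "- B"])
    fix w assume "w \<in> mspace m"
    then show "- B \<le> h w + real j * mdist m z w" using B[of w] by (intro add_increasing2) (auto simp: abs_le_iff)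
  qed
  have low: "hl j z \<le> h w + real j * mdist m z w" if "w \<in> mspace m" for j z w
    unfolding hl_def by (rule cINF_lower[OF bdd that])
  have up: "a \<le> hl j z" if "z \<in> mspace m" "\<And>w. w \<in> mspace m \<Longrightarrow> a \<le> h w + real j * mdist m z w" for a j z
    unfolding hl_def by (rule cINF_greatest) (use that in auto)
  have le: "hl j z \<le> h z" if "z \<in> mspace m" for j z using low[OF that, of j z] mdist_zero[OF that that] by simp
  have ge: "- B \<le> hl j z" if z: "z \<in> mspace m" for j z
  proof (rule up[OF z])
    fix w assume "w \<in> mspace m"
    then show "- B \<le> h w + real j * mdist m z w" using B[of w] by (intro add_increasing2) (auto simp: abs_le_iff)
  qed
  have lip: "hl j z \<le> hl j z' + real j * mdist m z z'" if z: "z \<in> mspace m" "z' \<in> mspace m" for j z z'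
  proof -
    have "hl j z - real j * mdist m z z' \<le> hl j z'"
    proof (rule up[OF z(2)])
      fix w assume w: "w \<in> mspace m"
      have "real j * mdist m z w \<le> real j * (mdist m z z' + mdist m z' w)"
        using z w by (intro mult_left_mono mdist_triangle) auto
      then show "hl j z - real j * mdist m z z' \<le> h w + real j * mdist m z' w"
        using low[OF w, of j z] by (simp add: algebra_simps)
    qed
    then show ?thesis by simp
  qed
  show ?thesis
  proof
    show "lipschitz_bounded m (hl j) (real j) B" for j
      unfolding lipschitz_bounded_def
    proof (intro conjI ballI)
      fix z assume z: "z \<in> mspace m"
      show "\<bar>hl j z\<bar> \<le> B" using le[OF z, of j] ge[OF z, of j] B[OF z] by simp
      fix w assume w: "w \<in> mspace m"
      show "\<bar>hl j z - hl j w\<bar> \<le> real j * mdist m z w"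
        using lip[OF z w, of j] lip[OF w z, of j] by (simp add: abs_le_iff mdist_commute[of m w z])
    qed simp
    show "\<And>j z. z \<in> mspace m \<Longrightarrow> hl j z \<le> h z" by (rule le)
    fix z assume z: "z \<in> mspace m"
    show "(\<lambda>j. hl j z) \<longlonglongrightarrow> h z"
    proof (rule LIMSEQ_I)
      fix e :: real assume e: "e > 0"
      obtain r where r: "r > 0" "\<And>w. w \<in> mspace m \<Longrightarrow> mdist m z w < r \<Longrightarrow> \<bar>h w - h z\<bar> < e / 2"
        using continuous_map_metric_real[OF cont z, of "e / 2"] e by auto
      \<comment> \<open>From here on the penalty outside the ball of radius \<open>r\<close> exceeds
        2 B, hence any possible gain of \<open>h\<close> there.\<close>
      obtain j0 :: nat where j0: "2 * B / r \<le> real j0" using real_arch_simple by blast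
      show "\<exists>no. \<forall>n\<ge>no. norm (hl n z - h z) < e"
      proof (intro exI allI impI)
        fix j assume j: "j \<ge> j0"
        have "h z - e / 2 \<le> hl j z"
        proof (rule up[OF z])
          fix w assume w: "w \<in> mspace m"
          show "h z - e / 2 \<le> h w + real j * mdist m z w"
          proof (cases "mdist m z w < r")
            case True
            have "h z - e / 2 \<le> h w" using r(2)[OF w True] by linarith
            then show ?thesis by (intro add_increasing2) auto
          next
            case False
            have "2 * B \<le> real j0 * r" using j0 r by (simp add: divide_le_eq)
            also have "\<dots> \<le> real j * mdist m z w" using j r False by (intro mult_mono) auto
            finally show ?thesis using B[OF z] B[OF w] e by simp
          qed
        qed
        then show "norm (hl j z - h z) < e" using le[OF z, of j] e by simp
      qed
    qed
  qed
qed

lemma weakly_converges_outer_lipschitz: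
  fixes X :: "nat \<Rightarrow> 'w \<Rightarrow> 'b"
  assumes M: "prob_space M" and L: "prob_space L" "space L = mspace m" "sets L = borel_sets_of m"
    and X: "\<forall>\<^sub>F n in sequentially. AE \<omega> in M. X n \<omega> \<in> mspace m"
    and lim: "\<And>h C B. lipschitz_bounded m h C B \<Longrightarrow> (\<lambda>n. outer_expectation M (\<lambda>\<omega>. h (X n \<omega>))) \<longlonglongrightarrow> (LINT z|L. h z)"
  shows "weakly_converges_outer M X m L"
  unfolding weakly_converges_outer_def
proof (intro conjI allI impI)
  fix h :: "'b \<Rightarrow> real"
  assume "continuous_map (mtopology_of m) euclideanreal h \<and> bounded (h ` mspace m)"
  then obtain B where cont: "continuous_map (mtopology_of m) euclideanreal h" and B: "\<And>z. z \<in> mspace m \<Longrightarrow> \<bar>h z\<bar> \<le> B"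
    by (auto simp: bounded_iff)
  interpret M: prob_space M by (rule M)
  interpret L: prob_space L by (rule L)
  have cont': "continuous_map (mtopology_of m) euclideanreal (\<lambda>z. - h z)" using cont by (rule continuous_map_minus)
  have B': "\<bar>- h z\<bar> \<le> B" if "z \<in> mspace m" for z using B[OF that] by simp
  obtain hl where hl: "\<And>j. lipschitz_bounded m (hl j) (real j) B" "\<And>j z. z \<in> mspace m \<Longrightarrow> hl j z \<le> h z"
    "\<And>z. z \<in> mspace m \<Longrightarrow> (\<lambda>j. hl j z) \<longlonglongrightarrow> h z" using lipschitz_approximation_below[OF cont B] by blast
  \<comment> \<open>Approximating - h from below and changing the sign gives Lipschitz functions
    above \<open>h\<close>.\<close>
  obtain hu where hu: "\<And>j. lipschitz_bounded m (hu j) (real j) B" "\<And>j z. z \<in> mspace m \<Longrightarrow> hu j z \<le> - h z"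
    "\<And>z. z \<in> mspace m \<Longrightarrow> (\<lambda>j. hu j z) \<longlonglongrightarrow> - h z" using lipschitz_approximation_below[OF cont' B'] by blast
  have hu': "lipschitz_bounded m (\<lambda>z. - hu j z) (real j) B" for j
    using hu(1)[of j] by (simp add: lipschitz_bounded_def abs_minus_commute)
  have int_lim: "(\<lambda>j. LINT z|L. g j z) \<longlonglongrightarrow> (LINT z|L. h z)"
    if g: "\<And>j. lipschitz_bounded m (g j) (real j) B" "\<And>z. z \<in> mspace m \<Longrightarrow> (\<lambda>j. g j z) \<longlonglongrightarrow> h z" for g
  proof (rule integral_dominated_convergence[where w = "\<lambda>_. B"])
    show "h \<in> borel_measurable L" by (rule borel_measurable_of_continuous_map[OF L(2,3) cont])
    show "g j \<in> borel_measurable L" for j by (rule borel_measurable_of_continuous_map[OF L(2,3) continuous_map_lipschitz[OF g(1)]])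
    show "AE z in L. (\<lambda>j. g j z) \<longlonglongrightarrow> h z" using g(2) L(2) by (intro AE_I2) simp
    show "AE z in L. norm (g j z) \<le> B" for j using g(1)[of j] L(2) by (intro AE_I2) (simp add: lipschitz_bounded_def)
  qed simp
  have lower: "(\<lambda>j. LINT z|L. hl j z) \<longlonglongrightarrow> (LINT z|L. h z)" by (rule int_lim[OF hl(1,3)])
  have upper: "(\<lambda>j. LINT z|L. - hu j z) \<longlonglongrightarrow> (LINT z|L. h z)"
  proof (rule int_lim)
    show "\<And>j. lipschitz_bounded m (\<lambda>z. - hu j z) (real j) B" by (rule hu')
    show "(\<lambda>j. - hu j z) \<longlonglongrightarrow> h z" if "z \<in> mspace m" for z using tendsto_minus[OF hu(3)[OF that]] by simp
  qed
  show "(\<lambda>n. outer_expectation M (\<lambda>\<omega>. h (X n \<omega>))) \<longlonglongrightarrow> (LINT z|L. h z)"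
  proof (rule order_tendstoI)
    fix a assume "a < (LINT z|L. h z)"
    from order_tendstoD(1)[OF lower this] obtain j where "a < (LINT z|L. hl j z)" by (auto simp: eventually_sequentially)
    from order_tendstoD(1)[OF lim[OF hl(1)] this] X
    show "\<forall>\<^sub>F n in sequentially. a < outer_expectation M (\<lambda>\<omega>. h (X n \<omega>))"
    proof eventually_elim
      case (elim n)
      have "outer_expectation M (\<lambda>\<omega>. hl j (X n \<omega>)) \<le> outer_expectation M (\<lambda>\<omega>. h (X n \<omega>))"
      proof (rule M.outer_expectation_mono[of _ _ B])
        show "AE \<omega> in M. hl j (X n \<omega>) \<le> h (X n \<omega>)" using elim(2) by eventually_elim (rule hl(2))
        show "AE \<omega> in M. - B \<le> hl j (X n \<omega>)" using elim(2) by eventually_elim (use hl(1)[of j] in \<open>auto simp: lipschitz_bounded_def abs_le_iff\<close>)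
        show "AE \<omega> in M. h (X n \<omega>) \<le> B" using elim(2) by eventually_elim (use B in \<open>auto simp: abs_le_iff\<close>)
      qed
      then show ?case using elim(1) by simp
    qed
  next
    fix a assume "(LINT z|L. h z) < a"
    from order_tendstoD(2)[OF upper this] obtain j where "(LINT z|L. - hu j z) < a" by (auto simp: eventually_sequentially)
    from order_tendstoD(2)[OF lim[OF hu'] this] X
    show "\<forall>\<^sub>F n in sequentially. outer_expectation M (\<lambda>\<omega>. h (X n \<omega>)) < a"
    proof eventually_elim
      case (elim n)
      have "outer_expectation M (\<lambda>\<omega>. h (X n \<omega>)) \<le> outer_expectation M (\<lambda>\<omega>. - hu j (X n \<omega>))"
      proof (rule M.outer_expectation_mono[of _ _ B])
        show "AE \<omega> in M. h (X n \<omega>) \<le> - hu j (X n \<omega>)" using elim(2) by eventually_elim (use hu(2)[of _ j] in force)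
        show "AE \<omega> in M. - hu j (X n \<omega>) \<le> B" using elim(2) by eventually_elim (use hu(1)[of j] in \<open>auto simp: lipschitz_bounded_def abs_le_iff\<close>)
        show "AE \<omega> in M. - B \<le> h (X n \<omega>)" using elim(2) by eventually_elim (use B in force)
      qed
      then show ?case using elim(1) by simp
    qed
  qed
qed (use L X in auto)

section \<open>The space of bounded functions on the class\<close>

lemma mspace_linfty: "z \<in> mspace (linfty \<G>) \<longleftrightarrow> z \<in> extensional \<G> \<and> bounded (z ` \<G>)"
  unfolding linfty_def mspace_funspace by (simp add: Met_TC.fspace_def)

lemma le_mdist_linfty:
  assumes z: "z \<in> mspace (linfty \<G>)" "w \<in> mspace (linfty \<G>)" and g: "g \<in> \<G>"
  shows "\<bar>z g - w g\<bar> \<le> mdist (linfty \<G>) z w"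
proof -
  have "\<G> \<noteq> {}" using g by blast
  then have "\<forall>g\<in>\<G>. dist (z g) (w g) \<le> mdist (linfty \<G>) z w"
    using Met_TC.funspace_mdist_le[of z \<G> w "mdist (linfty \<G>) z w"] z by (simp add: linfty_def)
  then show ?thesis using g by (simp add: dist_real_def)
qed

lemma mdist_linfty_le:
  assumes z: "z \<in> mspace (linfty \<G>)" "w \<in> mspace (linfty \<G>)" and a: "a \<ge> 0" "\<And>g. g \<in> \<G> \<Longrightarrow> \<bar>z g - w g\<bar> \<le> a"
  shows "mdist (linfty \<G>) z w \<le> a"
proof (cases "\<G> = {}")
  case True
  then show ?thesis using a by (simp add: linfty_def)
next
  case False
  then show ?thesis using Met_TC.funspace_mdist_le[of z \<G> w a] z a by (simp add: linfty_def dist_real_def)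
qed

lemma mcomplete_linfty: "mcomplete_of (linfty \<G>)"
  unfolding linfty_def
  by (rule Met_TC.mcomplete_funspace[unfolded Met_TC.Self_def euclidean_metric_def[symmetric]])
    (simp add: mcomplete_iff_complete complete_UNIV)

subsection \<open>Limits along finite nets\<close>

lemma borel_measurable_lipschitz_compose:
  fixes \<phi> :: "('i \<Rightarrow> real) \<Rightarrow> real"
  assumes J: "finite J" and lip: "\<And>x y. \<bar>\<phi> x - \<phi> y\<bar> \<le> C * (\<Sum>i\<in>J. \<bar>x i - y i\<bar>)" and C: "C \<ge> 0"
    and \<xi>: "\<And>i. i \<in> J \<Longrightarrow> \<xi> i \<in> borel_measurable M"
  shows "(\<lambda>\<omega>. \<phi> (\<lambda>i. \<xi> i \<omega>)) \<in> borel_measurable M"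
proof -
  have "(\<lambda>\<omega>. \<lambda>i\<in>J. \<xi> i \<omega>) \<in> measurable M (PiM J (\<lambda>_. borel))"
    by (rule measurable_restrict) (rule \<xi>)
  from measurable_compose[OF this measurable_PiM_lipschitz[OF J lip C]]
  have "(\<lambda>\<omega>. \<phi> (\<lambda>i\<in>J. \<xi> i \<omega>)) \<in> borel_measurable M" .
  moreover have "\<phi> (\<lambda>i\<in>J. \<xi> i \<omega>) = \<phi> (\<lambda>i. \<xi> i \<omega>)" for \<omega>
    using lip[of "\<lambda>i\<in>J. \<xi> i \<omega>" "\<lambda>i. \<xi> i \<omega>"] by simp
  ultimately show ?thesis by simp
qed

locale finite_nets =
  fixes \<G> :: "(real \<Rightarrow> real) set" and \<pi> :: "nat \<Rightarrow> (real \<Rightarrow> real) \<Rightarrow> (real \<Rightarrow> real)"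
  assumes \<pi>_mem: "\<And>m g. g \<in> \<G> \<Longrightarrow> \<pi> m g \<in> \<G>" and \<pi>_fin: "\<And>m. finite (\<pi> m ` \<G>)"
begin

abbreviation "E \<equiv> linfty \<G>"

text \<open>The process frozen along the net of level \<open>m\<close>. It takes finitely many
  values and so belongs to the space even if \<open>v\<close> is unbounded on the class.\<close>

definition step :: "nat \<Rightarrow> ((real \<Rightarrow> real) \<Rightarrow> real) \<Rightarrow> (real \<Rightarrow> real) \<Rightarrow> real" where
  "step m v = (\<lambda>g\<in>\<G>. v (\<pi> m g))"

lemma step_mem [simp]: "step m v \<in> mspace E"
proof -
  have "step m v ` \<G> \<subseteq> v ` \<pi> m ` \<G>" by (auto simp: step_def)
  then have "finite (step m v ` \<G>)" using \<pi>_fin[of m] by (rule finite_surj[rotated])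
  then show ?thesis unfolding mspace_linfty by (simp add: step_def finite_imp_bounded)
qed

lemma mdist_step_le: "mdist E (step m v) (step m w) \<le> (\<Sum>d\<in>\<pi> m ` \<G>. \<bar>v d - w d\<bar>)"
proof (rule mdist_linfty_le)
  fix g assume "g \<in> \<G>"
  then show "\<bar>step m v g - step m w g\<bar> \<le> (\<Sum>d\<in>\<pi> m ` \<G>. \<bar>v d - w d\<bar>)"
    unfolding step_def by (simp, intro member_le_sum[of _ _ "\<lambda>d. \<bar>v d - w d\<bar>"]) (auto simp: \<pi>_fin)
qed (auto intro: sum_nonneg)

lemma lipschitz_step:
  assumes "lipschitz_bounded E H C B"
  shows "\<bar>H (step m v) - H (step m w)\<bar> \<le> C * (\<Sum>d\<in>\<pi> m ` \<G>. \<bar>v d - w d\<bar>)" "\<bar>H (step m v)\<bar> \<le> B"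
proof -
  have "\<bar>H (step m v) - H (step m w)\<bar> \<le> C * mdist E (step m v) (step m w)" using assms by (simp add: lipschitz_bounded_def)
  also have "\<dots> \<le> C * (\<Sum>d\<in>\<pi> m ` \<G>. \<bar>v d - w d\<bar>)"
    using assms by (intro mult_left_mono mdist_step_le) (simp add: lipschitz_bounded_def)
  finally show "\<bar>H (step m v) - H (step m w)\<bar> \<le> C * (\<Sum>d\<in>\<pi> m ` \<G>. \<bar>v d - w d\<bar>)" .
  show "\<bar>H (step m v)\<bar> \<le> B" using assms by (simp add: lipschitz_bounded_def)
qed

definition gap :: "nat \<Rightarrow> ((real \<Rightarrow> real) \<Rightarrow> real) \<Rightarrow> real" where
  "gap m v = mdist E (step (Suc m) v) (step m v)"

lemma gap_nonneg [simp]: "gap m v \<ge> 0" by (simp add: gap_def)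

lemma gap_lipschitz: "\<bar>gap m v - gap m w\<bar> \<le> 2 * (\<Sum>d\<in>\<pi> m ` \<G> \<union> \<pi> (Suc m) ` \<G>. \<bar>v d - w d\<bar>)"
proof -
  let ?S = "\<Sum>d\<in>\<pi> m ` \<G> \<union> \<pi> (Suc m) ` \<G>. \<bar>v d - w d\<bar>"
  have 1: "mdist E (step m v) (step m w) \<le> ?S" "mdist E (step (Suc m) v) (step (Suc m) w) \<le> ?S"
    by (rule order_trans[OF mdist_step_le], rule sum_mono2, auto simp: \<pi>_fin)+
  have "gap m v \<le> mdist E (step (Suc m) v) (step (Suc m) w) + mdist E (step (Suc m) w) (step m v)"
    "mdist E (step (Suc m) w) (step m v) \<le> gap m w + mdist E (step m w) (step m v)"
    "gap m w \<le> mdist E (step (Suc m) w) (step (Suc m) v) + mdist E (step (Suc m) v) (step m w)"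
    "mdist E (step (Suc m) v) (step m w) \<le> gap m v + mdist E (step m v) (step m w)"
    unfolding gap_def by (rule mdist_triangle; simp)+
  then show ?thesis
    using 1 by (simp only: mdist_commute[of E "step m w" "step m v"] mdist_commute[of E "step (Suc m) w" "step (Suc m) v"] abs_le_iff) linarith
qed

lemma min_gap_lipschitz:
  "\<bar>min 1 (gap m v) - min 1 (gap m w)\<bar> \<le> 2 * (\<Sum>d\<in>\<pi> m ` \<G> \<union> \<pi> (Suc m) ` \<G>. \<bar>v d - w d\<bar>)"
  using gap_lipschitz[of m v w] by linarith

end

text \<open>The truncation by 1 keeps the oscillation integrable and turns it into a bounded
  Lipschitz function of finitely many coordinates, the kind of expectation that passes to the limit
  from the empirical process.\<close>

locale net_process = finite_nets + \<Omega>: prob_space \<Omega> for \<Omega> :: "'o measure" +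
  fixes Y :: "(real \<Rightarrow> real) \<Rightarrow> 'o \<Rightarrow> real"
  assumes Y_meas [measurable]: "\<And>d. Y d \<in> borel_measurable \<Omega>"
    and osc: "\<And>m. (LINT \<omega>|\<Omega>. min 1 (gap m (\<lambda>d. Y d \<omega>))) \<le> (1 / 2) ^ m"
begin

lemma measurable_gap [measurable]: "(\<lambda>\<omega>. gap m (\<lambda>d. Y d \<omega>)) \<in> borel_measurable \<Omega>"
  by (rule borel_measurable_lipschitz_compose[OF _ gap_lipschitz]) (auto simp: \<pi>_fin)

definition good :: "'o set" where
  "good = {\<omega> \<in> space \<Omega>. (\<Sum>m. ennreal (gap m (\<lambda>d. Y d \<omega>))) < \<infinity>}"

lemma good_sets [measurable]: "good \<in> sets \<Omega>"
  unfolding good_def by measurable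

text \<open>The truncated gaps have summable means, so their sum is finite almost surely; then they
  are eventually below 1 and the truncation disappears.\<close>

lemma AE_good: "AE \<omega> in \<Omega>. \<omega> \<in> good"
proof -
  have "(\<integral>\<^sup>+\<omega>. (\<Sum>m. ennreal (min 1 (gap m (\<lambda>d. Y d \<omega>)))) \<partial>\<Omega>) = (\<Sum>m. \<integral>\<^sup>+\<omega>. ennreal (min 1 (gap m (\<lambda>d. Y d \<omega>))) \<partial>\<Omega>)"
    by (rule nn_integral_suminf) measurable
  also have "\<dots> \<le> (\<Sum>m. ennreal ((1 / 2) ^ m))"
  proof (intro suminf_le summableI)
    fix m
    have "integrable \<Omega> (\<lambda>\<omega>. min 1 (gap m (\<lambda>d. Y d \<omega>)))" by (rule \<Omega>.integrable_const_bound[of _ 1]) auto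
    then show "(\<integral>\<^sup>+\<omega>. ennreal (min 1 (gap m (\<lambda>d. Y d \<omega>))) \<partial>\<Omega>) \<le> ennreal ((1 / 2) ^ m)"
      using osc[of m] by (subst nn_integral_eq_integral) (auto intro: ennreal_leI)
  qed
  also have "\<dots> < \<infinity>" by (subst suminf_ennreal2) (auto simp: summable_geometric)
  finally have "AE \<omega> in \<Omega>. (\<Sum>m. ennreal (min 1 (gap m (\<lambda>d. Y d \<omega>)))) \<noteq> \<infinity>"
    by (intro nn_integral_PInf_AE) auto
  then show ?thesis
  proof (rule AE_mp, intro AE_I2 impI)
    fix \<omega> assume \<omega>: "\<omega> \<in> space \<Omega>" "(\<Sum>m. ennreal (min 1 (gap m (\<lambda>d. Y d \<omega>)))) \<noteq> \<infinity>"
    then have s: "summable (\<lambda>m. min 1 (gap m (\<lambda>d. Y d \<omega>)))" by (intro summable_suminf_not_top) auto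
    have "\<forall>\<^sub>F m in sequentially. min 1 (gap m (\<lambda>d. Y d \<omega>)) < 1"
      using order_tendstoD(2)[OF summable_LIMSEQ_zero[OF s], of 1] by simp
    then have "\<forall>\<^sub>F m in sequentially. min 1 (gap m (\<lambda>d. Y d \<omega>)) = gap m (\<lambda>d. Y d \<omega>)"
      by eventually_elim auto
    from summable_cong[OF this] have "summable (\<lambda>m. gap m (\<lambda>d. Y d \<omega>))" using s by (rule iffD1)
    then show "\<omega> \<in> good" unfolding good_def using \<omega>(1) by (simp add: suminf_ennreal2)
  qed
qed

text \<open>Off \<open>good\<close> the zero function serves as a default, so that every value lies
  in the space.\<close>

definition limit :: "'o \<Rightarrow> (real \<Rightarrow> real) \<Rightarrow> real" where
  "limit \<omega> = (if \<omega> \<in> good then (\<lambda>g\<in>\<G>. lim (\<lambda>m. Y (\<pi> m g) \<omega>)) else step 0 (\<lambda>_. 0))"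

text \<open>Telescoping along the levels, with the tail \<open>R m\<close> of the summable gaps as a
  bound uniform over the class.\<close>

lemma limit_properties:
  assumes \<omega>: "\<omega> \<in> good"
  shows "limit \<omega> \<in> mspace E" "(\<lambda>m. mdist E (limit \<omega>) (step m (\<lambda>d. Y d \<omega>))) \<longlonglongrightarrow> 0"
proof -
  let ?O = "\<lambda>m. gap m (\<lambda>d. Y d \<omega>)"
  have s: "summable ?O" using \<omega> unfolding good_def by (intro summable_suminf_not_top) auto
  define R where "R m = (\<Sum>j. ?O (j + m))" for m
  have R0: "R m \<ge> 0" for m unfolding R_def using summable_ignore_initial_segment[OF s] by (intro suminf_nonneg) auto
  have close: "\<bar>limit \<omega> g - Y (\<pi> m g) \<omega>\<bar> \<le> R m" if g: "g \<in> \<G>" for m g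
  proof -
    define x where "x j = Y (\<pi> (Suc (j + m)) g) \<omega> - Y (\<pi> (j + m) g) \<omega>" for j
    have x: "\<bar>x j\<bar> \<le> ?O (j + m)" for j
      using le_mdist_linfty[OF step_mem step_mem g, of "Suc (j + m)" "\<lambda>d. Y d \<omega>" "j + m" "\<lambda>d. Y d \<omega>"] g
      by (simp add: gap_def step_def x_def)
    have sO: "summable (\<lambda>j. ?O (j + m))" using s by (rule summable_ignore_initial_segment)
    have sx: "summable (\<lambda>j. \<bar>x j\<bar>)" by (rule summable_comparison_test[OF _ sO]) (use x in auto)
    have tele: "(\<Sum>j<i. x j) = Y (\<pi> (i + m) g) \<omega> - Y (\<pi> m g) \<omega>" for i
      unfolding x_def by (induction i) auto
    have "(\<lambda>i. \<Sum>j<i. x j) \<longlonglongrightarrow> suminf x" by (rule summable_LIMSEQ[OF summable_rabs_cancel[OF sx]])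
    then have "(\<lambda>i. (\<Sum>j<i. x j) + Y (\<pi> m g) \<omega>) \<longlonglongrightarrow> suminf x + Y (\<pi> m g) \<omega>" by (intro tendsto_intros)
    then have "(\<lambda>i. Y (\<pi> (i + m) g) \<omega>) \<longlonglongrightarrow> suminf x + Y (\<pi> m g) \<omega>" by (simp add: tele)
    then have "(\<lambda>i. Y (\<pi> i g) \<omega>) \<longlonglongrightarrow> suminf x + Y (\<pi> m g) \<omega>" by (rule LIMSEQ_offset)
    then have "limit \<omega> g = suminf x + Y (\<pi> m g) \<omega>" using \<omega> g by (simp add: limit_def limI)
    moreover have "\<bar>suminf x\<bar> \<le> R m"
      unfolding R_def using summable_rabs[OF sx] suminf_le[OF x sx sO] by linarith
    ultimately show ?thesis by simp
  qed
  have "\<bar>limit \<omega> g\<bar> \<le> (\<Sum>d\<in>\<pi> 0 ` \<G>. \<bar>Y d \<omega>\<bar>) + R 0" if g: "g \<in> \<G>" for g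
  proof -
    have "\<bar>Y (\<pi> 0 g) \<omega>\<bar> \<le> (\<Sum>d\<in>\<pi> 0 ` \<G>. \<bar>Y d \<omega>\<bar>)"
      using g by (intro member_le_sum[of _ _ "\<lambda>d. \<bar>Y d \<omega>\<bar>"]) (auto simp: \<pi>_fin)
    then show ?thesis using close[OF g, of 0] by linarith
  qed
  then have "bounded (limit \<omega> ` \<G>)" by (auto simp: bounded_iff)
  then show mem: "limit \<omega> \<in> mspace E" unfolding mspace_linfty using \<omega> by (simp add: limit_def)
  have Rlim: "R \<longlonglongrightarrow> 0"
  proof -
    have "R = (\<lambda>m. suminf ?O - (\<Sum>j<m. ?O j))" unfolding R_def by (rule ext, rule suminf_minus_initial_segment[OF s])
    then show ?thesis using tendsto_diff[OF tendsto_const summable_LIMSEQ[OF s], of "suminf ?O"] by simp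
  qed
  show "(\<lambda>m. mdist E (limit \<omega>) (step m (\<lambda>d. Y d \<omega>))) \<longlonglongrightarrow> 0"
  proof (rule tendsto_sandwich[OF _ _ tendsto_const Rlim])
    show "\<forall>\<^sub>F m in sequentially. mdist E (limit \<omega>) (step m (\<lambda>d. Y d \<omega>)) \<le> R m"
      by (intro always_eventually allI mdist_linfty_le[OF mem step_mem]) (auto simp: R0 close step_def)
  qed simp
qed

lemma limit_mem [simp]: "limit \<omega> \<in> mspace E"
  using limit_properties(1)[of \<omega>] by (cases "\<omega> \<in> good") (auto simp: limit_def)

lemma lipschitz_limit:
  assumes H: "lipschitz_bounded E H C B" and \<omega>: "\<omega> \<in> good"
  shows "(\<lambda>m. H (step m (\<lambda>d. Y d \<omega>))) \<longlonglongrightarrow> H (limit \<omega>)"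
proof (rule LIM_zero_cancel, rule tendsto_rabs_zero_cancel, rule tendsto_sandwich[OF _ _ tendsto_const])
  show "(\<lambda>m. C * mdist E (limit \<omega>) (step m (\<lambda>d. Y d \<omega>))) \<longlonglongrightarrow> 0"
    using tendsto_mult_left[OF limit_properties(2)[OF \<omega>], of C] by simp
  show "\<forall>\<^sub>F m in sequentially. \<bar>H (step m (\<lambda>d. Y d \<omega>)) - H (limit \<omega>)\<bar> \<le> C * mdist E (limit \<omega>) (step m (\<lambda>d. Y d \<omega>))"
    using H by (intro always_eventually allI) (auto simp: lipschitz_bounded_def mdist_commute[of E "limit \<omega>"])
qed simp

lemma measurable_lipschitz_step [measurable]:
  assumes "lipschitz_bounded E H C B"
  shows "(\<lambda>\<omega>. H (step m (\<lambda>d. Y d \<omega>))) \<in> borel_measurable \<Omega>"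
  by (rule borel_measurable_lipschitz_compose[OF \<pi>_fin lipschitz_step(1)[OF assms]])
    (use assms in \<open>auto simp: lipschitz_bounded_def\<close>)

lemma measurable_lipschitz_limit:
  assumes H: "lipschitz_bounded E H C B"
  shows "(\<lambda>\<omega>. H (limit \<omega>)) \<in> borel_measurable \<Omega>"
proof (rule borel_measurable_LIMSEQ_real)
  show "(\<lambda>m. if \<omega> \<in> good then H (step m (\<lambda>d. Y d \<omega>)) else H (step 0 (\<lambda>_. 0))) \<longlonglongrightarrow> H (limit \<omega>)" if "\<omega> \<in> space \<Omega>" for \<omega>
    using lipschitz_limit[OF H, of \<omega>] by (auto simp: limit_def)
  show "(\<lambda>\<omega>. if \<omega> \<in> good then H (step m (\<lambda>d. Y d \<omega>)) else H (step 0 (\<lambda>_. 0))) \<in> borel_measurable \<Omega>" for m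
    using measurable_lipschitz_step[OF H] by measurable
qed

definition limit_law :: "((real \<Rightarrow> real) \<Rightarrow> real) measure" where
  "limit_law = distr \<Omega> (sigma (mspace E) {U. openin (mtopology_of E) U}) limit"

lemma openin_subset_Pow: "{U. openin (mtopology_of E) U} \<subseteq> Pow (mspace E)"
  by (auto simp: openin_mtopology_of)

text \<open>The space is not separable in general, so balls do not generate the Borel sets. For an
  open \<open>U\<close> the truncated distance to its complement is a bounded Lipschitz function
  that is positive exactly on \<open>U\<close>, and such functions of \<open>limit\<close> are
  measurable.\<close>

lemma limit_measurable: "limit \<in> measurable \<Omega> (sigma (mspace E) {U. openin (mtopology_of E) U})"
proof (rule measurable_measure_of)
  show "{U. openin (mtopology_of E) U} \<subseteq> Pow (mspace E)" by (rule openin_subset_Pow)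
  show "limit \<in> space \<Omega> \<rightarrow> mspace E" by simp
  fix U assume "U \<in> {U. openin (mtopology_of E) U}"
  then have U: "U \<subseteq> mspace E" "\<And>x. x \<in> U \<Longrightarrow> \<exists>r>0. \<forall>y\<in>mspace E. mdist E x y < r \<longrightarrow> y \<in> U"
    by (auto simp: openin_mtopology_of)
  show "limit -` U \<inter> space \<Omega> \<in> sets \<Omega>"
  proof (cases "U = mspace E")
    case True
    then have "limit -` U \<inter> space \<Omega> = space \<Omega>" by auto
    then show ?thesis by simp
  next
    case False
    define C where "C = mspace E - U"
    have C: "C \<noteq> {}" using False U unfolding C_def by blast
    define D where "D z = (INF w\<in>C. mdist E z w)" for z
    have bdd: "bdd_below ((\<lambda>w. mdist E z w) ` C)" for z by (rule bdd_belowI2[of _ 0]) simp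
    have D_le: "D z \<le> mdist E z w" if "w \<in> C" for z w unfolding D_def by (rule cINF_lower[OF bdd that])
    have D_nonneg: "D z \<ge> 0" for z unfolding D_def by (rule cINF_greatest[OF C]) simp
    have lip1: "D z \<le> mdist E z z' + D z'" if z: "z \<in> mspace E" "z' \<in> mspace E" for z z'
    proof -
      have "D z - mdist E z z' \<le> D z'"
        unfolding D_def[of z']
      proof (rule cINF_greatest[OF C])
        fix w assume w: "w \<in> C"
        have "mdist E z w \<le> mdist E z z' + mdist E z' w" using z w by (intro mdist_triangle) (auto simp: C_def)
        then show "D z - mdist E z z' \<le> mdist E z' w" using D_le[OF w, of z] by simp
      qed
      then show ?thesis by simp
    qed
    have lip: "lipschitz_bounded E (\<lambda>z. min 1 (D z)) 1 1"
      unfolding lipschitz_bounded_def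
    proof (intro conjI ballI)
      fix z assume z: "z \<in> mspace E"
      show "\<bar>min 1 (D z)\<bar> \<le> 1" using D_nonneg[of z] by simp
      fix w assume w: "w \<in> mspace E"
      show "\<bar>min 1 (D z) - min 1 (D w)\<bar> \<le> 1 * mdist E z w"
        using lip1[OF z w] lip1[OF w z] mdist_commute[of E w z] by linarith
    qed simp
    have pos: "D z > 0 \<longleftrightarrow> z \<in> U" if z: "z \<in> mspace E" for z
    proof
      assume "D z > 0"
      show "z \<in> U"
      proof (rule ccontr)
        assume "z \<notin> U"
        then have "z \<in> C" using z by (simp add: C_def)
        from D_le[OF this, of z] show False using \<open>D z > 0\<close> mdist_zero[OF z z] by simp
      qed
    next
      assume "z \<in> U"
      from U(2)[OF this] obtain r where r: "r > 0" "\<forall>y\<in>mspace E. mdist E z y < r \<longrightarrow> y \<in> U" by blast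
      have "r \<le> D z" unfolding D_def by (rule cINF_greatest[OF C]) (use r in \<open>force simp: C_def not_less[symmetric]\<close>)
      then show "D z > 0" using r by simp
    qed
    note [measurable] = measurable_lipschitz_limit[OF lip]
    have "{\<omega> \<in> space \<Omega>. min 1 (D (limit \<omega>)) > 0} \<in> sets \<Omega>" by measurable
    moreover have "limit -` U \<inter> space \<Omega> = {\<omega> \<in> space \<Omega>. min 1 (D (limit \<omega>)) > 0}" using pos by auto
    ultimately show ?thesis by simp
  qed
qed

lemma limit_law_basic:
  "prob_space limit_law" "space limit_law = mspace E" "sets limit_law = borel_sets_of E"
proof -
  show "prob_space limit_law" unfolding limit_law_def by (rule \<Omega>.prob_space_distr[OF limit_measurable])
  show "space limit_law = mspace E" unfolding limit_law_def using openin_subset_Pow by simp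
  show "sets limit_law = borel_sets_of E" unfolding limit_law_def borel_sets_of_def using openin_subset_Pow by simp
qed

lemma integral_limit_law:
  assumes "h \<in> borel_measurable limit_law"
  shows "(LINT z|limit_law. h z) = (LINT \<omega>|\<Omega>. (h (limit \<omega>) :: real))"
  using assms unfolding limit_law_def by (subst integral_distr[OF limit_measurable]) auto

lemma lipschitz_expectation_limit:
  assumes H: "lipschitz_bounded E H C B"
  shows "(\<lambda>m. LINT \<omega>|\<Omega>. H (step m (\<lambda>d. Y d \<omega>))) \<longlonglongrightarrow> (LINT z|limit_law. H z)"
proof -
  have "H \<in> borel_measurable limit_law"
    by (rule borel_measurable_of_continuous_map[OF limit_law_basic(2,3) continuous_map_lipschitz[OF H]])
  then have eq: "(LINT z|limit_law. H z) = (LINT \<omega>|\<Omega>. H (limit \<omega>))" by (rule integral_limit_law)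
  show ?thesis
    unfolding eq
  proof (rule integral_dominated_convergence[where w = "\<lambda>_. B"])
    show "(\<lambda>\<omega>. H (limit \<omega>)) \<in> borel_measurable \<Omega>" by (rule measurable_lipschitz_limit[OF H])
    show "(\<lambda>\<omega>. H (step m (\<lambda>d. Y d \<omega>))) \<in> borel_measurable \<Omega>" for m by (rule measurable_lipschitz_step[OF H])
    show "AE \<omega> in \<Omega>. (\<lambda>m. H (step m (\<lambda>d. Y d \<omega>))) \<longlonglongrightarrow> H (limit \<omega>)"
      using AE_good by eventually_elim (rule lipschitz_limit[OF H])
    show "AE \<omega> in \<Omega>. norm (H (step m (\<lambda>d. Y d \<omega>))) \<le> B" for m using lipschitz_step(2)[OF H] by simp
  qed simp
qed

text \<open>Step functions with rational values along the nets approximate all values of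
  \<open>limit\<close>, although the whole space may fail to be separable.\<close>

lemma countable_dense:
  obtains s :: "nat \<Rightarrow> (real \<Rightarrow> real) \<Rightarrow> real" where "\<And>i. s i \<in> mspace E" "\<And>\<omega> r. r > 0 \<Longrightarrow> \<exists>i. mdist E (limit \<omega>) (s i) < r"
proof -
  define S where "S = (\<Union>m. step m ` (\<pi> m ` \<G> \<rightarrow>\<^sub>E \<rat>))"
  have "countable S" unfolding S_def
    by (intro countable_UN countable_image countable_PiE \<pi>_fin) (auto intro: countable_rat)
  moreover have ne: "S \<noteq> {}"
  proof -
    have "(\<lambda>d\<in>\<pi> 0 ` \<G>. 0) \<in> \<pi> 0 ` \<G> \<rightarrow>\<^sub>E \<rat>" by auto
    then show ?thesis unfolding S_def by blast
  qed
  ultimately have range: "range (from_nat_into S) = S" by (rule range_from_nat_into[rotated])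
  have SE: "S \<subseteq> mspace E" unfolding S_def by auto
  have approx: "\<exists>s\<in>S. mdist E (step m v) s < r" if r: "r > 0" for m v r
  proof -
    let ?D = "\<pi> m ` \<G>"
    define \<eta> where "\<eta> = r / (real (card ?D) + 1)"
    have \<eta>: "\<eta> > 0" using r by (simp add: \<eta>_def)
    have "\<exists>q\<in>\<rat>. \<bar>v d - q\<bar> < \<eta>" for d
      using Rats_dense_in_real[of "v d" "v d + \<eta>"] \<eta> by force
    then obtain q where q: "\<And>d. q d \<in> \<rat>" "\<And>d. \<bar>v d - q d\<bar> < \<eta>" by metis
    have "mdist E (step m v) (step m (\<lambda>d\<in>?D. q d)) \<le> (\<Sum>d\<in>?D. \<bar>v d - (\<lambda>d\<in>?D. q d) d\<bar>)" by (rule mdist_step_le)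
    also have "\<dots> \<le> (\<Sum>d\<in>?D. \<eta>)" using q(2) by (intro sum_mono) (auto intro: less_imp_le)
    also have "\<dots> < (real (card ?D) + 1) * \<eta>" using \<eta> by (simp add: algebra_simps)
    also have "\<dots> = r" unfolding \<eta>_def by (simp add: add_nonneg_eq_0_iff)
    finally have "mdist E (step m v) (step m (\<lambda>d\<in>?D. q d)) < r" .
    moreover have "step m (\<lambda>d\<in>?D. q d) \<in> S" unfolding S_def using q(1) by (intro UN_I[of m] imageI) auto
    ultimately show ?thesis by blast
  qed
  have dense: "\<exists>s\<in>S. mdist E (limit \<omega>) s < r" if r: "r > 0" for \<omega> r
  proof -
    have "\<exists>m v. mdist E (limit \<omega>) (step m v) < r / 2"
    proof (cases "\<omega> \<in> good")
      case True
      have "\<forall>\<^sub>F m in sequentially. mdist E (limit \<omega>) (step m (\<lambda>d. Y d \<omega>)) < r / 2"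
        using order_tendstoD(2)[OF limit_properties(2)[OF True], of "r / 2"] r by simp
      then show ?thesis by (auto simp: eventually_sequentially)
    next
      case False
      then have "mdist E (limit \<omega>) (step 0 (\<lambda>_. 0)) = 0" by (simp add: limit_def)
      then show ?thesis using r by (metis half_gt_zero)
    qed
    then obtain m v where mv: "mdist E (limit \<omega>) (step m v) < r / 2" by blast
    obtain s where s: "s \<in> S" "mdist E (step m v) s < r / 2" using approx[of "r / 2"] r by auto
    have "mdist E (limit \<omega>) s \<le> mdist E (limit \<omega>) (step m v) + mdist E (step m v) s"
      using s SE by (intro mdist_triangle) auto
    then show ?thesis using mv s by (intro bexI[of _ s]) auto
  qed
  show ?thesis
  proof (rule that[of "from_nat_into S"])
    show "from_nat_into S i \<in> mspace E" for i using from_nat_into[OF ne] SE by blast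
    show "\<exists>i. mdist E (limit \<omega>) (from_nat_into S i) < r" if "r > 0" for \<omega> r
      using dense[OF that, of \<omega>] range by (metis image_iff)
  qed
qed

text \<open>Ulam's argument: for each radius finitely many closed balls around the dense sequence
  carry all but c / 2^(k+2) of the mass. Their intersection is closed and totally bounded, hence
  compact by completeness, and misses mass at most c / 2.\<close>

lemma tight_limit_law: "tight_law E limit_law"
  unfolding tight_law_def
proof (intro allI impI)
  fix c :: real assume c: "c > 0"
  interpret L: prob_space limit_law by (rule limit_law_basic)
  interpret E: Metric_space "mspace E" "mdist E" by simp
  obtain s :: "nat \<Rightarrow> (real \<Rightarrow> real) \<Rightarrow> real" where s: "\<And>i. s i \<in> mspace E" "\<And>\<omega> r. r > 0 \<Longrightarrow> \<exists>i. mdist E (limit \<omega>) (s i) < r"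
    using countable_dense by blast
  have open_sets: "U \<in> sets limit_law" if "openin (mtopology_of E) U" for U
    unfolding limit_law_basic borel_sets_of_def using that by (intro sigma_sets.Basic) simp
  have closed_sets: "F \<in> sets limit_law" if "closedin (mtopology_of E) F" for F
  proof -
    have "mspace E - F \<in> sets limit_law" using that by (intro open_sets) (simp add: closedin_def)
    from sets.compl_sets[OF this] have "mspace E - (mspace E - F) \<in> sets limit_law" by (simp add: limit_law_basic)
    moreover have "F \<subseteq> mspace E" using closedin_subset[OF that] by simp
    ultimately show ?thesis by (simp add: double_diff)
  qed
  let ?B = "\<lambda>k i. E.mcball (s i) (1 / real (Suc k))"
  have B_closed: "closedin (mtopology_of E) (?B k i)" for k i by (simp add: mtopology_of_def)
  have U_closed: "closedin (mtopology_of E) (\<Union>i<n. ?B k i)" for k n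
    by (intro closedin_Union) (auto simp del: of_nat_Suc intro: B_closed)
  have "\<exists>n. L.prob (\<Union>i<n. ?B k i) > 1 - c / 2 * (1 / 2) ^ Suc k" for k
  proof -
    have "(\<lambda>n. L.prob (\<Union>i<n. ?B k i)) \<longlonglongrightarrow> L.prob (\<Union>n. \<Union>i<n. ?B k i)"
    proof (rule L.finite_Lim_measure_incseq)
      show "range (\<lambda>n. \<Union>i<n. ?B k i) \<subseteq> sets limit_law" using closed_sets[OF U_closed] by blast
      show "incseq (\<lambda>n. \<Union>i<n. ?B k i)" by (rule incseq_SucI) (auto simp: less_Suc_eq)
    qed
    moreover have "L.prob (\<Union>n. \<Union>i<n. ?B k i) = 1"
    proof -
      have m: "(\<Union>n. \<Union>i<n. ?B k i) \<in> sets limit_law" by (rule sets.countable_UN') (auto simp del: of_nat_Suc intro: closed_sets[OF U_closed])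
      have "limit -` (\<Union>n. \<Union>i<n. ?B k i) \<inter> space \<Omega> = space \<Omega>"
      proof -
        have "limit \<omega> \<in> (\<Union>n. \<Union>i<n. ?B k i)" for \<omega>
        proof -
          obtain i where "mdist E (limit \<omega>) (s i) < 1 / real (Suc k)" using s(2)[of "1 / real (Suc k)"] by auto
          then have "limit \<omega> \<in> ?B k i" using s(1) by (simp add: mdist_commute[of E "s i"])
          then show ?thesis by blast
        qed
        then show ?thesis by blast
      qed
      then have "L.prob (\<Union>n. \<Union>i<n. ?B k i) = \<Omega>.prob (space \<Omega>)"
        using m unfolding limit_law_def by (subst measure_distr[OF limit_measurable]) simp_all
      then show ?thesis by (simp add: \<Omega>.prob_space)
    qed
    ultimately have "(\<lambda>n. L.prob (\<Union>i<n. ?B k i)) \<longlonglongrightarrow> 1" by simp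
    from order_tendstoD(1)[OF this, of "1 - c / 2 * (1 / 2) ^ Suc k"] c show ?thesis
      by (auto simp: eventually_sequentially)
  qed
  then obtain n where n: "\<And>k. L.prob (\<Union>i<n k. ?B k i) > 1 - c / 2 * (1 / 2) ^ Suc k" by metis
  define K where "K = (\<Inter>k. \<Union>i<n k. ?B k i)"
  have K_closed: "closedin (mtopology_of E) K" unfolding K_def by (rule closedin_Inter) (auto simp del: of_nat_Suc intro: U_closed)
  have "E.mtotally_bounded K"
    unfolding E.mtotally_bounded_def
  proof (intro allI impI)
    fix e :: real assume e: "e > 0"
    obtain k where k: "2 / e < real (Suc k)" using reals_Archimedean2[of "2 / e"] less_le_trans of_nat_le_iff le_SucI by (metis le_refl)
    have k': "2 * (1 / real (Suc k)) < e" using k e by (simp add: field_simps)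
    let ?I = "{i. i < n k \<and> ?B k i \<inter> K \<noteq> {}}"
    \<comment> \<open>Total boundedness asks for centres inside \<open>K\<close>, so every ball that
      meets \<open>K\<close> gets a point of \<open>K\<close> instead of its own centre, at twice
      the radius.\<close>
    obtain p where p: "\<And>i. i \<in> ?I \<Longrightarrow> p i \<in> ?B k i \<inter> K"
      using bchoice[of ?I "\<lambda>i x. x \<in> ?B k i \<inter> K"] by (smt (verit) all_not_in_conv mem_Collect_eq)
    show "\<exists>F. finite F \<and> F \<subseteq> K \<and> K \<subseteq> (\<Union>x\<in>F. E.mball x e)"
    proof (intro exI conjI)
      show "finite (p ` ?I)" by simp
      show "p ` ?I \<subseteq> K" using p by blast
      show "K \<subseteq> (\<Union>x\<in>p ` ?I. E.mball x e)"
      proof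
        fix x assume x: "x \<in> K"
        then obtain i where i: "i < n k" "x \<in> ?B k i" unfolding K_def by blast
        then have iI: "i \<in> ?I" using x by blast
        have pi: "p i \<in> ?B k i" using p[OF iI] by blast
        have "mdist E (p i) x \<le> mdist E (p i) (s i) + mdist E (s i) x"
          using pi i by (intro mdist_triangle) auto
        also have "\<dots> \<le> 2 * (1 / real (Suc k))" using pi i by (simp add: mdist_commute[of E "p i"])
        finally have "x \<in> E.mball (p i) e" using k' pi i by simp
        then show "x \<in> (\<Union>x\<in>p ` ?I. E.mball x e)" using iI by blast
      qed
    qed
  qed
  then have "compactin E.mtopology (E.mtopology closure_of K)"
    using E.mtotally_bounded_eq_compact_closure_of mcomplete_linfty by (simp add: mcomplete_of_def)
  then have compact: "compactin (mtopology_of E) K"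
    using K_closed by (simp add: mtopology_of_def closure_of_closedin)
  have "L.prob (mspace E - K) \<le> (\<Sum>k. L.prob (mspace E - (\<Union>i<n k. ?B k i)))"
  proof -
    have eq: "mspace E - K = (\<Union>k. mspace E - (\<Union>i<n k. ?B k i))" unfolding K_def by blast
    have small: "L.prob (mspace E - (\<Union>i<n k. ?B k i)) \<le> c / 2 * (1 / 2) ^ Suc k" for k
      using L.prob_compl[OF closed_sets[OF U_closed]] n[of k] by (simp add: limit_law_basic)
    have sum: "summable (\<lambda>k. L.prob (mspace E - (\<Union>i<n k. ?B k i)))"
    proof (rule summable_comparison_test)
      show "\<exists>N. \<forall>k\<ge>N. norm (L.prob (mspace E - (\<Union>i<n k. ?B k i))) \<le> c / 2 * (1 / 2) ^ Suc k" using small by auto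
      show "summable (\<lambda>k. c / 2 * (1 / 2) ^ Suc k)" by (intro summable_mult) (simp add: summable_Suc_iff)
    qed
    show ?thesis unfolding eq
    proof (rule L.finite_measure_subadditive_countably[OF _ sum])
      show "range (\<lambda>k. mspace E - (\<Union>i<n k. ?B k i)) \<subseteq> sets limit_law"
        using sets.compl_sets[OF closed_sets[OF U_closed]] unfolding limit_law_basic by blast
    qed
  qed
  also have "\<dots> \<le> (\<Sum>k. c / 2 * (1 / 2) ^ Suc k)"
  proof (rule suminf_le)
    show small: "L.prob (mspace E - (\<Union>i<n k. ?B k i)) \<le> c / 2 * (1 / 2) ^ Suc k" for k
      using L.prob_compl[OF closed_sets[OF U_closed]] n[of k] by (simp add: limit_law_basic)
    show sm: "summable (\<lambda>k. c / 2 * (1 / 2) ^ Suc k)" by (intro summable_mult) (simp add: summable_Suc_iff)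
    show "summable (\<lambda>k. L.prob (mspace E - (\<Union>i<n k. ?B k i)))"
      by (rule summable_comparison_test[OF _ sm]) (use small in auto)
  qed
  also have "\<dots> = c / 2"
    using sums_mult[OF power_half_series, of "c / 2"] by (simp add: sums_iff)
  finally have "L.prob (mspace E - K) \<le> c / 2" .
  then have "L.prob K > 1 - c" using L.prob_compl[OF closed_sets[OF K_closed]] c by (simp add: limit_law_basic)
  then show "\<exists>K. compactin (mtopology_of E) K \<and> L.prob K > 1 - c" using compact by blast
qed

end

locale net_convergence = net_process \<G> \<pi> \<Omega> Y + M: prob_space M
  for \<G> \<pi> and \<Omega> :: "'o measure" and Y and M :: "'w measure" +
  fixes \<xi> :: "nat \<Rightarrow> (real \<Rightarrow> real) \<Rightarrow> 'w \<Rightarrow> real"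
  assumes \<xi>_meas: "\<And>n d. d \<in> \<G> \<Longrightarrow> \<xi> n d \<in> borel_measurable M"
    and fidi: "\<And>m t. (\<lambda>n. CLINT \<omega>|M. iexp (\<Sum>d\<in>\<pi> m ` \<G>. t d * \<xi> n d \<omega>)) \<longlonglongrightarrow> (CLINT \<omega>|\<Omega>. iexp (\<Sum>d\<in>\<pi> m ` \<G>. t d * Y d \<omega>))"
begin

lemma net_range_subset: "\<pi> m ` \<G> \<subseteq> \<G>" using \<pi>_mem by blast

text \<open>The level \<open>m\<close> is fixed before \<open>n\<close>, since the
  finite-dimensional limits are taken for a fixed net. The process \<open>X\<close> is left general
  so that one argument covers both the raw and the smoothed empirical process.\<close>

definition asymptotically_close :: "(nat \<Rightarrow> 'w \<Rightarrow> (real \<Rightarrow> real) \<Rightarrow> real) \<Rightarrow> bool" where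
  "asymptotically_close X \<longleftrightarrow> (\<forall>n \<omega>. X n \<omega> \<in> extensional \<G>) \<and>
     (\<forall>e>0. \<exists>m0. \<forall>m\<ge>m0. \<exists>n0. \<forall>n\<ge>n0. \<exists>U. integrable M U \<and> (\<forall>\<omega>. U \<omega> \<ge> 0) \<and> (LINT \<omega>|M. U \<omega>) \<le> e \<and>
        (AE \<omega> in M. \<forall>g\<in>\<G>. \<bar>X n \<omega> g - \<xi> n (\<pi> m g) \<omega>\<bar> \<le> U \<omega>))"

lemma mem_of_close:
  assumes "x \<in> extensional \<G>" "\<forall>g\<in>\<G>. \<bar>x g - step m v g\<bar> \<le> u" "u \<ge> 0"
  shows "x \<in> mspace E" "mdist E x (step m v) \<le> u"
proof -
  have "bounded (step m v ` \<G>)" using step_mem[of m v] unfolding mspace_linfty by simp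
  then obtain B where B: "\<forall>g\<in>\<G>. \<bar>step m v g\<bar> \<le> B" by (auto simp: bounded_iff)
  have "\<bar>x g\<bar> \<le> B + u" if "g \<in> \<G>" for g using bspec[OF B that] bspec[OF assms(2) that] by linarith
  then have "bounded (x ` \<G>)" by (auto simp: bounded_iff)
  then show mem: "x \<in> mspace E" unfolding mspace_linfty using assms(1) by simp
  show "mdist E x (step m v) \<le> u" by (rule mdist_linfty_le[OF mem step_mem]) (use assms in auto)
qed

lemma lipschitz_step_tendsto:
  assumes H: "lipschitz_bounded E H C B"
  shows "(\<lambda>n. LINT \<omega>|M. H (step m (\<lambda>d. \<xi> n d \<omega>))) \<longlonglongrightarrow> (LINT \<omega>|\<Omega>. H (step m (\<lambda>d. Y d \<omega>)))"
  using H net_range_subset[of m]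
  by (intro lipschitz_expectation_tendsto[OF \<pi>_fin M.prob_space_axioms _ \<Omega>.prob_space_axioms Y_meas fidi
        measurable_PiM_lipschitz[OF \<pi>_fin lipschitz_step(1)[OF H]] lipschitz_step(1)[OF H] _ lipschitz_step(2)[OF H]] \<xi>_meas)
    (auto simp: lipschitz_bounded_def)

text \<open>For a Lipschitz test function three errors are added: from \<open>X n\<close> to its
  step version, from the empirical to the Gaussian step version at fixed \<open>m\<close>, and from
  the latter to the limit law. Choosing \<open>m\<close> serves the first and third, then
  \<open>n\<close> serves the second.\<close>

lemma weak_convergence:
  assumes X: "asymptotically_close X"
  shows "weakly_converges_outer M X E limit_law"
proof (rule weakly_converges_outer_lipschitz[OF M.prob_space_axioms limit_law_basic])
  have ext: "X n \<omega> \<in> extensional \<G>" for n \<omega> using X by (simp add: asymptotically_close_def)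
  have close: "\<exists>m0. \<forall>m\<ge>m0. \<exists>n0. \<forall>n\<ge>n0. \<exists>U. integrable M U \<and> (LINT \<omega>|M. U \<omega>) \<le> e \<and>
        (AE \<omega> in M. X n \<omega> \<in> mspace E \<and> mdist E (X n \<omega>) (step m (\<lambda>d. \<xi> n d \<omega>)) \<le> U \<omega>)" if e: "e > 0" for e
  proof -
    have "\<exists>U. integrable M U \<and> (LINT \<omega>|M. U \<omega>) \<le> e \<and>
        (AE \<omega> in M. X n \<omega> \<in> mspace E \<and> mdist E (X n \<omega>) (step m (\<lambda>d. \<xi> n d \<omega>)) \<le> U \<omega>)"
      if h: "\<exists>U. integrable M U \<and> (\<forall>\<omega>. U \<omega> \<ge> 0) \<and> (LINT \<omega>|M. U \<omega>) \<le> e \<and>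
        (AE \<omega> in M. \<forall>g\<in>\<G>. \<bar>X n \<omega> g - \<xi> n (\<pi> m g) \<omega>\<bar> \<le> U \<omega>)" for m n
    proof -
      obtain U where U: "integrable M U" "\<And>\<omega>. U \<omega> \<ge> 0" "(LINT \<omega>|M. U \<omega>) \<le> e"
        "AE \<omega> in M. \<forall>g\<in>\<G>. \<bar>X n \<omega> g - \<xi> n (\<pi> m g) \<omega>\<bar> \<le> U \<omega>" using h by blast
      have "AE \<omega> in M. X n \<omega> \<in> mspace E \<and> mdist E (X n \<omega>) (step m (\<lambda>d. \<xi> n d \<omega>)) \<le> U \<omega>"
        using U(4)
      proof eventually_elim
        case (elim \<omega>)
        then have "\<forall>g\<in>\<G>. \<bar>X n \<omega> g - step m (\<lambda>d. \<xi> n d \<omega>) g\<bar> \<le> U \<omega>" by (simp add: step_def)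
        from mem_of_close[OF ext this U(2)] show ?case by blast
      qed
      then show ?thesis using U by blast
    qed
    moreover have "\<exists>m0. \<forall>m\<ge>m0. \<exists>n0. \<forall>n\<ge>n0. \<exists>U. integrable M U \<and> (\<forall>\<omega>. U \<omega> \<ge> 0) \<and> (LINT \<omega>|M. U \<omega>) \<le> e \<and>
        (AE \<omega> in M. \<forall>g\<in>\<G>. \<bar>X n \<omega> g - \<xi> n (\<pi> m g) \<omega>\<bar> \<le> U \<omega>)" using X e unfolding asymptotically_close_def by blast
    ultimately show ?thesis by meson
  qed
  show "\<forall>\<^sub>F n in sequentially. AE \<omega> in M. X n \<omega> \<in> mspace E"
  proof -
    obtain m0 where m0: "\<forall>m\<ge>m0. \<exists>n0. \<forall>n\<ge>n0. \<exists>U. integrable M U \<and> (LINT \<omega>|M. U \<omega>) \<le> 1 \<and>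
        (AE \<omega> in M. X n \<omega> \<in> mspace E \<and> mdist E (X n \<omega>) (step m (\<lambda>d. \<xi> n d \<omega>)) \<le> U \<omega>)" using close[of 1] by auto
    obtain n0 where n0: "\<forall>n\<ge>n0. \<exists>U. integrable M U \<and> (LINT \<omega>|M. U \<omega>) \<le> 1 \<and>
        (AE \<omega> in M. X n \<omega> \<in> mspace E \<and> mdist E (X n \<omega>) (step m0 (\<lambda>d. \<xi> n d \<omega>)) \<le> U \<omega>)" using m0 by blast
    have "AE \<omega> in M. X n \<omega> \<in> mspace E" if n: "n \<ge> n0" for n
    proof -
      obtain U where "AE \<omega> in M. X n \<omega> \<in> mspace E \<and> mdist E (X n \<omega>) (step m0 (\<lambda>d. \<xi> n d \<omega>)) \<le> U \<omega>" using n0 n by blast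
      then show ?thesis by eventually_elim simp
    qed
    then show ?thesis by (auto simp: eventually_sequentially)
  qed
  fix H C B assume H: "lipschitz_bounded E H C B"
  then have C: "C \<ge> 0" by (simp add: lipschitz_bounded_def)
  show "(\<lambda>n. outer_expectation M (\<lambda>\<omega>. H (X n \<omega>))) \<longlonglongrightarrow> (LINT z|limit_law. H z)"
  proof (rule LIMSEQ_I)
    fix e :: real assume e: "e > 0"
    \<comment> \<open>\<open>C + 1\<close> instead of \<open>C\<close> admits test functions with
      Lipschitz constant zero.\<close>
    define \<eta> where "\<eta> = e / 3 / (C + 1)"
    have \<eta>: "\<eta> > 0" using e C by (simp add: \<eta>_def)
    have C\<eta>: "C * \<eta> \<le> e / 3"
    proof -
      have "C * \<eta> \<le> (C + 1) * \<eta>" using \<eta> by (simp add: algebra_simps)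
      also have "\<dots> = e / 3"
      proof -
        have "D * (a / D) = a" if "D \<noteq> 0" for a D :: real using that by simp
        then show ?thesis unfolding \<eta>_def using C by (metis add_nonneg_eq_0_iff zero_le_one zero_neq_one)
      qed
      finally show ?thesis .
    qed
    obtain m0 where m0: "\<forall>m\<ge>m0. \<exists>n0. \<forall>n\<ge>n0. \<exists>U. integrable M U \<and> (LINT \<omega>|M. U \<omega>) \<le> \<eta> \<and>
        (AE \<omega> in M. X n \<omega> \<in> mspace E \<and> mdist E (X n \<omega>) (step m (\<lambda>d. \<xi> n d \<omega>)) \<le> U \<omega>)" using close[OF \<eta>] by auto
    obtain m1 where m1: "\<And>m. m \<ge> m1 \<Longrightarrow> \<bar>(LINT \<omega>|\<Omega>. H (step m (\<lambda>d. Y d \<omega>))) - (LINT z|limit_law. H z)\<bar> < e / 3"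
      using LIMSEQ_D[OF lipschitz_expectation_limit[OF H], of "e / 3"] e by auto
    define m where "m = max m0 m1"
    obtain n0 where n0: "\<forall>n\<ge>n0. \<exists>U. integrable M U \<and> (LINT \<omega>|M. U \<omega>) \<le> \<eta> \<and>
        (AE \<omega> in M. X n \<omega> \<in> mspace E \<and> mdist E (X n \<omega>) (step m (\<lambda>d. \<xi> n d \<omega>)) \<le> U \<omega>)" using m0 unfolding m_def by (meson max.cobounded1)
    obtain n1 where n1: "\<And>n. n \<ge> n1 \<Longrightarrow> \<bar>(LINT \<omega>|M. H (step m (\<lambda>d. \<xi> n d \<omega>))) - (LINT \<omega>|\<Omega>. H (step m (\<lambda>d. Y d \<omega>)))\<bar> < e / 3"
      using LIMSEQ_D[OF lipschitz_step_tendsto[OF H, of m], of "e / 3"] e by auto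
    show "\<exists>no. \<forall>n\<ge>no. norm (outer_expectation M (\<lambda>\<omega>. H (X n \<omega>)) - (LINT z|limit_law. H z)) < e"
    proof (intro exI allI impI)
      fix n assume n: "n \<ge> max n0 n1"
      obtain U where U: "integrable M U" "(LINT \<omega>|M. U \<omega>) \<le> \<eta>"
        "AE \<omega> in M. X n \<omega> \<in> mspace E \<and> mdist E (X n \<omega>) (step m (\<lambda>d. \<xi> n d \<omega>)) \<le> U \<omega>" using n0 n by (meson max.boundedE)
      have "\<bar>outer_expectation M (\<lambda>\<omega>. H (X n \<omega>)) - (LINT \<omega>|M. H (step m (\<lambda>d. \<xi> n d \<omega>)))\<bar> \<le> (LINT \<omega>|M. C * U \<omega>)"
      proof (rule M.outer_expectation_close)
        have "(\<lambda>\<omega>. H (step m (\<lambda>d. \<xi> n d \<omega>))) \<in> borel_measurable M"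
          by (rule borel_measurable_lipschitz_compose[OF \<pi>_fin lipschitz_step(1)[OF H] C]) (use \<xi>_meas net_range_subset in blast)
        then show "integrable M (\<lambda>\<omega>. H (step m (\<lambda>d. \<xi> n d \<omega>)))"
          using lipschitz_step(2)[OF H] by (intro M.integrable_const_bound[of _ B]) auto
        show "integrable M (\<lambda>\<omega>. C * U \<omega>)" using U by simp
        show "AE \<omega> in M. \<bar>H (X n \<omega>) - H (step m (\<lambda>d. \<xi> n d \<omega>))\<bar> \<le> C * U \<omega>"
          using U(3)
        proof eventually_elim
          case (elim \<omega>)
          then have "\<bar>H (X n \<omega>) - H (step m (\<lambda>d. \<xi> n d \<omega>))\<bar> \<le> C * mdist E (X n \<omega>) (step m (\<lambda>d. \<xi> n d \<omega>))"
            using H unfolding lipschitz_bounded_def by auto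
          also have "\<dots> \<le> C * U \<omega>" using elim C by (intro mult_left_mono) auto
          finally show ?case .
        qed
      qed
      also have "\<dots> \<le> e / 3" using U(2) C C\<eta> mult_left_mono[OF U(2) C] by simp
      finally show "norm (outer_expectation M (\<lambda>\<omega>. H (X n \<omega>)) - (LINT z|limit_law. H z)) < e"
        using n1[of n] m1[of m] n unfolding real_norm_def m_def by linarith
    qed
  qed
qed

end

subsection \<open>The Brownian bridge\<close>

lemma centered_normal_law_properties:
  assumes v: "v \<ge> 0"
  shows "real_distribution (centered_normal_law v)" "char (centered_normal_law v) t = complex_of_real (exp (- t\<^sup>2 * v / 2))"
proof -
  show rd: "real_distribution (centered_normal_law v)"
  proof (cases "v = 0")
    case True
    then show ?thesis unfolding centered_normal_law_def real_distribution_def real_distribution_axioms_def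
      by (simp add: prob_space_return)
  next
    case False
    then have "prob_space (density lborel (normal_density 0 (sqrt v)))" using v by (intro prob_space_normal_density) simp
    then show ?thesis unfolding centered_normal_law_def real_distribution_def real_distribution_axioms_def using False by simp
  qed
  show "char (centered_normal_law v) t = complex_of_real (exp (- t\<^sup>2 * v / 2))"
  proof (cases "v = 0")
    case True
    then show ?thesis by (simp add: centered_normal_law_def char_def integral_return)
  next
    case False
    define \<sigma> where "\<sigma> = sqrt v"
    have \<sigma>: "\<sigma> > 0" "\<sigma>\<^sup>2 = v" using v False by (auto simp: \<sigma>_def)
    let ?N = "density lborel (\<lambda>x. ennreal (normal_density 0 \<sigma> x))"
    interpret N: prob_space ?N by (rule prob_space_normal_density[OF \<sigma>(1)])
    have "distributed ?N lborel (\<lambda>x. x) (normal_density 0 \<sigma>)"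
      by (auto simp: distributed_def distr_id2)
    then have "distributed ?N lborel (\<lambda>x. (x - 0) / \<sigma>) std_normal_density"
      using N.normal_standard_normal_convert[OF \<sigma>(1), of "\<lambda>x. x" 0] by simp
    then have D: "distr ?N lborel (\<lambda>x. x / \<sigma>) = std_normal_distribution"
      by (simp add: distributed_distr_eq_density)
    have "char (centered_normal_law v) t = (CLINT x|?N. iexp (\<sigma> * t * (x / \<sigma>)))"
      using \<sigma>(1) False by (simp add: char_def centered_normal_law_def \<sigma>_def)
    also have "\<dots> = char (distr ?N lborel (\<lambda>x. x / \<sigma>)) (\<sigma> * t)"
      unfolding char_def by (subst integral_distr) auto
    also have "\<dots> = complex_of_real (exp (- (\<sigma> * t)\<^sup>2 / 2))"
      unfolding D by (simp add: char_std_normal_distribution)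
    finally show ?thesis using \<sigma>(2) by (simp add: power_mult_distrib mult.commute)
  qed
qed

lemma (in prob_space) integral_iexp:
  assumes [measurable]: "X \<in> borel_measurable M"
  shows "Re (CLINT \<omega>|M. iexp (X \<omega>)) = (LINT \<omega>|M. cos (X \<omega>))" "Im (CLINT \<omega>|M. iexp (X \<omega>)) = (LINT \<omega>|M. sin (X \<omega>))"
proof -
  have "integrable M (\<lambda>\<omega>. iexp (X \<omega>))" by (intro integrable_const_bound[of _ 1]) auto
  then show "Re (CLINT \<omega>|M. iexp (X \<omega>)) = (LINT \<omega>|M. cos (X \<omega>))" "Im (CLINT \<omega>|M. iexp (X \<omega>)) = (LINT \<omega>|M. sin (X \<omega>))"
    by (simp_all add: integral_Re[symmetric] integral_Im[symmetric] Re_exp Im_exp del: integral_Re integral_Im)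
qed

lemma abs_cos_diff_le: "\<bar>cos x - cos y\<bar> \<le> \<bar>x - y :: real\<bar>"
  and abs_sin_diff_le: "\<bar>sin x - sin y\<bar> \<le> \<bar>x - y :: real\<bar>"
proof -
  have *: "\<bar>2 * a * b\<bar> \<le> 2 * \<bar>c\<bar>" if "\<bar>a\<bar> \<le> 1" "\<bar>b\<bar> \<le> \<bar>c\<bar>" for a b c :: real
    using mult_mono[OF that(1) that(2)] by (simp add: abs_mult)
  have "\<bar>2 * sin ((x + y) / 2) * sin ((y - x) / 2)\<bar> \<le> 2 * \<bar>(y - x) / 2\<bar>"
    by (rule *[OF abs_sin_le_one abs_sin_x_le_abs_x])
  then show "\<bar>cos x - cos y\<bar> \<le> \<bar>x - y\<bar>" unfolding cos_diff_cos by simp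
  have "\<bar>2 * cos ((x + y) / 2) * sin ((x - y) / 2)\<bar> \<le> 2 * \<bar>(x - y) / 2\<bar>"
    by (rule *[OF abs_cos_le_one abs_sin_x_le_abs_x])
  then show "\<bar>sin x - sin y\<bar> \<le> \<bar>x - y\<bar>" unfolding sin_diff_sin by (simp add: mult_ac)
qed

context net_convergence
begin

text \<open>Members of \<open>I\<close> need not be net points, and \<open>Y\<close> is tied to
  \<xi> only on the nets. The law is therefore read off from weak convergence of \<xi> itself:
  cosine and sine of a multiple of the linear functional are bounded Lipschitz functions, which
  identifies the characteristic function.\<close>

lemma linear_combination_law:
  assumes close: "asymptotically_close (\<lambda>n \<omega>. \<lambda>g\<in>\<G>. \<xi> n g \<omega>)" and I: "finite I" "I \<subseteq> \<G>" and v: "v \<ge> 0"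
    and char_lim: "\<And>t :: real. (\<lambda>n. CLINT \<omega>|M. iexp (t * (\<Sum>g\<in>I. a g * \<xi> n g \<omega>))) \<longlonglongrightarrow> complex_of_real (exp (- t\<^sup>2 * v / 2))"
  shows "distr limit_law borel (\<lambda>z. \<Sum>g\<in>I. a g * z g) = centered_normal_law v"
proof -
  interpret L: prob_space limit_law by (rule limit_law_basic)
  let ?l = "\<lambda>z. \<Sum>g\<in>I. a g * z g"
  let ?C = "\<Sum>g\<in>I. \<bar>a g\<bar>"
  have l_lip: "\<bar>?l z - ?l w\<bar> \<le> ?C * mdist E z w" if "z \<in> mspace E" "w \<in> mspace E" for z w
  proof -
    have "?l z - ?l w = (\<Sum>g\<in>I. a g * (z g - w g))" by (simp add: sum_subtractf right_diff_distrib)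
    also have "\<bar>\<dots>\<bar> \<le> (\<Sum>g\<in>I. \<bar>a g\<bar> * \<bar>z g - w g\<bar>)" by (rule order_trans[OF sum_abs]) (simp add: abs_mult)
    also have "\<dots> \<le> (\<Sum>g\<in>I. \<bar>a g\<bar> * mdist E z w)"
      using le_mdist_linfty[OF that] I by (intro sum_mono mult_left_mono) auto
    finally show ?thesis by (simp add: sum_distrib_right)
  qed
  have l_cont: "continuous_map (mtopology_of E) euclideanreal ?l"
  proof (intro continuous_map_sum I(1) continuous_map_real_mult_left)
    fix g assume g: "g \<in> I"
    show "continuous_map (mtopology_of E) euclideanreal (\<lambda>z. z g)"
      unfolding continuous_map openin_mtopology_of
    proof (intro conjI allI impI ballI)
      fix U z assume U: "openin euclideanreal U" and z: "z \<in> {z \<in> topspace (mtopology_of E). z g \<in> U}"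
      then obtain e where e: "e > 0" "ball (z g) e \<subseteq> U" by (auto simp: open_contains_ball)
      show "\<exists>r>0. \<forall>y\<in>mspace E. mdist E z y < r \<longrightarrow> y \<in> {z \<in> topspace (mtopology_of E). z g \<in> U}"
      proof (intro exI conjI ballI impI)
        fix y assume y: "y \<in> mspace E" "mdist E z y < e"
        have "\<bar>z g - y g\<bar> < e" using le_mdist_linfty[of z \<G> y g] y z g I by auto
        then have "y g \<in> ball (z g) e" by (simp add: dist_real_def)
        then show "y \<in> {z \<in> topspace (mtopology_of E). z g \<in> U}" using e(2) y by auto
      qed (rule e(1))
    qed auto
  qed
  have l_meas [measurable]: "?l \<in> borel_measurable limit_law"
    by (rule borel_measurable_of_continuous_map[OF limit_law_basic(2,3) l_cont])
  have lim: "(\<lambda>n. LINT \<omega>|M. c (t * (\<Sum>g\<in>I. a g * \<xi> n g \<omega>))) \<longlonglongrightarrow> (LINT z|limit_law. c (t * ?l z))"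
    if c: "\<And>x y. \<bar>c x - c y\<bar> \<le> \<bar>x - y\<bar>" "\<And>x. \<bar>c x\<bar> \<le> 1" "c \<in> borel_measurable borel" for t :: real and c :: "real \<Rightarrow> real"
  proof -
    note [measurable] = c(3)
    have lip: "lipschitz_bounded E (\<lambda>z. c (t * ?l z)) (\<bar>t\<bar> * ?C) 1"
      unfolding lipschitz_bounded_def
    proof (intro conjI ballI)
      fix z w assume zw: "z \<in> mspace E" "w \<in> mspace E"
      have "\<bar>c (t * ?l z) - c (t * ?l w)\<bar> \<le> \<bar>t * ?l z - t * ?l w\<bar>" by (rule c(1))
      also have "\<dots> = \<bar>t\<bar> * \<bar>?l z - ?l w\<bar>" by (simp only: right_diff_distrib[symmetric] abs_mult)
      also have "\<dots> \<le> \<bar>t\<bar> * (?C * mdist E z w)" by (intro mult_left_mono l_lip zw) auto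
      finally show "\<bar>c (t * ?l z) - c (t * ?l w)\<bar> \<le> \<bar>t\<bar> * ?C * mdist E z w" by (simp add: mult.assoc)
    qed (auto simp: c(2) sum_nonneg)
    have bnd: "bounded ((\<lambda>z. c (t * ?l z)) ` mspace E)" using c(2) by (auto simp: bounded_iff)
    have "(\<lambda>n. outer_expectation M (\<lambda>\<omega>. c (t * ?l (\<lambda>g\<in>\<G>. \<xi> n g \<omega>)))) \<longlonglongrightarrow> (LINT z|limit_law. c (t * ?l z))"
      using weak_convergence[OF close] continuous_map_lipschitz[OF lip] bnd
      unfolding weakly_converges_outer_def by blast
    moreover have "outer_expectation M (\<lambda>\<omega>. c (t * ?l (\<lambda>g\<in>\<G>. \<xi> n g \<omega>))) = (LINT \<omega>|M. c (t * (\<Sum>g\<in>I. a g * \<xi> n g \<omega>)))" for n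
    proof -
      have eq: "?l (\<lambda>g\<in>\<G>. \<xi> n g \<omega>) = (\<Sum>g\<in>I. a g * \<xi> n g \<omega>)" for \<omega>
        using I by (intro sum.cong) auto
      have [measurable]: "(\<lambda>\<omega>. \<Sum>g\<in>I. a g * \<xi> n g \<omega>) \<in> borel_measurable M"
        using I by (intro borel_measurable_sum borel_measurable_times \<xi>_meas) auto
      have "integrable M (\<lambda>\<omega>. c (t * (\<Sum>g\<in>I. a g * \<xi> n g \<omega>)))"
        by (rule M.integrable_const_bound[of _ 1]) (auto simp: c(2))
      from M.outer_expectation_close[OF this, of "\<lambda>_. 0"] show ?thesis unfolding eq by simp
    qed
    ultimately show ?thesis by simp
  qed
  have "char (distr limit_law borel ?l) t = char (centered_normal_law v) t" for t
  proof -
    have m: "(\<lambda>\<omega>. t * (\<Sum>g\<in>I. a g * \<xi> n g \<omega>)) \<in> borel_measurable M" for n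
      using I by (intro borel_measurable_sum borel_measurable_times \<xi>_meas) auto
    have tl_meas: "(\<lambda>z. t * ?l z) \<in> borel_measurable limit_law" by measurable
    have char_eq: "char (distr limit_law borel ?l) t = (CLINT z|limit_law. iexp (t * ?l z))"
      unfolding char_def by (subst integral_distr) auto
    have "(\<lambda>n. LINT \<omega>|M. cos (t * (\<Sum>g\<in>I. a g * \<xi> n g \<omega>))) \<longlonglongrightarrow> exp (- t\<^sup>2 * v / 2)"
      using tendsto_Re[OF char_lim[of t]] by (simp only: M.integral_iexp(1)[OF m] Re_complex_of_real)
    then have re: "(LINT z|limit_law. cos (t * ?l z)) = exp (- t\<^sup>2 * v / 2)"
      by (rule LIMSEQ_unique[rotated]) (rule lim, auto intro: abs_cos_diff_le)
    have "(\<lambda>n. LINT \<omega>|M. sin (t * (\<Sum>g\<in>I. a g * \<xi> n g \<omega>))) \<longlonglongrightarrow> 0"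
      using tendsto_Im[OF char_lim[of t]] by (simp only: M.integral_iexp(2)[OF m] Im_complex_of_real)
    then have im: "(LINT z|limit_law. sin (t * ?l z)) = 0"
      by (rule LIMSEQ_unique[rotated]) (rule lim, auto intro: abs_sin_diff_le)
    have "(CLINT z|limit_law. iexp (t * ?l z)) = complex_of_real (exp (- t\<^sup>2 * v / 2))"
      by (rule complex_eqI) (simp_all only: L.integral_iexp[OF tl_meas] re im Re_complex_of_real Im_complex_of_real)
    then show ?thesis unfolding char_eq centered_normal_law_properties(2)[OF v] .
  qed
  then show ?thesis
    by (intro Levy_uniqueness L.real_distribution_distr l_meas centered_normal_law_properties(1)[OF v] ext)
qed

end

context empirical_sample
begin

lemma nets_exist:
  assumes "\<And>m. r m > 0"
  obtains \<pi> where "finite_nets \<G> \<pi>" "\<And>m g. g \<in> \<G> \<Longrightarrow> L2_seminorm P (\<lambda>y. g y - \<pi> m g y) < r m"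
proof -
  have "\<exists>F. finite F \<and> F \<subseteq> \<G> \<and> (\<forall>g\<in>\<G>. \<exists>g0\<in>F. L2_seminorm P (\<lambda>y. g y - g0 y) < r m)" for m
    using totally_bounded[OF assms, of m] by metis
  then obtain F where F: "\<And>m. finite (F m)" "\<And>m. F m \<subseteq> \<G>" "\<And>m. \<forall>g\<in>\<G>. \<exists>g0\<in>F m. L2_seminorm P (\<lambda>y. g y - g0 y) < r m"
    by metis
  have "\<forall>m. \<exists>p. \<forall>g\<in>\<G>. p g \<in> F m \<and> L2_seminorm P (\<lambda>y. g y - p g y) < r m"
  proof
    fix m
    show "\<exists>p. \<forall>g\<in>\<G>. p g \<in> F m \<and> L2_seminorm P (\<lambda>y. g y - p g y) < r m"
      using F(3)[of m] by (intro bchoice) blast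
  qed
  from choice[OF this] obtain \<pi> where \<pi>: "\<And>m g. g \<in> \<G> \<Longrightarrow> \<pi> m g \<in> F m \<and> L2_seminorm P (\<lambda>y. g y - \<pi> m g y) < r m"
    by blast
  have "finite_nets \<G> \<pi>"
  proof
    show "\<And>m g. g \<in> \<G> \<Longrightarrow> \<pi> m g \<in> \<G>" using \<pi> F(2) by blast
    show "finite (\<pi> m ` \<G>)" for m by (rule finite_subset[OF _ F(1)[of m]]) (use \<pi> in blast)
  qed
  then show ?thesis using that \<pi> by blast
qed

lemma gaussian_process:
  assumes D: "countable D" "D \<subseteq> \<G>"
  obtains Y :: "(real \<Rightarrow> real) \<Rightarrow> (nat \<Rightarrow> real) \<Rightarrow> real" where
    "\<And>d. Y d \<in> borel_measurable (PiM UNIV (\<lambda>_. std_normal_distribution))"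
    "\<And>J t. finite J \<Longrightarrow> J \<subseteq> D \<Longrightarrow> (CLINT \<omega>|PiM UNIV (\<lambda>_. std_normal_distribution). iexp (\<Sum>d\<in>J. t d * Y d \<omega>)) =
       complex_of_real (exp (- (\<Sum>d\<in>J. \<Sum>d'\<in>J. t d * t d' * bridge_cov P d d') / 2))"
proof -
  define g where "g k = (if D = {} then (\<lambda>_. 0) else from_nat_into D k)" for k
  have g: "g k \<in> square_integrable" for k
  proof (cases "D = {}")
    case True
    then show ?thesis by (simp add: g_def square_integrable_def)
  next
    case False
    then show ?thesis using from_nat_into[OF False, of k] D(2) G_square_integrable by (auto simp: g_def)
  qed
  let ?\<Omega> = "PiM UNIV (\<lambda>_ :: nat. std_normal_distribution)"
  obtain W where W: "\<And>k. W k \<in> borel_measurable ?\<Omega>"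
    "\<And>(J :: nat set) t. finite J \<Longrightarrow> (CLINT \<omega>|?\<Omega>. iexp (\<Sum>k\<in>J. t k * W k \<omega>)) =
       complex_of_real (exp (- (\<Sum>k\<in>J. \<Sum>l\<in>J. t k * t l * bridge_cov P (g k) (g l)) / 2))"
    using gaussian_sequence[where g = g] g by blast
  show ?thesis
  proof (rule that[of "\<lambda>d. W (to_nat_on D d)"])
    fix J and t :: "(real \<Rightarrow> real) \<Rightarrow> real" assume J: "finite J" "J \<subseteq> D"
    have inj: "inj_on (to_nat_on D) J" using inj_on_to_nat_on[OF D(1)] J(2) by (rule inj_on_subset)
    have gd: "g (to_nat_on D d) = d" if "d \<in> J" for d
      using that J(2) D(1) by (auto simp: g_def)
    let ?s = "\<lambda>k. t (g k)"
    have 1: "(\<Sum>k\<in>to_nat_on D ` J. ?s k * W k \<omega>) = (\<Sum>d\<in>J. t d * W (to_nat_on D d) \<omega>)" for \<omega>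
      by (subst sum.reindex[OF inj]) (auto simp: gd intro!: sum.cong)
    have 2: "(\<Sum>k\<in>to_nat_on D ` J. \<Sum>l\<in>to_nat_on D ` J. ?s k * ?s l * bridge_cov P (g k) (g l)) =
        (\<Sum>d\<in>J. \<Sum>d'\<in>J. t d * t d' * bridge_cov P d d')"
      by (simp add: sum.reindex[OF inj] gd)
    show "(CLINT \<omega>|?\<Omega>. iexp (\<Sum>d\<in>J. t d * W (to_nat_on D d) \<omega>)) =
       complex_of_real (exp (- (\<Sum>d\<in>J. \<Sum>d'\<in>J. t d * t d' * bridge_cov P d d') / 2))"
      using W(2)[of "to_nat_on D ` J" ?s] J(1) by (simp only: 1 2 finite_imageI)
  qed (rule W(1))
qed

text \<open>From (a - b)^2 <= 2 a^2 + 2 b^2 and twice the bound d / 2; the halves are exactly what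
  this weaker form of the triangle inequality requires.\<close>

lemma L2_triangle:
  assumes "g \<in> \<G>" "g1 \<in> \<G>" "g2 \<in> \<G>" "d > 0"
    "L2_seminorm P (\<lambda>y. g y - g1 y) < d / 2" "L2_seminorm P (\<lambda>y. g y - g2 y) < d / 2"
  shows "L2_seminorm P (\<lambda>y. g1 y - g2 y) < d"
proof -
  have int: "integrable P (\<lambda>y. (h y - h' y)\<^sup>2)" if "h \<in> \<G>" "h' \<in> \<G>" for h h'
    using law_diff_le(1)[OF admissible_f, of "\<lambda>y. (h y - h' y)\<^sup>2" 4] diff_sq_le_V[OF that] G_meas[OF that(1)] G_meas[OF that(2)]
    by (simp add: P_eq)
  have sq: "(LINT y|P. (g y - g' y)\<^sup>2) < (d / 2)\<^sup>2" if "L2_seminorm P (\<lambda>y. g y - g' y) < d / 2" for g'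
  proof -
    have "(L2_seminorm P (\<lambda>y. g y - g' y))\<^sup>2 < (d / 2)\<^sup>2"
      by (rule power_strict_mono[OF that]) (auto simp: L2_seminorm_def intro: Bochner_Integration.integral_nonneg)
    then show ?thesis by (simp only: L2_seminorm_law_sq)
  qed
  have "(L2_seminorm P (\<lambda>y. g1 y - g2 y))\<^sup>2 = (LINT y|P. (g1 y - g2 y)\<^sup>2)" by (rule L2_seminorm_law_sq)
  also have "\<dots> \<le> (LINT y|P. 2 * (g y - g1 y)\<^sup>2 + 2 * (g y - g2 y)\<^sup>2)"
  proof (rule Bochner_Integration.integral_mono)
    show "(g1 y - g2 y)\<^sup>2 \<le> 2 * (g y - g1 y)\<^sup>2 + 2 * (g y - g2 y)\<^sup>2" for y
      using zero_le_power2[of "(g y - g1 y) + (g y - g2 y)"] by (simp add: power2_eq_square algebra_simps)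
  qed (use int assms in auto)
  also have "\<dots> < d\<^sup>2" using sq[OF assms(5)] sq[OF assms(6)] int[OF assms(1,2)] int[OF assms(1,3)] by (simp add: power_divide)
  finally show ?thesis using assms(4) by (simp add: power_less_imp_less_base)
qed

text \<open>The Gaussian process lives on a countable set of net points and knows nothing of the
  class beyond its covariance. Its oscillation between consecutive nets is inherited: the truncated
  gap is a Lipschitz function of finitely many coordinates, and its mean under the empirical process
  is at most 2^-m for large \<open>n\<close>.\<close>

lemma net_convergence_exists:
  obtains \<pi> Y where "net_convergence \<G> \<pi> (PiM UNIV (\<lambda>_. std_normal_distribution) :: (nat \<Rightarrow> real) measure) Y M emp"
    "\<And>r. r > 0 \<Longrightarrow> \<exists>m0. \<forall>m\<ge>m0. \<forall>g\<in>\<G>. L2_seminorm P (\<lambda>y. g y - \<pi> m g y) < r"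
proof -
  have "\<forall>m. \<exists>d n0. d > 0 \<and> (\<forall>n\<ge>n0.
    (\<exists>U. integrable M U \<and> (\<forall>\<omega>. U \<omega> \<ge> 0) \<and> (LINT \<omega>|M. U \<omega>) \<le> (1 / 2) ^ m \<and>
    (AE \<omega> in M. \<forall>g\<in>\<G>. \<forall>g'\<in>\<G>. L2_seminorm P (\<lambda>y. g y - g' y) < d \<longrightarrow> \<bar>emp n g \<omega> - emp n g' \<omega>\<bar> \<le> U \<omega>)))"
    by (rule allI, rule_tac e = "(1 / 2) ^ m" in emp_equicontinuous) (simp, blast)
  from choice[OF this] obtain d where "\<forall>m. \<exists>n0. d m > 0 \<and> (\<forall>n\<ge>n0.
    (\<exists>U. integrable M U \<and> (\<forall>\<omega>. U \<omega> \<ge> 0) \<and> (LINT \<omega>|M. U \<omega>) \<le> (1 / 2) ^ m \<and>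
    (AE \<omega> in M. \<forall>g\<in>\<G>. \<forall>g'\<in>\<G>. L2_seminorm P (\<lambda>y. g y - g' y) < d m \<longrightarrow> \<bar>emp n g \<omega> - emp n g' \<omega>\<bar> \<le> U \<omega>)))" by blast
  from choice[OF this] obtain n0 where d: "\<And>m. d m > 0" and U_ex: "\<And>m n. n \<ge> n0 m \<Longrightarrow>
    (\<exists>U. integrable M U \<and> (\<forall>\<omega>. U \<omega> \<ge> 0) \<and> (LINT \<omega>|M. U \<omega>) \<le> (1 / 2) ^ m \<and>
    (AE \<omega> in M. \<forall>g\<in>\<G>. \<forall>g'\<in>\<G>. L2_seminorm P (\<lambda>y. g y - g' y) < d m \<longrightarrow> \<bar>emp n g \<omega> - emp n g' \<omega>\<bar> \<le> U \<omega>))"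
    by blast
  \<comment> \<open>Projections to levels \<open>m\<close> and \<open>m + 1\<close> must be within d
    m of each other, so both radii have to be at most d m / 2; the index \<open>m - 1\<close>
    provides this for level \<open>m + 1\<close>. At \<open>m = 0\<close> it repeats d 0. The power
    of 1/2 makes the radii tend to zero.\<close>
  define r where "r m = min ((1 / 2) ^ m) (min (d m / 2) (d (m - 1) / 2))" for m
  have r: "r m > 0" for m using d by (simp add: r_def)
  obtain \<pi> where fn: "finite_nets \<G> \<pi>" and \<pi>: "\<And>m g. g \<in> \<G> \<Longrightarrow> L2_seminorm P (\<lambda>y. g y - \<pi> m g y) < r m"
    using nets_exist[of r] r by blast
  interpret finite_nets \<G> \<pi> by (rule fn)
  let ?\<Omega> = "PiM UNIV (\<lambda>_ :: nat. std_normal_distribution)"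
  define D where "D = (\<Union>m. \<pi> m ` \<G>)"
  have D: "countable D" unfolding D_def by (rule countable_UN) (simp_all add: countable_finite[OF \<pi>_fin])
  have D_sub: "D \<subseteq> \<G>" unfolding D_def using \<pi>_mem by blast
  note D = D D_sub
  obtain Y where Y: "\<And>d. Y d \<in> borel_measurable ?\<Omega>"
    "\<And>J t. finite J \<Longrightarrow> J \<subseteq> D \<Longrightarrow> (CLINT \<omega>|?\<Omega>. iexp (\<Sum>d\<in>J. t d * Y d \<omega>)) =
       complex_of_real (exp (- (\<Sum>d\<in>J. \<Sum>d'\<in>J. t d * t d' * bridge_cov P d d') / 2))"
    using gaussian_process[OF D] by blast
  interpret std: real_distribution std_normal_distribution by (rule real_dist_normal_dist)
  interpret \<Omega>: prob_space ?\<Omega> by (intro prob_space_PiM) (rule std.prob_space_axioms)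
  have fidi: "(\<lambda>n. CLINT \<omega>|M. iexp (\<Sum>d\<in>J. t d * emp n d \<omega>)) \<longlonglongrightarrow> (CLINT \<omega>|?\<Omega>. iexp (\<Sum>d\<in>J. t d * Y d \<omega>))"
    if J: "finite J" "J \<subseteq> D" for J t
  proof -
    have "J \<subseteq> square_integrable" using J(2) D(2) G_square_integrable by blast
    from emp_char_sum_tendsto[OF J(1) this, of t] show ?thesis by (simp only: Y(2)[OF J])
  qed
  have osc: "(LINT \<omega>|?\<Omega>. min 1 (gap m (\<lambda>d. Y d \<omega>))) \<le> (1 / 2) ^ m" for m
  proof (rule LIMSEQ_le_const2)
    let ?J = "\<pi> m ` \<G> \<union> \<pi> (Suc m) ` \<G>"
    have J: "finite ?J" "?J \<subseteq> D" "?J \<subseteq> \<G>" using \<pi>_fin \<pi>_mem by (auto simp: D_def)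
    show "(\<lambda>n. LINT \<omega>|M. min 1 (gap m (\<lambda>d. emp n d \<omega>))) \<longlonglongrightarrow> (LINT \<omega>|?\<Omega>. min 1 (gap m (\<lambda>d. Y d \<omega>)))"
      using J(3) by (intro lipschitz_expectation_tendsto[OF J(1) M.prob_space_axioms _ \<Omega>.prob_space_axioms Y(1) fidi[OF J(1,2)]
          measurable_PiM_lipschitz[OF J(1) min_gap_lipschitz] min_gap_lipschitz, where B = 1] G_measurable_emp) auto
    show "\<exists>N. \<forall>n\<ge>N. (LINT \<omega>|M. min 1 (gap m (\<lambda>d. emp n d \<omega>))) \<le> (1 / 2) ^ m"
    proof (intro exI allI impI)
      fix n assume n: "n \<ge> n0 m"
      obtain U where U: "integrable M U" "\<And>\<omega>. U \<omega> \<ge> 0" "(LINT \<omega>|M. U \<omega>) \<le> (1 / 2) ^ m"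
        "AE \<omega> in M. \<forall>g\<in>\<G>. \<forall>g'\<in>\<G>. L2_seminorm P (\<lambda>y. g y - g' y) < d m \<longrightarrow> \<bar>emp n g \<omega> - emp n g' \<omega>\<bar> \<le> U \<omega>"
        using U_ex[OF n] by blast
      have near: "L2_seminorm P (\<lambda>y. \<pi> (Suc m) g y - \<pi> m g y) < d m" if g: "g \<in> \<G>" for g
        using \<pi>[OF g, of m] \<pi>[OF g, of "Suc m"] \<pi>_mem[OF g] g d[of m] by - (rule L2_triangle[of g], auto simp: r_def)
      have ae: "AE \<omega> in M. min 1 (gap m (\<lambda>d. emp n d \<omega>)) \<le> U \<omega>"
        using U(4)
      proof eventually_elim
        case (elim \<omega>)
        have "gap m (\<lambda>d. emp n d \<omega>) \<le> U \<omega>"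
          unfolding gap_def
        proof (rule mdist_linfty_le[OF step_mem step_mem U(2)])
          fix g assume g: "g \<in> \<G>"
          show "\<bar>step (Suc m) (\<lambda>d. emp n d \<omega>) g - step m (\<lambda>d. emp n d \<omega>) g\<bar> \<le> U \<omega>"
            using elim near[OF g] \<pi>_mem[OF g] g by (simp add: step_def)
        qed
        then show ?case by simp
      qed
      have "(\<lambda>\<omega>. min 1 (gap m (\<lambda>d. emp n d \<omega>))) \<in> borel_measurable M"
        by (rule borel_measurable_lipschitz_compose[OF J(1) min_gap_lipschitz]) (use J(3) G_measurable_emp in auto)
      then have "integrable M (\<lambda>\<omega>. min 1 (gap m (\<lambda>d. emp n d \<omega>)))"
        by (intro M.integrable_const_bound[of _ 1]) auto
      from integral_mono_AE[OF this U(1) ae] show "(LINT \<omega>|M. min 1 (gap m (\<lambda>d. emp n d \<omega>))) \<le> (1 / 2) ^ m"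
        using U(3) by simp
    qed
  qed
  have nc: "net_convergence \<G> \<pi> ?\<Omega> Y M emp"
  proof (intro_locales, unfold_locales)
    show "\<And>d. Y d \<in> borel_measurable ?\<Omega>" by (rule Y(1))
    show "\<And>m. (LINT \<omega>|?\<Omega>. min 1 (gap m (\<lambda>d. Y d \<omega>))) \<le> (1 / 2) ^ m" by (rule osc)
    show "\<And>n d. d \<in> \<G> \<Longrightarrow> emp n d \<in> borel_measurable M" by (rule G_measurable_emp)
    show "(\<lambda>n. CLINT \<omega>|M. iexp (\<Sum>d\<in>\<pi> m ` \<G>. t d * emp n d \<omega>)) \<longlonglongrightarrow> (CLINT \<omega>|?\<Omega>. iexp (\<Sum>d\<in>\<pi> m ` \<G>. t d * Y d \<omega>))" for m t
      by (rule fidi[OF \<pi>_fin]) (auto simp: D_def)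
  qed
  show ?thesis
  proof (rule that[OF nc])
    fix s :: real assume s: "s > 0"
    obtain m0 where m0: "(1 / 2) ^ m0 < s" using real_arch_pow_inv[OF s, of "1/2"] by auto
    have "L2_seminorm P (\<lambda>y. g y - \<pi> m g y) < s" if "m \<ge> m0" "g \<in> \<G>" for m g
    proof -
      have "(1 / 2 :: real) ^ m \<le> (1 / 2) ^ m0" using that(1) by (rule power_decreasing) auto
      then show ?thesis using \<pi>[OF that(2), of m] m0 unfolding r_def by linarith
    qed
    then show "\<exists>m0. \<forall>m\<ge>m0. \<forall>g\<in>\<G>. L2_seminorm P (\<lambda>y. g y - \<pi> m g y) < s" by blast
  qed
qed

text \<open>One law works for every process that is close to the empirical process. The choice
  \<open>X = emp\<close> identifies it as the bridge; the smoothed process is inserted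
  later.\<close>

theorem empirical_limit:
  obtains L where "tight_brownian_bridge_law P \<G> L"
    "\<And>X. (\<And>n \<omega>. X n \<omega> \<in> extensional \<G>) \<Longrightarrow>
      (\<And>e. e > 0 \<Longrightarrow> \<exists>n0. \<forall>n\<ge>n0. \<exists>U. integrable M U \<and> (\<forall>\<omega>. U \<omega> \<ge> 0) \<and> (LINT \<omega>|M. U \<omega>) \<le> e \<and>
         (AE \<omega> in M. \<forall>g\<in>\<G>. \<bar>X n \<omega> g - emp n g \<omega>\<bar> \<le> U \<omega>)) \<Longrightarrow>
      weakly_converges_outer M X (linfty \<G>) L"
proof -
  obtain \<pi> Y where nc: "net_convergence \<G> \<pi> (PiM UNIV (\<lambda>_. std_normal_distribution) :: (nat \<Rightarrow> real) measure) Y M emp"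
    and near: "\<And>r. r > 0 \<Longrightarrow> \<exists>m0. \<forall>m\<ge>m0. \<forall>g\<in>\<G>. L2_seminorm P (\<lambda>y. g y - \<pi> m g y) < r"
    using net_convergence_exists by blast
  interpret nc: net_convergence \<G> \<pi> "PiM UNIV (\<lambda>_. std_normal_distribution) :: (nat \<Rightarrow> real) measure" Y M emp by (rule nc)
  have close: "nc.asymptotically_close X"
    if ext: "\<And>n \<omega>. X n \<omega> \<in> extensional \<G>"
      and X: "\<And>e. e > 0 \<Longrightarrow> \<exists>n0. \<forall>n\<ge>n0. \<exists>U. integrable M U \<and> (\<forall>\<omega>. U \<omega> \<ge> 0) \<and> (LINT \<omega>|M. U \<omega>) \<le> e \<and>
         (AE \<omega> in M. \<forall>g\<in>\<G>. \<bar>X n \<omega> g - emp n g \<omega>\<bar> \<le> U \<omega>)" for X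
    unfolding nc.asymptotically_close_def
  proof (intro conjI allI impI ext)
    fix e :: real assume e: "e > 0"
    then have e2: "e / 2 > 0" by simp
    obtain d n1 where d: "d > 0" and "n1 > 0" and n1: "\<And>n. n \<ge> n1 \<Longrightarrow>
      (\<exists>U. integrable M U \<and> (\<forall>\<omega>. U \<omega> \<ge> 0) \<and> (LINT \<omega>|M. U \<omega>) \<le> e / 2 \<and>
      (AE \<omega> in M. \<forall>g\<in>\<G>. \<forall>g'\<in>\<G>. L2_seminorm P (\<lambda>y. g y - g' y) < d \<longrightarrow> \<bar>emp n g \<omega> - emp n g' \<omega>\<bar> \<le> U \<omega>))"
      using emp_equicontinuous[OF e2] by blast
    obtain n2 where n2: "\<forall>n\<ge>n2. \<exists>U. integrable M U \<and> (\<forall>\<omega>. U \<omega> \<ge> 0) \<and> (LINT \<omega>|M. U \<omega>) \<le> e / 2 \<and>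
         (AE \<omega> in M. \<forall>g\<in>\<G>. \<bar>X n \<omega> g - emp n g \<omega>\<bar> \<le> U \<omega>)" using X[OF e2] by blast
    obtain m0 where m0: "\<forall>m\<ge>m0. \<forall>g\<in>\<G>. L2_seminorm P (\<lambda>y. g y - \<pi> m g y) < d" using near[OF d] by blast
    show "\<exists>m0. \<forall>m\<ge>m0. \<exists>n0. \<forall>n\<ge>n0. \<exists>U. integrable M U \<and> (\<forall>\<omega>. U \<omega> \<ge> 0) \<and> (LINT \<omega>|M. U \<omega>) \<le> e \<and>
        (AE \<omega> in M. \<forall>g\<in>\<G>. \<bar>X n \<omega> g - emp n (\<pi> m g) \<omega>\<bar> \<le> U \<omega>)"
    proof (rule exI[of _ m0], intro allI impI, rule exI[of _ "max n1 n2"], intro allI impI)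
      fix m n assume m: "m \<ge> m0" and n: "n \<ge> max n1 n2"
      have "n \<ge> n1" "n \<ge> n2" using n by auto
      obtain U where U: "integrable M U" "\<And>\<omega>. U \<omega> \<ge> 0" "(LINT \<omega>|M. U \<omega>) \<le> e / 2"
        "AE \<omega> in M. \<forall>g\<in>\<G>. \<forall>g'\<in>\<G>. L2_seminorm P (\<lambda>y. g y - g' y) < d \<longrightarrow> \<bar>emp n g \<omega> - emp n g' \<omega>\<bar> \<le> U \<omega>"
        using n1[OF \<open>n \<ge> n1\<close>] by blast
      obtain U' where U': "integrable M U'" "\<And>\<omega>. U' \<omega> \<ge> 0" "(LINT \<omega>|M. U' \<omega>) \<le> e / 2"
        "AE \<omega> in M. \<forall>g\<in>\<G>. \<bar>X n \<omega> g - emp n g \<omega>\<bar> \<le> U' \<omega>"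
        using n2 \<open>n \<ge> n2\<close> by blast
      show "\<exists>U. integrable M U \<and> (\<forall>\<omega>. U \<omega> \<ge> 0) \<and> (LINT \<omega>|M. U \<omega>) \<le> e \<and>
        (AE \<omega> in M. \<forall>g\<in>\<G>. \<bar>X n \<omega> g - emp n (\<pi> m g) \<omega>\<bar> \<le> U \<omega>)"
      proof (intro exI conjI allI)
        show "integrable M (\<lambda>\<omega>. U' \<omega> + U \<omega>)" using U U' by simp
        show "0 \<le> U' \<omega> + U \<omega>" for \<omega> using U(2) U'(2) by (simp add: add_nonneg_nonneg)
        show "(LINT \<omega>|M. U' \<omega> + U \<omega>) \<le> e" using U U' by simp
        show "AE \<omega> in M. \<forall>g\<in>\<G>. \<bar>X n \<omega> g - emp n (\<pi> m g) \<omega>\<bar> \<le> U' \<omega> + U \<omega>"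
          using U(4) U'(4)
        proof eventually_elim
          case (elim \<omega>)
          show ?case
          proof
            fix g assume g: "g \<in> \<G>"
            have "\<bar>emp n g \<omega> - emp n (\<pi> m g) \<omega>\<bar> \<le> U \<omega>" using elim(1) g nc.\<pi>_mem[OF g] m0 m by blast
            moreover have "\<bar>X n \<omega> g - emp n g \<omega>\<bar> \<le> U' \<omega>" using elim(2) g by blast
            ultimately show "\<bar>X n \<omega> g - emp n (\<pi> m g) \<omega>\<bar> \<le> U' \<omega> + U \<omega>" by linarith
          qed
        qed
      qed
    qed
  qed
  have emp_close: "nc.asymptotically_close (\<lambda>n \<omega>. \<lambda>g\<in>\<G>. emp n g \<omega>)"
    by (rule close) (auto intro!: exI[of _ "\<lambda>_. 0"])
  have "tight_brownian_bridge_law P \<G> nc.limit_law"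
    unfolding tight_brownian_bridge_law_def
  proof (intro conjI nc.limit_law_basic nc.tight_limit_law allI impI)
    fix I and a :: "(real \<Rightarrow> real) \<Rightarrow> real" assume I: "finite I \<and> I \<subseteq> \<G>"
    then have I': "finite I" "I \<subseteq> square_integrable" "I \<subseteq> \<G>" using G_square_integrable by auto
    let ?v = "\<Sum>g\<in>I. \<Sum>h\<in>I. a g * a h * bridge_cov P g h"
    show "distr nc.limit_law borel (\<lambda>z. \<Sum>g\<in>I. a g * z g) = centered_normal_law ?v"
    proof (rule nc.linear_combination_law[OF emp_close I'(1,3)])
      show "?v \<ge> 0"
        unfolding bridge_cov_double_sum[OF I'(1,2), symmetric] using I'(2)
        by (intro B_nonneg sum_mem[OF I'(1), of "\<lambda>g. g"]) auto
      fix t :: real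
      have "(\<Sum>g\<in>I. t * a g * emp n g \<omega>) = t * (\<Sum>g\<in>I. a g * emp n g \<omega>)" for n \<omega>
        by (simp add: sum_distrib_left mult.assoc)
      moreover have "(\<Sum>g\<in>I. \<Sum>h\<in>I. t * a g * (t * a h) * bridge_cov P g h) = t\<^sup>2 * ?v"
        by (simp add: sum_distrib_left power2_eq_square mult_ac)
      ultimately show "(\<lambda>n. CLINT \<omega>|M. iexp (t * (\<Sum>g\<in>I. a g * emp n g \<omega>))) \<longlonglongrightarrow> complex_of_real (exp (- t\<^sup>2 * ?v / 2))"
        using emp_char_sum_tendsto[OF I'(1,2), of "\<lambda>g. t * a g"] by simp
    qed
  qed
  then show ?thesis using that nc.weak_convergence close by blast
qed

end

subsection \<open>The smoothed empirical process\<close>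

lemma bandwidth_tendsto_zero:
  fixes b :: "nat \<Rightarrow> real"
  assumes "(\<lambda>n. real n * b n ^ 4) \<longlonglongrightarrow> 0" "d > 0"
  shows "\<forall>\<^sub>F n in sequentially. b n < d"
proof -
  have "\<forall>\<^sub>F n in sequentially. real n * b n ^ 4 < d ^ 4"
    using order_tendstoD(2)[OF assms(1)] assms(2) by simp
  then show ?thesis
    using eventually_ge_at_top[of 1]
  proof eventually_elim
    case (elim n)
    have "1 * b n ^ 4 \<le> real n * b n ^ 4" using elim(2) by (intro mult_right_mono) auto
    then have "b n ^ 4 < d ^ 4" using elim(1) by simp
    then show ?case using assms(2) by (simp add: power_less_imp_less_base)
  qed
qed

text \<open>The exceedance set lies in a null set united with the measurable set where the majorant
  is at least \<open>c\<close>, to which Markov's inequality applies.\<close>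

lemma small_o_outer_prob_of_majorants:
  fixes Z :: "nat \<Rightarrow> 'w \<Rightarrow> ennreal"
  assumes M: "prob_space M"
    and maj: "\<And>e. e > 0 \<Longrightarrow> \<exists>n0. \<forall>n\<ge>n0. \<exists>U. integrable M U \<and> (\<forall>\<omega>. U \<omega> \<ge> 0) \<and> (LINT \<omega>|M. U \<omega>) \<le> e \<and>
      (AE \<omega> in M. Z n \<omega> \<le> ennreal (U \<omega> * a n))"
    and a: "\<forall>\<^sub>F n in sequentially. a n > 0"
  shows "small_o_outer_prob M Z a"
  unfolding small_o_outer_prob_def
proof (intro allI impI)
  fix c :: real assume c: "c > 0"
  interpret prob_space M by (rule M)
  show "(\<lambda>n. outer_measure_of M {\<omega> \<in> space M. Z n \<omega> > ennreal (c * a n)}) \<longlonglongrightarrow> 0"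
  proof (rule order_tendstoI)
    fix y :: ennreal assume "0 < y"
    then obtain x where x: "0 < x" "x < y" using dense by blast
    then have "x < \<infinity>" by (metis less_trans top.not_eq_extremum infinity_ennreal_def not_less_iff_gr_or_eq)
    then obtain s where s: "x = ennreal s" "s \<ge> 0" by (cases x) auto
    then have s_pos: "s > 0" using x by (simp add: ennreal_less_zero_iff)
    \<comment> \<open>With mean at most c s, Markov's inequality at level \<open>c\<close> gives
      probability at most \<open>s\<close>.\<close>
    obtain n0 where n0: "\<forall>n\<ge>n0. \<exists>U. integrable M U \<and> (\<forall>\<omega>. U \<omega> \<ge> 0) \<and> (LINT \<omega>|M. U \<omega>) \<le> c * s \<and>
      (AE \<omega> in M. Z n \<omega> \<le> ennreal (U \<omega> * a n))" using maj[of "c * s"] c s_pos by auto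
    show "\<forall>\<^sub>F n in sequentially. outer_measure_of M {\<omega> \<in> space M. Z n \<omega> > ennreal (c * a n)} < y"
      using a eventually_ge_at_top[of n0]
    proof eventually_elim
      case (elim n)
      obtain U where U: "integrable M U" "\<And>\<omega>. U \<omega> \<ge> 0" "(LINT \<omega>|M. U \<omega>) \<le> c * s"
        "AE \<omega> in M. Z n \<omega> \<le> ennreal (U \<omega> * a n)" using n0 elim(2) by blast
      obtain N where N: "{\<omega> \<in> space M. \<not> Z n \<omega> \<le> ennreal (U \<omega> * a n)} \<subseteq> N" "emeasure M N = 0" "N \<in> sets M"
        by (rule AE_E[OF U(4)])
      let ?B = "{\<omega> \<in> space M. U \<omega> \<ge> c}"
      have B: "?B \<in> sets M" using U(1) by measurable
      have sub: "{\<omega> \<in> space M. Z n \<omega> > ennreal (c * a n)} \<subseteq> N \<union> ?B"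
      proof
        fix \<omega> assume \<omega>: "\<omega> \<in> {\<omega> \<in> space M. Z n \<omega> > ennreal (c * a n)}"
        show "\<omega> \<in> N \<union> ?B"
        proof (cases "\<omega> \<in> N")
          case False
          then have "Z n \<omega> \<le> ennreal (U \<omega> * a n)" using N(1) \<omega> by blast
          then have "ennreal (c * a n) < ennreal (U \<omega> * a n)" using \<omega> less_le_trans by blast
          then have "c * a n < U \<omega> * a n" using c elim(1) by (simp add: ennreal_less_iff)
          then show ?thesis using elim(1) \<omega> by simp
        qed simp
      qed
      have "outer_measure_of M {\<omega> \<in> space M. Z n \<omega> > ennreal (c * a n)} \<le> emeasure M (N \<union> ?B)"
        unfolding outer_measure_of_def by (rule INF_lower) (use sub N(3) B in auto)
      also have "\<dots> \<le> emeasure M N + emeasure M ?B" by (rule emeasure_subadditive[OF N(3) B])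
      also have "\<dots> \<le> ennreal ((1 / c) * (LINT \<omega>|M. U \<omega>))"
        using integral_Markov_inequality[OF U(1) _ c] U(2) N(2) by simp
      also have "\<dots> \<le> ennreal s" using U(3) c by (intro ennreal_leI) (simp add: divide_le_eq mult.commute)
      finally show ?case using x(2) s(1) by simp
    qed
  qed simp
qed

context empirical_sample
begin

lemma smoothing_kernel_scaled:
  assumes k: "smoothing_kernel k" and b: "b > 0"
  shows "kernel_density (scaled_kernel k b) b"
proof -
  have nonneg: "\<And>x. k x \<ge> 0" and int: "integrable lborel k" "(LINT x|lborel. k x) = 1" and supp: "\<And>x. \<bar>x\<bar> > 1 \<Longrightarrow> k x = 0"
    and diff: "twice_cont_differentiable k"
    using k by (auto simp: smoothing_kernel_def)
  obtain k' where k': "\<And>x. (k has_real_derivative k' x) (at x)" using diff unfolding twice_cont_differentiable_def by blast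
  have cont: "continuous_on UNIV k"
    using k' DERIV_isCont by (auto simp: continuous_on_eq_continuous_at)
  have [measurable]: "k \<in> borel_measurable borel" by (rule borel_measurable_continuous_onI[OF cont])
  have "compact (k ` {-1..1})" by (intro compact_continuous_image continuous_on_subset[OF cont]) auto
  then obtain B where B: "\<forall>y\<in>k ` {-1..1}. norm y \<le> B" using compact_imp_bounded bounded_iff by metis
  have bnd: "k x \<le> \<bar>B\<bar>" for x
  proof (cases "\<bar>x\<bar> > 1")
    case False
    then have "x \<in> {-1..1}" by auto
    then have "norm (k x) \<le> B" using B by blast
    then show ?thesis by simp
  qed (simp add: supp)
  have sc: "scaled_kernel k b = (\<lambda>y. k (0 + (1 / b) * y) / b)" by (simp add: scaled_kernel_def fun_eq_iff)
  have 1: "integrable lborel (\<lambda>y. k (0 + (1 / b) * y))" using int(1) b by (intro lborel_integrable_real_affine) auto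
  have 2: "(LINT y|lborel. k (0 + (1 / b) * y)) = b"
    using lborel_integral_real_affine[of "1 / b" k 0] int b by (simp add: field_simps)
  show ?thesis
    unfolding kernel_density_def
  proof (intro conjI allI impI exI)
    show "scaled_kernel k b \<in> borel_measurable borel" unfolding sc by measurable
    show "0 \<le> scaled_kernel k b v" for v using nonneg b by (simp add: scaled_kernel_def)
    show "scaled_kernel k b v \<le> \<bar>B\<bar> / b" for v using bnd b by (simp add: scaled_kernel_def divide_right_mono)
    show "integrable lborel (scaled_kernel k b)" unfolding sc using 1 by simp
    show "(LINT v|lborel. scaled_kernel k b v) = 1" unfolding sc using 2 b by simp
    show "scaled_kernel k b v = 0" if "b < \<bar>v\<bar>" for v using supp[of "v / b"] that b by (simp add: scaled_kernel_def)
  qed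
qed

text \<open>A translation in each summand turns the integral against the kernel into
  \<open>smooth\<close>. Integrability comes from the envelope at the countably many observations,
  so the null set does not depend on \<open>g\<close>.\<close>

lemma kde_integral:
  assumes \<kappa>: "kernel_density (scaled_kernel k (b n)) \<beta>" and adm: "admissible (conv f (scaled_kernel k (b n)))"
  shows "AE \<omega> in M. \<forall>g\<in>\<G>. integrable lborel (\<lambda>y. g y * kde k b eps n \<omega> y) \<and>
    (LINT y|lborel. g y * kde k b eps n \<omega> y) = (1 / real n) * (\<Sum>i<n. smooth (scaled_kernel k (b n)) g (eps i \<omega>))"
proof -
  let ?\<kappa> = "scaled_kernel k (b n)"
  have [measurable]: "?\<kappa> \<in> borel_measurable borel" and \<kappa>_nonneg: "\<And>v. ?\<kappa> v \<ge> 0" using \<kappa> by (auto simp: kernel_density_def)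
  have "AE \<omega> in M. integrable (kernel_law ?\<kappa>) (\<lambda>v. V (eps i \<omega> + v))" for i
    by (rule AE_distrD[OF eps_measurable]) (subst eps_law, rule AE_smooth_integrable[OF \<kappa> adm])
  then have "AE \<omega> in M. \<forall>i. integrable (kernel_law ?\<kappa>) (\<lambda>v. V (eps i \<omega> + v))"
    by (subst AE_all_countable) auto
  then show ?thesis
  proof eventually_elim
    case (elim \<omega>)
    show ?case
    proof
      fix g assume g: "g \<in> \<G>"
      note [measurable] = G_meas[OF g]
      have term_i: "integrable lborel (\<lambda>y. g y * ?\<kappa> (y - x))" "(LINT y|lborel. g y * ?\<kappa> (y - x)) = smooth ?\<kappa> g x"
        if x: "integrable (kernel_law ?\<kappa>) (\<lambda>v. V (x + v))" for x
      proof -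
        have "integrable (kernel_law ?\<kappa>) (\<lambda>v. g (x + v))"
          by (rule smooth_integrable_of_le_V[OF \<kappa> G_meas[OF g] G_le_1_V[OF g] x])
        then have 1: "integrable lborel (\<lambda>v. g (v + x) * ?\<kappa> (v + x - x))"
          unfolding kernel_law_def by (subst (asm) integrable_density) (auto simp: \<kappa>_nonneg mult.commute add.commute)
        have 2: "smooth ?\<kappa> g x = (LINT v|lborel. g (v + x) * ?\<kappa> (v + x - x))"
          unfolding smooth_def kernel_law_def by (subst integral_density) (auto simp: \<kappa>_nonneg mult.commute add.commute)
        show "integrable lborel (\<lambda>y. g y * ?\<kappa> (y - x))"
          using lborel_translation(1)[of "\<lambda>y. g y * ?\<kappa> (y - x)" x] 1 by simp
        show "(LINT y|lborel. g y * ?\<kappa> (y - x)) = smooth ?\<kappa> g x"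
          using lborel_translation(2)[of "\<lambda>y. g y * ?\<kappa> (y - x)" x] 2 by simp
      qed
      have eq: "g y * kde k b eps n \<omega> y = (1 / real n) * (\<Sum>i<n. g y * ?\<kappa> (y - eps i \<omega>))" for y
        by (simp add: kde_def sum_distrib_left)
      show "integrable lborel (\<lambda>y. g y * kde k b eps n \<omega> y) \<and>
        (LINT y|lborel. g y * kde k b eps n \<omega> y) = (1 / real n) * (\<Sum>i<n. smooth ?\<kappa> g (eps i \<omega>))"
        unfolding eq using term_i elim by simp
    qed
  qed
qed

text \<open>Half of \<open>e\<close> pays for the centred smoothing error, whose mean is bounded by
  \<open>smoothing_error_small\<close>, the other half for the deterministic bias.\<close>

lemma smoothed_empirical_measure_close:
  assumes k: "smoothing_kernel k" and b_pos: "\<And>n. n \<ge> 1 \<Longrightarrow> b n > 0" and b_lim: "(\<lambda>n. real n * b n ^ 4) \<longlonglongrightarrow> 0"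
    and bias: "(\<lambda>n. SUP g\<in>\<G>. ennreal \<bar>sqrt (real n) *
                  (LINT y|lborel. g y * (conv f (scaled_kernel k (b n)) y - f y))\<bar>) \<longlonglongrightarrow> 0"
    and e: "e > 0"
  shows "\<exists>n0>0. \<forall>n\<ge>n0. \<exists>U. integrable M U \<and> (\<forall>\<omega>. U \<omega> \<ge> 0) \<and> (LINT \<omega>|M. U \<omega>) \<le> e \<and>
    (AE \<omega> in M. \<forall>g\<in>\<G>. integrable lborel (\<lambda>y. g y * kde k b eps n \<omega> y) \<and>
       sqrt (real n) * \<bar>(LINT y|lborel. g y * kde k b eps n \<omega> y) - (1 / real n) * (\<Sum>i<n. g (eps i \<omega>))\<bar> \<le> U \<omega>)"
proof -
  have e2: "e / 2 > 0" using e by simp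
  obtain d n1 where d: "d > 0" and "n1 > 0" and n1: "\<And>n b \<kappa>. n \<ge> n1 \<Longrightarrow> b < d \<Longrightarrow> kernel_density \<kappa> b \<Longrightarrow>
    admissible (conv f \<kappa>) \<and>
    (\<exists>W. integrable (PiM {..<n} (\<lambda>_. P)) W \<and> (\<forall>x. W x \<ge> 0) \<and>
    (AE x in PiM {..<n} (\<lambda>_. P). \<forall>g\<in>\<G>. \<bar>(\<Sum>i<n. smooth \<kappa> g (x i) - g (x i)) -
        real n * ((LINT y|law (conv f \<kappa>). g y) - (LINT y|P. g y))\<bar> \<le> sqrt (real n) * W x) \<and>
    (LINT x|PiM {..<n} (\<lambda>_. P). W x) \<le> e / 2)"
    using smoothing_error_small[OF e2] by blast
  obtain n2 where n2: "\<And>n. n \<ge> n2 \<Longrightarrow> b n < d"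
    using bandwidth_tendsto_zero[OF b_lim d] by (auto simp: eventually_sequentially)
  have "ennreal (e / 2) > 0" using e by simp
  from order_tendstoD(2)[OF bias this] obtain n3 where n3: "\<And>n. n \<ge> n3 \<Longrightarrow>
    (SUP g\<in>\<G>. ennreal \<bar>sqrt (real n) * (LINT y|lborel. g y * (conv f (scaled_kernel k (b n)) y - f y))\<bar>) < ennreal (e / 2)"
    by (auto simp: eventually_sequentially)
  show ?thesis
  proof (rule exI[of _ "max n1 (max n2 n3)"], intro conjI allI impI)
    show "max n1 (max n2 n3) > 0" using \<open>n1 > 0\<close> by simp
    fix n assume n: "n \<ge> max n1 (max n2 n3)"
    then have n_pos: "n > 0" and n': "n \<ge> n1" "n \<ge> n2" "n \<ge> n3" using \<open>n1 > 0\<close> by auto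
    let ?\<kappa> = "scaled_kernel k (b n)"
    have \<kappa>: "kernel_density ?\<kappa> (b n)" by (rule smoothing_kernel_scaled[OF k b_pos]) (use n_pos in simp)
    obtain W where adm: "admissible (conv f ?\<kappa>)" and W: "integrable (PiM {..<n} (\<lambda>_. P)) W" "\<And>x. W x \<ge> 0"
      "AE x in PiM {..<n} (\<lambda>_. P). \<forall>g\<in>\<G>. \<bar>(\<Sum>i<n. smooth ?\<kappa> g (x i) - g (x i)) -
        real n * ((LINT y|law (conv f ?\<kappa>). g y) - (LINT y|P. g y))\<bar> \<le> sqrt (real n) * W x"
      "(LINT x|PiM {..<n} (\<lambda>_. P). W x) \<le> e / 2"
      using n1[OF n'(1) n2[OF n'(2)] \<kappa>] by blast
    have bias_n: "sqrt (real n) * \<bar>(LINT y|law (conv f ?\<kappa>). g y) - (LINT y|P. g y)\<bar> \<le> e / 2" if g: "g \<in> \<G>" for g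
    proof -
      have int: "integrable lborel (\<lambda>y. g y * conv f ?\<kappa> y)" "integrable lborel (\<lambda>y. g y * f y)"
        using integrable_law_of_le_V[OF adm G_meas[OF g] G_le_1_V[OF g]] integrable_law_of_le_V[OF admissible_f G_meas[OF g] G_le_1_V[OF g]]
          integral_law(1)[OF adm G_meas[OF g]] integral_law(1)[OF admissible_f G_meas[OF g]] by auto
      have eq: "(LINT y|law (conv f ?\<kappa>). g y) - (LINT y|P. g y) = (LINT y|lborel. g y * (conv f ?\<kappa> y - f y))"
        unfolding P_eq integral_law(2)[OF adm G_meas[OF g]] integral_law(2)[OF admissible_f G_meas[OF g]]
        using int by (simp add: right_diff_distrib)
      have "ennreal \<bar>sqrt (real n) * (LINT y|lborel. g y * (conv f ?\<kappa> y - f y))\<bar> < ennreal (e / 2)"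
        by (rule le_less_trans[OF SUP_upper[OF g] n3[OF n'(3)]])
      then have "\<bar>sqrt (real n) * (LINT y|lborel. g y * (conv f ?\<kappa> y - f y))\<bar> < e / 2" by (simp add: ennreal_less_iff)
      then show ?thesis unfolding eq by (simp add: abs_mult)
    qed
    have ae: "AE \<omega> in M. \<forall>g\<in>\<G>. integrable lborel (\<lambda>y. g y * kde k b eps n \<omega> y) \<and>
       sqrt (real n) * \<bar>(LINT y|lborel. g y * kde k b eps n \<omega> y) - (1 / real n) * (\<Sum>i<n. g (eps i \<omega>))\<bar> \<le> W (sample n \<omega>) + e / 2"
      using kde_integral[where k = k and b = b and n = n, OF \<kappa> adm] AE_sample[OF n_pos W(3)]
    proof eventually_elim
      case (elim \<omega>)
      show ?case
      proof (intro ballI conjI)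
        fix g assume g: "g \<in> \<G>"
        show "integrable lborel (\<lambda>y. g y * kde k b eps n \<omega> y)" using elim(1) g by blast
        define S where "S = (\<Sum>i<n. smooth ?\<kappa> g (eps i \<omega>) - g (eps i \<omega>))"
        define \<Delta> where "\<Delta> = (LINT y|law (conv f ?\<kappa>). g y) - (LINT y|P. g y)"
        have "S = (\<Sum>i<n. smooth ?\<kappa> g (sample n \<omega> i) - g (sample n \<omega> i))" unfolding S_def by (intro sum.cong) auto
        then have S: "\<bar>S - real n * \<Delta>\<bar> \<le> sqrt (real n) * W (sample n \<omega>)" using bspec[OF elim(2) g] by (simp add: \<Delta>_def)
        have "(LINT y|lborel. g y * kde k b eps n \<omega> y) - (1 / real n) * (\<Sum>i<n. g (eps i \<omega>)) = S / real n"
          using elim(1) g by (simp add: S_def sum_subtractf diff_divide_distrib)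
        also have "sqrt (real n) * \<bar>S / real n\<bar> = \<bar>S\<bar> / sqrt (real n)"
          using n_pos by (simp add: abs_divide real_div_sqrt field_simps)
        also have "\<dots> \<le> (sqrt (real n) * W (sample n \<omega>) + real n * \<bar>\<Delta>\<bar>) / sqrt (real n)"
        proof (rule divide_right_mono)
          have "\<bar>S\<bar> \<le> \<bar>S - real n * \<Delta>\<bar> + \<bar>real n * \<Delta>\<bar>" by linarith
          then show "\<bar>S\<bar> \<le> sqrt (real n) * W (sample n \<omega>) + real n * \<bar>\<Delta>\<bar>" using S by (simp add: abs_mult)
        qed simp
        also have "\<dots> = W (sample n \<omega>) + sqrt (real n) * \<bar>\<Delta>\<bar>"
        proof -
          have "(s * w + s * s * x) / s = w + s * x" if "s > 0" for s w x :: real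
            using that by (simp add: field_simps)
          from this[of "sqrt (real n)"] show ?thesis using n_pos by simp
        qed
        also have "\<dots> \<le> W (sample n \<omega>) + e / 2" using bias_n[OF g] by (simp add: \<Delta>_def)
        finally show "sqrt (real n) * \<bar>(LINT y|lborel. g y * kde k b eps n \<omega> y) - (1 / real n) * (\<Sum>i<n. g (eps i \<omega>))\<bar> \<le> W (sample n \<omega>) + e / 2" .
      qed
    qed
    show "\<exists>U. integrable M U \<and> (\<forall>\<omega>. U \<omega> \<ge> 0) \<and> (LINT \<omega>|M. U \<omega>) \<le> e \<and>
      (AE \<omega> in M. \<forall>g\<in>\<G>. integrable lborel (\<lambda>y. g y * kde k b eps n \<omega> y) \<and>
       sqrt (real n) * \<bar>(LINT y|lborel. g y * kde k b eps n \<omega> y) - (1 / real n) * (\<Sum>i<n. g (eps i \<omega>))\<bar> \<le> U \<omega>)"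
    proof (rule exI[of _ "\<lambda>\<omega>. W (sample n \<omega>) + e / 2"], intro conjI allI ae)
      show "integrable M (\<lambda>\<omega>. W (sample n \<omega>) + e / 2)" using integral_sample(1)[OF n_pos W(1)] by simp
      show "W (sample n \<omega>) + e / 2 \<ge> 0" for \<omega> using W(2) e by (simp add: add_nonneg_nonneg)
      show "(LINT \<omega>|M. W (sample n \<omega>) + e / 2) \<le> e"
        using integral_sample[OF n_pos W(1)] W(4) by (simp add: M.prob_space)
    qed
  qed
qed

text \<open>The centring by \<open>f\<close> cancels, so both claims concern the same quantity.
  Integrability of \<open>g\<close> times the estimator is what permits the splitting; it is
  available outside a null set common to the class.\<close>

lemma smoothed_process_diff:
  assumes g: "g \<in> \<G>" and int: "integrable lborel (\<lambda>y. g y * kde k b eps n \<omega> y)" and n: "n > 0"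
  shows "sqrt (real n) * (LINT y|lborel. g y * (kde k b eps n \<omega> y - f y)) - emp n g \<omega> =
    sqrt (real n) * ((LINT y|lborel. g y * kde k b eps n \<omega> y) - (1 / real n) * (\<Sum>i<n. g (eps i \<omega>)))"
proof -
  have f: "integrable lborel (\<lambda>y. g y * f y)" "(LINT y|P. g y) = (LINT y|lborel. g y * f y)"
    using G_integrable[OF g] integral_law[OF admissible_f G_meas[OF g]] by (simp_all add: P_eq)
  have 1: "(LINT y|lborel. g y * (kde k b eps n \<omega> y - f y)) = (LINT y|lborel. g y * kde k b eps n \<omega> y) - (LINT y|P. g y)"
    using int f by (simp add: right_diff_distrib)
  have 2: "emp n g \<omega> = sqrt (real n) * ((1 / real n) * (\<Sum>i<n. g (eps i \<omega>)) - (LINT y|P. g y))"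
    using n by (simp add: emp_def sum_subtractf field_simps)
  show ?thesis unfolding 1 2 by (simp add: algebra_simps)
qed

end

theorem proposition2p2:
  fixes M :: "'w measure"
    and eps :: "nat \<Rightarrow> 'w \<Rightarrow> real"
    and f k V :: "real \<Rightarrow> real"
    and b :: "nat \<Rightarrow> real"
    and d :: nat
    and \<G> :: "(real \<Rightarrow> real) set"
  defines "P \<equiv> density lborel (\<lambda>y. ennreal (f y))"
  assumes "prob_space M"
    and indep: "prob_space.indep_vars M (\<lambda>_. borel) eps UNIV"
    and f_pos: "\<And>y. f y > 0"
    and dens: "\<And>i. distributed M lborel (eps i) (\<lambda>y. ennreal (f y))"
    and mean_zero: "\<And>i. integrable M (eps i) \<and> (LINT \<omega>|M. eps i \<omega>) = 0"
    and finite_var: "\<And>i. integrable M (\<lambda>\<omega>. (eps i \<omega>)\<^sup>2)"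
    and kernel: "smoothing_kernel k"
    and d_pos: "d \<ge> 1"
    and b_pos: "\<And>n. n \<ge> 1 \<Longrightarrow> b n > 0"
    and b_upper: "(\<lambda>n. real n * b n ^ 4) \<longlonglongrightarrow> 0"
    and b_lower: "filterlim (\<lambda>n. real n * b n powr ((50 + 20 * real d) / (14 + 5 * real d)))
                    at_top sequentially"
    and G_meas: "\<G> \<subseteq> borel_measurable borel"
    and G_suitable: "suitably_measurable_class P \<G>"
    and G_entropy: "uniformly_integrable_L2_entropy \<G> V"
    and V_envelope: "envelope V \<G>"
    and V_L2: "V \<in> borel_measurable borel" "integrable P (\<lambda>y. (V y)\<^sup>2)"
    and V_shift: "((\<lambda>s. \<integral>\<^sup>+ y. ennreal ((V (y + s) - V y)\<^sup>2 * f y) \<partial>lborel) \<longlongrightarrow> 0) (at 0)"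
    and bias: "(\<lambda>n. SUP g\<in>\<G>. ennreal \<bar>sqrt (real n) *
                  (LINT y|lborel. g y * (conv f (scaled_kernel k (b n)) y - f y))\<bar>) \<longlonglongrightarrow> 0"
  shows "small_o_outer_prob M
           (\<lambda>n \<omega>. SUP g\<in>\<G>. ennreal \<bar>(LINT y|lborel. g y * kde k b eps n \<omega> y)
                                      - (1 / real n) * (\<Sum>i<n. g (eps i \<omega>))\<bar>)
           (\<lambda>n. real n powr (- 1 / 2))
       \<and> (\<exists>L. tight_brownian_bridge_law P \<G> L \<and>
              weakly_converges_outer M
                (\<lambda>n \<omega>. \<lambda>g\<in>\<G>. sqrt (real n) * (LINT y|lborel. g y * (kde k b eps n \<omega> y - f y)))
                (linfty \<G>) L)"
proof -
  interpret M: prob_space M by fact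
  \<comment> \<open>The density hypothesis gives measurability only after the embedding into
    extended reals; positivity of \<open>f\<close> allows undoing the embedding.\<close>
  have "(\<lambda>y. ennreal (f y)) \<in> borel_measurable lborel" using dens[of 0] by (simp add: distributed_def)
  then have "(\<lambda>y. enn2real (ennreal (f y))) \<in> borel_measurable borel" by measurable
  then have f_meas [measurable]: "f \<in> borel_measurable borel" using f_pos by (simp add: less_imp_le)
  have law: "distr M borel (eps i) = P" for i
  proof -
    have "distr M borel (eps i) = distr M lborel (eps i)" by (rule distr_cong) auto
    then show ?thesis using distributed_distr_eq_density[OF dens[of i]] by (simp add: P_def)
  qed
  have "prob_space P"
    unfolding law[of 0, symmetric] using indep by (intro M.prob_space_distr) (auto simp: M.indep_vars_def)
  then have nn: "(\<integral>\<^sup>+ y. ennreal (f y) \<partial>lborel) = 1"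
    using prob_space.emeasure_space_1[of P] by (simp add: P_def emeasure_density)
  have f_int: "integrable lborel f" "(LINT y|lborel. f y) = 1"
  proof -
    show "integrable lborel f" using nn f_pos by (intro integrableI_nonneg) (auto simp: less_imp_le)
    then show "(LINT y|lborel. f y) = 1"
      using nn f_pos by (subst integral_eq_nn_integral) (auto simp: less_imp_le)
  qed
  \<comment> \<open>An envelope of the empty class may be negative. The absolute value has the same
    seminorms, is again an envelope, and satisfies the shift condition by the reverse triangle
    inequality.\<close>
  let ?V = "\<lambda>y. \<bar>V y\<bar>"
  note [measurable] = V_L2(1)
  have env: "envelope ?V \<G>" using V_envelope unfolding envelope_def by (meson abs_ge_self order_trans)
  have "L2_seminorm Q ?V = L2_seminorm Q V" for Q by (simp add: L2_seminorm_def)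
  then have ent: "uniformly_integrable_L2_entropy \<G> ?V" using G_entropy by (simp add: uniformly_integrable_L2_entropy_def)
  obtain N where nets: "dyadic_nets \<G> ?V N" using uniform_entropy_imp_dyadic_nets[OF ent env] .
  have shift: "((\<lambda>s. \<integral>\<^sup>+ y. ennreal ((?V (y + s) - ?V y)\<^sup>2 * f y) \<partial>lborel) \<longlongrightarrow> 0) (at 0)"
  proof (rule tendsto_sandwich[OF _ _ tendsto_const V_shift])
    have "(\<bar>V (y + s)\<bar> - \<bar>V y\<bar>)\<^sup>2 \<le> (V (y + s) - V y)\<^sup>2" for y s
      by (rule abs_le_square_iff[THEN iffD1]) (rule abs_triangle_ineq3)
    then show "\<forall>\<^sub>F s in at 0. (\<integral>\<^sup>+ y. ennreal ((?V (y + s) - ?V y)\<^sup>2 * f y) \<partial>lborel) \<le> (\<integral>\<^sup>+ y. ennreal ((V (y + s) - V y)\<^sup>2 * f y) \<partial>lborel)"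
      using f_pos by (intro always_eventually allI nn_integral_mono ennreal_leI mult_right_mono) (auto simp: less_imp_le)
  qed simp
  interpret empirical_sample f ?V \<G> N P M eps
  proof unfold_locales
  qed (use f_meas f_pos f_int G_meas G_suitable nets env V_L2 shift indep law in \<open>auto simp: P_def\<close>)
  note close = smoothed_empirical_measure_close[OF kernel b_pos b_upper bias]
  have "small_o_outer_prob M
           (\<lambda>n \<omega>. SUP g\<in>\<G>. ennreal \<bar>(LINT y|lborel. g y * kde k b eps n \<omega> y)
                                      - (1 / real n) * (\<Sum>i<n. g (eps i \<omega>))\<bar>)
           (\<lambda>n. real n powr (- 1 / 2))"
  proof (rule small_o_outer_prob_of_majorants[OF M.prob_space_axioms])
    show "\<forall>\<^sub>F n in sequentially. real n powr (- 1 / 2) > 0" using eventually_gt_at_top[of 0] by eventually_elim simp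
    fix e :: real assume e: "e > 0"
    obtain n0 where n0: "n0 > 0" "\<forall>n\<ge>n0. \<exists>U. integrable M U \<and> (\<forall>\<omega>. U \<omega> \<ge> 0) \<and> (LINT \<omega>|M. U \<omega>) \<le> e \<and>
      (AE \<omega> in M. \<forall>g\<in>\<G>. integrable lborel (\<lambda>y. g y * kde k b eps n \<omega> y) \<and>
       sqrt (real n) * \<bar>(LINT y|lborel. g y * kde k b eps n \<omega> y) - (1 / real n) * (\<Sum>i<n. g (eps i \<omega>))\<bar> \<le> U \<omega>)"
      using close[OF _ e] by auto
    show "\<exists>n0. \<forall>n\<ge>n0. \<exists>U. integrable M U \<and> (\<forall>\<omega>. U \<omega> \<ge> 0) \<and> (LINT \<omega>|M. U \<omega>) \<le> e \<and>
      (AE \<omega> in M. (SUP g\<in>\<G>. ennreal \<bar>(LINT y|lborel. g y * kde k b eps n \<omega> y) - (1 / real n) * (\<Sum>i<n. g (eps i \<omega>))\<bar>)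
        \<le> ennreal (U \<omega> * real n powr (- 1 / 2)))"
    proof (intro exI[of _ n0] allI impI)
      fix n assume n: "n \<ge> n0"
      then have n_pos: "n > 0" using n0(1) by simp
      then have powr: "real n powr (- 1 / 2) = 1 / sqrt (real n)"
        using powr_minus_divide[of "real n" "1 / 2"] by (simp add: powr_half_sqrt)
      obtain U where U: "integrable M U" "\<And>\<omega>. U \<omega> \<ge> 0" "(LINT \<omega>|M. U \<omega>) \<le> e"
        "AE \<omega> in M. \<forall>g\<in>\<G>. integrable lborel (\<lambda>y. g y * kde k b eps n \<omega> y) \<and>
          sqrt (real n) * \<bar>(LINT y|lborel. g y * kde k b eps n \<omega> y) - (1 / real n) * (\<Sum>i<n. g (eps i \<omega>))\<bar> \<le> U \<omega>"
        using n0(2) n by blast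
      have "AE \<omega> in M. (SUP g\<in>\<G>. ennreal \<bar>(LINT y|lborel. g y * kde k b eps n \<omega> y) - (1 / real n) * (\<Sum>i<n. g (eps i \<omega>))\<bar>)
        \<le> ennreal (U \<omega> * real n powr (- 1 / 2))"
        using U(4)
      proof eventually_elim
        case (elim \<omega>)
        show ?case
        proof (intro SUP_least ennreal_leI)
          fix g assume "g \<in> \<G>"
          then have "sqrt (real n) * \<bar>(LINT y|lborel. g y * kde k b eps n \<omega> y) - (1 / real n) * (\<Sum>i<n. g (eps i \<omega>))\<bar> \<le> U \<omega>"
            using elim by blast
          then show "\<bar>(LINT y|lborel. g y * kde k b eps n \<omega> y) - (1 / real n) * (\<Sum>i<n. g (eps i \<omega>))\<bar> \<le> U \<omega> * real n powr (- 1 / 2)"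
            unfolding powr using n_pos by (simp add: le_divide_eq mult.commute)
        qed
      qed
      then show "\<exists>U. integrable M U \<and> (\<forall>\<omega>. U \<omega> \<ge> 0) \<and> (LINT \<omega>|M. U \<omega>) \<le> e \<and>
        (AE \<omega> in M. (SUP g\<in>\<G>. ennreal \<bar>(LINT y|lborel. g y * kde k b eps n \<omega> y) - (1 / real n) * (\<Sum>i<n. g (eps i \<omega>))\<bar>)
          \<le> ennreal (U \<omega> * real n powr (- 1 / 2)))"
        using U(1-3) by blast
    qed
  qed
  moreover obtain L where bridge: "tight_brownian_bridge_law P \<G> L"
    and L: "\<And>X. (\<And>n \<omega>. X n \<omega> \<in> extensional \<G>) \<Longrightarrow>
      (\<And>e. e > 0 \<Longrightarrow> \<exists>n0. \<forall>n\<ge>n0. \<exists>U. integrable M U \<and> (\<forall>\<omega>. U \<omega> \<ge> 0) \<and> (LINT \<omega>|M. U \<omega>) \<le> e \<and>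
         (AE \<omega> in M. \<forall>g\<in>\<G>. \<bar>X n \<omega> g - emp n g \<omega>\<bar> \<le> U \<omega>)) \<Longrightarrow>
      weakly_converges_outer M X (linfty \<G>) L"
    by (rule empirical_limit[where thesis = thesis], erule that) presburger
  moreover have "weakly_converges_outer M
      (\<lambda>n \<omega>. \<lambda>g\<in>\<G>. sqrt (real n) * (LINT y|lborel. g y * (kde k b eps n \<omega> y - f y))) (linfty \<G>) L"
  proof (rule L)
    fix e :: real assume e: "e > 0"
    obtain n0 where n0: "n0 > 0" "\<forall>n\<ge>n0. \<exists>U. integrable M U \<and> (\<forall>\<omega>. U \<omega> \<ge> 0) \<and> (LINT \<omega>|M. U \<omega>) \<le> e \<and>
      (AE \<omega> in M. \<forall>g\<in>\<G>. integrable lborel (\<lambda>y. g y * kde k b eps n \<omega> y) \<and>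
       sqrt (real n) * \<bar>(LINT y|lborel. g y * kde k b eps n \<omega> y) - (1 / real n) * (\<Sum>i<n. g (eps i \<omega>))\<bar> \<le> U \<omega>)"
      using close[OF _ e] by auto
    show "\<exists>n0. \<forall>n\<ge>n0. \<exists>U. integrable M U \<and> (\<forall>\<omega>. U \<omega> \<ge> 0) \<and> (LINT \<omega>|M. U \<omega>) \<le> e \<and>
      (AE \<omega> in M. \<forall>g\<in>\<G>. \<bar>(\<lambda>g\<in>\<G>. sqrt (real n) * (LINT y|lborel. g y * (kde k b eps n \<omega> y - f y))) g - emp n g \<omega>\<bar> \<le> U \<omega>)"
    proof (intro exI[of _ n0] allI impI)
      fix n assume n: "n \<ge> n0"
      then have n_pos: "n > 0" using n0(1) by simp
      obtain U where U: "integrable M U" "\<And>\<omega>. U \<omega> \<ge> 0" "(LINT \<omega>|M. U \<omega>) \<le> e"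
        "AE \<omega> in M. \<forall>g\<in>\<G>. integrable lborel (\<lambda>y. g y * kde k b eps n \<omega> y) \<and>
          sqrt (real n) * \<bar>(LINT y|lborel. g y * kde k b eps n \<omega> y) - (1 / real n) * (\<Sum>i<n. g (eps i \<omega>))\<bar> \<le> U \<omega>"
        using n0(2) n by blast
      have "AE \<omega> in M. \<forall>g\<in>\<G>. \<bar>(\<lambda>g\<in>\<G>. sqrt (real n) * (LINT y|lborel. g y * (kde k b eps n \<omega> y - f y))) g - emp n g \<omega>\<bar> \<le> U \<omega>"
        using U(4)
      proof eventually_elim
        case (elim \<omega>)
        show ?case
        proof
          fix g assume g: "g \<in> \<G>"
          then have *: "integrable lborel (\<lambda>y. g y * kde k b eps n \<omega> y)"
            "sqrt (real n) * \<bar>(LINT y|lborel. g y * kde k b eps n \<omega> y) - (1 / real n) * (\<Sum>i<n. g (eps i \<omega>))\<bar> \<le> U \<omega>"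
            using elim by blast+
          have "(\<lambda>g\<in>\<G>. sqrt (real n) * (LINT y|lborel. g y * (kde k b eps n \<omega> y - f y))) g - emp n g \<omega> =
            sqrt (real n) * ((LINT y|lborel. g y * kde k b eps n \<omega> y) - (1 / real n) * (\<Sum>i<n. g (eps i \<omega>)))"
            using smoothed_process_diff[OF g *(1) n_pos] g by simp
          then show "\<bar>(\<lambda>g\<in>\<G>. sqrt (real n) * (LINT y|lborel. g y * (kde k b eps n \<omega> y - f y))) g - emp n g \<omega>\<bar> \<le> U \<omega>"
            using *(2) by (simp only: abs_mult abs_of_nonneg[OF real_sqrt_ge_zero[OF of_nat_0_le_iff]])
        qed
      qed
      then show "\<exists>U. integrable M U \<and> (\<forall>\<omega>. U \<omega> \<ge> 0) \<and> (LINT \<omega>|M. U \<omega>) \<le> e \<and>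
        (AE \<omega> in M. \<forall>g\<in>\<G>. \<bar>(\<lambda>g\<in>\<G>. sqrt (real n) * (LINT y|lborel. g y * (kde k b eps n \<omega> y - f y))) g - emp n g \<omega>\<bar> \<le> U \<omega>)"
        using U(1-3) by blast
    qed
  qed simp
  ultimately show ?thesis by blast
qed

end
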